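(* Assume binary branching. For every $\rho\in[-1,1]$ and every $\beta=\sigma+i\tau\in\mathbb C$, \[ \lim_{t\to\infty}\frac1t\log\bigl|\mathcal X_{\beta,\rho}(t)\bigr|= \begin{cases} 1+\tfrac12(\sigma^2-\tau^2), & \beta\in\overline{B_1},\\ \sqrt2\,|\sigma|, & \beta\in\overline{B_2},\\ \tfrac12+\sigma^2, & \beta\in\overline{B_3}, \end{cases} \] in probability.
   Context: Branching Brownian motion (BBM): start with one particle at the origin at time $0$; each particle lives an independent Exp(1) time and then splits into $k\ge1$ particles with probability $p_k$, where $\sum_{k\ge1}p_k=1$, $\sum_k kp_k=2$ and $K:=\sum_k k(k-1)p_k<\infty$. "Binary branching" means $p_2=1$. Each particle moves as an independent standard Brownian motion started at its birth place. $n(t)$ is the number of particles at time $t$ and $x_k(t)$, $k\le n(t)$, their positions. Fix $\rho\in[-1,1]$ and let $z_k(t)$ be a second BBM on the same genealogical tree, independent of the motions $x$; set $y_k(t)=\rho x_k(t)+\sqrt{1-\rho^2}\,z_k(t)$. For $\beta=\sigma+i\tau\in\mathbb C$ the partition function is $\mathcal X_{\beta,\rho}(t)=\sum_{k=1}^{n(t)}e^{\sigma x_k(t)+i\tau y_k(t)}$. Regions: $B_2=\{\sigma+i\tau:2\sigma^2>1,\ |\sigma|+|\tau|>\sqrt2\}$, $B_3=\{\sigma+i\tau:2\sigma^2<1,\ \sigma^2+\tau^2>1\}$, $B_1=\mathbb C\setminus\overline{B_2\cup B_3}$. *)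

theory Defs
  imports "HOL-Probability.Probability"
begin

definition std_bm :: "'a measure \<Rightarrow> ('a \<Rightarrow> real \<Rightarrow> real) \<Rightarrow> bool" where
  "std_bm M B \<longleftrightarrow>
     (\<forall>s. (\<lambda>\<omega>. B \<omega> s) \<in> borel_measurable M) \<and>
     (\<forall>\<omega>\<in>space M. B \<omega> 0 = 0 \<and> continuous_on {0..} (B \<omega>)) \<and>
     (\<forall>ts::real list. sorted_wrt (<) ts \<longrightarrow> (\<forall>t\<in>set ts. 0 \<le> t) \<longrightarrow>
        prob_space.indep_vars M (\<lambda>_. borel)
           (\<lambda>k \<omega>. B \<omega> (ts ! Suc k) - B \<omega> (ts ! k)) {..<length ts - 1} \<and>
        (\<forall>k < length ts - 1.
           distributed M lborel (\<lambda>\<omega>. B \<omega> (ts ! Suc k) - B \<omega> (ts ! k))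
             (\<lambda>x. ennreal (normal_density 0 (sqrt (ts ! Suc k - ts ! k)) x))))"

(* Sources of randomness attached to each particle of the binary Ulam--Harris tree
   (labels = bool lists): its lifetime, and its two driving Brownian motions. *)
datatype src = Life | Wx | Wz

(* Primitive randomness of a binary BBM with a second BBM on the same tree:
   i.i.d. Exp(1) lifetimes L u, i.i.d. standard BMs W u (for x) and Z u (for z),
   the whole family mutually independent. *)
definition bbm_primitives ::
  "'a measure \<Rightarrow> (bool list \<Rightarrow> 'a \<Rightarrow> real) \<Rightarrow> (bool list \<Rightarrow> 'a \<Rightarrow> real \<Rightarrow> real)
     \<Rightarrow> (bool list \<Rightarrow> 'a \<Rightarrow> real \<Rightarrow> real) \<Rightarrow> bool" where
  "bbm_primitives M L W Z \<longleftrightarrow>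
     prob_space M \<and>
     (\<forall>u. distributed M lborel (L u) (\<lambda>x. ennreal (exponential_density 1 x))) \<and>
     (\<forall>u. std_bm M (W u)) \<and> (\<forall>u. std_bm M (Z u)) \<and>
     prob_space.indep_vars M (\<lambda>_. PiM UNIV (\<lambda>_::real. borel))
        (\<lambda>(u, k) \<omega>. case k of Life \<Rightarrow> (\<lambda>_. L u \<omega>) | Wx \<Rightarrow> W u \<omega> | Wz \<Rightarrow> Z u \<omega>)
        UNIV"

definition birth :: "(bool list \<Rightarrow> 'a \<Rightarrow> real) \<Rightarrow> bool list \<Rightarrow> 'a \<Rightarrow> real" where
  "birth L u \<omega> = (\<Sum>k<length u. L (take k u) \<omega>)"

definition alive :: "(bool list \<Rightarrow> 'a \<Rightarrow> real) \<Rightarrow> real \<Rightarrow> 'a \<Rightarrow> bool list set" where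
  "alive L t \<omega> = {u. birth L u \<omega> \<le> t \<and> t < birth L u \<omega> + L u \<omega>}"

definition pos :: "(bool list \<Rightarrow> 'a \<Rightarrow> real) \<Rightarrow> (bool list \<Rightarrow> 'a \<Rightarrow> real \<Rightarrow> real)
     \<Rightarrow> bool list \<Rightarrow> real \<Rightarrow> 'a \<Rightarrow> real" where
  "pos L W u t \<omega> = (\<Sum>k<length u. W (take k u) \<omega> (L (take k u) \<omega>)) + W u \<omega> (t - birth L u \<omega>)"

definition partition_fn ::
  "(bool list \<Rightarrow> 'a \<Rightarrow> real) \<Rightarrow> (bool list \<Rightarrow> 'a \<Rightarrow> real \<Rightarrow> real) \<Rightarrow> (bool list \<Rightarrow> 'a \<Rightarrow> real \<Rightarrow> real)
     \<Rightarrow> complex \<Rightarrow> real \<Rightarrow> real \<Rightarrow> 'a \<Rightarrow> complex" where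
  "partition_fn L W Z \<beta> \<rho> t \<omega> =
     (\<Sum>u\<in>alive L t \<omega>.
        exp (complex_of_real (Re \<beta> * pos L W u t \<omega>)
             + \<i> * complex_of_real (Im \<beta> * (\<rho> * pos L W u t \<omega> + sqrt (1 - \<rho>\<^sup>2) * pos L Z u t \<omega>))))"

definition B2 :: "complex set" where
  "B2 = {b. 2 * (Re b)\<^sup>2 > 1 \<and> \<bar>Re b\<bar> + \<bar>Im b\<bar> > sqrt 2}"

definition B3 :: "complex set" where
  "B3 = {b. 2 * (Re b)\<^sup>2 < 1 \<and> (Re b)\<^sup>2 + (Im b)\<^sup>2 > 1}"

definition B1 :: "complex set" where
  "B1 = - closure (B2 \<union> B3)"

(* convergence in probability of (1/t) log |X t| to c, where log 0 = -oo counts as far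
   from c; phrased with outer probability so no measurability side condition is hidden *)
definition log_rate_in_prob :: "'a measure \<Rightarrow> (real \<Rightarrow> 'a \<Rightarrow> complex) \<Rightarrow> real \<Rightarrow> bool" where
  "log_rate_in_prob M X c \<longleftrightarrow>
     (\<forall>\<epsilon>>0. \<forall>\<delta>>0. eventually (\<lambda>t. \<exists>A\<in>sets M.
        {\<omega>\<in>space M. X t \<omega> = 0 \<or> \<bar>ln (cmod (X t \<omega>)) / t - c\<bar> > \<epsilon>} \<subseteq> A \<and>
        measure M A < \<delta>) at_top)"

end

theory Submission
  imports Defs
begin

text \<open>
  The law of the partition function at a fixed time depends on the Brownian paths only through
  one Gaussian displacement per particle, so it can be computed on a product space carrying an
  \<open>Exp(1)\<close> lifetime and two standard normals per label. There it satisfies a first-split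
  equation with a unique solution, which yields the branching property at a fixed time: \<open>X(s + t)\<close>
  is distributed as \<open>\<Sum>u. a\<^sub>u X\<^sub>u(t)\<close> with independent copies \<open>X\<^sub>u\<close> attached to the particles alive at \<open>s\<close>.

  Upper bound: conditional second moments give \<open>E|X(s + t)|^p \<le> 2 |E X(t)|^p E|X(s)|^p + C(t) e^((1 + p\<^sup>2\<sigma>\<^sup>2/2) s)\<close>
  for \<open>p \<le> 2\<close>. Iterating in long blocks and applying Markov's inequality with \<open>p = min 2 (\<surd>2/|\<sigma>|)\<close>,
  or with a suitable \<open>p > 1\<close> in the first phase, gives the claimed rates.

  Lower bound: it suffices to show that \<open>|X(t)| \<ge> e^((F - \<epsilon>) t)\<close> has probability at least \<open>e^(-\<delta>t)\<close>
  for all \<open>\<epsilon>, \<delta> > 0\<close>. At time \<open>\<eta>t\<close> there are exponentially many particles; with high probability one of their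
  subtrees is that large and is multiplied by the independent exponential of its root's first unit displacement, a
  factor with no atoms, so that the total cannot cancel to something small. In the
  first phase the weak lower bound is a Paley--Zygmund argument with an exponent \<open>p > 1\<close>. In the other
  two, a conditional second moment argument bounds \<open>|X\<^sub>\<beta>(t + 1)|\<^sup>2\<close> below by a multiple of the real partition
  function at \<open>2\<sigma>\<close>, which is in the first phase or, for \<open>2|\<sigma>| \<ge> \<surd>2\<close>, is
  treated by convexity in the inverse temperature.
\<close>

section \<open>Trees with lifetimes\<close>

text \<open>Restarting lifetimes and paths at time s would be the direct way to the branching
  property. Uniqueness for the first-split equation avoids it: only laws at fixed times occur, lack
  of memory becomes a shift in an integral, and the Markov property becomes a convolution of
  Gaussians.

  Origin of the exponents: the bound (1 + p^2 sigma^2 / 2) / p on the rate is smallest at p = sqrt 2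
  / |sigma|, where it equals sqrt 2 |sigma|, the rate of the second phase. Conditional second
  moments serve only p <= 2, and p = 2 gives 1/2 + sigma^2, the rate of the third phase. In the
  first phase, its real tips apart, some p > 1 makes the bound at most the rate of the mean.

  Doubling sigma in the lower bounds comes from a variance: given the tree up to s, the variance of
  the sum is a multiple of the sum of the squared moduli of the weights, which is the real partition
  function at 2 sigma.\<close>

definition tree_birth :: "(bool list \<Rightarrow> real) \<Rightarrow> bool list \<Rightarrow> real" where
  "tree_birth l u = (\<Sum>k<length u. l (take k u))"

definition tree_alive :: "(bool list \<Rightarrow> real) \<Rightarrow> real \<Rightarrow> bool list set" where
  "tree_alive l t = {u. tree_birth l u \<le> t \<and> t < tree_birth l u + l u}"

text \<open>\<open>d u r\<close> is the complex exponent collected by particle \<open>u\<close> up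
  to age \<open>r\<close>. Adding exponents, instead of the two motions separately, lets one
  recursion serve every \<beta> and \<rho>.\<close>

definition tree_pos ::
  "(bool list \<Rightarrow> real) \<Rightarrow> (bool list \<Rightarrow> real \<Rightarrow> complex) \<Rightarrow> bool list \<Rightarrow> real \<Rightarrow> complex" where
  "tree_pos l d u t = (\<Sum>k<length u. d (take k u) (l (take k u))) + d u (t - tree_birth l u)"

text \<open>The marks \<open>y\<close> are 1 for the partition function itself; for the branching
  property they are the partition functions of the subtrees that start at time
  \<open>t\<close>.\<close>

definition tree_sum ::
  "(bool list \<Rightarrow> real) \<Rightarrow> (bool list \<Rightarrow> real \<Rightarrow> complex) \<Rightarrow> (bool list \<Rightarrow> complex) \<Rightarrow> real \<Rightarrow> complex" where
  "tree_sum l d y t = (\<Sum>u\<in>tree_alive l t. exp (tree_pos l d u t) * y u)"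

text \<open>No explosion. This holds almost surely and makes \<open>tree_alive\<close> finite; over
  an infinite index set the sum in \<open>tree_sum\<close> would be 0 by convention and the
  recursion at the root could fail.\<close>

definition tree_ok :: "(bool list \<Rightarrow> real) \<Rightarrow> bool" where
  "tree_ok l \<longleftrightarrow> (\<forall>u. 0 \<le> l u) \<and> (\<forall>t. finite {u. tree_birth l u \<le> t})"

lemma tree_birth_Nil [simp]: "tree_birth l [] = 0"
  by (simp add: tree_birth_def)

lemma tree_birth_Cons: "tree_birth l (b # u) = l [] + tree_birth (\<lambda>v. l (b # v)) u"
  unfolding tree_birth_def by (simp add: sum.lessThan_Suc_shift del: sum.lessThan_Suc)

lemma tree_birth_nonneg: "(\<And>u. 0 \<le> l u) \<Longrightarrow> 0 \<le> tree_birth l u"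
  by (simp add: tree_birth_def sum_nonneg)

lemma tree_pos_Nil [simp]: "tree_pos l d [] t = d [] t"
  by (simp add: tree_pos_def)

lemma tree_pos_Cons:
  "tree_pos l d (b # u) t = d [] (l []) + tree_pos (\<lambda>v. l (b # v)) (\<lambda>v. d (b # v)) u (t - l [])"
  unfolding tree_pos_def
  by (simp add: sum.lessThan_Suc_shift tree_birth_Cons algebra_simps del: sum.lessThan_Suc)

lemma tree_alive_before_split:
  assumes "\<And>u. 0 \<le> l u" "0 \<le> t" "t < l []"
  shows "tree_alive l t = {[]}"
proof -
  have "u = []" if "u \<in> tree_alive l t" for u
  proof (cases u)
    case (Cons b v)
    have "0 \<le> tree_birth (\<lambda>v. l (b # v)) v" using assms(1) by (intro tree_birth_nonneg) auto
    then show ?thesis using that assms Cons by (auto simp: tree_alive_def tree_birth_Cons)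
  qed auto
  then show ?thesis using assms by (auto simp: tree_alive_def)
qed

lemma tree_alive_after_split:
  assumes "l [] \<le> t"
  shows "tree_alive l t = Cons False ` tree_alive (\<lambda>v. l (False # v)) (t - l []) \<union>
    Cons True ` tree_alive (\<lambda>v. l (True # v)) (t - l [])"
proof -
  have "u \<in> tree_alive l t \<longleftrightarrow> u \<in> Cons False ` tree_alive (\<lambda>v. l (False # v)) (t - l []) \<union>
    Cons True ` tree_alive (\<lambda>v. l (True # v)) (t - l [])" for u
  proof (cases u)
    case Nil
    then show ?thesis using assms by (auto simp: tree_alive_def)
  next
    case (Cons b v)
    have "u \<in> tree_alive l t \<longleftrightarrow> v \<in> tree_alive (\<lambda>v. l (b # v)) (t - l [])"
      by (auto simp: tree_alive_def Cons tree_birth_Cons)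
    then show ?thesis by (cases b) (auto simp: Cons)
  qed
  then show ?thesis by blast
qed

lemma tree_ok_nonneg: "tree_ok l \<Longrightarrow> 0 \<le> l u"
  by (simp add: tree_ok_def)

lemma tree_ok_finite_alive: "tree_ok l \<Longrightarrow> finite (tree_alive l t)"
  by (rule finite_subset[of _ "{u. tree_birth l u \<le> t}"]) (auto simp: tree_ok_def tree_alive_def)

lemma tree_ok_Cons:
  assumes "tree_ok l" shows "tree_ok (\<lambda>v. l (b # v))"
proof -
  have "finite {u. tree_birth (\<lambda>v. l (b # v)) u \<le> t}" for t
  proof (rule finite_imageD[of "Cons b"])
    show "finite (Cons b ` {u. tree_birth (\<lambda>v. l (b # v)) u \<le> t})"
      by (rule finite_subset[of _ "{u. tree_birth l u \<le> l [] + t}"])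
        (use assms in \<open>auto simp: tree_ok_def tree_birth_Cons\<close>)
  qed auto
  then show ?thesis using assms by (auto simp: tree_ok_def)
qed

lemma tree_sum_before_split:
  assumes "\<And>u. 0 \<le> l u" "0 \<le> t" "t < l []"
  shows "tree_sum l d y t = exp (d [] t) * y []"
  by (simp add: tree_sum_def tree_alive_before_split[of l t, OF assms])

lemma tree_sum_after_split:
  assumes "tree_ok l" "l [] \<le> t"
  shows "tree_sum l d y t = exp (d [] (l [])) *
    (tree_sum (\<lambda>v. l (False # v)) (\<lambda>v. d (False # v)) (\<lambda>v. y (False # v)) (t - l []) +
     tree_sum (\<lambda>v. l (True # v)) (\<lambda>v. d (True # v)) (\<lambda>v. y (True # v)) (t - l []))"
proof -
  have fin: "finite (tree_alive (\<lambda>v. l (b # v)) (t - l []))" for b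
    by (intro tree_ok_finite_alive tree_ok_Cons assms)
  have *: "(\<Sum>u\<in>Cons b ` tree_alive (\<lambda>v. l (b # v)) (t - l []). exp (tree_pos l d u t) * y u) =
     exp (d [] (l [])) * tree_sum (\<lambda>v. l (b # v)) (\<lambda>v. d (b # v)) (\<lambda>v. y (b # v)) (t - l [])" for b
    by (subst sum.reindex)
      (auto simp: tree_sum_def tree_pos_Cons exp_add sum_distrib_left algebra_simps intro!: sum.cong)
  have "tree_sum l d y t =
      (\<Sum>u\<in>Cons False ` tree_alive (\<lambda>v. l (False # v)) (t - l []). exp (tree_pos l d u t) * y u) +
      (\<Sum>u\<in>Cons True ` tree_alive (\<lambda>v. l (True # v)) (t - l []). exp (tree_pos l d u t) * y u)"
    unfolding tree_sum_def tree_alive_after_split[of l t, OF assms(2)] using fin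
    by (intro sum.union_disjoint) auto
  then show ?thesis unfolding * by (simp add: algebra_simps)
qed

text \<open>A proper ancestor of \<open>u\<close> dies no later than \<open>u\<close> is born. Hence
  no particle is both alive at \<open>t\<close> and an ancestor of another one alive at
  \<open>t\<close>, so its displacement is read at one age only.\<close>

lemma tree_alive_prefix:
  assumes "\<And>u. 0 \<le> l u" "u \<in> tree_alive l t" "k < length u"
  shows "take k u \<notin> tree_alive l t"
proof -
  have "tree_birth l (take k u) + l (take k u) = (\<Sum>j<Suc k. l (take j u))"
    unfolding tree_birth_def using assms(3) by (auto intro!: sum.cong simp: min_def)
  also have "\<dots> \<le> tree_birth l u"
    unfolding tree_birth_def using assms by (intro sum_mono2) auto
  also have "\<dots> \<le> t" using assms by (simp add: tree_alive_def)
  finally show ?thesis by (simp add: tree_alive_def)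
qed

section \<open>Product measures over the tree\<close>

definition tree_cons :: "'d \<Rightarrow> (bool list \<Rightarrow> 'd) \<Rightarrow> (bool list \<Rightarrow> 'd) \<Rightarrow> bool list \<Rightarrow> 'd" where
  "tree_cons a e0 e1 u = (case u of [] \<Rightarrow> a | b # v \<Rightarrow> if b then e1 v else e0 v)"

lemma tree_cons_simps [simp]:
  "tree_cons a e0 e1 [] = a" "tree_cons a e0 e1 (False # v) = e0 v" "tree_cons a e0 e1 (True # v) = e1 v"
  by (simp_all add: tree_cons_def)

lemma measurable_tree_cons [measurable]:
  fixes N :: "bool list \<Rightarrow> 'd measure"
  shows "(\<lambda>(a, e0, e1). tree_cons a e0 e1) \<in>
    N [] \<Otimes>\<^sub>M (PiM UNIV (\<lambda>u. N (False # u)) \<Otimes>\<^sub>M PiM UNIV (\<lambda>u. N (True # u))) \<rightarrow>\<^sub>M PiM UNIV N"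
proof (rule measurable_PiM_single')
  fix u :: "bool list"
  show "(\<lambda>\<omega>. (case \<omega> of (a, e0, e1) \<Rightarrow> tree_cons a e0 e1) u) \<in>
    N [] \<Otimes>\<^sub>M (PiM UNIV (\<lambda>u. N (False # u)) \<Otimes>\<^sub>M PiM UNIV (\<lambda>u. N (True # u))) \<rightarrow>\<^sub>M N u"
  proof (cases u)
    case (Cons b v)
    then show ?thesis by (cases b) (auto simp: tree_cons_def split_beta)
  qed (auto simp: tree_cons_def split_beta)
qed (auto simp: space_PiM PiE_iff space_pair_measure tree_cons_def split: list.split)

text \<open>Independent labels on the binary tree amount to a root label and two independent trees
  of labels. Product measures are determined by cylinders, so it suffices to distribute the finite
  base \<open>J\<close> over the root and the two subtrees.\<close>

lemma PiM_tree_split: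
  fixes N :: "bool list \<Rightarrow> 'd measure"
  assumes N: "\<And>u. prob_space (N u)"
  shows "distr (N [] \<Otimes>\<^sub>M (PiM UNIV (\<lambda>u. N (False # u)) \<Otimes>\<^sub>M PiM UNIV (\<lambda>u. N (True # u)))) (PiM UNIV N)
    (\<lambda>(a, e0, e1). tree_cons a e0 e1) = PiM UNIV N" (is "distr ?S ?P ?f = _")
proof -
  interpret P: product_prob_space N UNIV using N by (simp add: product_prob_spaceI)
  interpret P0: product_prob_space "\<lambda>u. N (False # u)" UNIV using N by (simp add: product_prob_spaceI)
  interpret P1: product_prob_space "\<lambda>u. N (True # u)" UNIV using N by (simp add: product_prob_spaceI)
  interpret N0: prob_space "N []" by (rule N)
  interpret PP: pair_prob_space "PiM UNIV (\<lambda>u. N (False # u))" "PiM UNIV (\<lambda>u. N (True # u))" ..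
  interpret PPP: pair_prob_space "N []" "PiM UNIV (\<lambda>u. N (False # u)) \<Otimes>\<^sub>M PiM UNIV (\<lambda>u. N (True # u))" ..
  show ?thesis
  proof (rule P.PiM_eq)
    fix J :: "bool list set" and A
    assume J: "finite J" and A: "\<And>j. j \<in> J \<Longrightarrow> A j \<in> sets (N j)"
    define J0 where "J0 = {v. False # v \<in> J}"
    define J1 where "J1 = {v. True # v \<in> J}"
    define Jr where "Jr = J \<inter> {[]}"
    have fin: "finite J0" "finite J1" "finite Jr"
      using J unfolding J0_def J1_def Jr_def
      by (auto intro!: finite_vimageI[of J "Cons False", unfolded vimage_def] finite_vimageI[of J "Cons True", unfolded vimage_def])
    have Jeq: "J = Jr \<union> (Cons False ` J0 \<union> Cons True ` J1)"
    proof -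
      have "u \<in> J \<longleftrightarrow> u \<in> Jr \<union> (Cons False ` J0 \<union> Cons True ` J1)" for u
      proof (cases u)
        case (Cons b v) then show ?thesis by (cases b) (auto simp: J0_def J1_def Jr_def)
      qed (auto simp: Jr_def)
      then show ?thesis by blast
    qed
    define A' where "A' = (if [] \<in> J then A [] else space (N []))"
    define B0 where "B0 = prod_emb UNIV (\<lambda>u. N (False # u)) J0 (Pi\<^sub>E J0 (\<lambda>v. A (False # v)))"
    define B1 where "B1 = prod_emb UNIV (\<lambda>u. N (True # u)) J1 (Pi\<^sub>E J1 (\<lambda>v. A (True # v)))"
    have meas: "A' \<in> sets (N [])" "B0 \<in> sets (PiM UNIV (\<lambda>u. N (False # u)))" "B1 \<in> sets (PiM UNIV (\<lambda>u. N (True # u)))"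
      using A fin by (auto simp: A'_def B0_def B1_def J0_def J1_def intro!: sets_PiM_I)
    have "emeasure (distr ?S ?P ?f) (P.emb UNIV J (Pi\<^sub>E J A)) =
        emeasure ?S (?f -` P.emb UNIV J (Pi\<^sub>E J A) \<inter> space ?S)"
      using J A by (intro emeasure_distr measurable_tree_cons sets_PiM_I) auto
    also have "?f -` P.emb UNIV J (Pi\<^sub>E J A) \<inter> space ?S = A' \<times> (B0 \<times> B1)"
    proof -
      have 1: "tree_cons a e0 e1 \<in> space (PiM UNIV N)" if "(a, e0, e1) \<in> space ?S" for a e0 e1
        using measurable_space[OF measurable_tree_cons, of "(a, e0, e1)"] that by auto
      have "x \<in> ?f -` P.emb UNIV J (Pi\<^sub>E J A) \<inter> space ?S \<longleftrightarrow> x \<in> A' \<times> (B0 \<times> B1)" for x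
      proof -
        obtain a e0 e1 where x: "x = (a, e0, e1)" by (cases x) auto
        have ball: "(\<forall>u\<in>J. tree_cons a e0 e1 u \<in> A u) \<longleftrightarrow> ([] \<in> J \<longrightarrow> a \<in> A []) \<and> (\<forall>v\<in>J0. e0 v \<in> A (False # v)) \<and> (\<forall>v\<in>J1. e1 v \<in> A (True # v))"
          by (subst Jeq) (auto simp: Jr_def ball_Un)
        have "A [] \<subseteq> space (N [])" if "[] \<in> J" using A[OF that] by (rule sets.sets_into_space)
        then show ?thesis using 1[of a e0 e1] ball
          by (auto simp: x prod_emb_def space_pair_measure A'_def B0_def B1_def restrict_PiE_iff space_PiM PiE_iff
              simp del: tree_cons_simps)
      qed
      then show ?thesis by blast
    qed
    also have "emeasure ?S (A' \<times> (B0 \<times> B1)) = emeasure (N []) A' * (emeasure (PiM UNIV (\<lambda>u. N (False # u))) B0 * emeasure (PiM UNIV (\<lambda>u. N (True # u))) B1)"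
      using meas by (simp add: PP.emeasure_pair_measure_Times P1.emeasure_pair_measure_Times)
    also have "emeasure (PiM UNIV (\<lambda>u. N (False # u))) B0 = (\<Prod>v\<in>J0. emeasure (N (False # v)) (A (False # v)))"
      unfolding B0_def using fin A by (intro P0.emeasure_PiM_emb) (auto simp: J0_def)
    also have "emeasure (PiM UNIV (\<lambda>u. N (True # u))) B1 = (\<Prod>v\<in>J1. emeasure (N (True # v)) (A (True # v)))"
      unfolding B1_def using fin A by (intro P1.emeasure_PiM_emb) (auto simp: J1_def)
    also have "emeasure (N []) A' = (\<Prod>u\<in>Jr. emeasure (N u) (A u))"
      by (auto simp: A'_def Jr_def prob_space.emeasure_space_1[OF N])
    also have "\<dots> * ((\<Prod>v\<in>J0. emeasure (N (False # v)) (A (False # v))) * (\<Prod>v\<in>J1. emeasure (N (True # v)) (A (True # v))))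
        = (\<Prod>u\<in>J. emeasure (N u) (A u))"
      apply (subst Jeq)
      apply (subst prod.union_disjoint)
      using fin apply (auto simp: Jr_def)[3]
      apply (subst prod.union_disjoint)
      using fin apply (auto)[3]
      apply (simp add: prod.reindex)
      done
    finally show "emeasure (distr ?S ?P ?f) (P.emb UNIV J (Pi\<^sub>E J A)) = (\<Prod>u\<in>J. emeasure (N u) (A u))" .
  qed simp
qed

lemma nn_integral_PiM_tree_split:
  fixes N :: "bool list \<Rightarrow> 'd measure"
  assumes N: "\<And>u. prob_space (N u)" and [measurable]: "f \<in> borel_measurable (PiM UNIV N)"
  shows "(\<integral>\<^sup>+\<eta>. f \<eta> \<partial>PiM UNIV N) =
    (\<integral>\<^sup>+a. \<integral>\<^sup>+\<eta>0. \<integral>\<^sup>+\<eta>1. f (tree_cons a \<eta>0 \<eta>1) \<partial>PiM UNIV (\<lambda>u. N (True # u)) \<partial>PiM UNIV (\<lambda>u. N (False # u)) \<partial>N [])"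
    (is "_ = ?R")
proof -
  interpret P0: prob_space "PiM UNIV (\<lambda>u. N (False # u))" using N by (intro prob_space_PiM)
  interpret P1: prob_space "PiM UNIV (\<lambda>u. N (True # u))" using N by (intro prob_space_PiM)
  interpret PP: pair_prob_space "PiM UNIV (\<lambda>u. N (False # u))" "PiM UNIV (\<lambda>u. N (True # u))" ..
  have [measurable]: "(\<lambda>(a, e0, e1). f (tree_cons a e0 e1)) \<in> borel_measurable (N [] \<Otimes>\<^sub>M (PiM UNIV (\<lambda>u. N (False # u)) \<Otimes>\<^sub>M PiM UNIV (\<lambda>u. N (True # u))))"
    using measurable_compose[OF measurable_tree_cons[of N] assms(2)] by (simp add: split_beta')
  have "(\<integral>\<^sup>+\<eta>. f \<eta> \<partial>PiM UNIV N) = (\<integral>\<^sup>+x. (case x of (a, e0, e1) \<Rightarrow> f (tree_cons a e0 e1)) \<partial>(N [] \<Otimes>\<^sub>M (PiM UNIV (\<lambda>u. N (False # u)) \<Otimes>\<^sub>M PiM UNIV (\<lambda>u. N (True # u)))))"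
    by (subst PiM_tree_split[OF N, symmetric], subst nn_integral_distr[OF measurable_tree_cons])
      (auto simp: split_beta')
  also have "\<dots> = ?R"
    by (subst PP.nn_integral_fst[symmetric], simp, intro nn_integral_cong, subst P1.nn_integral_fst[symmetric]) auto
  finally show ?thesis .
qed

lemma nn_integral_prod_PiM:
  fixes N :: "'i \<Rightarrow> 'd measure"
  assumes N: "\<And>u. prob_space (N u)" and "finite J" and f: "\<And>j. j \<in> J \<Longrightarrow> f j \<in> borel_measurable (N j)"
  shows "(\<integral>\<^sup>+\<eta>. (\<Prod>j\<in>J. f j (\<eta> j)) \<partial>PiM UNIV N) = (\<Prod>j\<in>J. \<integral>\<^sup>+x. f j x \<partial>N j)"
proof -
  interpret P: product_prob_space N UNIV using N by (simp add: product_prob_spaceI)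
  have "(\<integral>\<^sup>+\<eta>. (\<Prod>j\<in>J. f j (\<eta> j)) \<partial>PiM UNIV N) = (\<integral>\<^sup>+\<eta>. (\<Prod>j\<in>J. f j (restrict \<eta> J j)) \<partial>PiM UNIV N)"
    by (intro nn_integral_cong prod.cong) auto
  also have "\<dots> = (\<integral>\<^sup>+\<eta>. (\<Prod>j\<in>J. f j (\<eta> j)) \<partial>distr (PiM UNIV N) (PiM J N) (\<lambda>\<eta>. restrict \<eta> J))"
    using f by (subst nn_integral_distr) (auto intro!: borel_measurable_prod_ennreal measurable_compose[OF measurable_component_singleton])
  also have "distr (PiM UNIV N) (PiM J N) (\<lambda>\<eta>. restrict \<eta> J) = PiM J N"
    using assms(2) by (intro P.distr_PiM_restrict_finite[OF _ ]) auto
  also have "(\<integral>\<^sup>+\<eta>. (\<Prod>j\<in>J. f j (\<eta> j)) \<partial>PiM J N) = (\<Prod>j\<in>J. \<integral>\<^sup>+x. f j x \<partial>N j)"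
    using f assms(2) by (intro P.product_nn_integral_prod) auto
  finally show ?thesis .
qed

text \<open>This allows lifetimes and displacements, or a tree and its marks, to be integrated one
  after the other.\<close>

lemma PiM_zip:
  fixes A :: "'i \<Rightarrow> 'd measure" and B :: "'i \<Rightarrow> 'k measure"
  assumes A: "\<And>u. prob_space (A u)" and B: "\<And>u. prob_space (B u)"
  shows "distr (PiM UNIV A \<Otimes>\<^sub>M PiM UNIV B) (PiM UNIV (\<lambda>u. A u \<Otimes>\<^sub>M B u)) (\<lambda>(\<eta>, \<zeta>) u. (\<eta> u, \<zeta> u))
     = PiM UNIV (\<lambda>u. A u \<Otimes>\<^sub>M B u)" (is "distr ?S ?P ?f = _")
proof -
  have AB: "prob_space (A u \<Otimes>\<^sub>M B u)" for u
  proof -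
    interpret A: prob_space "A u" by (rule A)
    interpret B: prob_space "B u" by (rule B)
    interpret AB: pair_prob_space "A u" "B u" ..
    show ?thesis by (rule AB.prob_space_axioms)
  qed
  interpret P: product_prob_space "\<lambda>u. A u \<Otimes>\<^sub>M B u" UNIV using AB by (simp add: product_prob_spaceI)
  interpret PA: prob_space "PiM UNIV A" using A by (intro prob_space_PiM)
  interpret PB: prob_space "PiM UNIV B" using B by (intro prob_space_PiM)
  have f [measurable]: "?f \<in> ?S \<rightarrow>\<^sub>M ?P"
    by (rule measurable_PiM_single') (auto simp: split_beta' space_PiM PiE_iff space_pair_measure)
  show ?thesis
  proof (rule P.PiM_eq)
    fix J :: "'i set" and C
    assume J: "finite J" and C: "\<And>j. j \<in> J \<Longrightarrow> C j \<in> sets (A j \<Otimes>\<^sub>M B j)"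
    \<comment> \<open>The sets \<open>C j\<close> need not be rectangles, so the cylinder is not a
      product set in the two factors. Its indicator is a product over \<open>J\<close>, and that is
      what Fubini can handle.\<close>
    have ind: "indicator (?f -` P.emb UNIV J (Pi\<^sub>E J C)) (\<eta>, \<zeta>) = (\<Prod>j\<in>J. indicator (C j) (\<eta> j, \<zeta> j) :: ennreal)"
      if "\<eta> \<in> space (PiM UNIV A)" "\<zeta> \<in> space (PiM UNIV B)" for \<eta> \<zeta>
    proof -
      have "?f (\<eta>, \<zeta>) \<in> space ?P" using measurable_space[OF f, of "(\<eta>, \<zeta>)"] that by (auto simp: space_pair_measure)
      then have "(\<eta>, \<zeta>) \<in> ?f -` P.emb UNIV J (Pi\<^sub>E J C) \<longleftrightarrow> (\<forall>j\<in>J. (\<eta> j, \<zeta> j) \<in> C j)"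
        by (auto simp: prod_emb_def restrict_PiE_iff space_PiM PiE_iff)
      then show ?thesis using J by (auto simp: indicator_def prod_ennreal split: if_splits)
    qed
    have "emeasure (distr ?S ?P ?f) (P.emb UNIV J (Pi\<^sub>E J C)) = emeasure ?S (?f -` P.emb UNIV J (Pi\<^sub>E J C) \<inter> space ?S)"
      using J C by (intro emeasure_distr f sets_PiM_I) auto
    also have "\<dots> = (\<integral>\<^sup>+x. indicator (?f -` P.emb UNIV J (Pi\<^sub>E J C)) x \<partial>?S)"
      using J C by (subst nn_integral_indicator[symmetric])
        (auto intro!: nn_integral_cong measurable_sets[OF f] sets_PiM_I simp: indicator_def)
    also have "\<dots> = (\<integral>\<^sup>+x. (\<Prod>j\<in>J. indicator (C j) (fst x j, snd x j)) \<partial>?S)"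
      using ind by (intro nn_integral_cong) (auto simp: space_pair_measure)
    also have "\<dots> = (\<integral>\<^sup>+\<eta>. \<integral>\<^sup>+\<zeta>. (\<Prod>j\<in>J. indicator (C j) (\<eta> j, \<zeta> j)) \<partial>PiM UNIV B \<partial>PiM UNIV A)"
      using J C by (subst PB.nn_integral_fst[symmetric]) (auto intro!: borel_measurable_prod_ennreal borel_measurable_indicator')
    also have "\<dots> = (\<integral>\<^sup>+\<eta>. (\<Prod>j\<in>J. \<integral>\<^sup>+k. indicator (C j) (\<eta> j, k) \<partial>B j) \<partial>PiM UNIV A)"
      using J C B by (intro nn_integral_cong nn_integral_prod_PiM) (auto simp: space_PiM PiE_iff)
    also have "\<dots> = (\<Prod>j\<in>J. \<integral>\<^sup>+x. (\<integral>\<^sup>+k. indicator (C j) (x, k) \<partial>B j) \<partial>A j)"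
    proof (rule nn_integral_prod_PiM[OF A J])
      fix j assume "j \<in> J"
      interpret B: prob_space "B j" by (rule B)
      show "(\<lambda>x. \<integral>\<^sup>+k. indicator (C j) (x, k) \<partial>B j) \<in> borel_measurable (A j)"
        using C[OF \<open>j \<in> J\<close>] by measurable
    qed
    also have "\<dots> = (\<Prod>j\<in>J. emeasure (A j \<Otimes>\<^sub>M B j) (C j))"
    proof (intro prod.cong refl)
      fix j assume "j \<in> J"
      interpret B: prob_space "B j" by (rule B)
      show "(\<integral>\<^sup>+x. (\<integral>\<^sup>+k. indicator (C j) (x, k) \<partial>B j) \<partial>A j) = emeasure (A j \<Otimes>\<^sub>M B j) (C j)"
        using C[OF \<open>j \<in> J\<close>] by (simp add: B.emeasure_pair_measure)
    qed
    finally show "emeasure (distr ?S ?P ?f) (P.emb UNIV J (Pi\<^sub>E J C)) = (\<Prod>u\<in>J. emeasure (A u \<Otimes>\<^sub>M B u) (C u))" .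
  qed simp
qed

lemma measurable_zip [measurable]:
  "(\<lambda>x u. (fst x u, snd x u)) \<in> PiM UNIV A \<Otimes>\<^sub>M PiM UNIV B \<rightarrow>\<^sub>M PiM UNIV (\<lambda>u. A u \<Otimes>\<^sub>M B u)"
  by (rule measurable_PiM_single') (auto simp: split_beta' space_PiM PiE_iff space_pair_measure)

lemma nn_integral_PiM_zip:
  fixes A :: "'i \<Rightarrow> 'd measure" and B :: "'i \<Rightarrow> 'k measure"
  assumes A: "\<And>u. prob_space (A u)" and B: "\<And>u. prob_space (B u)"
    and [measurable]: "f \<in> borel_measurable (PiM UNIV (\<lambda>u. A u \<Otimes>\<^sub>M B u))"
  shows "(\<integral>\<^sup>+\<eta>. f \<eta> \<partial>PiM UNIV (\<lambda>u. A u \<Otimes>\<^sub>M B u)) =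
    (\<integral>\<^sup>+\<eta>. \<integral>\<^sup>+\<zeta>. f (\<lambda>u. (\<eta> u, \<zeta> u)) \<partial>PiM UNIV B \<partial>PiM UNIV A)"
proof -
  interpret PB: prob_space "PiM UNIV B" using B by (intro prob_space_PiM)
  have m: "(\<lambda>x. f (\<lambda>u. (fst x u, snd x u))) \<in> borel_measurable (PiM UNIV A \<Otimes>\<^sub>M PiM UNIV B)"
    by measurable
  have "(\<integral>\<^sup>+\<eta>. f \<eta> \<partial>PiM UNIV (\<lambda>u. A u \<Otimes>\<^sub>M B u)) = (\<integral>\<^sup>+x. f (\<lambda>u. (fst x u, snd x u)) \<partial>(PiM UNIV A \<Otimes>\<^sub>M PiM UNIV B))"
    by (subst PiM_zip[OF A B, symmetric]) (simp add: split_beta' nn_integral_distr)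
  also have "\<dots> = (\<integral>\<^sup>+\<eta>. \<integral>\<^sup>+\<zeta>. f (\<lambda>u. (\<eta> u, \<zeta> u)) \<partial>PiM UNIV B \<partial>PiM UNIV A)"
    using m by (subst PB.nn_integral_fst[symmetric]) auto
  finally show ?thesis .
qed

section \<open>The canonical branching Brownian motion\<close>

definition exp1 :: "real measure" where
  "exp1 = density lborel (\<lambda>x. ennreal (exponential_density 1 x))"

definition gauss2 :: "(real \<times> real) measure" where
  "gauss2 = density lborel (\<lambda>x. ennreal (std_normal_density x)) \<Otimes>\<^sub>M density lborel (\<lambda>x. ennreal (std_normal_density x))"

definition particle :: "(real \<times> (real \<times> real)) measure" where
  "particle = exp1 \<Otimes>\<^sub>M gauss2"

definition lin :: "real \<Rightarrow> complex \<Rightarrow> real \<times> real \<Rightarrow> complex" where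
  "lin \<rho> \<beta> p = complex_of_real (Re \<beta> * fst p) +
     \<i> * complex_of_real (Im \<beta> * (\<rho> * fst p + sqrt (1 - \<rho>\<^sup>2) * snd p))"

lemma prob_space_exp1: "prob_space exp1"
  unfolding exp1_def by (rule prob_space_exponential_density) simp

lemma sets_exp1 [measurable_cong, simp]: "sets exp1 = sets borel"
  by (simp add: exp1_def)

lemma space_exp1 [simp]: "space exp1 = UNIV"
  by (simp add: exp1_def)

lemma sets_gauss2 [measurable_cong, simp]: "sets gauss2 = sets (borel \<Otimes>\<^sub>M borel)"
  unfolding gauss2_def by (intro sets_pair_measure_cong) auto

lemma prob_space_gauss2: "prob_space gauss2"
proof -
  interpret A: prob_space "density lborel (\<lambda>x. ennreal (std_normal_density x))"
    by (rule prob_space_normal_density) simp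
  interpret B: pair_prob_space "density lborel (\<lambda>x. ennreal (std_normal_density x))" "density lborel (\<lambda>x. ennreal (std_normal_density x))" ..
  show ?thesis unfolding gauss2_def by (rule B.prob_space_axioms)
qed

lemma sets_particle [measurable_cong, simp]: "sets particle = sets (borel \<Otimes>\<^sub>M (borel \<Otimes>\<^sub>M borel))"
  unfolding particle_def by (intro sets_pair_measure_cong) auto

lemma prob_space_pairI: "prob_space A \<Longrightarrow> prob_space B \<Longrightarrow> prob_space (A \<Otimes>\<^sub>M B)"
proof -
  assume "prob_space A" "prob_space B"
  then interpret A: prob_space A + B: prob_space B .
  interpret AB: pair_prob_space A B ..
  show ?thesis by (rule AB.prob_space_axioms)
qed

lemma prob_space_particle: "prob_space particle"
  unfolding particle_def by (intro prob_space_pairI prob_space_exp1 prob_space_gauss2)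

lemma measurable_lin [measurable]: "lin \<rho> \<beta> \<in> borel_measurable (borel \<Otimes>\<^sub>M borel)"
  unfolding lin_def by measurable

lemma nn_integral_exp1:
  assumes [measurable]: "f \<in> borel_measurable borel"
  shows "(\<integral>\<^sup>+x. f x \<partial>exp1) = (\<integral>\<^sup>+x. ennreal (exp (- x)) * indicator {0..} x * f x \<partial>lborel)"
  unfolding exp1_def
  by (subst nn_integral_density) (auto intro!: nn_integral_cong simp: exponential_density_def indicator_def)

lemma emeasure_exp1_greaterThan:
  assumes "0 \<le> s" shows "emeasure exp1 {s<..} = ennreal (exp (- s))"
proof -
  interpret prob_space exp1 by (rule prob_space_exp1)
  have "distributed exp1 lborel (\<lambda>x. x) (\<lambda>x. ennreal (exponential_density 1 x))"
    unfolding distributed_def by (simp add: exp1_def distr_id2)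
  from exponential_distributedD_gt[OF this assms] have "prob {x. s < x} = exp (- s)" by simp
  moreover have "{x. s < x} = {s<..}" by auto
  ultimately show ?thesis by (simp add: emeasure_eq_measure)
qed

text \<open>The Laplace transform of a lifetime at 3. Any argument above 1 gives a value below 1/2,
  which beats the 2^n labels of generation n.\<close>

lemma nn_integral_exp1_exp: "(\<integral>\<^sup>+x. ennreal (exp (- 3 * x)) \<partial>exp1) = ennreal (1/4)"
proof -
  have "(\<integral>\<^sup>+x. ennreal (exp (- 3 * x)) \<partial>exp1) = (\<integral>\<^sup>+x. ennreal (1/4) * ennreal (exponential_density 4 x) \<partial>lborel)"
    by (subst nn_integral_exp1)
      (auto intro!: nn_integral_cong simp: exponential_density_def indicator_def ennreal_mult[symmetric] mult_exp_exp)
  also have "\<dots> = ennreal (1/4) * emeasure (density lborel (exponential_density 4)) UNIV"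
    by (subst nn_integral_cmult) (auto simp: emeasure_density)
  also have "\<dots> = ennreal (1/4)"
    using prob_space.emeasure_space_1[OF prob_space_exponential_density[of 4]] by simp
  finally show ?thesis .
qed

lemma AE_exp1_nonneg: "AE x in exp1. 0 \<le> x"
  unfolding exp1_def by (subst AE_density) (auto simp: exponential_density_def)

section \<open>No explosion of the tree\<close>

lemma measurable_tree_birth [measurable (raw)]:
  assumes [measurable]: "\<And>u. (\<lambda>x. l x u) \<in> borel_measurable M"
  shows "(\<lambda>x. tree_birth (l x) u) \<in> borel_measurable M"
  unfolding tree_birth_def by measurable

text \<open>Chernoff's bound for the sum of the independent lifetimes along the ancestral line of
  \<open>u\<close>.\<close>

lemma tree_birth_tail:
  "emeasure (PiM UNIV (\<lambda>_. exp1)) {l \<in> space (PiM UNIV (\<lambda>_. exp1)). tree_birth l u \<le> t}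
     \<le> ennreal (exp (3 * t) * (1/4) ^ length u)"
proof -
  let ?P = "PiM UNIV (\<lambda>_::bool list. exp1)"
  have "emeasure ?P {l \<in> space ?P. tree_birth l u \<le> t} = (\<integral>\<^sup>+l. indicator {l \<in> space ?P. tree_birth l u \<le> t} l \<partial>?P)"
    by simp
  also have "\<dots> \<le> (\<integral>\<^sup>+l. ennreal (exp (3 * t)) * ennreal (exp (- 3 * tree_birth l u)) \<partial>?P)"
    by (intro nn_integral_mono) (auto simp: indicator_def ennreal_mult[symmetric] mult_exp_exp)
  also have "\<dots> = ennreal (exp (3 * t)) * (\<integral>\<^sup>+l. ennreal (exp (- 3 * tree_birth l u)) \<partial>?P)"
    by (subst nn_integral_cmult) auto
  also have "(\<lambda>l. ennreal (exp (- 3 * tree_birth l u))) =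
     (\<lambda>l. \<Prod>v\<in>(\<lambda>k. take k u) ` {..<length u}. ennreal (exp (- 3 * l v)))" (is "_ = ?r")
  proof
    fix l
    have inj: "inj_on (\<lambda>k. take k u) {..<length u}"
      by (rule inj_onI) (metis length_take lessThan_iff min.absorb4)
    show "ennreal (exp (- 3 * tree_birth l u)) = ?r l"
      unfolding tree_birth_def
      by (subst prod.reindex[OF inj])
        (simp add: exp_sum[symmetric] prod_ennreal sum_distrib_left)
  qed
  also have "(\<integral>\<^sup>+l. ?r l \<partial>?P) = (\<Prod>v\<in>(\<lambda>k. take k u) ` {..<length u}. \<integral>\<^sup>+x. ennreal (exp (- 3 * x)) \<partial>exp1)"
    by (rule nn_integral_prod_PiM) (auto simp: prob_space_exp1)
  also have "\<dots> = ennreal ((1/4) ^ length u)"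
  proof -
    have "inj_on (\<lambda>k. take k u) {..<length u}"
      by (rule inj_onI) (metis length_take lessThan_iff min.absorb4)
    then show ?thesis by (simp only: nn_integral_exp1_exp prod_constant card_image card_lessThan) (simp add: ennreal_power)
  qed
  finally show ?thesis by (simp add: ennreal_mult)
qed

lemma finite_bool_lists_length: "finite {u :: bool list. length u = n}" "card {u :: bool list. length u = n} = 2 ^ n"
  using finite_lists_length_eq[of "UNIV :: bool set" n] card_lists_length_eq[of "UNIV :: bool set" n] by auto

text \<open>Borel-Cantelli over the generations: some label of length n is born by time
  \<open>t\<close> with probability at most exp (3 t) 2^(-n).\<close>

lemma AE_PiM_exp1_tree_ok: "AE l in PiM UNIV (\<lambda>_. exp1). tree_ok l"
proof -
  let ?P = "PiM UNIV (\<lambda>_::bool list. exp1)"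
  interpret P: prob_space ?P by (intro prob_space_PiM prob_space_exp1)
  have nn: "AE l in ?P. \<forall>u. 0 \<le> l u"
  proof (rule AE_all_countable[THEN iffD2], rule allI)
    fix u :: "bool list"
    show "AE l in ?P. 0 \<le> l u"
      using AE_PiM_component[of UNIV "\<lambda>_. exp1" u "\<lambda>x. 0 \<le> x"] prob_space_exp1 AE_exp1_nonneg by auto
  qed
  have fin: "AE l in ?P. \<forall>t::nat. eventually (\<lambda>n. l \<in> space ?P - {l \<in> space ?P. \<exists>u. length u = n \<and> tree_birth l u \<le> t}) sequentially"
  proof (rule AE_all_countable[THEN iffD2], rule allI)
    fix t :: nat
    show "AE l in ?P. eventually (\<lambda>n. l \<in> space ?P - {l \<in> space ?P. \<exists>u. length u = n \<and> tree_birth l u \<le> t}) sequentially"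
    proof (rule borel_cantelli_AE1)
      fix n :: nat
      show "{l \<in> space ?P. \<exists>u. length u = n \<and> tree_birth l u \<le> t} \<in> sets ?P" by measurable
      show "emeasure ?P {l \<in> space ?P. \<exists>u. length u = n \<and> tree_birth l u \<le> t} < \<infinity>"
        by (simp add: less_top[symmetric])
    next
      show "summable (\<lambda>n. measure ?P {l \<in> space ?P. \<exists>u. length u = n \<and> tree_birth l u \<le> t})"
      proof (rule summable_comparison_test)
        show "summable (\<lambda>n. exp (3 * real t) * (1/2) ^ n)" by (intro summable_mult summable_geometric) simp
        have "measure ?P {l \<in> space ?P. \<exists>u. length u = n \<and> tree_birth l u \<le> t} \<le> exp (3 * real t) * (1/2) ^ n" for n
        proof -
          have "{l \<in> space ?P. \<exists>u. length u = n \<and> tree_birth l u \<le> t} = (\<Union>u\<in>{u. length u = n}. {l \<in> space ?P. tree_birth l u \<le> t})"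
            by auto
          then have "measure ?P {l \<in> space ?P. \<exists>u. length u = n \<and> tree_birth l u \<le> t} \<le> (\<Sum>u\<in>{u. length u = n}. measure ?P {l \<in> space ?P. tree_birth l u \<le> t})"
            using finite_bool_lists_length(1)[of n] by (auto intro!: measure_UNION_le)
          also have "\<dots> \<le> (\<Sum>u\<in>{u::bool list. length u = n}. exp (3 * real t) * (1/4) ^ n)"
          proof (intro sum_mono)
            fix u :: "bool list" assume "u \<in> {u. length u = n}"
            then show "measure ?P {l \<in> space ?P. tree_birth l u \<le> t} \<le> exp (3 * real t) * (1/4) ^ n"
              using tree_birth_tail[of u t] by (simp add: P.emeasure_eq_measure)
          qed
          also have "\<dots> = exp (3 * real t) * (1/2) ^ n"
            by (simp add: finite_bool_lists_length power_mult_distrib[symmetric])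
          finally show ?thesis .
        qed
        then show "\<exists>N. \<forall>n\<ge>N. norm (measure ?P {l \<in> space ?P. \<exists>u. length u = n \<and> tree_birth l u \<le> t}) \<le> exp (3 * real t) * (1/2) ^ n"
          by auto
      qed
    qed
  qed
  from nn fin show ?thesis
  proof (eventually_elim)
    case (elim l)
    have "finite {u. tree_birth l u \<le> t}" for t
    proof -
      obtain m :: nat where m: "t \<le> m" using real_arch_simple by blast
      from elim(2)[rule_format, of m] obtain n0 where
        n0: "\<And>n. n \<ge> n0 \<Longrightarrow> l \<in> space ?P - {l \<in> space ?P. \<exists>u. length u = n \<and> tree_birth l u \<le> m}"
        unfolding eventually_sequentially by blast
      have "{u. tree_birth l u \<le> t} \<subseteq> (\<Union>n<n0. {u. length u = n})"
      proof
        fix u assume "u \<in> {u. tree_birth l u \<le> t}"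
        then have "tree_birth l u \<le> m" using m by simp
        then have "\<not> n0 \<le> length u" using n0[of "length u"] by blast
        then show "u \<in> (\<Union>n<n0. {u. length u = n})" by simp
      qed
      then show ?thesis by (rule finite_subset) (auto simp: finite_bool_lists_length)
    qed
    then show ?case using elim(1) by (simp add: tree_ok_def)
  qed
qed

lemma PiM_fst:
  fixes A :: "'i \<Rightarrow> 'd measure" and B :: "'i \<Rightarrow> 'k measure"
  assumes A: "\<And>u. prob_space (A u)" and B: "\<And>u. prob_space (B u)"
  shows "distr (PiM UNIV (\<lambda>u. A u \<Otimes>\<^sub>M B u)) (PiM UNIV A) (\<lambda>\<eta> u. fst (\<eta> u)) = PiM UNIV A"
proof -
  interpret PA: prob_space "PiM UNIV A" using A by (intro prob_space_PiM)
  interpret PB: prob_space "PiM UNIV B" using B by (intro prob_space_PiM)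
  interpret PAB: pair_prob_space "PiM UNIV A" "PiM UNIV B" ..
  have m [measurable]: "(\<lambda>\<eta> u. fst (\<eta> u)) \<in> PiM UNIV (\<lambda>u. A u \<Otimes>\<^sub>M B u) \<rightarrow>\<^sub>M PiM UNIV A"
    by (rule measurable_PiM_single') (auto simp: space_PiM PiE_iff space_pair_measure mem_Times_iff)
  have "distr (PiM UNIV (\<lambda>u. A u \<Otimes>\<^sub>M B u)) (PiM UNIV A) (\<lambda>\<eta> u. fst (\<eta> u)) =
     distr (PiM UNIV A \<Otimes>\<^sub>M PiM UNIV B) (PiM UNIV A) fst"
    by (subst PiM_zip[OF A B, symmetric], subst distr_distr)
      (auto simp: split_beta' comp_def intro!: distr_cong)
  also have "\<dots> = PiM UNIV A"
  proof (rule measure_eqI)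
    fix X assume "X \<in> sets (distr (PiM UNIV A \<Otimes>\<^sub>M PiM UNIV B) (PiM UNIV A) fst)"
    then have X: "X \<in> sets (PiM UNIV A)" by simp
    have "fst -` X \<inter> space (PiM UNIV A \<Otimes>\<^sub>M PiM UNIV B) = X \<times> space (PiM UNIV B)"
      using sets.sets_into_space[OF X] by (auto simp: space_pair_measure)
    then show "emeasure (distr (PiM UNIV A \<Otimes>\<^sub>M PiM UNIV B) (PiM UNIV A) fst) X = emeasure (PiM UNIV A) X"
      using X by (simp add: emeasure_distr PB.emeasure_pair_measure_Times PB.emeasure_space_1)
  qed simp
  finally show ?thesis .
qed

lemma AE_PiM_tree_ok:
  assumes B: "\<And>u. prob_space (B u)"
  shows "AE \<eta> in PiM UNIV (\<lambda>u. exp1 \<Otimes>\<^sub>M B u). tree_ok (\<lambda>u. fst (\<eta> u))"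
proof -
  let ?f = "\<lambda>(\<eta> :: bool list \<Rightarrow> real \<times> 'a) u. fst (\<eta> u)"
  have m: "?f \<in> PiM UNIV (\<lambda>u. exp1 \<Otimes>\<^sub>M B u) \<rightarrow>\<^sub>M PiM UNIV (\<lambda>_. exp1)"
    by (rule measurable_PiM_single') (auto simp: space_PiM PiE_iff space_pair_measure mem_Times_iff)
  have "distr (PiM UNIV (\<lambda>u. exp1 \<Otimes>\<^sub>M B u)) (PiM UNIV (\<lambda>_. exp1)) ?f = PiM UNIV (\<lambda>_. exp1)"
    by (rule PiM_fst) (auto intro: prob_space_exp1 B)
  then have "almost_everywhere (distr (PiM UNIV (\<lambda>u. exp1 \<Otimes>\<^sub>M B u)) (PiM UNIV (\<lambda>_. exp1)) ?f) tree_ok"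
    using AE_PiM_exp1_tree_ok by (rule ssubst)
  from AE_distrD[OF m this] show ?thesis .
qed

section \<open>Measurability of sums over a random tree\<close>

lemma measurable_tree_pos [measurable (raw)]:
  assumes [measurable]: "\<And>u. (\<lambda>x. l x u) \<in> borel_measurable M" "T \<in> borel_measurable M"
    and d: "\<And>u. (\<lambda>(x, r). d x u r) \<in> borel_measurable (M \<Otimes>\<^sub>M borel)"
  shows "(\<lambda>x. tree_pos (l x) (d x) u (T x)) \<in> borel_measurable M"
proof -
  have [measurable]: "(\<lambda>x. d x v (r x)) \<in> borel_measurable M" if "r \<in> borel_measurable M" for v r
    using measurable_compose[OF measurable_Pair[OF measurable_ident that] d[of v]] by simp
  show ?thesis unfolding tree_pos_def by measurable
qed

text \<open>If the alive labels have bounded length, the sum is the limit of finite sums over labels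
  of bounded length. Otherwise infinitely many are alive and the sum is 0 by convention. The formula
  \<open>eq\<close> therefore covers every tree, and measurability holds without an exceptional
  set.\<close>

lemma measurable_tree_sum:
  assumes [measurable]: "\<And>u. (\<lambda>x. l x u) \<in> borel_measurable M" "T \<in> borel_measurable M"
      "\<And>u. (\<lambda>x. y x u) \<in> borel_measurable M"
    and d [measurable]: "\<And>u. (\<lambda>(x, r). d x u r) \<in> borel_measurable (M \<Otimes>\<^sub>M borel)"
  shows "(\<lambda>x. tree_sum (l x) (d x) (y x) (T x)) \<in> borel_measurable M"
proof -
  let ?al = "\<lambda>x u. tree_birth (l x) u \<le> T x \<and> T x < tree_birth (l x) u + l x u"
  define S where "S n x = (\<Sum>u\<in>{u. length u \<le> n}. if ?al x u then exp (tree_pos (l x) (d x) u (T x)) * y x u else 0)" for n x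
  have fin: "finite {u :: bool list. length u \<le> n}" for n
    using finite_lists_length_le[of "UNIV :: bool set" n] by simp
  have [measurable]: "S n \<in> borel_measurable M" for n
    unfolding S_def by measurable
  have eq: "tree_sum (l x) (d x) (y x) (T x) =
      (if \<exists>n. \<forall>u. ?al x u \<longrightarrow> length u \<le> n then lim (\<lambda>n. S n x) else 0)" for x
  proof (cases "\<exists>n. \<forall>u. ?al x u \<longrightarrow> length u \<le> n")
    case True
    then obtain n where n: "\<And>u. ?al x u \<Longrightarrow> length u \<le> n" by blast
    have "S m x = tree_sum (l x) (d x) (y x) (T x)" if "m \<ge> n" for m
    proof -
      have "S m x = (\<Sum>u\<in>{u \<in> {u. length u \<le> m}. ?al x u}. exp (tree_pos (l x) (d x) u (T x)) * y x u)"
        unfolding S_def using fin[of m] by (rule sum.inter_filter[symmetric])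
      also have "{u \<in> {u. length u \<le> m}. ?al x u} = tree_alive (l x) (T x)"
        using n that by (force simp: tree_alive_def)
      finally show ?thesis by (simp add: tree_sum_def)
    qed
    then have "(\<lambda>m. S m x) \<longlonglongrightarrow> tree_sum (l x) (d x) (y x) (T x)"
      by (intro tendsto_eventually) (auto simp: eventually_sequentially)
    then show ?thesis using True by (simp add: limI)
  next
    case False
    have "infinite (tree_alive (l x) (T x))"
    proof
      assume "finite (tree_alive (l x) (T x))"
      then have "finite (length ` tree_alive (l x) (T x))" by simp
      then obtain n where "\<forall>k\<in>length ` tree_alive (l x) (T x). k \<le> n" using finite_nat_set_iff_bounded_le by blast
      then show False using False by (auto simp: tree_alive_def)
    qed
    then show ?thesis by (simp only: False if_False) (simp add: tree_sum_def)
  qed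
  show ?thesis unfolding eq by measurable
qed

section \<open>The canonical model and its first-split equation\<close>

definition bbm_space :: "(bool list \<Rightarrow> real \<times> (real \<times> real)) measure" where
  "bbm_space = PiM UNIV (\<lambda>_. particle)"

text \<open>Gaussian stand-in for the displacement at age \<open>r\<close>. For different \<open>r\<close> these are not jointly Brownian,
  which is harmless because each particle is evaluated at a single age.\<close>

definition disp :: "real \<Rightarrow> complex \<Rightarrow> real \<Rightarrow> real \<times> real \<Rightarrow> complex" where
  "disp \<rho> \<beta> r p = complex_of_real (sqrt r) * lin \<rho> \<beta> p"

definition bbm_sum :: "real \<Rightarrow> complex \<Rightarrow> real \<Rightarrow> (bool list \<Rightarrow> real \<times> (real \<times> real)) \<Rightarrow> (bool list \<Rightarrow> complex) \<Rightarrow> complex" where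
  "bbm_sum \<rho> \<beta> s \<eta> y = tree_sum (\<lambda>u. fst (\<eta> u)) (\<lambda>u r. disp \<rho> \<beta> r (snd (\<eta> u))) y s"

definition bbm :: "real \<Rightarrow> complex \<Rightarrow> real \<Rightarrow> (bool list \<Rightarrow> real \<times> (real \<times> real)) \<Rightarrow> complex" where
  "bbm \<rho> \<beta> s \<eta> = bbm_sum \<rho> \<beta> s \<eta> (\<lambda>_. 1)"

text \<open>The marks belong to the same product as the particles, so a marked tree splits at its
  root exactly as an unmarked one does.\<close>

definition marked_sum :: "real \<Rightarrow> complex \<Rightarrow> ('k \<Rightarrow> complex) \<Rightarrow> real \<Rightarrow> (bool list \<Rightarrow> (real \<times> (real \<times> real)) \<times> 'k) \<Rightarrow> complex" where
  "marked_sum \<rho> \<beta> y s \<eta> = bbm_sum \<rho> \<beta> s (\<lambda>u. fst (\<eta> u)) (\<lambda>u. y (snd (\<eta> u)))"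

lemma prob_space_bbm_space: "prob_space bbm_space"
  unfolding bbm_space_def by (intro prob_space_PiM prob_space_particle)

lemma measurable_disp [measurable]: "(\<lambda>(r, p). disp \<rho> \<beta> r p) \<in> borel_measurable (borel \<Otimes>\<^sub>M (borel \<Otimes>\<^sub>M borel))"
  unfolding disp_def by measurable

lemma measurable_bbm_sum [measurable (raw)]:
  assumes [measurable]: "T \<in> borel_measurable M" "\<And>u. (\<lambda>x. e x u) \<in> M \<rightarrow>\<^sub>M (borel \<Otimes>\<^sub>M (borel \<Otimes>\<^sub>M borel))"
    "\<And>u. (\<lambda>x. y x u) \<in> borel_measurable M"
  shows "(\<lambda>x. bbm_sum \<rho> \<beta> (T x) (e x) (y x)) \<in> borel_measurable M"
  unfolding bbm_sum_def by (intro measurable_tree_sum) (auto simp: split_beta')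

lemma measurable_bbm [measurable (raw)]:
  assumes [measurable]: "T \<in> borel_measurable M" "f \<in> M \<rightarrow>\<^sub>M bbm_space"
  shows "(\<lambda>x. bbm \<rho> \<beta> (T x) (f x)) \<in> borel_measurable M"
proof -
  have "(\<lambda>x. f x u) \<in> M \<rightarrow>\<^sub>M particle" for u
    using measurable_compose[OF assms(2)[unfolded bbm_space_def] measurable_component_singleton[of u]] by simp
  then have "(\<lambda>x. f x u) \<in> M \<rightarrow>\<^sub>M (borel \<Otimes>\<^sub>M (borel \<Otimes>\<^sub>M borel))" for u
    by (simp add: measurable_cong_sets[OF refl sets_particle])
  then show ?thesis unfolding bbm_def by (intro measurable_bbm_sum assms) auto
qed

lemma measurable_marked_sum [measurable (raw)]:
  assumes [measurable]: "y \<in> borel_measurable K" "T \<in> borel_measurable M" "f \<in> M \<rightarrow>\<^sub>M PiM UNIV (\<lambda>_. particle \<Otimes>\<^sub>M K)"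
  shows "(\<lambda>x. marked_sum \<rho> \<beta> y (T x) (f x)) \<in> borel_measurable M"
proof -
  have f: "(\<lambda>x. f x u) \<in> M \<rightarrow>\<^sub>M particle \<Otimes>\<^sub>M K" for u
    using measurable_compose[OF assms(3) measurable_component_singleton[of u]] by simp
  have "(\<lambda>x. fst (f x u)) \<in> M \<rightarrow>\<^sub>M (borel \<Otimes>\<^sub>M (borel \<Otimes>\<^sub>M borel))" for u
    using measurable_compose[OF f measurable_fst, of u] by (simp add: measurable_cong_sets[OF refl sets_particle])
  moreover have "(\<lambda>x. y (snd (f x u))) \<in> borel_measurable M" for u
    using measurable_compose[OF measurable_compose[OF f measurable_snd] assms(1)] .
  ultimately show ?thesis unfolding marked_sum_def by (intro measurable_bbm_sum assms)
qed

lemma marked_sum_const: "marked_sum \<rho> \<beta> (\<lambda>_. 1) s \<eta> = bbm \<rho> \<beta> s (\<lambda>u. fst (\<eta> u))"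
  by (simp add: marked_sum_def bbm_def)

text \<open>The renewal equation at the first split, tested against \<open>g\<close>.
  \<open>c s g\<close> is the part where the root outlives \<open>s\<close>; otherwise it splits at
  age \<open>l\<close>, and the two offspring are independent copies, expressed by the double
  integral over \<open>\<Omega>\<close>. The space is arbitrary so that different models can be
  compared through the equation.\<close>

definition first_split ::
  "real \<Rightarrow> complex \<Rightarrow> 'w measure \<Rightarrow> (real \<Rightarrow> 'w \<Rightarrow> complex) \<Rightarrow> (real \<Rightarrow> (complex \<Rightarrow> ennreal) \<Rightarrow> ennreal) \<Rightarrow> bool" where
  "first_split \<rho> \<beta> \<Omega> X c \<longleftrightarrow> prob_space \<Omega> \<and> (\<lambda>(s, \<omega>). X s \<omega>) \<in> borel_measurable (borel \<Otimes>\<^sub>M \<Omega>) \<and>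
    (\<forall>s\<ge>0. \<forall>g\<in>borel_measurable borel. (\<integral>\<^sup>+\<omega>. g (X s \<omega>) \<partial>\<Omega>) = c s g +
      (\<integral>\<^sup>+l. ennreal (exp (- l)) * indicator {0..s} l *
        (\<integral>\<^sup>+p. \<integral>\<^sup>+\<omega>. \<integral>\<^sup>+\<omega>'. g (exp (disp \<rho> \<beta> l p) * (X (s - l) \<omega> + X (s - l) \<omega>')) \<partial>\<Omega> \<partial>\<Omega> \<partial>gauss2) \<partial>lborel))"

text \<open>The step of every iteration below: a factor \<open>c\<close> and one integration turn
  the n-th term of the exponential series into the next one.\<close>

lemma nn_integral_power_Icc:
  fixes c s :: real
  assumes "0 \<le> c" "0 \<le> s"
  shows "(\<integral>\<^sup>+l. ennreal (c * ((c * (s - l)) ^ n / fact n)) * indicator {0..s} l \<partial>lborel) = ennreal ((c * s) ^ Suc n / fact (Suc n))"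
proof -
  have "(\<integral>\<^sup>+l. ennreal (c * ((c * (s - l)) ^ n / fact n)) * indicator {0..s} l \<partial>lborel) =
     ennreal ((\<lambda>l. - ((c * (s - l)) ^ Suc n / fact (Suc n))) s - (\<lambda>l. - ((c * (s - l)) ^ Suc n / fact (Suc n))) 0)"
  proof (rule nn_integral_FTC_Icc)
    fix l assume l: "l \<in> {0..s}"
    show "((\<lambda>l. - ((c * (s - l)) ^ Suc n / fact (Suc n))) has_real_derivative c * ((c * (s - l)) ^ n / fact n)) (at l)"
    proof -
      have "((\<lambda>l. - ((c * (s - l)) ^ Suc n / fact (Suc n))) has_real_derivative
          - (real (Suc n) * (c * (0 - 1)) * (c * (s - l)) ^ n / fact (Suc n))) (at l)"
        by (rule derivative_eq_intros refl | simp)+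
      also have "- (real (Suc n) * (c * (0 - 1)) * (c * (s - l)) ^ n / fact (Suc n)) = c * ((c * (s - l)) ^ n / fact n)"
        unfolding fact_Suc by (simp add: divide_simps)
      finally show ?thesis .
    qed
    show "0 \<le> c * ((c * (s - l)) ^ n / fact n)" using assms l by auto
  qed (use assms in auto)
  then show ?thesis by simp
qed

text \<open>Two solutions of the same first-split equation differ by at most \<open>(2 s)\<^sup>n / n!\<close> on test functions
  bounded by 1: each iteration of the equation doubles the number of copies.\<close>

lemma first_split_le:
  assumes X: "first_split \<rho> \<beta> \<Omega> X c" and Y: "first_split \<rho> \<beta> \<Omega>' Y c"
    and "0 \<le> s" and "g \<in> borel_measurable borel" and "\<And>z. g z \<le> 1"
  shows "(\<integral>\<^sup>+\<omega>. g (X s \<omega>) \<partial>\<Omega>) \<le> (\<integral>\<^sup>+\<omega>. g (Y s \<omega>) \<partial>\<Omega>') + ennreal ((2 * s) ^ n / fact n)"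
  using assms(3-5)
proof (induction n arbitrary: s g)
  case 0
  interpret A: prob_space \<Omega> using X by (simp add: first_split_def)
  have "(\<integral>\<^sup>+\<omega>. g (X s \<omega>) \<partial>\<Omega>) \<le> (\<integral>\<^sup>+\<omega>. 1 \<partial>\<Omega>)" using 0 by (intro nn_integral_mono) auto
  also have "\<dots> = 1" by (simp add: A.emeasure_space_1)
  finally show ?case by (simp add: add_increasing)
next
  case (Suc n)
  note [measurable] = \<open>g \<in> borel_measurable borel\<close>
  interpret A: prob_space \<Omega> using X by (simp add: first_split_def)
  interpret B: prob_space \<Omega>' using Y by (simp add: first_split_def)
  interpret G: prob_space gauss2 by (rule prob_space_gauss2)
  interpret AB: pair_prob_space \<Omega> \<Omega>' ..
  have Xm [measurable]: "(\<lambda>(s, \<omega>). X s \<omega>) \<in> borel_measurable (borel \<Otimes>\<^sub>M \<Omega>)"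
    and Ym [measurable]: "(\<lambda>(s, \<omega>). Y s \<omega>) \<in> borel_measurable (borel \<Otimes>\<^sub>M \<Omega>')"
    using X Y by (auto simp: first_split_def)
  define JX where "JX l = (\<integral>\<^sup>+p. \<integral>\<^sup>+\<omega>. \<integral>\<^sup>+\<omega>'. g (exp (disp \<rho> \<beta> l p) * (X (s - l) \<omega> + X (s - l) \<omega>')) \<partial>\<Omega> \<partial>\<Omega> \<partial>gauss2)" for l
  define JY where "JY l = (\<integral>\<^sup>+p. \<integral>\<^sup>+\<omega>. \<integral>\<^sup>+\<omega>'. g (exp (disp \<rho> \<beta> l p) * (Y (s - l) \<omega> + Y (s - l) \<omega>')) \<partial>\<Omega>' \<partial>\<Omega>' \<partial>gauss2)" for l
  have JY_meas [measurable]: "JY \<in> borel_measurable borel" unfolding JY_def by measurable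
  have JXY: "JX l \<le> JY l + 2 * ennreal ((2 * (s - l)) ^ n / fact n)" if l: "l \<in> {0..s}" for l
  proof -
    let ?e = "ennreal ((2 * (s - l)) ^ n / fact n)"
    have [measurable]: "X (s - l) \<in> borel_measurable \<Omega>" "Y (s - l) \<in> borel_measurable \<Omega>'"
      using measurable_Pair2[OF Xm, of "s - l"] measurable_Pair2[OF Ym, of "s - l"] by auto
    \<comment> \<open>The two offspring are exchanged one at a time. With the other one frozen, the
      test function is \<open>g\<close> after an affine map, again bounded by 1, so the induction
      hypothesis applies; each exchange costs \<open>?e\<close>.\<close>
    have *: "(\<integral>\<^sup>+\<omega>. \<integral>\<^sup>+\<omega>'. g (exp (disp \<rho> \<beta> l p) * (X (s - l) \<omega> + X (s - l) \<omega>')) \<partial>\<Omega> \<partial>\<Omega>)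
       \<le> (\<integral>\<^sup>+\<omega>. \<integral>\<^sup>+\<omega>'. g (exp (disp \<rho> \<beta> l p) * (Y (s - l) \<omega> + Y (s - l) \<omega>')) \<partial>\<Omega>' \<partial>\<Omega>') + 2 * ?e" for p
    proof -
      let ?z = "exp (disp \<rho> \<beta> l p)"
      have "(\<integral>\<^sup>+\<omega>. \<integral>\<^sup>+\<omega>'. g (?z * (X (s - l) \<omega> + X (s - l) \<omega>')) \<partial>\<Omega> \<partial>\<Omega>)
         \<le> (\<integral>\<^sup>+\<omega>. (\<integral>\<^sup>+\<omega>'. g (?z * (X (s - l) \<omega> + Y (s - l) \<omega>')) \<partial>\<Omega>') + ?e \<partial>\<Omega>)"
      proof (rule nn_integral_mono)
        fix w assume "w \<in> space \<Omega>"
        show "(\<integral>\<^sup>+\<omega>'. g (?z * (X (s - l) w + X (s - l) \<omega>')) \<partial>\<Omega>) \<le> (\<integral>\<^sup>+\<omega>'. g (?z * (X (s - l) w + Y (s - l) \<omega>')) \<partial>\<Omega>') + ?e"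
          by (rule Suc.IH[of "s - l" "\<lambda>x. g (?z * (X (s - l) w + x))"]) (use l Suc.prems(3) in auto)
      qed
      also have "\<dots> = (\<integral>\<^sup>+\<omega>. \<integral>\<^sup>+\<omega>'. g (?z * (X (s - l) \<omega> + Y (s - l) \<omega>')) \<partial>\<Omega>' \<partial>\<Omega>) + ?e"
        by (subst nn_integral_add) (auto simp: A.emeasure_space_1)
      finally have 1: "(\<integral>\<^sup>+\<omega>. \<integral>\<^sup>+\<omega>'. g (?z * (X (s - l) \<omega> + X (s - l) \<omega>')) \<partial>\<Omega> \<partial>\<Omega>) \<le> (\<integral>\<^sup>+\<omega>. \<integral>\<^sup>+\<omega>'. g (?z * (X (s - l) \<omega> + Y (s - l) \<omega>')) \<partial>\<Omega>' \<partial>\<Omega>) + ?e" .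
      have "(\<integral>\<^sup>+\<omega>. \<integral>\<^sup>+\<omega>'. g (?z * (X (s - l) \<omega> + Y (s - l) \<omega>')) \<partial>\<Omega>' \<partial>\<Omega>) =
          (\<integral>\<^sup>+\<omega>'. \<integral>\<^sup>+\<omega>. g (?z * (X (s - l) \<omega> + Y (s - l) \<omega>')) \<partial>\<Omega> \<partial>\<Omega>')"
        by (rule AB.Fubini'[symmetric]) measurable
      also have "\<dots> \<le> (\<integral>\<^sup>+\<omega>'. (\<integral>\<^sup>+\<omega>. g (?z * (Y (s - l) \<omega>' + Y (s - l) \<omega>)) \<partial>\<Omega>') + ?e \<partial>\<Omega>')"
      proof (rule nn_integral_mono)
        fix w assume "w \<in> space \<Omega>'"
        have "(\<integral>\<^sup>+\<omega>. g (?z * (X (s - l) \<omega> + Y (s - l) w)) \<partial>\<Omega>) \<le> (\<integral>\<^sup>+\<omega>. g (?z * (Y (s - l) \<omega> + Y (s - l) w)) \<partial>\<Omega>') + ?e"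
          by (rule Suc.IH[of "s - l" "\<lambda>x. g (?z * (x + Y (s - l) w))"]) (use l Suc.prems(3) in auto)
        then show "(\<integral>\<^sup>+\<omega>. g (?z * (X (s - l) \<omega> + Y (s - l) w)) \<partial>\<Omega>) \<le> (\<integral>\<^sup>+\<omega>. g (?z * (Y (s - l) w + Y (s - l) \<omega>)) \<partial>\<Omega>') + ?e"
          by (simp add: add.commute)
      qed
      also have "\<dots> = (\<integral>\<^sup>+\<omega>. \<integral>\<^sup>+\<omega>'. g (?z * (Y (s - l) \<omega> + Y (s - l) \<omega>')) \<partial>\<Omega>' \<partial>\<Omega>') + ?e"
        by (subst nn_integral_add) (auto simp: B.emeasure_space_1)
      finally have 2: "(\<integral>\<^sup>+\<omega>. \<integral>\<^sup>+\<omega>'. g (?z * (X (s - l) \<omega> + Y (s - l) \<omega>')) \<partial>\<Omega>' \<partial>\<Omega>) \<le>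
        (\<integral>\<^sup>+\<omega>. \<integral>\<^sup>+\<omega>'. g (?z * (Y (s - l) \<omega> + Y (s - l) \<omega>')) \<partial>\<Omega>' \<partial>\<Omega>') + ?e" .
      show ?thesis using order_trans[OF 1 add_right_mono[OF 2]] by (simp only: mult_2[of ?e] add.assoc)
    qed
    have "JX l \<le> (\<integral>\<^sup>+p. (\<integral>\<^sup>+\<omega>. \<integral>\<^sup>+\<omega>'. g (exp (disp \<rho> \<beta> l p) * (Y (s - l) \<omega> + Y (s - l) \<omega>')) \<partial>\<Omega>' \<partial>\<Omega>') + 2 * ?e \<partial>gauss2)"
      unfolding JX_def by (intro nn_integral_mono *)
    also have "\<dots> = JY l + 2 * ?e"
      unfolding JY_def by (subst nn_integral_add) (auto simp: G.emeasure_space_1)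
    finally show ?thesis .
  qed
  have eqX: "(\<integral>\<^sup>+\<omega>. g (X s \<omega>) \<partial>\<Omega>) = c s g + (\<integral>\<^sup>+l. ennreal (exp (- l)) * indicator {0..s} l * JX l \<partial>lborel)"
    using X Suc.prems unfolding first_split_def JX_def by blast
  have "(\<integral>\<^sup>+l. ennreal (exp (- l)) * indicator {0..s} l * JX l \<partial>lborel) \<le>
     (\<integral>\<^sup>+l. ennreal (exp (- l)) * indicator {0..s} l * JY l + ennreal (2 * ((2 * (s - l)) ^ n / fact n)) * indicator {0..s} l \<partial>lborel)"
  proof (intro nn_integral_mono)
    fix l :: real
    show "ennreal (exp (- l)) * indicator {0..s} l * JX l \<le>
      ennreal (exp (- l)) * indicator {0..s} l * JY l + ennreal (2 * ((2 * (s - l)) ^ n / fact n)) * indicator {0..s} l"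
    proof (cases "l \<in> {0..s}")
      case True
      have "ennreal (exp (- l)) * JX l \<le> ennreal (exp (- l)) * (JY l + 2 * ennreal ((2 * (s - l)) ^ n / fact n))"
        by (intro mult_left_mono JXY True) simp
      also have "\<dots> \<le> ennreal (exp (- l)) * JY l + 1 * (2 * ennreal ((2 * (s - l)) ^ n / fact n))"
        unfolding distrib_left using True by (intro add_mono mult_right_mono order_refl) auto
      also have "1 * (2 * ennreal ((2 * (s - l)) ^ n / fact n)) = ennreal (2 * ((2 * (s - l)) ^ n / fact n))"
        using True by (subst ennreal_mult) auto
      finally show ?thesis using True by simp
    qed auto
  qed
  also have "\<dots> = (\<integral>\<^sup>+l. ennreal (exp (- l)) * indicator {0..s} l * JY l \<partial>lborel) + ennreal ((2 * s) ^ Suc n / fact (Suc n))"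
  proof (subst nn_integral_add)
    show "(\<integral>\<^sup>+l. ennreal (exp (- l)) * indicator {0..s} l * JY l \<partial>lborel) + (\<integral>\<^sup>+l. ennreal (2 * ((2 * (s - l)) ^ n / fact n)) * indicator {0..s} l \<partial>lborel) =
      (\<integral>\<^sup>+l. ennreal (exp (- l)) * indicator {0..s} l * JY l \<partial>lborel) + ennreal ((2 * s) ^ Suc n / fact (Suc n))"
      by (subst nn_integral_power_Icc[of 2 s n]) (use Suc.prems(1) in simp_all)
  qed measurable
  finally have le: "(\<integral>\<^sup>+l. ennreal (exp (- l)) * indicator {0..s} l * JX l \<partial>lborel) \<le>
    (\<integral>\<^sup>+l. ennreal (exp (- l)) * indicator {0..s} l * JY l \<partial>lborel) + ennreal ((2 * s) ^ Suc n / fact (Suc n))" .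
  have eqY: "(\<integral>\<^sup>+\<omega>. g (Y s \<omega>) \<partial>\<Omega>') = c s g + (\<integral>\<^sup>+l. ennreal (exp (- l)) * indicator {0..s} l * JY l \<partial>lborel)"
    using Y Suc.prems unfolding first_split_def JY_def by blast
  show ?case unfolding eqX eqY add.assoc by (rule add_left_mono[OF le])
qed

lemma ennreal_le_add_power_fact:
  fixes a b :: ennreal
  assumes "\<And>n. a \<le> b + ennreal (C * ((c ^ n) / fact n))"
  shows "a \<le> b"
proof (rule LIMSEQ_le_const)
  have "(\<lambda>n. C * (c ^ n / fact n)) \<longlonglongrightarrow> C * 0"
    using summable_LIMSEQ_zero[OF summable_exp[of c]]
    by (intro tendsto_mult tendsto_const) (simp add: inverse_eq_divide)
  then have "(\<lambda>n. b + ennreal (C * (c ^ n / fact n))) \<longlonglongrightarrow> b + ennreal (C * 0)"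
    by (intro tendsto_add tendsto_const tendsto_ennrealI)
  then show "(\<lambda>n. b + ennreal (C * (c ^ n / fact n))) \<longlonglongrightarrow> b" by simp
  show "\<exists>N. \<forall>n\<ge>N. a \<le> b + ennreal (C * (c ^ n / fact n))" using assms by auto
qed

text \<open>Indicators are test functions bounded by 1, so the two laws at time \<open>s\<close>
  agree; then the integrals of unbounded \<open>g\<close> agree as well.\<close>

lemma first_split_unique:
  assumes X: "first_split \<rho> \<beta> \<Omega> X c" and Y: "first_split \<rho> \<beta> \<Omega>' Y c"
    and "0 \<le> s" and [measurable]: "g \<in> borel_measurable borel"
  shows "(\<integral>\<^sup>+\<omega>. g (X s \<omega>) \<partial>\<Omega>) = (\<integral>\<^sup>+\<omega>. g (Y s \<omega>) \<partial>\<Omega>')"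
proof -
  have [measurable]: "X s \<in> borel_measurable \<Omega>" "Y s \<in> borel_measurable \<Omega>'"
    using measurable_Pair2[of "\<lambda>(s, \<omega>). X s \<omega>" borel \<Omega> borel s] measurable_Pair2[of "\<lambda>(s, \<omega>). Y s \<omega>" borel \<Omega>' borel s]
      X Y by (auto simp: first_split_def)
  have "distr \<Omega> borel (X s) = distr \<Omega>' borel (Y s)"
  proof (rule measure_eqI)
    fix A assume "A \<in> sets (distr \<Omega> borel (X s))"
    then have [measurable]: "A \<in> sets borel" by simp
    have eq: "(\<integral>\<^sup>+\<omega>. indicator A (X s \<omega>) \<partial>\<Omega>) = (\<integral>\<^sup>+\<omega>. indicator A (Y s \<omega>) \<partial>\<Omega>')"
    proof (rule antisym; rule ennreal_le_add_power_fact[where C=1 and c="2 * s"])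
      fix n
      show "(\<integral>\<^sup>+\<omega>. indicator A (X s \<omega>) \<partial>\<Omega>) \<le> (\<integral>\<^sup>+\<omega>. indicator A (Y s \<omega>) \<partial>\<Omega>') + ennreal (1 * ((2 * s) ^ n / fact n))"
        using first_split_le[OF X Y \<open>0 \<le> s\<close>, of "indicator A" n] by (simp add: indicator_def)
      show "(\<integral>\<^sup>+\<omega>. indicator A (Y s \<omega>) \<partial>\<Omega>') \<le> (\<integral>\<^sup>+\<omega>. indicator A (X s \<omega>) \<partial>\<Omega>) + ennreal (1 * ((2 * s) ^ n / fact n))"
        using first_split_le[OF Y X \<open>0 \<le> s\<close>, of "indicator A" n] by (simp add: indicator_def)
    qed
    have "emeasure (distr \<Omega> borel (X s)) A = (\<integral>\<^sup>+z. indicator A z \<partial>distr \<Omega> borel (X s))" by simp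
    also have "\<dots> = (\<integral>\<^sup>+\<omega>. indicator A (X s \<omega>) \<partial>\<Omega>)" by (subst nn_integral_distr) auto
    also note eq
    also have "(\<integral>\<^sup>+\<omega>. indicator A (Y s \<omega>) \<partial>\<Omega>') = (\<integral>\<^sup>+z. indicator A z \<partial>distr \<Omega>' borel (Y s))"
      by (subst nn_integral_distr) auto
    also have "\<dots> = emeasure (distr \<Omega>' borel (Y s)) A" by simp
    finally show "emeasure (distr \<Omega> borel (X s)) A = emeasure (distr \<Omega>' borel (Y s)) A" .
  qed simp
  then have "(\<integral>\<^sup>+z. g z \<partial>distr \<Omega> borel (X s)) = (\<integral>\<^sup>+z. g z \<partial>distr \<Omega>' borel (Y s))" by simp
  then show ?thesis by (simp add: nn_integral_distr)
qed

section \<open>The branching property\<close>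

lemma measurable_shift: "(\<lambda>\<eta> v. \<eta> (b # v)) \<in> PiM UNIV (\<lambda>_::bool list. N) \<rightarrow>\<^sub>M PiM UNIV (\<lambda>_. N)"
  by (rule measurable_PiM_single') (auto simp: space_PiM PiE_iff)

lemma AE_marked_tree_ok:
  assumes K: "prob_space K"
  shows "AE \<eta> in PiM UNIV (\<lambda>_. particle \<Otimes>\<^sub>M K). tree_ok (\<lambda>u. fst (fst (\<eta> u)))"
proof -
  let ?f = "\<lambda>(\<eta> :: bool list \<Rightarrow> (real \<times> real \<times> real) \<times> 'a) u. fst (\<eta> u)"
  have m: "?f \<in> PiM UNIV (\<lambda>_. particle \<Otimes>\<^sub>M K) \<rightarrow>\<^sub>M PiM UNIV (\<lambda>_. particle)"
    by (rule measurable_PiM_single') (auto simp: space_PiM PiE_iff space_pair_measure mem_Times_iff)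
  have "distr (PiM UNIV (\<lambda>_. particle \<Otimes>\<^sub>M K)) (PiM UNIV (\<lambda>_. particle)) ?f = PiM UNIV (\<lambda>_. particle)"
    by (rule PiM_fst) (auto intro: prob_space_particle K)
  moreover have "AE \<eta> in PiM UNIV (\<lambda>_::bool list. particle). tree_ok (\<lambda>u. fst (\<eta> u))"
    unfolding particle_def by (rule AE_PiM_tree_ok) (rule prob_space_gauss2)
  ultimately have "almost_everywhere (distr (PiM UNIV (\<lambda>_. particle \<Otimes>\<^sub>M K)) (PiM UNIV (\<lambda>_. particle)) ?f) (\<lambda>\<eta>. tree_ok (\<lambda>u. fst (\<eta> u)))"
    by (rule ssubst)
  from AE_distrD[OF m this] show ?thesis .
qed

lemma nn_integral_marked_fst:
  assumes K: "prob_space K" and [measurable]: "f \<in> borel_measurable bbm_space"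
  shows "(\<integral>\<^sup>+\<eta>. f (\<lambda>u. fst (\<eta> u)) \<partial>PiM UNIV (\<lambda>_. particle \<Otimes>\<^sub>M K)) = (\<integral>\<^sup>+\<eta>. f \<eta> \<partial>bbm_space)"
proof -
  let ?f = "\<lambda>(\<eta> :: bool list \<Rightarrow> (real \<times> real \<times> real) \<times> 'a) u. fst (\<eta> u)"
  have m: "?f \<in> PiM UNIV (\<lambda>_. particle \<Otimes>\<^sub>M K) \<rightarrow>\<^sub>M PiM UNIV (\<lambda>_. particle)"
    by (rule measurable_PiM_single') (auto simp: space_PiM PiE_iff space_pair_measure mem_Times_iff)
  have d: "distr (PiM UNIV (\<lambda>_. particle \<Otimes>\<^sub>M K)) (PiM UNIV (\<lambda>_. particle)) ?f = PiM UNIV (\<lambda>_. particle)"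
    by (rule PiM_fst) (auto intro: prob_space_particle K)
  have "(\<integral>\<^sup>+\<eta>. f \<eta> \<partial>bbm_space) = (\<integral>\<^sup>+\<eta>. f \<eta> \<partial>distr (PiM UNIV (\<lambda>_. particle \<Otimes>\<^sub>M K)) (PiM UNIV (\<lambda>_. particle)) ?f)"
    unfolding d bbm_space_def ..
  also have "\<dots> = (\<integral>\<^sup>+\<eta>. f (?f \<eta>) \<partial>PiM UNIV (\<lambda>_. particle \<Otimes>\<^sub>M K))"
    by (rule nn_integral_distr[OF m]) (use assms(2) in \<open>simp add: bbm_space_def\<close>)
  finally show ?thesis by simp
qed

lemma nn_integral_particle_marked:
  assumes K: "prob_space K" and [measurable]: "f \<in> borel_measurable (particle \<Otimes>\<^sub>M K)"
  shows "(\<integral>\<^sup>+a. f a \<partial>(particle \<Otimes>\<^sub>M K)) = (\<integral>\<^sup>+l. \<integral>\<^sup>+p. \<integral>\<^sup>+k. f ((l, p), k) \<partial>K \<partial>gauss2 \<partial>exp1)"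
proof -
  interpret K: prob_space K by (rule K)
  interpret G: prob_space gauss2 by (rule prob_space_gauss2)
  have [measurable]: "(\<lambda>a. \<integral>\<^sup>+k. f (a, k) \<partial>K) \<in> borel_measurable particle" by measurable
  have "(\<integral>\<^sup>+a. f a \<partial>(particle \<Otimes>\<^sub>M K)) = (\<integral>\<^sup>+a. \<integral>\<^sup>+k. f (a, k) \<partial>K \<partial>particle)"
    by (rule K.nn_integral_fst[symmetric]) measurable
  also have "\<dots> = (\<integral>\<^sup>+l. \<integral>\<^sup>+p. \<integral>\<^sup>+k. f ((l, p), k) \<partial>K \<partial>gauss2 \<partial>exp1)"
    unfolding particle_def
    by (rule G.nn_integral_fst[symmetric]) (use \<open>(\<lambda>a. \<integral>\<^sup>+k. f (a, k) \<partial>K) \<in> borel_measurable particle\<close> in \<open>simp add: particle_def\<close>)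
  finally show ?thesis .
qed

lemma marked_sum_before_split:
  assumes "tree_ok (\<lambda>u. fst (fst (\<eta> u)))" "0 \<le> s" "s < fst (fst (\<eta> []))"
  shows "marked_sum \<rho> \<beta> y s \<eta> = exp (disp \<rho> \<beta> s (snd (fst (\<eta> [])))) * y (snd (\<eta> []))"
  unfolding marked_sum_def bbm_sum_def
  by (rule tree_sum_before_split) (use assms in \<open>auto simp: tree_ok_def\<close>)

lemma marked_sum_after_split:
  assumes "tree_ok (\<lambda>u. fst (fst (\<eta> u)))" "fst (fst (\<eta> [])) \<le> s"
  shows "marked_sum \<rho> \<beta> y s \<eta> = exp (disp \<rho> \<beta> (fst (fst (\<eta> []))) (snd (fst (\<eta> [])))) *
    (marked_sum \<rho> \<beta> y (s - fst (fst (\<eta> []))) (\<lambda>v. \<eta> (False # v)) + marked_sum \<rho> \<beta> y (s - fst (fst (\<eta> []))) (\<lambda>v. \<eta> (True # v)))"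
  unfolding marked_sum_def bbm_sum_def
  by (rule tree_sum_after_split) (use assms in auto)

text \<open>On \<open>tree_ok\<close> trees the recursion at the root is an identity for each single
  tree, and the product measure splits into the root and two independent subtrees with the same
  law.\<close>

lemma first_split_marked:
  assumes K: "prob_space K" and [measurable]: "y \<in> borel_measurable K"
  shows "first_split \<rho> \<beta> (PiM UNIV (\<lambda>_. particle \<Otimes>\<^sub>M K)) (marked_sum \<rho> \<beta> y)
    (\<lambda>s g. ennreal (exp (- s)) * (\<integral>\<^sup>+p. \<integral>\<^sup>+k. g (exp (disp \<rho> \<beta> s p) * y k) \<partial>K \<partial>gauss2))"
  unfolding first_split_def
proof (intro conjI allI ballI impI)
  let ?\<Omega> = "PiM UNIV (\<lambda>_::bool list. particle \<Otimes>\<^sub>M K)" and ?X = "marked_sum \<rho> \<beta> y"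
  have pK: "prob_space (particle \<Otimes>\<^sub>M K)" by (intro prob_space_pairI prob_space_particle K)
  show P: "prob_space ?\<Omega>" by (intro prob_space_PiM pK)
  show Xm: "(\<lambda>(s, \<omega>). ?X s \<omega>) \<in> borel_measurable (borel \<Otimes>\<^sub>M ?\<Omega>)" by measurable
  interpret P: prob_space ?\<Omega> by (rule P)
  interpret K: prob_space K by (rule K)
  interpret G: prob_space gauss2 by (rule prob_space_gauss2)
  fix s :: real and g :: "complex \<Rightarrow> ennreal"
  assume s: "0 \<le> s" and [measurable]: "g \<in> borel_measurable borel"
  define J where "J l = (\<integral>\<^sup>+p. \<integral>\<^sup>+\<omega>. \<integral>\<^sup>+\<omega>'. g (exp (disp \<rho> \<beta> l p) * (?X (s - l) \<omega> + ?X (s - l) \<omega>')) \<partial>?\<Omega> \<partial>?\<Omega> \<partial>gauss2)" for l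
  define C where "C = (\<integral>\<^sup>+p. \<integral>\<^sup>+k. g (exp (disp \<rho> \<beta> s p) * y k) \<partial>K \<partial>gauss2)"
  have J [measurable]: "J \<in> borel_measurable borel" unfolding J_def by measurable
  define f where "f \<eta> = (if s < fst (fst (\<eta> [])) then g (exp (disp \<rho> \<beta> s (snd (fst (\<eta> [])))) * y (snd (\<eta> [])))
      else g (exp (disp \<rho> \<beta> (fst (fst (\<eta> []))) (snd (fst (\<eta> [])))) *
        (?X (s - fst (fst (\<eta> []))) (\<lambda>v. \<eta> (False # v)) + ?X (s - fst (fst (\<eta> []))) (\<lambda>v. \<eta> (True # v)))))" for \<eta>
  have [measurable]: "(\<lambda>\<eta>. ?X (s - fst (fst (\<eta> []))) (\<lambda>v. \<eta> (b # v))) \<in> borel_measurable ?\<Omega>" for b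
    by (intro measurable_marked_sum[OF assms(2)] measurable_shift) measurable
  have [measurable]: "f \<in> borel_measurable ?\<Omega>" unfolding f_def by measurable
  have "(\<integral>\<^sup>+\<eta>. g (?X s \<eta>) \<partial>?\<Omega>) = (\<integral>\<^sup>+\<eta>. f \<eta> \<partial>?\<Omega>)"
  proof (rule nn_integral_cong_AE)
    show "AE \<eta> in ?\<Omega>. g (?X s \<eta>) = f \<eta>"
      using AE_marked_tree_ok[OF K]
      by eventually_elim (auto simp: f_def s marked_sum_before_split marked_sum_after_split)
  qed
  also have "\<dots> = (\<integral>\<^sup>+a. \<integral>\<^sup>+\<eta>0. \<integral>\<^sup>+\<eta>1. f (tree_cons a \<eta>0 \<eta>1) \<partial>?\<Omega> \<partial>?\<Omega> \<partial>(particle \<Otimes>\<^sub>M K))"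
    by (rule nn_integral_PiM_tree_split[where N="\<lambda>_. particle \<Otimes>\<^sub>M K", OF pK]) measurable
  also have "\<dots> = (\<integral>\<^sup>+a. (if s < fst (fst a) then g (exp (disp \<rho> \<beta> s (snd (fst a))) * y (snd a))
      else \<integral>\<^sup>+\<eta>0. \<integral>\<^sup>+\<eta>1. g (exp (disp \<rho> \<beta> (fst (fst a)) (snd (fst a))) *
        (?X (s - fst (fst a)) \<eta>0 + ?X (s - fst (fst a)) \<eta>1)) \<partial>?\<Omega> \<partial>?\<Omega>) \<partial>(particle \<Otimes>\<^sub>M K))"
    by (intro nn_integral_cong) (auto simp: f_def P.emeasure_space_1)
  also have "\<dots> = (\<integral>\<^sup>+l. \<integral>\<^sup>+p. \<integral>\<^sup>+k. (if s < l then g (exp (disp \<rho> \<beta> s p) * y k)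
      else \<integral>\<^sup>+\<eta>0. \<integral>\<^sup>+\<eta>1. g (exp (disp \<rho> \<beta> l p) * (?X (s - l) \<eta>0 + ?X (s - l) \<eta>1)) \<partial>?\<Omega> \<partial>?\<Omega>) \<partial>K \<partial>gauss2 \<partial>exp1)"
    by (subst nn_integral_particle_marked[OF K]) (measurable, simp only: fst_conv snd_conv)
  also have "\<dots> = (\<integral>\<^sup>+l. C * indicator {s<..} l + J l * indicator {..s} l \<partial>exp1)"
    by (intro nn_integral_cong) (auto simp: C_def J_def K.emeasure_space_1 indicator_def not_less)
  also have "\<dots> = C * emeasure exp1 {s<..} + (\<integral>\<^sup>+l. J l * indicator {..s} l \<partial>exp1)"
    by (subst nn_integral_add) (auto simp: nn_integral_cmult)
  also have "(\<integral>\<^sup>+l. J l * indicator {..s} l \<partial>exp1) = (\<integral>\<^sup>+l. ennreal (exp (- l)) * indicator {0..s} l * J l \<partial>lborel)"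
    by (subst nn_integral_exp1) (auto intro!: nn_integral_cong simp: indicator_def)
  finally show "(\<integral>\<^sup>+\<eta>. g (?X s \<eta>) \<partial>?\<Omega>) = ennreal (exp (- s)) * (\<integral>\<^sup>+p. \<integral>\<^sup>+k. g (exp (disp \<rho> \<beta> s p) * y k) \<partial>K \<partial>gauss2) +
     (\<integral>\<^sup>+l. ennreal (exp (- l)) * indicator {0..s} l *
        (\<integral>\<^sup>+p. \<integral>\<^sup>+\<omega>. \<integral>\<^sup>+\<omega>'. g (exp (disp \<rho> \<beta> l p) * (?X (s - l) \<omega> + ?X (s - l) \<omega>')) \<partial>?\<Omega> \<partial>?\<Omega> \<partial>gauss2) \<partial>lborel)"
    unfolding J_def[symmetric] C_def[symmetric] by (simp add: emeasure_exp1_greaterThan s mult.commute)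
qed

text \<open>The unmarked model is the marked one with a single possible mark, which is then
  integrated out.\<close>

lemma first_split_bbm:
  "first_split \<rho> \<beta> bbm_space (bbm \<rho> \<beta>) (\<lambda>s g. ennreal (exp (- s)) * (\<integral>\<^sup>+p. g (exp (disp \<rho> \<beta> s p)) \<partial>gauss2))"
proof -
  let ?K = "return (count_space UNIV) ()" and ?\<Omega> = "PiM UNIV (\<lambda>_::bool list. particle \<Otimes>\<^sub>M return (count_space UNIV) ())"
  have K: "prob_space ?K" by (rule prob_space_return) simp
  interpret K: prob_space ?K by (rule K)
  interpret B: prob_space bbm_space by (rule prob_space_bbm_space)
  have fs: "first_split \<rho> \<beta> ?\<Omega> (marked_sum \<rho> \<beta> (\<lambda>_. 1))
    (\<lambda>s g. ennreal (exp (- s)) * (\<integral>\<^sup>+p. \<integral>\<^sup>+k. g (exp (disp \<rho> \<beta> s p) * 1) \<partial>?K \<partial>gauss2))"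
    by (rule first_split_marked[OF K]) simp
  show ?thesis
    unfolding first_split_def
  proof (intro conjI allI ballI impI)
    show "prob_space bbm_space" by (rule prob_space_bbm_space)
    show "(\<lambda>(s, \<omega>). bbm \<rho> \<beta> s \<omega>) \<in> borel_measurable (borel \<Otimes>\<^sub>M bbm_space)" by measurable
    fix s :: real and g :: "complex \<Rightarrow> ennreal"
    assume s: "0 \<le> s" and [measurable]: "g \<in> borel_measurable borel"
    have "(\<integral>\<^sup>+\<eta>. g (bbm \<rho> \<beta> s \<eta>) \<partial>bbm_space) = (\<integral>\<^sup>+\<eta>. g (marked_sum \<rho> \<beta> (\<lambda>_. 1) s \<eta>) \<partial>?\<Omega>)"
      unfolding marked_sum_const by (rule nn_integral_marked_fst[OF K, symmetric]) measurable
    also have "\<dots> = ennreal (exp (- s)) * (\<integral>\<^sup>+p. \<integral>\<^sup>+k. g (exp (disp \<rho> \<beta> s p) * 1) \<partial>?K \<partial>gauss2) +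
      (\<integral>\<^sup>+l. ennreal (exp (- l)) * indicator {0..s} l *
        (\<integral>\<^sup>+p. \<integral>\<^sup>+\<omega>. \<integral>\<^sup>+\<omega>'. g (exp (disp \<rho> \<beta> l p) * (bbm \<rho> \<beta> (s - l) (\<lambda>u. fst (\<omega> u)) + bbm \<rho> \<beta> (s - l) (\<lambda>u. fst (\<omega>' u)))) \<partial>?\<Omega> \<partial>?\<Omega> \<partial>gauss2) \<partial>lborel)"
      using fs[unfolded first_split_def marked_sum_const, THEN conjunct2, THEN conjunct2, rule_format, OF s, of g] by (simp add: marked_sum_const)
    also have "(\<lambda>l p. \<integral>\<^sup>+\<omega>. \<integral>\<^sup>+\<omega>'. g (exp (disp \<rho> \<beta> l p) * (bbm \<rho> \<beta> (s - l) (\<lambda>u. fst (\<omega> u)) + bbm \<rho> \<beta> (s - l) (\<lambda>u. fst (\<omega>' u)))) \<partial>?\<Omega> \<partial>?\<Omega>) =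
       (\<lambda>l p. \<integral>\<^sup>+\<omega>. \<integral>\<^sup>+\<omega>'. g (exp (disp \<rho> \<beta> l p) * (bbm \<rho> \<beta> (s - l) \<omega> + bbm \<rho> \<beta> (s - l) \<omega>')) \<partial>bbm_space \<partial>bbm_space)"
    proof (intro ext)
      fix l p
      have "(\<integral>\<^sup>+\<omega>'. g (exp (disp \<rho> \<beta> l p) * (z + bbm \<rho> \<beta> (s - l) (\<lambda>u. fst (\<omega>' u)))) \<partial>?\<Omega>) =
         (\<integral>\<^sup>+\<omega>'. g (exp (disp \<rho> \<beta> l p) * (z + bbm \<rho> \<beta> (s - l) \<omega>')) \<partial>bbm_space)" for z
        by (rule nn_integral_marked_fst[OF K]) measurable
      then have "(\<integral>\<^sup>+\<omega>. \<integral>\<^sup>+\<omega>'. g (exp (disp \<rho> \<beta> l p) * (bbm \<rho> \<beta> (s - l) (\<lambda>u. fst (\<omega> u)) + bbm \<rho> \<beta> (s - l) (\<lambda>u. fst (\<omega>' u)))) \<partial>?\<Omega> \<partial>?\<Omega>) =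
        (\<integral>\<^sup>+\<omega>. \<integral>\<^sup>+\<omega>'. g (exp (disp \<rho> \<beta> l p) * (bbm \<rho> \<beta> (s - l) (\<lambda>u. fst (\<omega> u)) + bbm \<rho> \<beta> (s - l) \<omega>')) \<partial>bbm_space \<partial>?\<Omega>)"
        by simp
      also have "\<dots> = (\<integral>\<^sup>+\<omega>. \<integral>\<^sup>+\<omega>'. g (exp (disp \<rho> \<beta> l p) * (bbm \<rho> \<beta> (s - l) \<omega> + bbm \<rho> \<beta> (s - l) \<omega>')) \<partial>bbm_space \<partial>bbm_space)"
        by (rule nn_integral_marked_fst[OF K]) measurable
      finally show "(\<integral>\<^sup>+\<omega>. \<integral>\<^sup>+\<omega>'. g (exp (disp \<rho> \<beta> l p) * (bbm \<rho> \<beta> (s - l) (\<lambda>u. fst (\<omega> u)) + bbm \<rho> \<beta> (s - l) (\<lambda>u. fst (\<omega>' u)))) \<partial>?\<Omega> \<partial>?\<Omega>) =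
        (\<integral>\<^sup>+\<omega>. \<integral>\<^sup>+\<omega>'. g (exp (disp \<rho> \<beta> l p) * (bbm \<rho> \<beta> (s - l) \<omega> + bbm \<rho> \<beta> (s - l) \<omega>')) \<partial>bbm_space \<partial>bbm_space)" .
    qed
    finally show "(\<integral>\<^sup>+\<eta>. g (bbm \<rho> \<beta> s \<eta>) \<partial>bbm_space) = ennreal (exp (- s)) * (\<integral>\<^sup>+p. g (exp (disp \<rho> \<beta> s p)) \<partial>gauss2) +
      (\<integral>\<^sup>+l. ennreal (exp (- l)) * indicator {0..s} l *
        (\<integral>\<^sup>+p. \<integral>\<^sup>+\<omega>. \<integral>\<^sup>+\<omega>'. g (exp (disp \<rho> \<beta> l p) * (bbm \<rho> \<beta> (s - l) \<omega> + bbm \<rho> \<beta> (s - l) \<omega>')) \<partial>bbm_space \<partial>bbm_space \<partial>gauss2) \<partial>lborel)"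
      by (simp add: K.emeasure_space_1)
  qed
qed

section \<open>Convolution of Gaussian displacements and the restarted tree\<close>

abbreviation std_normal :: "real measure" where
  "std_normal \<equiv> density lborel (\<lambda>x. ennreal (std_normal_density x))"

lemma prob_space_std_normal: "prob_space std_normal"
  by (rule prob_space_normal_density) simp

lemma nn_integral_gauss2:
  assumes [measurable]: "f \<in> borel_measurable (borel \<Otimes>\<^sub>M borel)"
  shows "(\<integral>\<^sup>+p. f p \<partial>gauss2) = (\<integral>\<^sup>+x. \<integral>\<^sup>+z. f (x, z) \<partial>std_normal \<partial>std_normal)"
proof -
  interpret prob_space std_normal by (rule prob_space_std_normal)
  show ?thesis unfolding gauss2_def by (rule nn_integral_fst[symmetric]) measurable
qed

lemma nn_integral_std_normal_scale:
  assumes "0 < \<sigma>" and [measurable]: "f \<in> borel_measurable borel"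
  shows "(\<integral>\<^sup>+x. f (\<sigma> * x) \<partial>std_normal) = (\<integral>\<^sup>+x. ennreal (normal_density 0 \<sigma> x) * f x \<partial>lborel)"
proof -
  have "(\<integral>\<^sup>+x. ennreal (normal_density 0 \<sigma> x) * f x \<partial>lborel) =
     ennreal \<bar>\<sigma>\<bar> * (\<integral>\<^sup>+x. ennreal (normal_density 0 \<sigma> (0 + \<sigma> * x)) * f (0 + \<sigma> * x) \<partial>lborel)"
    using assms by (intro nn_integral_real_affine) auto
  also have "\<dots> = (\<integral>\<^sup>+x. ennreal \<bar>\<sigma>\<bar> * (ennreal (normal_density 0 \<sigma> (0 + \<sigma> * x)) * f (0 + \<sigma> * x)) \<partial>lborel)"
    by (rule nn_integral_cmult[symmetric]) measurable
  also have "\<dots> = (\<integral>\<^sup>+x. ennreal (std_normal_density x) * f (\<sigma> * x) \<partial>lborel)"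
  proof (intro nn_integral_cong)
    fix x :: real
    have "ennreal \<bar>\<sigma>\<bar> * ennreal (normal_density 0 \<sigma> (\<sigma> * x)) = ennreal (std_normal_density x)"
      using assms(1) by (subst ennreal_mult[symmetric])
        (auto simp: normal_density_def real_sqrt_mult power_mult_distrib field_simps)
    then show "ennreal \<bar>\<sigma>\<bar> * (ennreal (normal_density 0 \<sigma> (0 + \<sigma> * x)) * f (0 + \<sigma> * x)) = ennreal (std_normal_density x) * f (\<sigma> * x)"
      by (simp add: mult.assoc[symmetric])
  qed
  also have "\<dots> = (\<integral>\<^sup>+x. f (\<sigma> * x) \<partial>std_normal)"
    by (subst nn_integral_density) auto
  finally show ?thesis ..
qed

text \<open>Independent centred Gaussians of variances \<open>s\<close> and \<open>l\<close> add to
  one of variance \<open>s + l\<close>. Variance 0 has no density and is treated apart.\<close>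

lemma nn_integral_std_normal_add:
  assumes "0 \<le> s" "0 \<le> l" and [measurable]: "f \<in> borel_measurable borel"
  shows "(\<integral>\<^sup>+x. f (sqrt (s + l) * x) \<partial>std_normal) = (\<integral>\<^sup>+x. \<integral>\<^sup>+y. f (sqrt s * x + sqrt l * y) \<partial>std_normal \<partial>std_normal)"
proof -
  interpret N: prob_space std_normal by (rule prob_space_std_normal)
  consider "s = 0" | "l = 0" | "0 < s" "0 < l" using assms by linarith
  then show ?thesis
  proof cases
    case 1 then show ?thesis using N.emeasure_space_1 by simp
  next
    case 2 then show ?thesis using N.emeasure_space_1 by simp
  next
    case 3
    let ?n = "\<lambda>r x. ennreal (normal_density 0 (sqrt r) x)"
    have "(\<integral>\<^sup>+x. \<integral>\<^sup>+y. f (sqrt s * x + sqrt l * y) \<partial>std_normal \<partial>std_normal) =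
        (\<integral>\<^sup>+x. \<integral>\<^sup>+y. ?n l y * f (sqrt s * x + y) \<partial>lborel \<partial>std_normal)"
      using 3 by (intro nn_integral_cong nn_integral_std_normal_scale[of "sqrt l" "\<lambda>y. f (_ + y)"]) auto
    also have "\<dots> = (\<integral>\<^sup>+x. ?n s x * (\<integral>\<^sup>+y. ?n l y * f (x + y) \<partial>lborel) \<partial>lborel)"
      using 3 by (intro nn_integral_std_normal_scale[of "sqrt s" "\<lambda>x. \<integral>\<^sup>+y. ?n l y * f (x + y) \<partial>lborel"]) auto
    also have "\<dots> = (\<integral>\<^sup>+x. \<integral>\<^sup>+y. ?n s x * (?n l y * f (x + y)) \<partial>lborel \<partial>lborel)"
      by (intro nn_integral_cong nn_integral_cmult[symmetric]) auto
    also have "\<dots> = (\<integral>\<^sup>+y. \<integral>\<^sup>+x. ?n s x * (?n l y * f (x + y)) \<partial>lborel \<partial>lborel)"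
      by (rule lborel_pair.Fubini'[symmetric]) auto
    also have "\<dots> = (\<integral>\<^sup>+y. \<integral>\<^sup>+x. ?n s (x - y) * (?n l y * f x) \<partial>lborel \<partial>lborel)"
    proof (rule nn_integral_cong)
      fix y :: real
      show "(\<integral>\<^sup>+x. ?n s x * (?n l y * f (x + y)) \<partial>lborel) = (\<integral>\<^sup>+x. ?n s (x - y) * (?n l y * f x) \<partial>lborel)"
        by (subst nn_integral_real_affine[where c=1 and t="-y"]) (auto simp: algebra_simps)
    qed
    also have "\<dots> = (\<integral>\<^sup>+x. \<integral>\<^sup>+y. ?n s (x - y) * (?n l y * f x) \<partial>lborel \<partial>lborel)"
      by (rule lborel_pair.Fubini') auto
    also have "\<dots> = (\<integral>\<^sup>+x. ?n (s + l) x * f x \<partial>lborel)"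
    proof (intro nn_integral_cong)
      fix x :: real
      have "(\<integral>\<^sup>+y. ?n s (x - y) * (?n l y * f x) \<partial>lborel) = (\<integral>\<^sup>+y. ennreal (normal_density 0 (sqrt s) (x - y) * normal_density 0 (sqrt l) y) * f x \<partial>lborel)"
        by (intro nn_integral_cong) (simp add: ennreal_mult mult.assoc)
      also have "\<dots> = (\<integral>\<^sup>+y. ennreal (normal_density 0 (sqrt s) (x - y) * normal_density 0 (sqrt l) y) \<partial>lborel) * f x"
        by (rule nn_integral_multc) auto
      also have "(\<integral>\<^sup>+y. ennreal (normal_density 0 (sqrt s) (x - y) * normal_density 0 (sqrt l) y) \<partial>lborel) = ?n (s + l) x"
        using fun_cong[OF conv_normal_density_zero_mean[of "sqrt s" "sqrt l"], of x] 3 by simp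
      finally show "(\<integral>\<^sup>+y. ?n s (x - y) * (?n l y * f x) \<partial>lborel) = ?n (s + l) x * f x" .
    qed
    also have "\<dots> = (\<integral>\<^sup>+x. f (sqrt (s + l) * x) \<partial>std_normal)"
      using 3 by (intro nn_integral_std_normal_scale[symmetric]) auto
    finally show ?thesis ..
  qed
qed

lemma nn_integral_gauss2_add:
  assumes s: "0 \<le> s" and l: "0 \<le> l" and [measurable]: "f \<in> borel_measurable (borel \<Otimes>\<^sub>M borel)"
  shows "(\<integral>\<^sup>+p. f (sqrt (s + l) * fst p, sqrt (s + l) * snd p) \<partial>gauss2) =
    (\<integral>\<^sup>+p. \<integral>\<^sup>+q. f (sqrt s * fst p + sqrt l * fst q, sqrt s * snd p + sqrt l * snd q) \<partial>gauss2 \<partial>gauss2)"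
proof -
  interpret N: prob_space std_normal by (rule prob_space_std_normal)
  interpret NN: pair_prob_space std_normal std_normal ..
  interpret G: prob_space gauss2 by (rule prob_space_gauss2)
  have "(\<integral>\<^sup>+p. f (sqrt (s + l) * fst p, sqrt (s + l) * snd p) \<partial>gauss2) =
     (\<integral>\<^sup>+x. \<integral>\<^sup>+z. f (sqrt (s + l) * x, sqrt (s + l) * z) \<partial>std_normal \<partial>std_normal)"
    by (subst nn_integral_gauss2) auto
  also have "\<dots> = (\<integral>\<^sup>+x. \<integral>\<^sup>+z. \<integral>\<^sup>+z'. f (sqrt (s + l) * x, sqrt s * z + sqrt l * z') \<partial>std_normal \<partial>std_normal \<partial>std_normal)"
    by (intro nn_integral_cong nn_integral_std_normal_add[OF s l, of "\<lambda>z. f (_, z)"]) auto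
  also have "\<dots> = (\<integral>\<^sup>+x. \<integral>\<^sup>+x'. \<integral>\<^sup>+z. \<integral>\<^sup>+z'. f (sqrt s * x + sqrt l * x', sqrt s * z + sqrt l * z') \<partial>std_normal \<partial>std_normal \<partial>std_normal \<partial>std_normal)"
    by (rule nn_integral_std_normal_add[OF s l, of "\<lambda>x. \<integral>\<^sup>+z. \<integral>\<^sup>+z'. f (x, sqrt s * z + sqrt l * z') \<partial>std_normal \<partial>std_normal"]) measurable
  also have "\<dots> = (\<integral>\<^sup>+x. \<integral>\<^sup>+z. \<integral>\<^sup>+x'. \<integral>\<^sup>+z'. f (sqrt s * x + sqrt l * x', sqrt s * z + sqrt l * z') \<partial>std_normal \<partial>std_normal \<partial>std_normal \<partial>std_normal)"
    by (intro nn_integral_cong NN.Fubini') measurable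
  also have "\<dots> = (\<integral>\<^sup>+x. \<integral>\<^sup>+z. \<integral>\<^sup>+q. f (sqrt s * x + sqrt l * fst q, sqrt s * z + sqrt l * snd q) \<partial>gauss2 \<partial>std_normal \<partial>std_normal)"
    by (subst nn_integral_gauss2) auto
  also have "\<dots> = (\<integral>\<^sup>+p. \<integral>\<^sup>+q. f (sqrt s * fst p + sqrt l * fst q, sqrt s * snd p + sqrt l * snd q) \<partial>gauss2 \<partial>gauss2)"
    by (subst (2) nn_integral_gauss2) auto
  finally show ?thesis .
qed

lemma disp_eq_lin: "disp \<rho> \<beta> r p = lin \<rho> \<beta> (sqrt r * fst p, sqrt r * snd p)"
  by (simp add: disp_def lin_def algebra_simps)

lemma disp_add_lin: "disp \<rho> \<beta> r p + disp \<rho> \<beta> r' q = lin \<rho> \<beta> (sqrt r * fst p + sqrt r' * fst q, sqrt r * snd p + sqrt r' * snd q)"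
  by (simp add: disp_def lin_def algebra_simps)

text \<open>The displacement over age \<open>s + l\<close> has the law of two independent ones over
  \<open>s\<close> and \<open>l\<close>. In the branching argument this takes the place of the
  Markov property of Brownian motion.\<close>

lemma nn_integral_disp_add:
  assumes s: "0 \<le> s" and l: "0 \<le> l" and [measurable]: "h \<in> borel_measurable borel"
  shows "(\<integral>\<^sup>+p. h (exp (disp \<rho> \<beta> (s + l) p)) \<partial>gauss2) = (\<integral>\<^sup>+p. \<integral>\<^sup>+q. h (exp (disp \<rho> \<beta> s p) * exp (disp \<rho> \<beta> l q)) \<partial>gauss2 \<partial>gauss2)"
  unfolding exp_add[symmetric] disp_add_lin
  unfolding disp_eq_lin
  by (rule nn_integral_gauss2_add[OF s l, of "\<lambda>x. h (exp (lin \<rho> \<beta> x))"]) measurable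

text \<open>Observed at time \<open>s + t\<close>, the tree satisfies a first-split equation in
  \<open>s\<close> whose constant term puts a fresh tree of age \<open>t\<close> on a root that
  outlives \<open>s\<close>. The part with lifetime above \<open>s\<close> supplies that
  term.\<close>

lemma first_split_bbm_shift:
  assumes t: "0 \<le> t"
  shows "first_split \<rho> \<beta> bbm_space (\<lambda>s. bbm \<rho> \<beta> (s + t))
    (\<lambda>s g. ennreal (exp (- s)) * (\<integral>\<^sup>+p. \<integral>\<^sup>+\<omega>. g (exp (disp \<rho> \<beta> s p) * bbm \<rho> \<beta> t \<omega>) \<partial>bbm_space \<partial>gauss2))"
  unfolding first_split_def
proof (intro conjI allI ballI impI)
  let ?\<Omega> = bbm_space and ?X = "bbm \<rho> \<beta>" and ?G = gauss2
  interpret B: prob_space ?\<Omega> by (rule prob_space_bbm_space)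
  interpret G: prob_space ?G by (rule prob_space_gauss2)
  interpret GL: pair_sigma_finite ?G lborel ..
  show "prob_space ?\<Omega>" by (rule prob_space_bbm_space)
  show "(\<lambda>(s, \<omega>). ?X (s + t) \<omega>) \<in> borel_measurable (borel \<Otimes>\<^sub>M ?\<Omega>)" by measurable
  fix s :: real and g :: "complex \<Rightarrow> ennreal"
  assume s: "0 \<le> s" and [measurable]: "g \<in> borel_measurable borel"
  define H where "H r z = (\<integral>\<^sup>+\<omega>. \<integral>\<^sup>+\<omega>'. g (z * (?X r \<omega> + ?X r \<omega>')) \<partial>?\<Omega> \<partial>?\<Omega>)" for r z
  have [measurable]: "(\<lambda>(r, z). H r z) \<in> borel_measurable (borel \<Otimes>\<^sub>M borel)"
    unfolding H_def by measurable
  have fs: "(\<integral>\<^sup>+\<omega>. h (?X r \<omega>) \<partial>?\<Omega>) = ennreal (exp (- r)) * (\<integral>\<^sup>+p. h (exp (disp \<rho> \<beta> r p)) \<partial>?G) +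
      (\<integral>\<^sup>+l. ennreal (exp (- l)) * indicator {0..r} l *
        (\<integral>\<^sup>+p. \<integral>\<^sup>+\<omega>. \<integral>\<^sup>+\<omega>'. h (exp (disp \<rho> \<beta> l p) * (?X (r - l) \<omega> + ?X (r - l) \<omega>')) \<partial>?\<Omega> \<partial>?\<Omega> \<partial>?G) \<partial>lborel)"
    if "0 \<le> r" "h \<in> borel_measurable borel" for r h
    using first_split_bbm[of \<rho> \<beta>, unfolded first_split_def, THEN conjunct2, THEN conjunct2, rule_format, OF that] .
  let ?J = "\<lambda>l. \<integral>\<^sup>+p. H (s + t - l) (exp (disp \<rho> \<beta> l p)) \<partial>?G"
  have [measurable]: "?J \<in> borel_measurable borel" by measurable
  have "(\<integral>\<^sup>+\<omega>. g (?X (s + t) \<omega>) \<partial>?\<Omega>) = ennreal (exp (- (s + t))) * (\<integral>\<^sup>+p. g (exp (disp \<rho> \<beta> (s + t) p)) \<partial>?G) +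
      (\<integral>\<^sup>+l. ennreal (exp (- l)) * indicator {0..s + t} l * ?J l \<partial>lborel)"
    unfolding H_def using s t by (intro fs) auto
  also have "(\<integral>\<^sup>+l. ennreal (exp (- l)) * indicator {0..s + t} l * ?J l \<partial>lborel) =
     (\<integral>\<^sup>+l. ennreal (exp (- l)) * indicator {0..s} l * ?J l + ennreal (exp (- l)) * indicator {s<..s + t} l * ?J l \<partial>lborel)"
    using s t by (intro nn_integral_cong) (auto simp: indicator_def)
  also have "\<dots> = (\<integral>\<^sup>+l. ennreal (exp (- l)) * indicator {0..s} l * ?J l \<partial>lborel) + (\<integral>\<^sup>+l. ennreal (exp (- l)) * indicator {s<..s + t} l * ?J l \<partial>lborel)"
    by (rule nn_integral_add) measurable
  \<comment> \<open>Lack of memory: lifetimes in \<open>{s<..s + t}\<close> are counted from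
    \<open>s\<close> on, and a factor exp (- s) can be split off. The half-open interval becomes
    closed up to the null set where \<open>l\<close> is 0.\<close>
  also have "(\<integral>\<^sup>+l. ennreal (exp (- l)) * indicator {s<..s + t} l * ?J l \<partial>lborel) =
     (\<integral>\<^sup>+l. ennreal (exp (- (s + l))) * indicator {0..t} l * ?J (s + l) \<partial>lborel)"
  proof -
    have "(\<integral>\<^sup>+l. ennreal (exp (- l)) * indicator {s<..s + t} l * ?J l \<partial>lborel) =
      ennreal \<bar>1\<bar> * (\<integral>\<^sup>+l. ennreal (exp (- (s + 1 * l))) * indicator {s<..s + t} (s + 1 * l) * ?J (s + 1 * l) \<partial>lborel)"
      by (rule nn_integral_real_affine) auto
    also have "\<dots> = (\<integral>\<^sup>+l. ennreal (exp (- (s + l))) * indicator {0..t} l * ?J (s + l) \<partial>lborel)"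
    proof -
      have "AE l in lborel. ennreal (exp (- (s + 1 * l))) * indicator {s<..s + t} (s + 1 * l) * ?J (s + 1 * l) =
          ennreal (exp (- (s + l))) * indicator {0..t} l * ?J (s + l)"
        using AE_lborel_singleton[of "0::real"] by eventually_elim (auto simp: indicator_def)
      then show ?thesis by (simp only: abs_one ennreal_1 mult_1_left cong: nn_integral_cong_AE)
    qed
    finally show ?thesis .
  qed
  also have "\<dots> = (\<integral>\<^sup>+l. ennreal (exp (- s)) * (\<integral>\<^sup>+p. ennreal (exp (- l)) * indicator {0..t} l * (\<integral>\<^sup>+q. H (t - l) (exp (disp \<rho> \<beta> s p) * exp (disp \<rho> \<beta> l q)) \<partial>?G) \<partial>?G) \<partial>lborel)"
  proof (intro nn_integral_cong)
    fix l :: real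
    show "ennreal (exp (- (s + l))) * indicator {0..t} l * ?J (s + l) =
      ennreal (exp (- s)) * (\<integral>\<^sup>+p. ennreal (exp (- l)) * indicator {0..t} l * (\<integral>\<^sup>+q. H (t - l) (exp (disp \<rho> \<beta> s p) * exp (disp \<rho> \<beta> l q)) \<partial>?G) \<partial>?G)"
    proof (cases "l \<in> {0..t}")
      case True
      have "?J (s + l) = (\<integral>\<^sup>+p. \<integral>\<^sup>+q. H (t - l) (exp (disp \<rho> \<beta> s p) * exp (disp \<rho> \<beta> l q)) \<partial>?G \<partial>?G)"
        using nn_integral_disp_add[of s l "H (t - l)" \<rho> \<beta>] s True by (simp add: algebra_simps)
      then show ?thesis using True
        by (subst nn_integral_cmult) (auto simp: exp_add exp_minus exp_diff ennreal_mult[symmetric] mult.assoc[symmetric] field_simps)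
    qed auto
  qed
  also have "\<dots> = ennreal (exp (- s)) * (\<integral>\<^sup>+l. \<integral>\<^sup>+p. ennreal (exp (- l)) * indicator {0..t} l * (\<integral>\<^sup>+q. H (t - l) (exp (disp \<rho> \<beta> s p) * exp (disp \<rho> \<beta> l q)) \<partial>?G) \<partial>?G \<partial>lborel)"
    by (rule nn_integral_cmult) measurable
  also have "(\<integral>\<^sup>+l. \<integral>\<^sup>+p. ennreal (exp (- l)) * indicator {0..t} l * (\<integral>\<^sup>+q. H (t - l) (exp (disp \<rho> \<beta> s p) * exp (disp \<rho> \<beta> l q)) \<partial>?G) \<partial>?G \<partial>lborel) =
     (\<integral>\<^sup>+p. \<integral>\<^sup>+l. ennreal (exp (- l)) * indicator {0..t} l * (\<integral>\<^sup>+q. H (t - l) (exp (disp \<rho> \<beta> s p) * exp (disp \<rho> \<beta> l q)) \<partial>?G) \<partial>lborel \<partial>?G)" (is "_ = (\<integral>\<^sup>+p. ?I p \<partial>?G)")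
    by (rule GL.Fubini') measurable
  also have "ennreal (exp (- (s + t))) * (\<integral>\<^sup>+p. g (exp (disp \<rho> \<beta> (s + t) p)) \<partial>?G) =
     ennreal (exp (- s)) * (\<integral>\<^sup>+p. ennreal (exp (- t)) * (\<integral>\<^sup>+q. g (exp (disp \<rho> \<beta> s p) * exp (disp \<rho> \<beta> t q)) \<partial>?G) \<partial>?G)"
    by (subst nn_integral_disp_add[OF s t], measurable, subst nn_integral_cmult, measurable)
      (simp add: exp_add exp_minus exp_diff ennreal_mult[symmetric] mult.assoc[symmetric] field_simps)
  finally have "(\<integral>\<^sup>+\<omega>. g (?X (s + t) \<omega>) \<partial>?\<Omega>) =
     ennreal (exp (- s)) * (\<integral>\<^sup>+p. ennreal (exp (- t)) * (\<integral>\<^sup>+q. g (exp (disp \<rho> \<beta> s p) * exp (disp \<rho> \<beta> t q)) \<partial>?G) \<partial>?G) +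
     ((\<integral>\<^sup>+l. ennreal (exp (- l)) * indicator {0..s} l * ?J l \<partial>lborel) + ennreal (exp (- s)) * (\<integral>\<^sup>+p. ?I p \<partial>?G))" .
  also have "\<dots> = ennreal (exp (- s)) * ((\<integral>\<^sup>+p. ennreal (exp (- t)) * (\<integral>\<^sup>+q. g (exp (disp \<rho> \<beta> s p) * exp (disp \<rho> \<beta> t q)) \<partial>?G) \<partial>?G) + (\<integral>\<^sup>+p. ?I p \<partial>?G))
     + (\<integral>\<^sup>+l. ennreal (exp (- l)) * indicator {0..s} l * ?J l \<partial>lborel)"
    by (simp add: distrib_left add_ac)
  also have "(\<integral>\<^sup>+p. ennreal (exp (- t)) * (\<integral>\<^sup>+q. g (exp (disp \<rho> \<beta> s p) * exp (disp \<rho> \<beta> t q)) \<partial>?G) \<partial>?G) + (\<integral>\<^sup>+p. ?I p \<partial>?G) =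
     (\<integral>\<^sup>+p. ennreal (exp (- t)) * (\<integral>\<^sup>+q. g (exp (disp \<rho> \<beta> s p) * exp (disp \<rho> \<beta> t q)) \<partial>?G) + ?I p \<partial>?G)"
    by (rule nn_integral_add[symmetric]) measurable
  \<comment> \<open>The first-split equation at time \<open>t\<close>, read from right to left,
    reassembles the tree that restarts at \<open>s\<close>.\<close>
  also have "\<dots> = (\<integral>\<^sup>+p. \<integral>\<^sup>+\<omega>. g (exp (disp \<rho> \<beta> s p) * ?X t \<omega>) \<partial>?\<Omega> \<partial>?G)"
    by (intro nn_integral_cong, subst fs[OF t, of "\<lambda>z. g (exp (disp \<rho> \<beta> s _) * z)"])
      (auto simp: H_def mult.assoc)
  finally show "(\<integral>\<^sup>+\<omega>. g (?X (s + t) \<omega>) \<partial>?\<Omega>) =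
     ennreal (exp (- s)) * (\<integral>\<^sup>+p. \<integral>\<^sup>+\<omega>. g (exp (disp \<rho> \<beta> s p) * ?X t \<omega>) \<partial>?\<Omega> \<partial>?G) +
     (\<integral>\<^sup>+l. ennreal (exp (- l)) * indicator {0..s} l *
        (\<integral>\<^sup>+p. \<integral>\<^sup>+\<omega>. \<integral>\<^sup>+\<omega>'. g (exp (disp \<rho> \<beta> l p) * (?X (s - l + t) \<omega> + ?X (s - l + t) \<omega>')) \<partial>?\<Omega> \<partial>?\<Omega> \<partial>?G) \<partial>lborel)"
    by (simp add: H_def algebra_simps)
qed

text \<open>Both sides solve the same first-split equation in \<open>s\<close>: the tree observed at
  \<open>s + t\<close>, and the tree stopped at \<open>s\<close> whose particles carry independent
  trees of age \<open>t\<close> as marks.\<close>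

lemma bbm_branching:
  assumes s: "0 \<le> s" and t: "0 \<le> t" and [measurable]: "g \<in> borel_measurable borel"
  shows "(\<integral>\<^sup>+\<omega>. g (bbm \<rho> \<beta> (s + t) \<omega>) \<partial>bbm_space) =
    (\<integral>\<^sup>+\<eta>. \<integral>\<^sup>+\<zeta>. g (bbm_sum \<rho> \<beta> s \<eta> (\<lambda>u. bbm \<rho> \<beta> t (\<zeta> u))) \<partial>PiM UNIV (\<lambda>_. bbm_space) \<partial>bbm_space)"
proof -
  have m: "bbm \<rho> \<beta> t \<in> borel_measurable bbm_space" by measurable
  have "(\<integral>\<^sup>+\<omega>. g (bbm \<rho> \<beta> (s + t) \<omega>) \<partial>bbm_space) =
     (\<integral>\<^sup>+\<eta>. g (marked_sum \<rho> \<beta> (bbm \<rho> \<beta> t) s \<eta>) \<partial>PiM UNIV (\<lambda>_. particle \<Otimes>\<^sub>M bbm_space))"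
    by (rule first_split_unique[OF first_split_bbm_shift[OF t] first_split_marked[OF prob_space_bbm_space m] s]) measurable
  also have "\<dots> = (\<integral>\<^sup>+\<eta>. \<integral>\<^sup>+\<zeta>. g (marked_sum \<rho> \<beta> (bbm \<rho> \<beta> t) s (\<lambda>u. (\<eta> u, \<zeta> u))) \<partial>PiM UNIV (\<lambda>_. bbm_space) \<partial>PiM UNIV (\<lambda>_. particle))"
    by (rule nn_integral_PiM_zip[where A="\<lambda>_. particle" and B="\<lambda>_. bbm_space"])
      (auto intro: prob_space_particle prob_space_bbm_space measurable_compose[OF measurable_marked_sum[OF m]])
  finally show ?thesis by (simp add: marked_sum_def bbm_space_def)
qed

section \<open>Moments\<close>

lemma nn_integral_std_normal_exp: "(\<integral>\<^sup>+x. ennreal (exp (c * x)) \<partial>std_normal) = ennreal (exp (c\<^sup>2 / 2))"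
proof -
  have "(\<integral>\<^sup>+x. ennreal (exp (c * x)) \<partial>std_normal) = (\<integral>\<^sup>+x. ennreal (exp (c\<^sup>2 / 2)) * ennreal (normal_density c 1 x) \<partial>lborel)"
  proof (subst nn_integral_density, simp, simp, rule nn_integral_cong)
    fix x :: real
    have "- x\<^sup>2 / 2 + c * x = c\<^sup>2 / 2 - (x - c)\<^sup>2 / 2" by (simp add: power2_eq_square field_simps)
    then have "exp (- x\<^sup>2 / 2) * exp (c * x) = exp (c\<^sup>2 / 2) * exp (- (x - c)\<^sup>2 / 2)"
      by (simp add: mult_exp_exp)
    then show "ennreal (std_normal_density x) * ennreal (exp (c * x)) = ennreal (exp (c\<^sup>2 / 2)) * ennreal (normal_density c 1 x)"
      by (simp add: normal_density_def ennreal_mult[symmetric] field_simps)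
  qed
  also have "\<dots> = ennreal (exp (c\<^sup>2 / 2)) * emeasure (density lborel (normal_density c 1)) UNIV"
    by (subst nn_integral_cmult) (auto simp: emeasure_density)
  also have "\<dots> = ennreal (exp (c\<^sup>2 / 2))"
    using prob_space.emeasure_space_1[OF prob_space_normal_density[of 1 c]] by simp
  finally show ?thesis .
qed

lemma cmod_exp_disp: "cmod (exp (disp \<rho> \<beta> r p)) = exp (sqrt r * Re \<beta> * fst p)"
  by (simp add: disp_def lin_def norm_exp_eq_Re algebra_simps)

lemma nn_integral_disp_powr:
  assumes "0 \<le> r"
  shows "(\<integral>\<^sup>+p. ennreal (cmod (exp (disp \<rho> \<beta> r p)) powr q) \<partial>gauss2) = ennreal (exp (q\<^sup>2 * (Re \<beta>)\<^sup>2 * r / 2))"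
proof -
  interpret N: prob_space std_normal by (rule prob_space_std_normal)
  have "(\<integral>\<^sup>+p. ennreal (cmod (exp (disp \<rho> \<beta> r p)) powr q) \<partial>gauss2) = (\<integral>\<^sup>+p. ennreal (exp (q * sqrt r * Re \<beta> * fst p)) \<partial>gauss2)"
    by (intro nn_integral_cong) (simp add: cmod_exp_disp powr_def mult.assoc del: norm_exp_eq_Re)
  also have "\<dots> = (\<integral>\<^sup>+x. ennreal (exp (q * sqrt r * Re \<beta> * x)) \<partial>std_normal)"
    using N.emeasure_space_1 by (subst nn_integral_gauss2) auto
  also have "\<dots> = ennreal (exp (q\<^sup>2 * (Re \<beta>)\<^sup>2 * r / 2))"
    unfolding nn_integral_std_normal_exp using assms by (simp add: power_mult_distrib mult_ac)
  finally show ?thesis .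
qed

text \<open>Translating the integration variable by Re z completes the square in the real part and
  leaves the characteristic function of the normal law at Im z.\<close>

lemma integral_std_normal_cexp:
  "integrable std_normal (\<lambda>x. exp (z * complex_of_real x))"
  "(\<integral>x. exp (z * complex_of_real x) \<partial>std_normal) = exp (z\<^sup>2 / 2)"
proof -
  define a b where "a = Re z" and "b = Im z"
  have z: "z = complex_of_real a + \<i> * complex_of_real b" by (simp add: a_def b_def complex_eq)
  have "(\<integral>\<^sup>+x. ennreal (norm (exp (z * complex_of_real x))) \<partial>std_normal) < \<infinity>"
    using nn_integral_std_normal_exp[of a] by (simp add: norm_exp_eq_Re a_def)
  then show int: "integrable std_normal (\<lambda>x. exp (z * complex_of_real x))"
    by (intro integrableI_bounded) auto
  have "(\<integral>x. exp (z * complex_of_real x) \<partial>std_normal) = (\<integral>x. std_normal_density x *\<^sub>R exp (z * complex_of_real x) \<partial>lborel)"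
    by (subst integral_density) auto
  also have "\<dots> = \<bar>1\<bar> *\<^sub>R (\<integral>x. std_normal_density (a + 1 * x) *\<^sub>R exp (z * complex_of_real (a + 1 * x)) \<partial>lborel)"
    by (rule lborel_integral_real_affine) simp
  also have "(\<lambda>x. std_normal_density (a + 1 * x) *\<^sub>R exp (z * complex_of_real (a + 1 * x))) =
     (\<lambda>x. exp (complex_of_real (a\<^sup>2 / 2) + \<i> * (a * b)) * (std_normal_density x *\<^sub>R iexp (b * x)))"
  proof
    fix x :: real
    have "- ((a + x)\<^sup>2 / 2) + a * (a + x) = a\<^sup>2 / 2 + - (x\<^sup>2 / 2)" by (simp add: power2_eq_square field_simps)
    then have e: "complex_of_real (- ((a + x)\<^sup>2 / 2)) + z * complex_of_real (a + x) =
       (complex_of_real (a\<^sup>2 / 2) + \<i> * (a * b)) + (complex_of_real (- (x\<^sup>2 / 2)) + \<i> * complex_of_real (b * x))"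
      unfolding z complex_eq_iff by (simp add: algebra_simps)
    have n: "complex_of_real (std_normal_density x) = complex_of_real (1 / sqrt (2 * pi)) * exp (complex_of_real (- (x\<^sup>2 / 2)))" for x
      by (simp add: std_normal_density_def exp_of_real[symmetric] del: exp_of_real)
    have "exp (complex_of_real (- ((a + x)\<^sup>2 / 2))) * exp (z * complex_of_real (a + x)) =
      exp (complex_of_real (a\<^sup>2 / 2) + \<i> * (a * b)) * (exp (complex_of_real (- (x\<^sup>2 / 2))) * exp (\<i> * complex_of_real (b * x)))"
      unfolding mult_exp_exp e ..
    then have "complex_of_real (1 / sqrt (2 * pi)) * (exp (complex_of_real (- ((a + x)\<^sup>2 / 2))) * exp (z * complex_of_real (a + x))) =
      complex_of_real (1 / sqrt (2 * pi)) * (exp (complex_of_real (a\<^sup>2 / 2) + \<i> * (a * b)) * (exp (complex_of_real (- (x\<^sup>2 / 2))) * exp (\<i> * complex_of_real (b * x))))"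
      by (rule arg_cong)
    then show "std_normal_density (a + 1 * x) *\<^sub>R exp (z * complex_of_real (a + 1 * x)) =
      exp (complex_of_real (a\<^sup>2 / 2) + \<i> * (a * b)) * (std_normal_density x *\<^sub>R iexp (b * x))"
      unfolding scaleR_conv_of_real n mult_1_left by (simp only: mult.assoc mult.left_commute)
  qed
  also have "(\<integral>x. exp (complex_of_real (a\<^sup>2 / 2) + \<i> * (a * b)) * (std_normal_density x *\<^sub>R iexp (b * x)) \<partial>lborel) =
    exp (complex_of_real (a\<^sup>2 / 2) + \<i> * (a * b)) * (\<integral>x. std_normal_density x *\<^sub>R iexp (b * x) \<partial>lborel)"
    by (rule integral_mult_right_zero)
  also have "(\<integral>x. std_normal_density x *\<^sub>R iexp (b * x) \<partial>lborel) = char std_normal_distribution b"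
    unfolding char_def by (subst integral_density) auto
  also have "\<dots> = exp (complex_of_real (- (b\<^sup>2) / 2))"
    unfolding exp_of_real char_std_normal_distribution ..
  finally show "(\<integral>x. exp (z * complex_of_real x) \<partial>std_normal) = exp (z\<^sup>2 / 2)"
  proof -
    assume "(\<integral>x. exp (z * complex_of_real x) \<partial>std_normal) =
      \<bar>1\<bar> *\<^sub>R (exp (complex_of_real (a\<^sup>2 / 2) + \<i> * (a * b)) * exp (complex_of_real (- (b\<^sup>2) / 2)))"
    moreover have "(complex_of_real (a\<^sup>2 / 2) + \<i> * (a * b)) + complex_of_real (- (b\<^sup>2) / 2) = z\<^sup>2 / 2"
      unfolding z complex_eq_iff by (simp add: power2_eq_square)
    ultimately show ?thesis by (simp only: mult_exp_exp abs_one scaleR_one)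
  qed
qed

text \<open>Half the second moment E[(sigma x + i tau y)^2] of a unit displacement, hence an
  exponent for its exponential mean. The correlation \<rho> enters the imaginary part only, so the
  modulus of the mean does not depend on it.\<close>

definition kap :: "real \<Rightarrow> complex \<Rightarrow> complex" where
  "kap \<rho> \<beta> = complex_of_real (((Re \<beta>)\<^sup>2 - (Im \<beta>)\<^sup>2) / 2) + \<i> * complex_of_real (\<rho> * Re \<beta> * Im \<beta>)"

lemma integral_disp:
  assumes "0 \<le> r" "-1 \<le> \<rho>" "\<rho> \<le> 1"
  shows "integrable gauss2 (\<lambda>p. exp (disp \<rho> \<beta> r p))" "(\<integral>p. exp (disp \<rho> \<beta> r p) \<partial>gauss2) = exp (r * kap \<rho> \<beta>)"
proof -
  interpret N: prob_space std_normal by (rule prob_space_std_normal)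
  interpret NN: pair_prob_space std_normal std_normal ..
  let ?z1 = "sqrt r * (complex_of_real (Re \<beta>) + \<i> * (Im \<beta> * \<rho>))" and ?z2 = "sqrt r * (\<i> * (Im \<beta> * sqrt (1 - \<rho>\<^sup>2)))"
  have eq: "(\<lambda>p. exp (disp \<rho> \<beta> r p)) = (\<lambda>p. exp (?z1 * complex_of_real (fst p)) * exp (?z2 * complex_of_real (snd p)))"
    by (simp add: disp_def lin_def mult_exp_exp algebra_simps)
  have fin: "(\<integral>\<^sup>+p. ennreal (norm (exp (disp \<rho> \<beta> r p))) \<partial>gauss2) < \<infinity>"
    using nn_integral_disp_powr[OF assms(1), of \<rho> \<beta> 1] by simp
  show int: "integrable gauss2 (\<lambda>p. exp (disp \<rho> \<beta> r p))"
    by (rule integrableI_bounded[OF _ fin]) measurable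
  have rho: "\<rho>\<^sup>2 \<le> 1" using assms by (simp add: abs_square_le_1 abs_le_iff)
  have "(\<integral>p. exp (disp \<rho> \<beta> r p) \<partial>gauss2) = (\<integral>x. \<integral>y. exp (?z1 * complex_of_real x) * exp (?z2 * complex_of_real y) \<partial>std_normal \<partial>std_normal)"
    using NN.integral_fst'[OF int[unfolded gauss2_def eq]] unfolding gauss2_def eq by simp
  also have "\<dots> = exp (?z1\<^sup>2 / 2) * exp (?z2\<^sup>2 / 2)"
    by (simp add: integral_std_normal_cexp)
  also have "\<dots> = exp (r * kap \<rho> \<beta>)"
  proof -
    have s: "complex_of_real (sqrt r) * complex_of_real (sqrt r) = complex_of_real r"
      using assms(1) by (simp add: of_real_mult[symmetric] del: of_real_mult)
    have s2: "complex_of_real (sqrt (1 - \<rho>\<^sup>2)) * complex_of_real (sqrt (1 - \<rho>\<^sup>2)) = 1 - complex_of_real (\<rho>\<^sup>2)"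
      using rho by (simp add: of_real_mult[symmetric] del: of_real_mult of_real_power)
    have e1: "?z1\<^sup>2 = complex_of_real r * (complex_of_real (Re \<beta>) + \<i> * (Im \<beta> * \<rho>))\<^sup>2"
      unfolding power2_eq_square s[symmetric] by (simp add: mult_ac)
    have e2: "?z2\<^sup>2 = complex_of_real r * (- ((Im \<beta>)\<^sup>2 * (1 - complex_of_real (\<rho>\<^sup>2))))"
      unfolding power2_eq_square[of "complex_of_real (sqrt r) * _"] s[symmetric] s2[symmetric] power2_eq_square[of "complex_of_real (Im _)"]
      by (simp add: mult_ac power2_eq_square)
    have "?z1\<^sup>2 / 2 + ?z2\<^sup>2 / 2 = r * kap \<rho> \<beta>"
      unfolding e1 e2 kap_def by (simp add: power2_eq_square field_simps)
    then show ?thesis by (simp add: mult_exp_exp)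
  qed
  finally show "(\<integral>p. exp (disp \<rho> \<beta> r p) \<partial>gauss2) = exp (r * kap \<rho> \<beta>)" .
qed

section \<open>Absolute moments of the partition function\<close>

lemma bbm_first_split:
  assumes "0 \<le> s" "g \<in> borel_measurable borel"
  shows "(\<integral>\<^sup>+\<omega>. g (bbm \<rho> \<beta> s \<omega>) \<partial>bbm_space) = ennreal (exp (- s)) * (\<integral>\<^sup>+p. g (exp (disp \<rho> \<beta> s p)) \<partial>gauss2) +
      (\<integral>\<^sup>+l. ennreal (exp (- l)) * indicator {0..s} l *
        (\<integral>\<^sup>+p. \<integral>\<^sup>+\<omega>. \<integral>\<^sup>+\<omega>'. g (exp (disp \<rho> \<beta> l p) * (bbm \<rho> \<beta> (s - l) \<omega> + bbm \<rho> \<beta> (s - l) \<omega>')) \<partial>bbm_space \<partial>bbm_space \<partial>gauss2) \<partial>lborel)"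
  using first_split_bbm[of \<rho> \<beta>, unfolded first_split_def, THEN conjunct2, THEN conjunct2, rule_format, OF assms] .

text \<open>A constant C for (x + y)^q <= C (x^q + y^q). For \<open>q\<close> at most 1 the value 1
  matters, since the rate in \<open>bbm_moment\<close> contains 2 C - 1 and is then used as it
  stands; for larger \<open>q\<close> any finite value serves.\<close>

definition powr_const :: "real \<Rightarrow> real" where
  "powr_const q = (if q \<le> 1 then 1 else 2 powr q)"

lemma powr_add_le:
  assumes "0 < q" "0 \<le> x" "0 \<le> (y::real)"
  shows "(x + y) powr q \<le> powr_const q * (x powr q + y powr q)"
proof (cases "q \<le> 1")
  case True
  \<comment> \<open>On [0, 1] a number is at most its q-th power when \<open>q\<close> is at most 1.
    The two fractions of \<open>x + y\<close> add up to 1.\<close>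
  have *: "z powr q \<ge> (x + y) powr q * (z / (x + y))" if "0 \<le> z" "z \<le> x + y" "0 < x + y" for z
  proof (cases "z = 0")
    case False
    have "z / (x + y) \<le> (z / (x + y)) powr q"
      using that False True assms powr_mono'[of q 1 "z / (x + y)"] by simp
    also have "\<dots> = z powr q / (x + y) powr q" using that by (simp add: powr_divide)
    finally show ?thesis using that by (simp add: pos_le_divide_eq mult.commute)
  qed simp
  show ?thesis
  proof (cases "x + y = 0")
    case False
    then have "0 < x + y" using assms by simp
    then have "(x + y) powr q = (x + y) powr q * (x / (x + y)) + (x + y) powr q * (y / (x + y))"
      by (simp add: distrib_left[symmetric] add_divide_distrib[symmetric])
    also have "\<dots> \<le> x powr q + y powr q" using assms \<open>0 < x + y\<close> by (intro add_mono *) auto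
    finally show ?thesis using True by (simp add: powr_const_def)
  qed (use assms in \<open>simp add: powr_const_def\<close>)
next
  case False
  have "(x + y) powr q \<le> (2 * max x y) powr q" using assms by (intro powr_mono2) auto
  also have "\<dots> = 2 powr q * (max x y) powr q" using assms by (simp add: powr_mult)
  also have "\<dots> \<le> 2 powr q * (x powr q + y powr q)" by (intro mult_left_mono) (auto simp: max_def)
  finally show ?thesis using False by (simp add: powr_const_def)
qed

lemma nn_integral_exp_Icc:
  fixes c s :: real
  assumes "0 \<le> c" "0 \<le> s"
  shows "(\<integral>\<^sup>+l. ennreal (c * exp (- c * l)) * indicator {0..s} l \<partial>lborel) = ennreal (1 - exp (- c * s))"
proof -
  have "(\<integral>\<^sup>+l. ennreal (c * exp (- c * l)) * indicator {0..s} l \<partial>lborel) = ennreal (- exp (- c * s) - (- exp (- c * 0)))"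
    by (rule nn_integral_FTC_Icc) (use assms in \<open>auto intro!: derivative_eq_intros\<close>)
  then show ?thesis by simp
qed

lemma truncated_powr_scale:
  assumes "0 < q" "0 \<le> c" "0 \<le> B" "0 \<le> e"
  shows "ennreal (min (c * e) B powr q) \<le> ennreal (c powr q) * ennreal (e powr q)"
proof -
  have "min (c * e) B powr q \<le> (c * e) powr q"
    using assms by (intro powr_mono2) auto
  also have "\<dots> = c powr q * e powr q" using assms by (simp add: powr_mult)
  finally show ?thesis by (subst ennreal_mult[symmetric]) (auto intro: ennreal_leI)
qed

lemma truncated_powr_add:
  assumes "0 < q" "0 \<le> d" "0 \<le> B" "0 \<le> r" "0 \<le> x" "0 \<le> y" "r \<le> d * (x + y)"
  shows "ennreal (min r B powr q) \<le> ennreal (powr_const q) * (ennreal (min (d * x) B powr q) + ennreal (min (d * y) B powr q))"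
proof -
  have dxy: "0 \<le> d * x" "0 \<le> d * y" using assms by auto
  have "min r B \<le> min (d * x) B + min (d * y) B"
  proof -
    have "min r B \<le> min u B + min v B" if "r \<le> u + v" "0 \<le> u" "0 \<le> v" for u v
      using that \<open>0 \<le> B\<close> by (auto simp: min_def)
    then show ?thesis using dxy assms(7) by (simp add: distrib_left)
  qed
  then have "min r B powr q \<le> (min (d * x) B + min (d * y) B) powr q"
    using assms by (intro powr_mono2) auto
  also have "\<dots> \<le> powr_const q * (min (d * x) B powr q + min (d * y) B powr q)"
    using assms by (intro powr_add_le) auto
  finally have "ennreal (min r B powr q) \<le> ennreal (powr_const q * (min (d * x) B powr q + min (d * y) B powr q))"
    by (rule ennreal_leI)
  also have "\<dots> = ennreal (powr_const q) * (ennreal (min (d * x) B powr q) + ennreal (min (d * y) B powr q))"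
    by (subst ennreal_mult) (auto simp: powr_const_def)
  finally show ?thesis .
qed

text \<open>The truncation at \<open>B\<close> gives a finite quantity to start the iteration of the
  first-split equation from; after \<open>n\<close> iterations the start value carries a factor 1 /
  n! and fades out. The scale \<open>c\<close> is free because the displacement of the root
  multiplies the sums of the subtrees before they are truncated.\<close>

lemma bbm_truncated_moment:
  assumes q: "0 < q" and B: "0 \<le> B" and "0 \<le> s" "0 \<le> c"
  shows "(\<integral>\<^sup>+\<omega>. ennreal (min (c * cmod (bbm \<rho> \<beta> s \<omega>)) B powr q) \<partial>bbm_space) \<le>
    ennreal (c powr q * exp ((2 * powr_const q - 1 + q\<^sup>2 * (Re \<beta>)\<^sup>2 / 2) * s)) +
    ennreal (B powr q * ((2 * powr_const q * s) ^ n / fact n))"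
  using assms(3,4)
proof (induction n arbitrary: s c)
  case 0
  interpret P: prob_space bbm_space by (rule prob_space_bbm_space)
  have "(\<integral>\<^sup>+\<omega>. ennreal (min (c * cmod (bbm \<rho> \<beta> s \<omega>)) B powr q) \<partial>bbm_space) \<le> (\<integral>\<^sup>+\<omega>. ennreal (B powr q) \<partial>bbm_space)"
    using 0 q B by (intro nn_integral_mono ennreal_leI powr_mono2) auto
  then show ?case by (simp add: P.emeasure_space_1 add_increasing)
next
  case (Suc n)
  interpret P: prob_space bbm_space by (rule prob_space_bbm_space)
  interpret G: prob_space gauss2 by (rule prob_space_gauss2)
  define C where "C = 2 * powr_const q"
  define k where "k = q\<^sup>2 * (Re \<beta>)\<^sup>2 / 2"
  \<comment> \<open>The rate for which the bound reproduces itself: up to the factor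
    \<open>c powr q\<close>, the root contributes exp (a s) exp (- C s), and the splits integrate to
    exp (a s) (1 - exp (- C s)).\<close>
  define a where "a = C - 1 + k"
  have C: "0 \<le> C" "powr_const q \<ge> 0" by (auto simp: C_def powr_const_def)
  let ?X = "bbm \<rho> \<beta>"
  let ?g = "\<lambda>c z. ennreal (min (c * cmod z) B powr q)"
  define E where "E l p = cmod (exp (disp \<rho> \<beta> l p))" for l p
  have E0: "0 \<le> E l p" for l p by (simp add: E_def)
  have [measurable]: "E l \<in> borel_measurable gauss2" for l unfolding E_def by measurable
  have Eq: "(\<integral>\<^sup>+p. ennreal (E l p powr q) \<partial>gauss2) = ennreal (exp (k * l))" if "0 \<le> l" for l
    using nn_integral_disp_powr[OF that, of \<rho> \<beta> q] by (simp add: E_def k_def del: norm_exp_eq_Re)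
  have root: "(\<integral>\<^sup>+p. ?g c (exp (disp \<rho> \<beta> s p)) \<partial>gauss2) \<le> ennreal (c powr q * exp (k * s))"
  proof -
    have "(\<integral>\<^sup>+p. ?g c (exp (disp \<rho> \<beta> s p)) \<partial>gauss2) \<le> (\<integral>\<^sup>+p. ennreal (c powr q) * ennreal (E s p powr q) \<partial>gauss2)"
      unfolding E_def[symmetric] using Suc.prems q B E0 by (intro nn_integral_mono truncated_powr_scale) auto
    also have "\<dots> = ennreal (c powr q) * ennreal (exp (k * s))"
      by (subst nn_integral_cmult) (simp_all add: Eq Suc.prems)
    finally show ?thesis by (simp add: ennreal_mult)
  qed
  have inner: "(\<integral>\<^sup>+p. \<integral>\<^sup>+\<omega>. \<integral>\<^sup>+\<omega>'. ?g c (exp (disp \<rho> \<beta> l p) * (?X (s - l) \<omega> + ?X (s - l) \<omega>')) \<partial>bbm_space \<partial>bbm_space \<partial>gauss2)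
     \<le> ennreal (C * (c powr q * exp (k * l) * exp (a * (s - l)))) + ennreal (C * (B powr q * ((C * (s - l)) ^ n / fact n)))"
    if l: "l \<in> {0..s}" for l
  proof -
    let ?e = "E l"
    let ?b = "B powr q * ((C * (s - l)) ^ n / fact n)"
    have b0: "0 \<le> ?b" using l C by auto
    have step: "(\<integral>\<^sup>+\<omega>. \<integral>\<^sup>+\<omega>'. ?g c (exp (disp \<rho> \<beta> l p) * (?X (s - l) \<omega> + ?X (s - l) \<omega>')) \<partial>bbm_space \<partial>bbm_space)
       \<le> ennreal (C * exp (a * (s - l)) * c powr q) * ennreal (?e p powr q) + ennreal (C * ?b)" for p
    proof -
      let ?d = "c * ?e p"
      let ?h = "\<integral>\<^sup>+\<omega>. ?g ?d (?X (s - l) \<omega>) \<partial>bbm_space"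
      have d0: "0 \<le> ?d" using Suc.prems(2) E0 by simp
      have pt: "?g c (exp (disp \<rho> \<beta> l p) * (x + y)) \<le> ennreal (powr_const q) * (?g ?d x + ?g ?d y)" for x y
        unfolding norm_mult E_def[symmetric] mult.assoc[symmetric]
        by (rule truncated_powr_add[OF q d0 B]) (use d0 norm_triangle_ineq[of x y] in \<open>auto intro!: mult_left_mono\<close>)
      have "(\<integral>\<^sup>+\<omega>. \<integral>\<^sup>+\<omega>'. ?g c (exp (disp \<rho> \<beta> l p) * (?X (s - l) \<omega> + ?X (s - l) \<omega>')) \<partial>bbm_space \<partial>bbm_space)
         \<le> (\<integral>\<^sup>+\<omega>. \<integral>\<^sup>+\<omega>'. ennreal (powr_const q) * (?g ?d (?X (s - l) \<omega>) + ?g ?d (?X (s - l) \<omega>')) \<partial>bbm_space \<partial>bbm_space)"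
        by (intro nn_integral_mono pt)
      also have "\<dots> = ennreal (powr_const q) * (?h + ?h)"
        by (simp add: nn_integral_cmult nn_integral_add P.emeasure_space_1)
      also have "\<dots> = ennreal C * ?h"
        using C by (simp add: C_def ennreal_mult mult_2[symmetric] mult_ac)
      also have "\<dots> \<le> ennreal C * (ennreal (?d powr q * exp (a * (s - l))) + ennreal ?b)"
        using Suc.IH[of "s - l" ?d] l d0 unfolding a_def k_def C_def by (intro mult_left_mono) auto
      also have "\<dots> = ennreal (C * exp (a * (s - l)) * c powr q) * ennreal (?e p powr q) + ennreal (C * ?b)"
      proof -
        have "?d powr q = c powr q * E l p powr q" using Suc.prems E0 by (simp add: powr_mult)
        then have "C * (?d powr q * exp (a * (s - l))) = (C * exp (a * (s - l)) * c powr q) * (E l p powr q)" by simp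
        then have "ennreal C * ennreal (?d powr q * exp (a * (s - l))) = ennreal (C * exp (a * (s - l)) * c powr q) * ennreal (E l p powr q)"
          using C by (simp add: ennreal_mult[symmetric])
        moreover have "ennreal C * ennreal ?b = ennreal (C * ?b)" using C b0 by (simp only: ennreal_mult)
        ultimately show ?thesis by (simp only: distrib_left)
      qed
      finally show ?thesis .
    qed
    have "(\<integral>\<^sup>+p. \<integral>\<^sup>+\<omega>. \<integral>\<^sup>+\<omega>'. ?g c (exp (disp \<rho> \<beta> l p) * (?X (s - l) \<omega> + ?X (s - l) \<omega>')) \<partial>bbm_space \<partial>bbm_space \<partial>gauss2)
       \<le> (\<integral>\<^sup>+p. ennreal (C * exp (a * (s - l)) * c powr q) * ennreal (?e p powr q) + ennreal (C * ?b) \<partial>gauss2)"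
      by (intro nn_integral_mono step)
    also have "\<dots> = ennreal (C * exp (a * (s - l)) * c powr q) * ennreal (exp (k * l)) + ennreal (C * ?b)"
      using l by (simp add: nn_integral_add nn_integral_cmult Eq G.emeasure_space_1)
    also have "\<dots> = ennreal (C * (c powr q * exp (k * l) * exp (a * (s - l)))) + ennreal (C * ?b)"
      using C by (simp add: ennreal_mult[symmetric] mult_ac)
    finally show ?thesis .
  qed
  have le: "ennreal (exp (- l)) * indicator {0..s} l * (\<integral>\<^sup>+p. \<integral>\<^sup>+\<omega>. \<integral>\<^sup>+\<omega>'. ?g c (exp (disp \<rho> \<beta> l p) * (?X (s - l) \<omega> + ?X (s - l) \<omega>')) \<partial>bbm_space \<partial>bbm_space \<partial>gauss2)
     \<le> ennreal (c powr q * exp (a * s)) * (ennreal (C * exp (- C * l)) * indicator {0..s} l) + ennreal (B powr q) * (ennreal (C * ((C * (s - l)) ^ n / fact n)) * indicator {0..s} l)" for l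
  proof (cases "l \<in> {0..s}")
    case True
    have e: "- l + k * l + a * (s - l) = a * s - C * l" by (simp add: a_def algebra_simps)
    have "ennreal (exp (- l)) * (\<integral>\<^sup>+p. \<integral>\<^sup>+\<omega>. \<integral>\<^sup>+\<omega>'. ?g c (exp (disp \<rho> \<beta> l p) * (?X (s - l) \<omega> + ?X (s - l) \<omega>')) \<partial>bbm_space \<partial>bbm_space \<partial>gauss2)
      \<le> ennreal (exp (- l)) * (ennreal (C * (c powr q * exp (k * l) * exp (a * (s - l)))) + ennreal (C * (B powr q * ((C * (s - l)) ^ n / fact n))))"
      by (intro mult_left_mono inner True) simp
    also have "\<dots> \<le> ennreal (exp (- l)) * ennreal (C * (c powr q * exp (k * l) * exp (a * (s - l)))) + 1 * ennreal (C * (B powr q * ((C * (s - l)) ^ n / fact n)))"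
      unfolding distrib_left using True by (intro add_mono mult_right_mono order_refl) auto
    also have "ennreal (exp (- l)) * ennreal (C * (c powr q * exp (k * l) * exp (a * (s - l)))) = ennreal (c powr q * exp (a * s)) * ennreal (C * exp (- C * l))"
    proof -
      have "exp (- l) * (exp (k * l) * exp (a * (s - l))) = exp (a * s) * exp (- C * l)"
        unfolding mult_exp_exp using e by (simp add: algebra_simps)
      then have "exp (- l) * (C * (c powr q * exp (k * l) * exp (a * (s - l)))) = (c powr q * exp (a * s)) * (C * exp (- C * l))"
        by (simp add: mult_ac)
      then show ?thesis using C by (simp add: ennreal_mult[symmetric])
    qed
    also have "1 * ennreal (C * (B powr q * ((C * (s - l)) ^ n / fact n))) = ennreal (B powr q) * ennreal (C * ((C * (s - l)) ^ n / fact n))"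
      using C True by (subst ennreal_mult[symmetric]) (auto simp: mult_ac)
    finally show ?thesis using True by simp
  qed auto
  have "(\<integral>\<^sup>+\<omega>. ?g c (?X s \<omega>) \<partial>bbm_space) \<le> ennreal (exp (- s)) * ennreal (c powr q * exp (k * s)) +
     (\<integral>\<^sup>+l. ennreal (c powr q * exp (a * s)) * (ennreal (C * exp (- C * l)) * indicator {0..s} l) + ennreal (B powr q) * (ennreal (C * ((C * (s - l)) ^ n / fact n)) * indicator {0..s} l) \<partial>lborel)"
    by (subst bbm_first_split[OF Suc.prems(1), of "?g c"], measurable)
      (intro add_mono mult_left_mono root nn_integral_mono le, simp)
  also have "(\<integral>\<^sup>+l. ennreal (c powr q * exp (a * s)) * (ennreal (C * exp (- C * l)) * indicator {0..s} l) + ennreal (B powr q) * (ennreal (C * ((C * (s - l)) ^ n / fact n)) * indicator {0..s} l) \<partial>lborel)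
     = ennreal (c powr q * exp (a * s)) * ennreal (1 - exp (- C * s)) + ennreal (B powr q) * ennreal ((C * s) ^ Suc n / fact (Suc n))"
    unfolding nn_integral_exp_Icc[OF C(1) Suc.prems(1), symmetric] nn_integral_power_Icc[OF C(1) Suc.prems(1), symmetric]
    by (subst nn_integral_add, measurable, subst nn_integral_cmult, measurable, subst nn_integral_cmult, measurable)
  also have "ennreal (exp (- s)) * ennreal (c powr q * exp (k * s)) = ennreal (c powr q * exp (a * s)) * ennreal (exp (- C * s))"
  proof -
    have "exp (- s) * exp (k * s) = exp (a * s) * exp (- C * s)"
      unfolding mult_exp_exp by (simp add: a_def algebra_simps)
    then show ?thesis by (simp add: ennreal_mult[symmetric] mult_ac)
  qed
  also have "ennreal (c powr q * exp (a * s)) * ennreal (exp (- C * s)) + (ennreal (c powr q * exp (a * s)) * ennreal (1 - exp (- C * s)) + ennreal (B powr q) * ennreal ((C * s) ^ Suc n / fact (Suc n)))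
     = ennreal (c powr q * exp (a * s)) * (ennreal (exp (- C * s)) + ennreal (1 - exp (- C * s))) + ennreal (B powr q) * ennreal ((C * s) ^ Suc n / fact (Suc n))"
    by (simp only: distrib_left add.assoc)
  also have "ennreal (exp (- C * s)) + ennreal (1 - exp (- C * s)) = 1"
    using C Suc.prems by (subst ennreal_plus[symmetric]) auto
  also have "ennreal (B powr q) * ennreal ((C * s) ^ Suc n / fact (Suc n)) = ennreal (B powr q * ((C * s) ^ Suc n / fact (Suc n)))"
    using C Suc.prems by (intro ennreal_mult[symmetric]) auto
  finally show ?case by (simp add: a_def k_def C_def)
qed

text \<open>Fatou's lemma removes the truncation. For \<open>q\<close> at most 1 the rate is 1 + q^2
  sigma^2 / 2; above 1 it is only a crude bound.\<close>

lemma bbm_moment: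
  assumes q: "0 < q" and s: "0 \<le> s"
  shows "(\<integral>\<^sup>+\<omega>. ennreal (cmod (bbm \<rho> \<beta> s \<omega>) powr q) \<partial>bbm_space) \<le>
    ennreal (exp ((2 * powr_const q - 1 + q\<^sup>2 * (Re \<beta>)\<^sup>2 / 2) * s))"
proof -
  let ?f = "\<lambda>n \<omega>. ennreal (min (1 * cmod (bbm \<rho> \<beta> s \<omega>)) (real n) powr q)"
  let ?R = "ennreal (exp ((2 * powr_const q - 1 + q\<^sup>2 * (Re \<beta>)\<^sup>2 / 2) * s))"
  have bound: "(\<integral>\<^sup>+\<omega>. ?f n \<omega> \<partial>bbm_space) \<le> ?R" for n
  proof (rule ennreal_le_add_power_fact)
    fix m
    show "(\<integral>\<^sup>+\<omega>. ?f n \<omega> \<partial>bbm_space) \<le> ?R + ennreal (real n powr q * ((2 * powr_const q * s) ^ m / fact m))"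
      using bbm_truncated_moment[OF q, of "real n" s 1 \<rho> \<beta> m] s by simp
  qed
  have lim: "liminf (\<lambda>n. ?f n \<omega>) = ennreal (cmod (bbm \<rho> \<beta> s \<omega>) powr q)" for \<omega>
  proof (rule lim_imp_Liminf)
    obtain N :: nat where N: "cmod (bbm \<rho> \<beta> s \<omega>) \<le> N" using real_arch_simple by blast
    have "eventually (\<lambda>n. ?f n \<omega> = ennreal (cmod (bbm \<rho> \<beta> s \<omega>) powr q)) sequentially"
      using eventually_ge_at_top[of N] by eventually_elim (use N in \<open>auto simp: min_def\<close>)
    then show "(\<lambda>n. ?f n \<omega>) \<longlonglongrightarrow> ennreal (cmod (bbm \<rho> \<beta> s \<omega>) powr q)" by (rule tendsto_eventually)
  qed simp
  have "(\<integral>\<^sup>+\<omega>. ennreal (cmod (bbm \<rho> \<beta> s \<omega>) powr q) \<partial>bbm_space) = (\<integral>\<^sup>+\<omega>. liminf (\<lambda>n. ?f n \<omega>) \<partial>bbm_space)"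
    by (simp only: lim)
  also have "\<dots> \<le> liminf (\<lambda>n. \<integral>\<^sup>+\<omega>. ?f n \<omega> \<partial>bbm_space)"
    by (rule nn_integral_liminf) measurable
  also have "\<dots> \<le> liminf (\<lambda>n::nat. ?R)" by (intro Liminf_mono always_eventually allI bound)
  also have "\<dots> = ?R" by (simp add: Liminf_const)
  finally show ?thesis .
qed

section \<open>The number of particles\<close>

lemma disp_zero [simp]: "disp \<rho> 0 r p = 0"
  by (simp add: disp_def lin_def)

lemma bbm_zero: "bbm \<rho> 0 s \<omega> = of_nat (card (tree_alive (\<lambda>u. fst (\<omega> u)) s))"
  by (simp add: bbm_def bbm_sum_def tree_sum_def tree_pos_def)

text \<open>The number of particles is a Yule process, geometric with parameter exp (- s). Its
  generating function \<open>w\<close> solves the first-split equation, and the iteration compares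
  \<open>h\<close> with it. The result bounds the chance of having few particles.\<close>

lemma bbm_count_generating_function:
  assumes z: "0 < z" "z < 1" and "0 \<le> s"
  shows "(\<integral>\<^sup>+\<omega>. ennreal (z powr cmod (bbm \<rho> 0 s \<omega>)) \<partial>bbm_space) \<le> ennreal (exp (- s) / (1 - z))"
proof -
  interpret P: prob_space bbm_space by (rule prob_space_bbm_space)
  interpret G: prob_space gauss2 by (rule prob_space_gauss2)
  define h where "h s = (\<integral>\<^sup>+\<omega>. ennreal (z powr cmod (bbm \<rho> 0 s \<omega>)) \<partial>bbm_space)" for s
  define w where "w s = z * exp (- s) / (1 - z + z * exp (- s))" for s
  have pos: "0 < 1 - z + z * x" if "0 \<le> x" for x
  proof -
    have "0 \<le> z * x" using z that by simp
    then show ?thesis using z by linarith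
  qed
  have w01: "0 \<le> w s" "w s \<le> 1" for s
  proof -
    show "0 \<le> w s" unfolding w_def using z pos[of "exp (- s)"] by simp
    show "w s \<le> 1" unfolding w_def using z pos[of "exp (- s)"] by (subst divide_le_eq_1_pos) auto
  qed
  have h1: "h s \<le> 1" for s
  proof -
    have "h s \<le> (\<integral>\<^sup>+\<omega>. 1 \<partial>bbm_space)" unfolding h_def
      using z by (intro nn_integral_mono) (simp add: powr_le_one_le ennreal_le_1 powr_le1)
    then show ?thesis by (simp add: P.emeasure_space_1)
  qed
  have hm [measurable]: "h \<in> borel_measurable borel" unfolding h_def by measurable
  have h_eq: "h s = ennreal (exp (- s)) * ennreal z + (\<integral>\<^sup>+l. ennreal (exp (- l)) * indicator {0..s} l * (h (s - l) * h (s - l)) \<partial>lborel)"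
    if "0 \<le> s" for s
  proof -
    have "(\<integral>\<^sup>+p. \<integral>\<^sup>+\<omega>. \<integral>\<^sup>+\<omega>'. ennreal (z powr cmod (exp (disp \<rho> 0 l p) * (bbm \<rho> 0 (s - l) \<omega> + bbm \<rho> 0 (s - l) \<omega>'))) \<partial>bbm_space \<partial>bbm_space \<partial>gauss2) = h (s - l) * h (s - l)" for l
    proof -
      have "z powr cmod (exp (disp \<rho> 0 l p) * (bbm \<rho> 0 (s - l) \<omega> + bbm \<rho> 0 (s - l) \<omega>')) = z powr cmod (bbm \<rho> 0 (s - l) \<omega>) * z powr cmod (bbm \<rho> 0 (s - l) \<omega>')" for p \<omega> \<omega>'
        unfolding bbm_zero by (simp add: of_nat_add[symmetric] norm_of_nat del: of_nat_add) (simp add: powr_add)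
      then have "(\<integral>\<^sup>+p. \<integral>\<^sup>+\<omega>. \<integral>\<^sup>+\<omega>'. ennreal (z powr cmod (exp (disp \<rho> 0 l p) * (bbm \<rho> 0 (s - l) \<omega> + bbm \<rho> 0 (s - l) \<omega>'))) \<partial>bbm_space \<partial>bbm_space \<partial>gauss2) =
        (\<integral>\<^sup>+p. \<integral>\<^sup>+\<omega>. \<integral>\<^sup>+\<omega>'. ennreal (z powr cmod (bbm \<rho> 0 (s - l) \<omega>)) * ennreal (z powr cmod (bbm \<rho> 0 (s - l) \<omega>')) \<partial>bbm_space \<partial>bbm_space \<partial>gauss2)"
        by (simp only: ennreal_mult powr_ge_zero)
      also have "\<dots> = h (s - l) * h (s - l)"
        unfolding h_def by (simp add: nn_integral_cmult nn_integral_multc G.emeasure_space_1)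
      finally show ?thesis .
    qed
    then show ?thesis unfolding h_def
      using bbm_first_split[OF that, of "\<lambda>x. ennreal (z powr cmod x)" \<rho> 0] z
      by (simp add: G.emeasure_space_1 del: norm_exp_eq_Re)
  qed
  have int_w: "(\<integral>\<^sup>+l. ennreal (exp (- l) * (w (s - l) * w (s - l))) * indicator {0..s} l \<partial>lborel) = ennreal (w s - z * exp (- s))"
    if "0 \<le> s" for s
  proof -
    let ?D = "\<lambda>l. 1 - z + z * exp (l - s)"
    let ?F = "\<lambda>l. - (z * exp (- s)) / ?D l"
    have "(\<integral>\<^sup>+l. ennreal (exp (- l) * (w (s - l) * w (s - l))) * indicator {0..s} l \<partial>lborel) = ennreal (?F s - ?F 0)"
    proof (rule nn_integral_FTC_Icc)
      fix l assume l: "l \<in> {0..s}"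
      have D: "?D l \<noteq> 0" using pos[of "exp (l - s)"] by simp
      have "(?F has_real_derivative (z * exp (- s)) * (z * exp (l - s)) / (?D l)\<^sup>2) (at l)"
        using D by (auto intro!: derivative_eq_intros simp: power2_eq_square)
      moreover have "(z * exp (- s)) * (z * exp (l - s)) / (?D l)\<^sup>2 = exp (- l) * (w (s - l) * w (s - l))"
      proof -
        have e: "exp (- l) * (exp (l - s) * exp (l - s)) = exp (- s) * exp (l - s)"
          by (simp add: mult_exp_exp)
        have "exp (- l) * (w (s - l) * w (s - l)) = z * z * (exp (- l) * (exp (l - s) * exp (l - s))) / (?D l)\<^sup>2"
          unfolding w_def by (simp add: power2_eq_square)
        then show ?thesis unfolding e by (simp add: mult_ac)
      qed
      ultimately show "(?F has_real_derivative exp (- l) * (w (s - l) * w (s - l))) (at l)" by simp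
      show "0 \<le> exp (- l) * (w (s - l) * w (s - l))" using w01 by simp
    next
      show "(\<lambda>l. exp (- l) * (w (s - l) * w (s - l))) \<in> borel_measurable borel" unfolding w_def by measurable
    qed (use that in auto)
    also have "?F s - ?F 0 = w s - z * exp (- s)" by (simp add: w_def)
    finally show ?thesis .
  qed
  have w_ge: "z * exp (- s) \<le> w s" if "0 \<le> s" for s
  proof -
    have "z * exp (- s) \<le> z" using z that by simp
    then have "1 - z + z * exp (- s) \<le> 1" by simp
    then have "z * exp (- s) / 1 \<le> w s" unfolding w_def using z pos[of "exp (- s)"] by (intro divide_left_mono) auto
    then show ?thesis by simp
  qed
  have bound: "h s \<le> ennreal (w s) + ennreal ((2 * s) ^ n / fact n)" if "0 \<le> s" for s n
    using that
  proof (induction n arbitrary: s)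
    case 0 then show ?case using h1[of s] by (simp add: add_increasing)
  next
    case (Suc n)
    \<comment> \<open>Both \<open>h\<close> and \<open>w\<close> are at most 1, so replacing the
      factors of the square one by one costs the error twice.\<close>
    have sq: "h r * h r \<le> ennreal (w r * w r) + 2 * ennreal ((2 * r) ^ n / fact n)" if "0 \<le> r" for r
    proof -
      let ?e = "ennreal ((2 * r) ^ n / fact n)"
      have "h r * h r \<le> h r * (ennreal (w r) + ?e)" by (intro mult_left_mono Suc.IH that) simp
      also have "\<dots> = h r * ennreal (w r) + h r * ?e" by (simp add: distrib_left)
      also have "\<dots> \<le> (ennreal (w r) + ?e) * ennreal (w r) + 1 * ?e"
        by (intro add_mono mult_right_mono Suc.IH that h1) auto
      also have "\<dots> = ennreal (w r * w r) + (?e * ennreal (w r) + ?e)"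
        using w01 by (simp add: distrib_right ennreal_mult add.assoc)
      also have "\<dots> \<le> ennreal (w r * w r) + (?e * 1 + ?e)"
        using w01[of r] by (intro add_mono mult_left_mono order_refl) (auto simp: ennreal_le_1)
      finally show ?thesis by (simp only: mult_2[of ?e] mult_1_right)
    qed
    have "ennreal (exp (- l)) * indicator {0..s} l * (h (s - l) * h (s - l)) \<le>
        ennreal (exp (- l) * (w (s - l) * w (s - l))) * indicator {0..s} l + ennreal (2 * ((2 * (s - l)) ^ n / fact n)) * indicator {0..s} l" for l
    proof (cases "l \<in> {0..s}")
      case True
      let ?e = "ennreal ((2 * (s - l)) ^ n / fact n)"
      have "ennreal (exp (- l)) * (h (s - l) * h (s - l)) \<le> ennreal (exp (- l)) * (ennreal (w (s - l) * w (s - l)) + 2 * ?e)"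
        using True by (intro mult_left_mono sq) auto
      also have "\<dots> \<le> ennreal (exp (- l)) * ennreal (w (s - l) * w (s - l)) + 1 * (2 * ?e)"
        unfolding distrib_left using True by (intro add_mono mult_right_mono order_refl) auto
      also have "ennreal (exp (- l)) * ennreal (w (s - l) * w (s - l)) = ennreal (exp (- l) * (w (s - l) * w (s - l)))"
        using w01 by (simp add: ennreal_mult)
      also have "1 * (2 * ?e) = ennreal (2 * ((2 * (s - l)) ^ n / fact n))"
        using True by (subst ennreal_mult) auto
      finally show ?thesis using True by simp
    qed auto
    then have "(\<integral>\<^sup>+l. ennreal (exp (- l)) * indicator {0..s} l * (h (s - l) * h (s - l)) \<partial>lborel) \<le>
      (\<integral>\<^sup>+l. ennreal (exp (- l) * (w (s - l) * w (s - l))) * indicator {0..s} l + ennreal (2 * ((2 * (s - l)) ^ n / fact n)) * indicator {0..s} l \<partial>lborel)"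
      by (intro nn_integral_mono)
    also have "\<dots> = ennreal (w s - z * exp (- s)) + ennreal ((2 * s) ^ Suc n / fact (Suc n))"
    proof (subst nn_integral_add)
      show "(\<lambda>l. ennreal (exp (- l) * (w (s - l) * w (s - l))) * indicator {0..s} l) \<in> borel_measurable lborel"
        unfolding w_def by measurable
      show "(\<integral>\<^sup>+l. ennreal (exp (- l) * (w (s - l) * w (s - l))) * indicator {0..s} l \<partial>lborel) + (\<integral>\<^sup>+l. ennreal (2 * ((2 * (s - l)) ^ n / fact n)) * indicator {0..s} l \<partial>lborel) =
         ennreal (w s - z * exp (- s)) + ennreal ((2 * s) ^ Suc n / fact (Suc n))"
        unfolding int_w[OF Suc.prems] by (subst nn_integral_power_Icc[of 2 s n]) (use Suc.prems in simp_all)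
    qed measurable
    finally have "h s \<le> ennreal (exp (- s)) * ennreal z + (ennreal (w s - z * exp (- s)) + ennreal ((2 * s) ^ Suc n / fact (Suc n)))"
      unfolding h_eq[OF Suc.prems] by (rule add_left_mono)
    also have "\<dots> = (ennreal (z * exp (- s)) + ennreal (w s - z * exp (- s))) + ennreal ((2 * s) ^ Suc n / fact (Suc n))"
      using z by (simp only: ennreal_mult[symmetric] exp_ge_zero less_imp_le add.assoc mult.commute)
    also have "ennreal (z * exp (- s)) + ennreal (w s - z * exp (- s)) = ennreal (w s)"
      using z w_ge[OF Suc.prems] by (subst ennreal_plus[symmetric]) auto
    finally show ?case .
  qed
  have "h s \<le> ennreal (w s)"
    by (rule ennreal_le_add_power_fact[where C=1 and c="2 * s"]) (unfold mult_1_left, rule bound[OF \<open>0 \<le> s\<close>])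
  moreover have "w s \<le> exp (- s) / (1 - z)"
    unfolding w_def using z by (intro frac_le) auto
  then have "ennreal (w s) \<le> ennreal (exp (- s) / (1 - z))" by (rule ennreal_leI)
  ultimately show ?thesis unfolding h_def by (rule order_trans)
qed

text \<open>The upper half is the moment bound at exponent 1. For the lower half, \<open>n\<close>
  iterations of the first-split equation yield exp (- s) times the first \<open>n\<close> terms of
  the series of exp (2 s).\<close>

lemma bbm_count_mean:
  assumes "0 \<le> s"
  shows "(\<integral>\<^sup>+\<omega>. ennreal (cmod (bbm \<rho> 0 s \<omega>)) \<partial>bbm_space) = ennreal (exp s)"
proof (rule antisym)
  show "(\<integral>\<^sup>+\<omega>. ennreal (cmod (bbm \<rho> 0 s \<omega>)) \<partial>bbm_space) \<le> ennreal (exp s)"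
    using bbm_moment[of 1 s \<rho> 0] assms by (simp add: powr_const_def)
  interpret P: prob_space bbm_space by (rule prob_space_bbm_space)
  interpret G: prob_space gauss2 by (rule prob_space_gauss2)
  define h where "h s = (\<integral>\<^sup>+\<omega>. ennreal (cmod (bbm \<rho> 0 s \<omega>)) \<partial>bbm_space)" for s
  have h_eq: "h s = ennreal (exp (- s)) + (\<integral>\<^sup>+l. ennreal (exp (- l)) * indicator {0..s} l * (2 * h (s - l)) \<partial>lborel)"
    if "0 \<le> s" for s
  proof -
    have "cmod (exp (disp \<rho> 0 l p) * (bbm \<rho> 0 (s - l) \<omega> + bbm \<rho> 0 (s - l) \<omega>')) = cmod (bbm \<rho> 0 (s - l) \<omega>) + cmod (bbm \<rho> 0 (s - l) \<omega>')" for l p \<omega> \<omega>'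
      unfolding bbm_zero by (simp add: of_nat_add[symmetric] norm_of_nat del: of_nat_add)
    then have "(\<integral>\<^sup>+p. \<integral>\<^sup>+\<omega>. \<integral>\<^sup>+\<omega>'. ennreal (cmod (exp (disp \<rho> 0 l p) * (bbm \<rho> 0 (s - l) \<omega> + bbm \<rho> 0 (s - l) \<omega>'))) \<partial>bbm_space \<partial>bbm_space \<partial>gauss2) = 2 * h (s - l)" for l
      unfolding h_def by (simp add: nn_integral_add P.emeasure_space_1 G.emeasure_space_1 mult_2)
    then show ?thesis unfolding h_def
      using bbm_first_split[OF that, of "\<lambda>x. ennreal (cmod x)" \<rho> 0]
      by (simp add: G.emeasure_space_1)
  qed
  have "ennreal (exp (- s) * (\<Sum>j<n. (2 * s) ^ j / fact j)) \<le> h s" if "0 \<le> s" for s n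
    using that
  proof (induction n arbitrary: s)
    case (Suc n)
    have "ennreal (exp (- s) * (\<Sum>j<n. (2 * s) ^ Suc j / fact (Suc j))) =
       ennreal (exp (- s)) * (\<Sum>j<n. ennreal ((2 * s) ^ Suc j / fact (Suc j)))"
      using Suc.prems by (subst sum_ennreal) (auto simp: ennreal_mult sum_nonneg simp del: power_Suc fact_Suc)
    also have "(\<Sum>j<n. ennreal ((2 * s) ^ Suc j / fact (Suc j))) = (\<Sum>j<n. \<integral>\<^sup>+l. ennreal (2 * ((2 * (s - l)) ^ j / fact j)) * indicator {0..s} l \<partial>lborel)"
      using Suc.prems by (intro sum.cong refl nn_integral_power_Icc[symmetric]) auto
    also have "\<dots> = (\<integral>\<^sup>+l. (\<Sum>j<n. ennreal (2 * ((2 * (s - l)) ^ j / fact j)) * indicator {0..s} l) \<partial>lborel)"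
      by (rule nn_integral_sum[symmetric]) measurable
    also have "ennreal (exp (- s)) * \<dots> = (\<integral>\<^sup>+l. ennreal (exp (- s)) * (\<Sum>j<n. ennreal (2 * ((2 * (s - l)) ^ j / fact j)) * indicator {0..s} l) \<partial>lborel)"
      by (rule nn_integral_cmult[symmetric]) measurable
    also have "\<dots> \<le> (\<integral>\<^sup>+l. ennreal (exp (- l)) * indicator {0..s} l * (2 * h (s - l)) \<partial>lborel)"
    proof (rule nn_integral_mono)
      fix l :: real
      show "ennreal (exp (- s)) * (\<Sum>j<n. ennreal (2 * ((2 * (s - l)) ^ j / fact j)) * indicator {0..s} l) \<le> ennreal (exp (- l)) * indicator {0..s} l * (2 * h (s - l))"
      proof (cases "l \<in> {0..s}")
        case True
        have nn: "0 \<le> (\<Sum>j<n. (2 * (s - l)) ^ j / fact j)" using True by (intro sum_nonneg) auto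
        have "ennreal (exp (- s)) * (\<Sum>j<n. ennreal (2 * ((2 * (s - l)) ^ j / fact j))) = ennreal (exp (- s) * (2 * (\<Sum>j<n. (2 * (s - l)) ^ j / fact j)))"
        proof -
          have "(\<Sum>j<n. ennreal (2 * ((2 * (s - l)) ^ j / fact j))) = ennreal (\<Sum>j<n. 2 * ((2 * (s - l)) ^ j / fact j))"
            using True by (intro sum_ennreal) auto
          also have "\<dots> = ennreal (2 * (\<Sum>j<n. (2 * (s - l)) ^ j / fact j))" by (simp only: sum_distrib_left)
          finally show ?thesis using nn by (simp only: ennreal_mult exp_ge_zero mult_nonneg_nonneg zero_le_numeral)
        qed
        also have "exp (- s) * (2 * (\<Sum>j<n. (2 * (s - l)) ^ j / fact j)) = exp (- l) * (2 * (exp (- (s - l)) * (\<Sum>j<n. (2 * (s - l)) ^ j / fact j)))"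
          by (simp add: mult_exp_exp mult.assoc[symmetric] mult.commute[of _ 2])
        also have "ennreal \<dots> = ennreal (exp (- l)) * (2 * ennreal (exp (- (s - l)) * (\<Sum>j<n. (2 * (s - l)) ^ j / fact j)))"
          using nn by (simp add: ennreal_mult)
        also have "\<dots> \<le> ennreal (exp (- l)) * (2 * h (s - l))"
          using True by (intro mult_left_mono Suc.IH) auto
        finally show ?thesis using True by simp
      qed auto
    qed
    finally have "ennreal (exp (- s)) + ennreal (exp (- s) * (\<Sum>j<n. (2 * s) ^ Suc j / fact (Suc j))) \<le> h s"
      unfolding h_eq[OF Suc.prems] by (rule add_left_mono)
    also have "ennreal (exp (- s)) + ennreal (exp (- s) * (\<Sum>j<n. (2 * s) ^ Suc j / fact (Suc j))) = ennreal (exp (- s) * (\<Sum>j<Suc n. (2 * s) ^ j / fact j))"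
    proof -
      have "0 \<le> (\<Sum>j<n. (2 * s) ^ Suc j / fact (Suc j))" using Suc.prems by (intro sum_nonneg) simp
      then show ?thesis unfolding sum.lessThan_Suc_shift
        by (subst ennreal_plus[symmetric]) (simp_all add: distrib_left del: power_Suc fact_Suc)
    qed
    finally show ?case .
  qed simp
  then have le: "\<And>n. ennreal (exp (- s) * (\<Sum>j<n. (2 * s) ^ j / fact j)) \<le> h s" using assms by blast
  have "(\<lambda>n. \<Sum>j<n. (2 * s) ^ j / fact j) \<longlonglongrightarrow> exp (2 * s)"
    using exp_converges[of "2 * s"] by (simp add: sums_def scaleR_conv_of_real divide_inverse mult.commute)
  then have "(\<lambda>n. ennreal (exp (- s) * (\<Sum>j<n. (2 * s) ^ j / fact j))) \<longlonglongrightarrow> ennreal (exp (- s) * exp (2 * s))"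
    by (intro tendsto_ennrealI tendsto_mult tendsto_const)
  then have "ennreal (exp (- s) * exp (2 * s)) \<le> h s" by (rule LIMSEQ_le_const2) (use le in auto)
  then show "ennreal (exp s) \<le> (\<integral>\<^sup>+\<omega>. ennreal (cmod (bbm \<rho> 0 s \<omega>)) \<partial>bbm_space)"
    by (simp add: mult_exp_exp h_def)
qed

section \<open>The exact mean of the partition function\<close>

lemma integral_prod_PiM:
  fixes N :: "'i \<Rightarrow> 'd measure" and f :: "'i \<Rightarrow> 'd \<Rightarrow> complex"
  assumes N: "\<And>u. prob_space (N u)" and "finite J" and f: "\<And>j. j \<in> J \<Longrightarrow> integrable (N j) (f j)"
  shows "integrable (PiM UNIV N) (\<lambda>\<eta>. \<Prod>j\<in>J. f j (\<eta> j))"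
    "(\<integral>\<eta>. (\<Prod>j\<in>J. f j (\<eta> j)) \<partial>PiM UNIV N) = (\<Prod>j\<in>J. \<integral>x. f j x \<partial>N j)"
proof -
  interpret P: product_prob_space N UNIV using N by (simp add: product_prob_spaceI)
  let ?g = "\<lambda>\<eta>. \<Prod>j\<in>J. f j (\<eta> j)"
  have d: "distr (PiM UNIV N) (PiM J N) (\<lambda>\<eta>. restrict \<eta> J) = PiM J N"
    using assms(2) by (intro P.distr_PiM_restrict_finite) auto
  have m: "(\<lambda>\<eta>. restrict \<eta> J) \<in> PiM UNIV N \<rightarrow>\<^sub>M PiM J N" by (rule measurable_restrict_subset) simp
  have int: "integrable (PiM J N) ?g" using assms(2) f by (rule P.product_integrable_prod)
  have r: "?g (restrict \<eta> J) = ?g \<eta>" for \<eta> by (intro prod.cong) auto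
  have "integrable (PiM UNIV N) (\<lambda>\<eta>. ?g (restrict \<eta> J))"
    using int by (intro integrable_distr[OF m]) (simp only: d)
  then show "integrable (PiM UNIV N) ?g" by (simp only: r)
  have "(\<integral>\<eta>. ?g \<eta> \<partial>PiM UNIV N) = (\<integral>\<eta>. ?g (restrict \<eta> J) \<partial>PiM UNIV N)" by (simp only: r)
  also have "\<dots> = (\<integral>\<eta>. ?g \<eta> \<partial>distr (PiM UNIV N) (PiM J N) (\<lambda>\<eta>. restrict \<eta> J))"
    using borel_measurable_integrable[OF int] by (intro integral_distr[symmetric] m) auto
  also have "\<dots> = (\<integral>\<eta>. ?g \<eta> \<partial>PiM J N)" by (simp only: d)
  also have "\<dots> = (\<Prod>j\<in>J. \<integral>x. f j x \<partial>N j)" using assms(2) f by (rule P.product_integral_prod)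
  finally show "(\<integral>\<eta>. ?g \<eta> \<partial>PiM UNIV N) = (\<Prod>j\<in>J. \<integral>x. f j x \<partial>N j)" .
qed

text \<open>The ages along the ancestral line of \<open>u\<close> add up to \<open>t\<close>, so the
  means of the independent displacement factors multiply to exp (t kap), whatever the shape of the
  tree.\<close>

lemma integral_exp_tree_pos:
  fixes l :: "bool list \<Rightarrow> real"
  assumes rho: "-1 \<le> \<rho>" "\<rho> \<le> 1" and l: "\<And>u. 0 \<le> l u" and u: "tree_birth l u \<le> t"
  shows "integrable (PiM UNIV (\<lambda>_. gauss2)) (\<lambda>p. exp (tree_pos l (\<lambda>u r. disp \<rho> \<beta> r (p u)) u t))"
    "(\<integral>p. exp (tree_pos l (\<lambda>u r. disp \<rho> \<beta> r (p u)) u t) \<partial>PiM UNIV (\<lambda>_. gauss2)) = exp (t * kap \<rho> \<beta>)"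
proof -
  \<comment> \<open>\<open>R k\<close> is the age at which the k-th ancestor is read; k = length u
    is \<open>u\<close> itself, whose age is counted up to \<open>t\<close>.\<close>
  define R where "R k = (if k < length u then l (take k u) else t - tree_birth l u)" for k
  have R0: "0 \<le> R k" for k using l u by (simp add: R_def)
  let ?J = "(\<lambda>k. take k u) ` {..length u}"
  have inj: "inj_on (\<lambda>k. take k u) {..length u}"
    by (rule inj_onI) (metis length_take atMost_iff min.absorb2)
  have eq: "exp (tree_pos l (\<lambda>u r. disp \<rho> \<beta> r (p u)) u t) = (\<Prod>v\<in>?J. exp (disp \<rho> \<beta> (R (length v)) (p v)))" for p :: "bool list \<Rightarrow> real \<times> real"
  proof -
    have "tree_pos l (\<lambda>u r. disp \<rho> \<beta> r (p u)) u t = (\<Sum>k\<le>length u. disp \<rho> \<beta> (R k) (p (take k u)))"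
      unfolding tree_pos_def lessThan_Suc_atMost[symmetric] by (simp add: R_def)
    then show ?thesis
      by (subst prod.reindex[OF inj]) (auto simp: exp_sum min_def intro!: prod.cong)
  qed
  have 1: "finite ?J" by simp
  have 2: "integrable gauss2 (\<lambda>x. exp (disp \<rho> \<beta> (R (length v)) x))" for v :: "bool list"
    by (rule integral_disp(1)[OF R0 rho])
  show "integrable (PiM UNIV (\<lambda>_. gauss2)) (\<lambda>p. exp (tree_pos l (\<lambda>u r. disp \<rho> \<beta> r (p u)) u t))"
    unfolding eq using integral_prod_PiM(1)[of "\<lambda>_. gauss2" ?J "\<lambda>v x. exp (disp \<rho> \<beta> (R (length v)) x)", OF prob_space_gauss2 1 2] .
  have "(\<integral>p. exp (tree_pos l (\<lambda>u r. disp \<rho> \<beta> r (p u)) u t) \<partial>PiM UNIV (\<lambda>_. gauss2)) = (\<Prod>v\<in>?J. \<integral>x. exp (disp \<rho> \<beta> (R (length v)) x) \<partial>gauss2)"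
    unfolding eq using integral_prod_PiM(2)[of "\<lambda>_. gauss2" ?J "\<lambda>v x. exp (disp \<rho> \<beta> (R (length v)) x)", OF prob_space_gauss2 1 2] .
  also have "\<dots> = (\<Prod>v\<in>?J. exp (R (length v) * kap \<rho> \<beta>))"
    by (intro prod.cong refl integral_disp(2)[OF R0 rho])
  also have "\<dots> = (\<Prod>k\<le>length u. exp (R k * kap \<rho> \<beta>))"
    by (subst prod.reindex[OF inj]) (auto simp: min_def intro!: prod.cong)
  also have "\<dots> = exp (complex_of_real (\<Sum>k\<le>length u. R k) * kap \<rho> \<beta>)"
    by (simp add: exp_sum sum_distrib_right)
  also have "(\<Sum>k\<le>length u. R k) = t"
    unfolding lessThan_Suc_atMost[symmetric] by (simp add: R_def tree_birth_def)
  finally show "(\<integral>p. exp (tree_pos l (\<lambda>u r. disp \<rho> \<beta> r (p u)) u t) \<partial>PiM UNIV (\<lambda>_. gauss2)) = exp (t * kap \<rho> \<beta>)" .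
qed

lemma bbm_integrable:
  assumes "0 \<le> t"
  shows "integrable bbm_space (bbm \<rho> \<beta> t)"
proof (rule integrableI_bounded)
  have "(\<integral>\<^sup>+\<omega>. ennreal (norm (bbm \<rho> \<beta> t \<omega>)) \<partial>bbm_space) \<le> ennreal (exp ((2 * powr_const 1 - 1 + 1\<^sup>2 * (Re \<beta>)\<^sup>2 / 2) * t))"
    using bbm_moment[of 1 t \<rho> \<beta>] assms by simp
  then show "(\<integral>\<^sup>+\<omega>. ennreal (norm (bbm \<rho> \<beta> t \<omega>)) \<partial>bbm_space) < \<infinity>"
    by (rule le_less_trans) simp
qed measurable

text \<open>Given the lifetimes, every particle alive at \<open>t\<close> has the same mean, so the
  mean of the sum is exp (t kap) times the expected number of particles. That number is read off
  from the case where \<beta> is 0.\<close>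

lemma bbm_mean:
  assumes rho: "-1 \<le> \<rho>" "\<rho> \<le> 1" and t: "0 \<le> t"
  shows "(\<integral>\<omega>. bbm \<rho> \<beta> t \<omega> \<partial>bbm_space) = exp (t * (1 + kap \<rho> \<beta>))"
proof -
  let ?E = "PiM UNIV (\<lambda>_::bool list. exp1)" and ?G = "PiM UNIV (\<lambda>_::bool list. gauss2)"
  interpret E: prob_space ?E by (intro prob_space_PiM prob_space_exp1)
  interpret G: prob_space ?G by (intro prob_space_PiM prob_space_gauss2)
  interpret EG: pair_prob_space ?E ?G ..
  let ?zip = "\<lambda>x u. (fst x u, snd x u)"
  have zm: "?zip \<in> ?E \<Otimes>\<^sub>M ?G \<rightarrow>\<^sub>M bbm_space"
    unfolding bbm_space_def particle_def by (rule measurable_zip)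
  have d: "bbm_space = distr (?E \<Otimes>\<^sub>M ?G) bbm_space ?zip"
    using PiM_zip[of "\<lambda>_::bool list. exp1" "\<lambda>_. gauss2", OF prob_space_exp1 prob_space_gauss2]
    unfolding bbm_space_def particle_def by (simp add: split_beta')
  have nested: "(\<integral>\<omega>. bbm \<rho> b t \<omega> \<partial>bbm_space) = (\<integral>l. \<integral>p. bbm \<rho> b t (\<lambda>u. (l u, p u)) \<partial>?G \<partial>?E)" for b
  proof -
    have int: "integrable (?E \<Otimes>\<^sub>M ?G) (\<lambda>x. bbm \<rho> b t (?zip x))"
      using bbm_integrable[OF t, of \<rho> b] by (subst (asm) d) (rule integrable_distr[OF zm])
    have "(\<integral>\<omega>. bbm \<rho> b t \<omega> \<partial>bbm_space) = (\<integral>x. bbm \<rho> b t (?zip x) \<partial>(?E \<Otimes>\<^sub>M ?G))"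
      by (subst d, rule integral_distr[OF zm]) measurable
    also have "\<dots> = (\<integral>l. \<integral>p. bbm \<rho> b t (\<lambda>u. (l u, p u)) \<partial>?G \<partial>?E)"
      using EG.integral_fst'[OF int] by simp
    finally show ?thesis .
  qed
  have inner: "(\<integral>p. bbm \<rho> b t (\<lambda>u. (l u, p u)) \<partial>?G) = exp (t * kap \<rho> b) * of_nat (card (tree_alive l t))"
    if "tree_ok l" for b l
  proof -
    have "(\<integral>p. bbm \<rho> b t (\<lambda>u. (l u, p u)) \<partial>?G) = (\<integral>p. (\<Sum>u\<in>tree_alive l t. exp (tree_pos l (\<lambda>u r. disp \<rho> b r (p u)) u t)) \<partial>?G)"
      by (simp add: bbm_def bbm_sum_def tree_sum_def)
    also have "\<dots> = (\<Sum>u\<in>tree_alive l t. \<integral>p. exp (tree_pos l (\<lambda>u r. disp \<rho> b r (p u)) u t) \<partial>?G)"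
      by (rule Bochner_Integration.integral_sum) (auto intro!: integral_exp_tree_pos(1) rho tree_ok_nonneg[OF that] simp: tree_alive_def)
    also have "\<dots> = (\<Sum>u\<in>tree_alive l t. exp (t * kap \<rho> b))"
      by (intro sum.cong refl integral_exp_tree_pos(2)[OF rho tree_ok_nonneg[OF that]]) (auto simp: tree_alive_def)
    finally show ?thesis by (simp add: mult.commute)
  qed
  have outer: "(\<integral>\<omega>. bbm \<rho> b t \<omega> \<partial>bbm_space) = exp (t * kap \<rho> b) * (\<integral>l. of_nat (card (tree_alive l t)) \<partial>?E)" for b
  proof -
    have m: "(\<lambda>l. of_nat (card (tree_alive l t)) :: complex) \<in> borel_measurable ?E"
    proof -
      have "(\<lambda>l. of_nat (card (tree_alive l t))) = (\<lambda>l. tree_sum l (\<lambda>u r. 0) (\<lambda>_. 1) t)"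
        by (simp add: tree_sum_def tree_pos_def)
      then show ?thesis by (simp only:) (rule measurable_tree_sum; measurable)
    qed
    have "(\<integral>\<omega>. bbm \<rho> b t \<omega> \<partial>bbm_space) = (\<integral>l. exp (t * kap \<rho> b) * of_nat (card (tree_alive l t)) \<partial>?E)"
      unfolding nested
    proof (rule integral_cong_AE)
      show "AE l in ?E. (\<integral>p. bbm \<rho> b t (\<lambda>u. (l u, p u)) \<partial>?G) = exp (t * kap \<rho> b) * of_nat (card (tree_alive l t))"
        using AE_PiM_exp1_tree_ok by eventually_elim (rule inner)
      have "(\<lambda>x. bbm \<rho> b t (?zip x)) \<in> borel_measurable (?E \<Otimes>\<^sub>M ?G)" using zm by measurable
      then show "(\<lambda>l. \<integral>p. bbm \<rho> b t (\<lambda>u. (l u, p u)) \<partial>?G) \<in> borel_measurable ?E"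
        by (intro G.borel_measurable_lebesgue_integral) (simp add: split_beta')
    qed (use m in measurable)
    then show ?thesis by simp
  qed
  have "(\<integral>\<omega>. bbm \<rho> 0 t \<omega> \<partial>bbm_space) = (\<integral>\<omega>. complex_of_real (cmod (bbm \<rho> 0 t \<omega>)) \<partial>bbm_space)"
    by (simp add: bbm_zero norm_of_nat)
  also have "\<dots> = complex_of_real (\<integral>\<omega>. cmod (bbm \<rho> 0 t \<omega>) \<partial>bbm_space)" by simp
  also have "(\<integral>\<omega>. cmod (bbm \<rho> 0 t \<omega>) \<partial>bbm_space) = exp t"
    by (subst integral_eq_nn_integral) (auto simp: bbm_count_mean[OF t])
  finally have "(\<integral>l. of_nat (card (tree_alive l t)) \<partial>?E) = complex_of_real (exp t)"
    unfolding outer[of 0] by (simp add: kap_def)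
  then show ?thesis unfolding outer[of \<beta>] by (simp add: distrib_left exp_add exp_of_real mult.commute)
qed

section \<open>Sums with independent marks\<close>

lemma nn_integral_PiM_coordinate:
  fixes K :: "'k measure" and u :: 'i
  assumes K: "prob_space K" and [measurable]: "F \<in> borel_measurable (PiM UNIV (\<lambda>_. K))"
  shows "(\<integral>\<^sup>+\<zeta>. F \<zeta> \<partial>PiM UNIV (\<lambda>_. K)) = (\<integral>\<^sup>+k. \<integral>\<^sup>+\<zeta>. F (\<zeta>(u := k)) \<partial>PiM (UNIV - {u}) (\<lambda>_. K) \<partial>K)"
proof -
  interpret K: prob_space K by (rule K)
  interpret Q: prob_space "PiM (UNIV - {u}) (\<lambda>_. K)" by (intro prob_space_PiM K)
  have i: "insert u (UNIV - {u}) = UNIV" by auto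
  have m: "(\<lambda>(x, X). X(u := x)) \<in> K \<Otimes>\<^sub>M PiM (UNIV - {u}) (\<lambda>_. K) \<rightarrow>\<^sub>M PiM UNIV (\<lambda>_. K)"
    using measurable_compose[OF measurable_pair_swap' measurable_add_dim[of u "UNIV - {u}" "\<lambda>_. K"]] unfolding i
    by (simp add: split_beta' comp_def)
  have d: "distr (K \<Otimes>\<^sub>M PiM (UNIV - {u}) (\<lambda>_. K)) (PiM UNIV (\<lambda>_. K)) (\<lambda>(x, X). X(u := x)) = PiM UNIV (\<lambda>_. K)"
    using distr_pair_PiM_eq_PiM[where i'=u and I="UNIV - {u}" and M="\<lambda>_. K"] K unfolding i by auto
  have "(\<integral>\<^sup>+\<zeta>. F \<zeta> \<partial>PiM UNIV (\<lambda>_. K)) = (\<integral>\<^sup>+x. F ((\<lambda>(x, X). X(u := x)) x) \<partial>(K \<Otimes>\<^sub>M PiM (UNIV - {u}) (\<lambda>_. K)))"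
    by (subst d[symmetric], rule nn_integral_distr[OF m]) measurable
  also have "\<dots> = (\<integral>\<^sup>+k. \<integral>\<^sup>+\<zeta>. F (\<zeta>(u := k)) \<partial>PiM (UNIV - {u}) (\<lambda>_. K) \<partial>K)"
    by (subst Q.nn_integral_fst[symmetric]) (use measurable_compose[OF m assms(2)] in \<open>auto simp: split_beta'\<close>)
  finally show ?thesis .
qed

locale iid_marks = prob_space K for K :: "'k measure" +
  fixes y :: "'k \<Rightarrow> complex"
  assumes y_meas [measurable]: "y \<in> borel_measurable K"
begin

abbreviation "KK \<equiv> PiM UNIV (\<lambda>_::bool list. K)"

lemma prob_space_KK: "prob_space KK"
  by (intro prob_space_PiM prob_space_axioms)

lemma mark_sum_measurable [measurable]: "(\<lambda>\<zeta>. \<Sum>v\<in>A. c v * y (\<zeta> v)) \<in> borel_measurable KK"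
  by measurable

text \<open>Exposes one mark: the remaining sum does not involve coordinate \<open>u\<close>, so
  integrating over the other coordinates or over all of them is the same. Here the new mark is
  integrated last, as the anticoncentration bound requires; the primed version integrates it first,
  which suits the moment computations.\<close>

lemma mark_sum_insert:
  assumes A: "finite A" "u \<notin> A" and [measurable]: "G \<in> borel_measurable borel"
  shows "(\<integral>\<^sup>+\<zeta>. G (w + (\<Sum>v\<in>insert u A. c v * y (\<zeta> v))) \<partial>KK) =
    (\<integral>\<^sup>+k. \<integral>\<^sup>+\<zeta>. G (w + c u * y k + (\<Sum>v\<in>A. c v * y (\<zeta> v))) \<partial>KK \<partial>K)"
proof -
  let ?Q = "PiM (UNIV - {u}) (\<lambda>_::bool list. K)"
  have upd: "(\<Sum>v\<in>A. c v * y ((\<zeta>(u := k)) v)) = (\<Sum>v\<in>A. c v * y (\<zeta> v))" for \<zeta> k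
    using A by (intro sum.cong) auto
  have "(\<integral>\<^sup>+\<zeta>. G (w + (\<Sum>v\<in>insert u A. c v * y (\<zeta> v))) \<partial>KK) =
      (\<integral>\<^sup>+k. \<integral>\<^sup>+\<zeta>. G (w + (\<Sum>v\<in>insert u A. c v * y ((\<zeta>(u := k)) v))) \<partial>?Q \<partial>K)"
    by (rule nn_integral_PiM_coordinate[OF prob_space_axioms]) measurable
  also have "\<dots> = (\<integral>\<^sup>+k. \<integral>\<^sup>+\<zeta>. G (w + c u * y k + (\<Sum>v\<in>A. c v * y (\<zeta> v))) \<partial>?Q \<partial>K)"
    using A upd by (simp add: add.assoc)
  also have "\<dots> = (\<integral>\<^sup>+k. \<integral>\<^sup>+\<zeta>. G (w + c u * y k + (\<Sum>v\<in>A. c v * y (\<zeta> v))) \<partial>KK \<partial>K)"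
  proof (rule nn_integral_cong)
    fix k
    have "(\<integral>\<^sup>+\<zeta>. G (w + c u * y k + (\<Sum>v\<in>A. c v * y (\<zeta> v))) \<partial>KK) =
       (\<integral>\<^sup>+k'. \<integral>\<^sup>+\<zeta>. G (w + c u * y k + (\<Sum>v\<in>A. c v * y ((\<zeta>(u := k')) v))) \<partial>?Q \<partial>K)"
      by (rule nn_integral_PiM_coordinate[OF prob_space_axioms]) measurable
    then show "(\<integral>\<^sup>+\<zeta>. G (w + c u * y k + (\<Sum>v\<in>A. c v * y (\<zeta> v))) \<partial>?Q) = (\<integral>\<^sup>+\<zeta>. G (w + c u * y k + (\<Sum>v\<in>A. c v * y (\<zeta> v))) \<partial>KK)"
      unfolding upd by (simp add: emeasure_space_1)
  qed
  finally show ?thesis .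
qed

lemma mark_sum_insert':
  assumes A: "finite A" "u \<notin> A" and [measurable]: "G \<in> borel_measurable borel"
  shows "(\<integral>\<^sup>+\<zeta>. G (w + (\<Sum>v\<in>insert u A. c v * y (\<zeta> v))) \<partial>KK) =
    (\<integral>\<^sup>+\<zeta>. \<integral>\<^sup>+k. G ((w + (\<Sum>v\<in>A. c v * y (\<zeta> v))) + c u * y k) \<partial>K \<partial>KK)"
proof -
  interpret KK: prob_space KK by (rule prob_space_KK)
  interpret KKK: pair_prob_space KK K ..
  have "(\<integral>\<^sup>+\<zeta>. G (w + (\<Sum>v\<in>insert u A. c v * y (\<zeta> v))) \<partial>KK) =
     (\<integral>\<^sup>+k. \<integral>\<^sup>+\<zeta>. G ((w + (\<Sum>v\<in>A. c v * y (\<zeta> v))) + c u * y k) \<partial>KK \<partial>K)"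
    unfolding mark_sum_insert[OF A assms(3)] by (simp add: add_ac)
  also have "\<dots> = (\<integral>\<^sup>+\<zeta>. \<integral>\<^sup>+k. G ((w + (\<Sum>v\<in>A. c v * y (\<zeta> v))) + c u * y k) \<partial>K \<partial>KK)"
    by (rule KKK.Fubini') measurable
  finally show ?thesis .
qed

end

lemma cmod_add_square:
  "(cmod (w + x))\<^sup>2 = (cmod w)\<^sup>2 + (cmod x)\<^sup>2 + 2 * Re (cnj w * x)"
  unfolding cmod_power2 by (simp add: power2_eq_square algebra_simps)

lemma power4_aux:
  fixes A B C D P S T :: real
  assumes "C = A + B + 4 * D + 2 * P + 4 * S + 4 * T" "D \<le> P" "T \<le> (P + B) / 2"
  shows "C \<le> A + 8 * P + 3 * B + 4 * S"
proof -
  have "4 * T \<le> 2 * P + 2 * B" using assms(3) by simp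
  then show ?thesis using assms(1,2) by simp
qed

text \<open>The term 4 |w|^2 Re (cnj w * x) is kept exactly because it vanishes on average for a
  centred \<open>x\<close>; the other cross terms are estimated by |w|^2 |x|^2 and |x|^4.\<close>

lemma cmod_add_power4_le:
  "(cmod (w + x)) ^ 4 \<le> (cmod w) ^ 4 + 8 * (cmod w)\<^sup>2 * (cmod x)\<^sup>2 + 3 * (cmod x) ^ 4 + 4 * (cmod w)\<^sup>2 * Re (cnj w * x)"
proof -
  define a b r where "a = cmod w" and "b = cmod x" and "r = Re (cnj w * x)"
  have ab: "0 \<le> a" "0 \<le> b" by (auto simp: a_def b_def)
  have r: "\<bar>r\<bar> \<le> a * b" using abs_Re_le_cmod[of "cnj w * x"] by (simp add: r_def a_def b_def norm_mult)
  have R: "r\<^sup>2 \<le> (a * b)\<^sup>2" using r ab by (simp add: abs_le_square_iff[symmetric] abs_mult)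
  have "b\<^sup>2 * r \<le> b\<^sup>2 * ((a\<^sup>2 + b\<^sup>2) / 2)"
  proof (rule mult_left_mono)
    have "r \<le> a * b" using r by simp
    also have "\<dots> \<le> (a\<^sup>2 + b\<^sup>2) / 2" using sum_squares_bound[of a b] by simp
    finally show "r \<le> (a\<^sup>2 + b\<^sup>2) / 2" .
  qed simp
  also have "\<dots> = ((a * b)\<^sup>2 + b ^ 4) / 2"
    by (simp add: power2_eq_square power4_eq_xxxx algebra_simps)
  finally have Q: "b\<^sup>2 * r \<le> ((a * b)\<^sup>2 + b ^ 4) / 2" .
  have "(cmod (w + x)) ^ 4 = ((cmod (w + x))\<^sup>2)\<^sup>2" by simp
  also have "\<dots> = (a\<^sup>2 + b\<^sup>2 + 2 * r)\<^sup>2"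
    unfolding a_def b_def r_def cmod_add_square ..
  also have "\<dots> = a ^ 4 + b ^ 4 + 4 * r\<^sup>2 + 2 * (a * b)\<^sup>2 + 4 * (a\<^sup>2 * r) + 4 * (b\<^sup>2 * r)"
    by (simp add: power2_eq_square power4_eq_xxxx algebra_simps)
  finally have "(cmod (w + x)) ^ 4 \<le> a ^ 4 + 8 * (a * b)\<^sup>2 + 3 * b ^ 4 + 4 * (a\<^sup>2 * r)"
    by (rule power4_aux[OF _ R Q])
  then show ?thesis by (simp add: a_def b_def r_def mult.assoc power_mult_distrib)
qed

locale centered_marks = iid_marks +
  fixes v m4 :: real
  assumes int1: "integrable K y" and mean0: "(\<integral>k. y k \<partial>K) = 0"
    and int2: "integrable K (\<lambda>k. (cmod (y k))\<^sup>2)" and v_def: "v = (\<integral>k. (cmod (y k))\<^sup>2 \<partial>K)"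
    and int4: "integrable K (\<lambda>k. (cmod (y k)) ^ 4)" and m4_def: "m4 = (\<integral>k. (cmod (y k)) ^ 4 \<partial>K)"
begin

lemma v_nonneg: "0 \<le> v" and m4_nonneg: "0 \<le> m4"
  unfolding v_def m4_def by (auto intro!: integral_nonneg)

lemma int_cross: "integrable K (\<lambda>k. Re (cnj w * (c * y k)))" "(\<integral>k. Re (cnj w * (c * y k)) \<partial>K) = 0"
proof -
  have i: "integrable K (\<lambda>k. cnj w * (c * y k))" using int1 by simp
  then show "integrable K (\<lambda>k. Re (cnj w * (c * y k)))" by (rule integrable_bounded_linear[OF bounded_linear_Re])
  have "(\<integral>k. Re (cnj w * (c * y k)) \<partial>K) = Re (\<integral>k. cnj w * (c * y k) \<partial>K)"
    using integral_bounded_linear[OF bounded_linear_Re i] .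
  then show "(\<integral>k. Re (cnj w * (c * y k)) \<partial>K) = 0" using mean0 by simp
qed

lemma single_second_moment: "(\<integral>\<^sup>+k. ennreal ((cmod (w + c * y k))\<^sup>2) \<partial>K) = ennreal ((cmod w)\<^sup>2 + (cmod c)\<^sup>2 * v)"
proof -
  define X where "X = (\<lambda>k. Re (cnj w * (c * y k)))"
  have X: "integrable K X" "(\<integral>k. X k \<partial>K) = 0" unfolding X_def by (rule int_cross)+
  have eq: "(cmod (w + c * y k))\<^sup>2 = (cmod w)\<^sup>2 + (cmod c)\<^sup>2 * (cmod (y k))\<^sup>2 + 2 * X k" for k
    unfolding cmod_add_square X_def by (simp add: norm_mult power_mult_distrib)
  have int: "integrable K (\<lambda>k. (cmod (w + c * y k))\<^sup>2)"
    unfolding eq using int2 X by (intro Bochner_Integration.integrable_add integrable_mult_right integrable_const)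
  have "(\<integral>\<^sup>+k. ennreal ((cmod (w + c * y k))\<^sup>2) \<partial>K) = ennreal (\<integral>k. (cmod (w + c * y k))\<^sup>2 \<partial>K)"
    using int by (intro nn_integral_eq_integral) auto
  also have "(\<integral>k. (cmod (w + c * y k))\<^sup>2 \<partial>K) = (cmod w)\<^sup>2 + (cmod c)\<^sup>2 * v"
    unfolding eq using int2 X
    by (subst Bochner_Integration.integral_add) (auto simp: prob_space v_def)
  finally show ?thesis .
qed

lemma single_fourth_moment:
  "(\<integral>\<^sup>+k. ennreal ((cmod (w + c * y k)) ^ 4) \<partial>K) \<le> ennreal ((cmod w) ^ 4 + 8 * (cmod w)\<^sup>2 * ((cmod c)\<^sup>2 * v) + 3 * ((cmod c) ^ 4 * m4))"
proof -
  define X where "X = (\<lambda>k. Re (cnj w * (c * y k)))"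
  have X: "integrable K X" "(\<integral>k. X k \<partial>K) = 0" unfolding X_def by (rule int_cross)+
  let ?B = "\<lambda>k. ((cmod w) ^ 4 + 8 * (cmod w)\<^sup>2 * ((cmod c)\<^sup>2 * (cmod (y k))\<^sup>2) + 3 * ((cmod c) ^ 4 * (cmod (y k)) ^ 4)) + 4 * (cmod w)\<^sup>2 * X k"
  have le: "(cmod (w + c * y k)) ^ 4 \<le> ?B k" for k
    using cmod_add_power4_le[of w "c * y k"] unfolding X_def by (simp add: norm_mult power_mult_distrib)
  have int: "integrable K ?B"
    using int2 int4 X by (intro Bochner_Integration.integrable_add integrable_mult_right integrable_const)
  have "(\<integral>\<^sup>+k. ennreal ((cmod (w + c * y k)) ^ 4) \<partial>K) \<le> (\<integral>\<^sup>+k. ennreal (?B k) \<partial>K)"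
    by (intro nn_integral_mono ennreal_leI le)
  also have "\<dots> = ennreal (\<integral>k. ?B k \<partial>K)"
    using int by (intro nn_integral_eq_integral AE_I2 order_trans[OF _ le]) auto
  also have "(\<integral>k. ?B k \<partial>K) = (cmod w) ^ 4 + 8 * (cmod w)\<^sup>2 * ((cmod c)\<^sup>2 * v) + 3 * ((cmod c) ^ 4 * m4)"
    using int2 int4 X by (simp add: prob_space v_def m4_def)
  finally show ?thesis .
qed

lemma mark_sum_second_moment:
  assumes "finite A"
  shows "(\<integral>\<^sup>+\<zeta>. ennreal ((cmod (w + (\<Sum>u\<in>A. c u * y (\<zeta> u))))\<^sup>2) \<partial>KK) = ennreal ((cmod w)\<^sup>2 + v * (\<Sum>u\<in>A. (cmod (c u))\<^sup>2))"
  using assms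
proof (induction A)
  case empty
  interpret KK: prob_space KK by (rule prob_space_KK)
  show ?case by (simp add: KK.emeasure_space_1)
next
  case (insert u A)
  interpret KK: prob_space KK by (rule prob_space_KK)
  have "(\<integral>\<^sup>+\<zeta>. ennreal ((cmod (w + (\<Sum>u\<in>insert u A. c u * y (\<zeta> u))))\<^sup>2) \<partial>KK) =
     (\<integral>\<^sup>+\<zeta>. \<integral>\<^sup>+k. ennreal ((cmod ((w + (\<Sum>u\<in>A. c u * y (\<zeta> u))) + c u * y k))\<^sup>2) \<partial>K \<partial>KK)"
    by (rule mark_sum_insert'[OF insert(1,2)]) measurable
  also have "\<dots> = (\<integral>\<^sup>+\<zeta>. ennreal ((cmod (w + (\<Sum>u\<in>A. c u * y (\<zeta> u))))\<^sup>2) + ennreal ((cmod (c u))\<^sup>2 * v) \<partial>KK)"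
    unfolding single_second_moment using v_nonneg by (simp add: ennreal_plus)
  also have "\<dots> = ennreal ((cmod w)\<^sup>2 + v * (\<Sum>u\<in>A. (cmod (c u))\<^sup>2)) + ennreal ((cmod (c u))\<^sup>2 * v)"
    by (subst nn_integral_add) (auto simp: insert.IH KK.emeasure_space_1)
  also have "\<dots> = ennreal ((cmod w)\<^sup>2 + v * (\<Sum>u\<in>insert u A. (cmod (c u))\<^sup>2))"
  proof -
    have "0 \<le> v * (\<Sum>u\<in>A. (cmod (c u))\<^sup>2)" using v_nonneg by (intro mult_nonneg_nonneg sum_nonneg) auto
    then have "0 \<le> (cmod w)\<^sup>2 + v * (\<Sum>u\<in>A. (cmod (c u))\<^sup>2)" by simp
    moreover have "0 \<le> (cmod (c u))\<^sup>2 * v" using v_nonneg by simp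
    ultimately have "ennreal ((cmod w)\<^sup>2 + v * (\<Sum>u\<in>A. (cmod (c u))\<^sup>2)) + ennreal ((cmod (c u))\<^sup>2 * v) =
      ennreal ((cmod w)\<^sup>2 + v * (\<Sum>u\<in>A. (cmod (c u))\<^sup>2) + (cmod (c u))\<^sup>2 * v)" by (rule ennreal_plus[symmetric])
    also have "(cmod w)\<^sup>2 + v * (\<Sum>u\<in>A. (cmod (c u))\<^sup>2) + (cmod (c u))\<^sup>2 * v = (cmod w)\<^sup>2 + v * (\<Sum>u\<in>insert u A. (cmod (c u))\<^sup>2)"
      using insert(1,2) by (simp add: distrib_left mult.commute)
    finally show ?thesis .
  qed
  finally show ?case .
qed

text \<open>In the induction below the squared scale grows by 2 d (W + V) + d^2, where
  \<open>d\<close> belongs to the new coefficient. \<open>C4\<close> dominates the matching factors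
  4 v max 1 v and 3 m4; the 1 covers the empty sum.\<close>

definition "C4 = max 1 (max (4 * v * max 1 v) (3 * m4))"

text \<open>The fourth moment is at most a constant times the square of the second-moment scale,
  uniformly in the coefficients. This uniformity gives the Paley-Zygmund bound a fixed
  probability.\<close>

lemma mark_sum_fourth_moment:
  assumes "finite A"
  shows "(\<integral>\<^sup>+\<zeta>. ennreal ((cmod (w + (\<Sum>u\<in>A. c u * y (\<zeta> u)))) ^ 4) \<partial>KK) \<le> ennreal (C4 * ((cmod w)\<^sup>2 + (\<Sum>u\<in>A. (cmod (c u))\<^sup>2))\<^sup>2)"
  using assms
proof (induction A)
  case empty
  interpret KK: prob_space KK by (rule prob_space_KK)
  have "(cmod w) ^ 4 = 1 * ((cmod w)\<^sup>2)\<^sup>2" by simp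
  also have "\<dots> \<le> C4 * ((cmod w)\<^sup>2)\<^sup>2" by (intro mult_right_mono) (auto simp: C4_def)
  finally have "ennreal ((cmod w) ^ 4) \<le> ennreal (C4 * ((cmod w)\<^sup>2)\<^sup>2)" by (rule ennreal_leI)
  then show ?case by (simp add: KK.emeasure_space_1)
next
  case (insert u A)
  interpret KK: prob_space KK by (rule prob_space_KK)
  define V where "V = (\<Sum>u\<in>A. (cmod (c u))\<^sup>2)"
  define d where "d = (cmod (c u))\<^sup>2"
  define W where "W = (cmod w)\<^sup>2"
  have nn: "0 \<le> V" "0 \<le> d" "0 \<le> W" by (auto simp: V_def d_def W_def sum_nonneg)
  let ?T = "\<lambda>\<zeta>. w + (\<Sum>u\<in>A. c u * y (\<zeta> u))"
  have "(\<integral>\<^sup>+\<zeta>. ennreal ((cmod (w + (\<Sum>u\<in>insert u A. c u * y (\<zeta> u)))) ^ 4) \<partial>KK) =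
     (\<integral>\<^sup>+\<zeta>. \<integral>\<^sup>+k. ennreal ((cmod (?T \<zeta> + c u * y k)) ^ 4) \<partial>K \<partial>KK)"
    by (rule mark_sum_insert'[OF insert(1,2)]) measurable
  also have "\<dots> \<le> (\<integral>\<^sup>+\<zeta>. ennreal ((cmod (?T \<zeta>)) ^ 4 + 8 * (cmod (?T \<zeta>))\<^sup>2 * ((cmod (c u))\<^sup>2 * v) + 3 * ((cmod (c u)) ^ 4 * m4)) \<partial>KK)"
    by (intro nn_integral_mono single_fourth_moment)
  also have "\<dots> = (\<integral>\<^sup>+\<zeta>. ennreal ((cmod (?T \<zeta>)) ^ 4) + ennreal (8 * (d * v)) * ennreal ((cmod (?T \<zeta>))\<^sup>2) + ennreal (3 * (d\<^sup>2 * m4)) \<partial>KK)"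
    using v_nonneg m4_nonneg nn
    by (intro nn_integral_cong) (simp add: d_def ennreal_mult[symmetric] ennreal_plus[symmetric] mult_ac del: ennreal_plus)
  also have "\<dots> = (\<integral>\<^sup>+\<zeta>. ennreal ((cmod (?T \<zeta>)) ^ 4) \<partial>KK) + ennreal (8 * (d * v)) * ennreal (W + v * V) + ennreal (3 * (d\<^sup>2 * m4))"
    by (simp add: nn_integral_add nn_integral_cmult mark_sum_second_moment[OF insert(1)] KK.emeasure_space_1 W_def V_def)
  also have "\<dots> \<le> ennreal (C4 * (W + V)\<^sup>2) + ennreal (8 * (d * v)) * ennreal (W + v * V) + ennreal (3 * (d\<^sup>2 * m4))"
    using insert.IH unfolding W_def V_def by (intro add_right_mono)
  also have "\<dots> = ennreal (C4 * (W + V)\<^sup>2 + 8 * (d * v) * (W + v * V) + 3 * (d\<^sup>2 * m4))"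
    using v_nonneg m4_nonneg nn by (simp add: C4_def ennreal_mult[symmetric] ennreal_plus[symmetric] del: ennreal_plus)
  also have "\<dots> \<le> ennreal (C4 * (W + (d + V))\<^sup>2)"
  proof (rule ennreal_leI)
    have C: "4 * v * max 1 v \<le> C4" "3 * m4 \<le> C4" by (auto simp: C4_def)
    have 1: "W + v * V \<le> max 1 v * (W + V)"
    proof -
      have "1 * W \<le> max 1 v * W" "v * V \<le> max 1 v * V" using nn by (intro mult_right_mono; simp)+
      then show ?thesis by (simp add: distrib_left)
    qed
    have "8 * (d * v) * (W + v * V) \<le> 8 * (d * v) * (max 1 v * (W + V))"
      using 1 nn v_nonneg by (intro mult_left_mono) auto
    also have "\<dots> = (4 * v * max 1 v) * (2 * d * (W + V))" by simp
    also have "\<dots> \<le> C4 * (2 * d * (W + V))" using C nn by (intro mult_right_mono) auto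
    finally have a: "8 * (d * v) * (W + v * V) \<le> C4 * (2 * d * (W + V))" .
    have b: "3 * (d\<^sup>2 * m4) \<le> C4 * d\<^sup>2" using mult_right_mono[OF C(2), of "d\<^sup>2"] by (simp add: mult_ac)
    have "C4 * (W + (d + V))\<^sup>2 = C4 * (W + V)\<^sup>2 + C4 * (2 * d * (W + V)) + C4 * d\<^sup>2"
      by (simp add: power2_eq_square algebra_simps)
    then show "C4 * (W + V)\<^sup>2 + 8 * (d * v) * (W + v * V) + 3 * (d\<^sup>2 * m4) \<le> C4 * (W + (d + V))\<^sup>2"
      using a b by linarith
  qed
  finally show ?case using insert(1,2) by (simp add: W_def V_def d_def)
qed

end

text \<open>In place of the Cauchy-Schwarz inequality a pointwise bound is integrated: on the event
  \<open>Z\<close> is at most L / 2 + Z^2 / (2 L), and off it at most e / 2.\<close>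

lemma (in prob_space) paley_zygmund:
  assumes [measurable]: "Z \<in> borel_measurable M" and Z0: "\<And>\<omega>. 0 \<le> Z \<omega>"
    and e: "(\<integral>\<^sup>+\<omega>. ennreal (Z \<omega>) \<partial>M) = ennreal e" "0 < e"
    and f: "(\<integral>\<^sup>+\<omega>. ennreal ((Z \<omega>)\<^sup>2) \<partial>M) \<le> ennreal f"
  shows "e\<^sup>2 / (4 * f) \<le> prob {\<omega> \<in> space M. e / 2 \<le> Z \<omega>}"
proof (cases "0 < f")
  case True
  let ?A = "{\<omega> \<in> space M. e / 2 \<le> Z \<omega>}"
  \<comment> \<open>Makes the quadratic term contribute f / (2 L) = e / 4, which leaves e / 4 for
    the event.\<close>
  define L where "L = 2 * f / e"
  have L: "0 < L" using True e by (simp add: L_def)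
  have pt: "Z \<omega> \<le> e / 2 + L / 2 * indicator ?A \<omega> + 1 / (2 * L) * (Z \<omega>)\<^sup>2" if "\<omega> \<in> space M" for \<omega>
  proof (cases "\<omega> \<in> ?A")
    case True
    have "0 \<le> (L - Z \<omega>)\<^sup>2" by simp
    then have "2 * L * Z \<omega> \<le> L\<^sup>2 + (Z \<omega>)\<^sup>2" by (simp add: power2_eq_square algebra_simps)
    then have "Z \<omega> \<le> (L\<^sup>2 + (Z \<omega>)\<^sup>2) / (2 * L)" using L by (simp add: pos_le_divide_eq mult.commute)
    also have "\<dots> = L / 2 + 1 / (2 * L) * (Z \<omega>)\<^sup>2" using L by (simp add: field_simps power2_eq_square)
    finally show ?thesis using True e by simp
  next
    case False
    then have "Z \<omega> \<le> e / 2" using that by auto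
    then show ?thesis using False L by (simp add: add_increasing2)
  qed
  have "ennreal e \<le> (\<integral>\<^sup>+\<omega>. ennreal (e / 2) + ennreal (L / 2) * indicator ?A \<omega> + ennreal (1 / (2 * L)) * ennreal ((Z \<omega>)\<^sup>2) \<partial>M)"
    unfolding e(1)[symmetric]
  proof (rule nn_integral_mono)
    fix \<omega> assume "\<omega> \<in> space M"
    then have "ennreal (Z \<omega>) \<le> ennreal (e / 2 + L / 2 * indicator ?A \<omega> + 1 / (2 * L) * (Z \<omega>)\<^sup>2)"
      by (intro ennreal_leI pt)
    also have "\<dots> = ennreal (e / 2) + ennreal (L / 2) * indicator ?A \<omega> + ennreal (1 / (2 * L)) * ennreal ((Z \<omega>)\<^sup>2)"
      using L e by (cases "\<omega> \<in> ?A") (simp_all add: ennreal_mult[symmetric] ennreal_plus[symmetric] del: ennreal_plus)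
    finally show "ennreal (Z \<omega>) \<le> \<dots>" .
  qed
  also have "\<dots> = ennreal (e / 2) + ennreal (L / 2) * emeasure M ?A + ennreal (1 / (2 * L)) * (\<integral>\<^sup>+\<omega>. ennreal ((Z \<omega>)\<^sup>2) \<partial>M)"
    by (simp add: nn_integral_add nn_integral_cmult emeasure_space_1)
  also have "\<dots> \<le> ennreal (e / 2) + ennreal (L / 2) * emeasure M ?A + ennreal (1 / (2 * L)) * ennreal f"
    by (intro add_left_mono mult_left_mono f) simp
  also have "\<dots> = ennreal (e / 2 + L / 2 * prob ?A + 1 / (2 * L) * f)"
    using L e True by (simp add: emeasure_eq_measure ennreal_mult[symmetric] ennreal_plus[symmetric] del: ennreal_plus)
  finally have "e \<le> e / 2 + L / 2 * prob ?A + 1 / (2 * L) * f"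
    using L e True by (subst (asm) ennreal_le_iff) auto
  moreover have "1 / (2 * L) * f = e / 4" using True e by (simp add: L_def field_simps)
  ultimately have "e / 4 \<le> L / 2 * prob ?A" by simp
  then have "e / 4 \<le> f / e * prob ?A" by (simp add: L_def)
  then show ?thesis using True e by (simp add: field_simps power2_eq_square)
next
  case False
  then have "e\<^sup>2 / (4 * f) \<le> 0" by (intro divide_nonneg_nonpos) auto
  also have "0 \<le> prob {\<omega> \<in> space M. e / 2 \<le> Z \<omega>}" by simp
  finally show ?thesis .
qed

section \<open>Moment rates and the upper bound\<close>

definition bbm_pos :: "real \<Rightarrow> (bool list \<Rightarrow> real \<times> (real \<times> real)) \<Rightarrow> bool list \<Rightarrow> real" where
  "bbm_pos s \<eta> u = (\<Sum>k<length u. sqrt (fst (\<eta> (take k u))) * fst (snd (\<eta> (take k u)))) +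
     sqrt (s - tree_birth (\<lambda>u. fst (\<eta> u)) u) * fst (snd (\<eta> u))"

text \<open>The weight with which the subtree of \<open>u\<close> enters the branching decomposition
  at time \<open>s\<close>.\<close>

definition coef :: "real \<Rightarrow> complex \<Rightarrow> real \<Rightarrow> (bool list \<Rightarrow> real \<times> (real \<times> real)) \<Rightarrow> bool list \<Rightarrow> complex" where
  "coef \<rho> \<beta> s \<eta> u = exp (tree_pos (\<lambda>u. fst (\<eta> u)) (\<lambda>u r. disp \<rho> \<beta> r (snd (\<eta> u))) u s)"

abbreviation bbm_alive :: "real \<Rightarrow> (bool list \<Rightarrow> real \<times> (real \<times> real)) \<Rightarrow> bool list set" where
  "bbm_alive s \<eta> \<equiv> tree_alive (\<lambda>u. fst (\<eta> u)) s"

text \<open>The real partition function. Since the modulus of \<open>coef\<close> is exp (Re \<beta>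
  * bbm_pos), it is also the sum of the powers |coef|^p when \<open>\<theta>\<close> is p * Re
  \<beta>.\<close>

definition rsum :: "real \<Rightarrow> real \<Rightarrow> (bool list \<Rightarrow> real \<times> (real \<times> real)) \<Rightarrow> real" where
  "rsum \<theta> s \<eta> = (\<Sum>u\<in>bbm_alive s \<eta>. exp (\<theta> * bbm_pos s \<eta> u))"

lemma bbm_sum_coef: "bbm_sum \<rho> \<beta> s \<eta> y = (\<Sum>u\<in>bbm_alive s \<eta>. coef \<rho> \<beta> s \<eta> u * y u)"
  by (simp add: bbm_sum_def tree_sum_def coef_def)

lemma bbm_coef: "bbm \<rho> \<beta> s \<eta> = (\<Sum>u\<in>bbm_alive s \<eta>. coef \<rho> \<beta> s \<eta> u)"
  by (simp add: bbm_def bbm_sum_coef)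

lemma cmod_coef: "cmod (coef \<rho> \<beta> s \<eta> u) = exp (Re \<beta> * bbm_pos s \<eta> u)"
  by (simp add: coef_def tree_pos_def bbm_pos_def disp_def lin_def algebra_simps sum_distrib_left)

lemma coef_real: "coef \<rho> (complex_of_real \<theta>) s \<eta> u = complex_of_real (exp (\<theta> * bbm_pos s \<eta> u))"
  by (simp add: coef_def tree_pos_def bbm_pos_def disp_def lin_def exp_of_real[symmetric] algebra_simps sum_distrib_left)

lemma rsum_eq: "rsum \<theta> s \<eta> = cmod (bbm \<rho> (complex_of_real \<theta>) s \<eta>)"
proof -
  have "bbm \<rho> (complex_of_real \<theta>) s \<eta> = complex_of_real (rsum \<theta> s \<eta>)"
    by (simp add: bbm_coef coef_real rsum_def)
  moreover have "0 \<le> rsum \<theta> s \<eta>" by (simp add: rsum_def sum_nonneg)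
  ultimately show ?thesis by simp
qed

lemma rsum_nonneg: "0 \<le> rsum \<theta> s \<eta>"
  by (simp add: rsum_def sum_nonneg)

lemma measurable_rsum [measurable]: "rsum \<theta> s \<in> borel_measurable bbm_space"
  unfolding rsum_eq[of _ _ _ 0] by measurable

lemma rsum_mean_le:
  assumes "0 \<le> s"
  shows "(\<integral>\<^sup>+\<eta>. ennreal (rsum \<theta> s \<eta>) \<partial>bbm_space) \<le> ennreal (exp ((1 + \<theta>\<^sup>2 / 2) * s))"
  using bbm_moment[of 1 s 0 "complex_of_real \<theta>"] assms by (simp add: rsum_eq[of _ _ _ 0] powr_const_def)

lemma AE_bbm_tree_ok: "AE \<eta> in bbm_space. tree_ok (\<lambda>u. fst (\<eta> u))"
  unfolding bbm_space_def particle_def by (rule AE_PiM_tree_ok) (rule prob_space_gauss2)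

lemma bbm_integrable_power:
  assumes "0 \<le> t" "0 < n"
  shows "integrable bbm_space (\<lambda>\<omega>. cmod (bbm \<rho> \<beta> t \<omega>) ^ n)"
proof (rule integrableI_bounded)
  have "(\<integral>\<^sup>+\<omega>. ennreal (norm (cmod (bbm \<rho> \<beta> t \<omega>) ^ n)) \<partial>bbm_space) = (\<integral>\<^sup>+\<omega>. ennreal (cmod (bbm \<rho> \<beta> t \<omega>) powr n) \<partial>bbm_space)"
    using assms by (simp add: powr_realpow')
  also have "\<dots> < \<infinity>"
    using bbm_moment[of "real n" t \<rho> \<beta>] assms by (auto intro: le_less_trans)
  finally show "(\<integral>\<^sup>+\<omega>. ennreal (norm (cmod (bbm \<rho> \<beta> t \<omega>) ^ n)) \<partial>bbm_space) < \<infinity>" .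
qed measurable

section \<open>Conditional moments given an initial piece of the tree\<close>

definition rate1 :: "complex \<Rightarrow> real" where
  "rate1 \<beta> = 1 + ((Re \<beta>)\<^sup>2 - (Im \<beta>)\<^sup>2) / 2"

locale bbm_corr =
  fixes \<rho> :: real
  assumes rho: "-1 \<le> \<rho>" "\<rho> \<le> 1"
begin

definition mean :: "complex \<Rightarrow> real \<Rightarrow> complex" where
  "mean \<beta> t = exp (t * (1 + kap \<rho> \<beta>))"

lemma cmod_mean: "cmod (mean \<beta> t) = exp (rate1 \<beta> * t)"
  by (simp add: mean_def kap_def rate1_def algebra_simps)

definition bvar :: "complex \<Rightarrow> real \<Rightarrow> real" where
  "bvar \<beta> t = (\<integral>\<omega>. (cmod (bbm \<rho> \<beta> t \<omega> - mean \<beta> t))\<^sup>2 \<partial>bbm_space)"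

lemma bbm_centered_integrable4:
  assumes "0 \<le> t"
  shows "integrable bbm_space (\<lambda>\<omega>. (cmod (bbm \<rho> \<beta> t \<omega> - mean \<beta> t)) ^ 4)"
proof (rule Bochner_Integration.integrable_bound)
  interpret prob_space bbm_space by (rule prob_space_bbm_space)
  show "integrable bbm_space (\<lambda>\<omega>. 16 * (cmod (bbm \<rho> \<beta> t \<omega>) ^ 4 + cmod (mean \<beta> t) ^ 4))"
    using bbm_integrable_power[OF assms, of 4] by (intro integrable_mult_right Bochner_Integration.integrable_add integrable_const) auto
  show "AE \<omega> in bbm_space. norm (cmod (bbm \<rho> \<beta> t \<omega> - mean \<beta> t) ^ 4) \<le> norm (16 * (cmod (bbm \<rho> \<beta> t \<omega>) ^ 4 + cmod (mean \<beta> t) ^ 4))"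
  proof (rule AE_I2)
    fix \<omega>
    let ?x = "cmod (bbm \<rho> \<beta> t \<omega>)" and ?y = "cmod (mean \<beta> t)"
    have "cmod (bbm \<rho> \<beta> t \<omega> - mean \<beta> t) ^ 4 \<le> (?x + ?y) ^ 4" by (intro power_mono norm_triangle_ineq4) simp
    also have "\<dots> \<le> (2 * max ?x ?y) ^ 4" by (intro power_mono) auto
    also have "\<dots> = 16 * (max ?x ?y) ^ 4" by (simp add: power_mult_distrib)
    also have "\<dots> \<le> 16 * (?x ^ 4 + ?y ^ 4)" by (auto simp: max_def)
    finally show "norm (cmod (bbm \<rho> \<beta> t \<omega> - mean \<beta> t) ^ 4) \<le> norm (16 * (?x ^ 4 + ?y ^ 4))" by simp
  qed
qed measurable

lemma bbm_centered_integrable2: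
  assumes "0 \<le> t"
  shows "integrable bbm_space (\<lambda>\<omega>. (cmod (bbm \<rho> \<beta> t \<omega> - mean \<beta> t))\<^sup>2)"
proof (rule Bochner_Integration.integrable_bound)
  interpret prob_space bbm_space by (rule prob_space_bbm_space)
  show "integrable bbm_space (\<lambda>\<omega>. 1 + (cmod (bbm \<rho> \<beta> t \<omega> - mean \<beta> t)) ^ 4)"
    using bbm_centered_integrable4[OF assms] by (intro Bochner_Integration.integrable_add integrable_const) auto
  have "x\<^sup>2 \<le> 1 + x ^ 4" for x :: real
  proof -
    have "0 \<le> (x\<^sup>2 - 1 / 2)\<^sup>2" by simp
    then show ?thesis by (simp add: power2_eq_square power4_eq_xxxx algebra_simps)
  qed
  then show "AE \<omega> in bbm_space. norm ((cmod (bbm \<rho> \<beta> t \<omega> - mean \<beta> t))\<^sup>2) \<le> norm (1 + (cmod (bbm \<rho> \<beta> t \<omega> - mean \<beta> t)) ^ 4)"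
    by (intro AE_I2) simp
qed measurable

lemma centered_marks_bbm:
  assumes "0 \<le> t"
  shows "centered_marks bbm_space (\<lambda>\<omega>. bbm \<rho> \<beta> t \<omega> - mean \<beta> t) (bvar \<beta> t) (\<integral>\<omega>. (cmod (bbm \<rho> \<beta> t \<omega> - mean \<beta> t)) ^ 4 \<partial>bbm_space)"
proof -
  interpret P: prob_space bbm_space by (rule prob_space_bbm_space)
  have int: "integrable bbm_space (\<lambda>\<omega>. bbm \<rho> \<beta> t \<omega> - mean \<beta> t)"
    using bbm_integrable[OF assms] by simp
  have "(\<integral>\<omega>. bbm \<rho> \<beta> t \<omega> - mean \<beta> t \<partial>bbm_space) = 0"
    using bbm_integrable[OF assms, of \<rho> \<beta>] bbm_mean[OF rho assms, of \<beta>]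
    by (subst Bochner_Integration.integral_diff) (auto simp: mean_def P.prob_space)
  then show ?thesis
    using int bbm_centered_integrable2[OF assms] bbm_centered_integrable4[OF assms]
    by unfold_locales (auto simp: bvar_def)
qed

text \<open>The 7 is 2 * 4 - 1 from \<open>bbm_moment\<close> at exponent 2. The rate is crude, but
  in the iteration over blocks it is paid for one block length only.\<close>

lemma bvar_le:
  assumes "0 \<le> t"
  shows "bvar \<beta> t \<le> 4 * exp ((7 + 2 * (Re \<beta>)\<^sup>2) * t)"
proof -
  interpret P: prob_space bbm_space by (rule prob_space_bbm_space)
  have i: "integrable bbm_space (\<lambda>\<omega>. (cmod (bbm \<rho> \<beta> t \<omega>))\<^sup>2)" by (rule bbm_integrable_power) (use assms in auto)
  have "bvar \<beta> t \<le> (\<integral>\<omega>. 2 * (cmod (bbm \<rho> \<beta> t \<omega>))\<^sup>2 + 2 * (cmod (mean \<beta> t))\<^sup>2 \<partial>bbm_space)"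
    unfolding bvar_def
  proof (rule integral_mono)
    show "integrable bbm_space (\<lambda>\<omega>. 2 * (cmod (bbm \<rho> \<beta> t \<omega>))\<^sup>2 + 2 * (cmod (mean \<beta> t))\<^sup>2)" using i by simp
    fix \<omega>
    let ?x = "cmod (bbm \<rho> \<beta> t \<omega>)" and ?y = "cmod (mean \<beta> t)"
    have "(cmod (bbm \<rho> \<beta> t \<omega> - mean \<beta> t))\<^sup>2 \<le> (?x + ?y)\<^sup>2" by (intro power_mono norm_triangle_ineq4) simp
    also have "\<dots> \<le> 2 * ?x\<^sup>2 + 2 * ?y\<^sup>2" using sum_squares_bound[of ?x ?y] by (simp add: power2_sum)
    finally show "(cmod (bbm \<rho> \<beta> t \<omega> - mean \<beta> t))\<^sup>2 \<le> 2 * ?x\<^sup>2 + 2 * ?y\<^sup>2" .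
  qed (rule bbm_centered_integrable2[OF assms])
  also have "\<dots> = 2 * (\<integral>\<omega>. (cmod (bbm \<rho> \<beta> t \<omega>))\<^sup>2 \<partial>bbm_space) + 2 * (cmod (mean \<beta> t))\<^sup>2"
    using i by (simp add: P.prob_space)
  also have "(\<integral>\<omega>. (cmod (bbm \<rho> \<beta> t \<omega>))\<^sup>2 \<partial>bbm_space) \<le> exp ((7 + 2 * (Re \<beta>)\<^sup>2) * t)"
  proof -
    have "ennreal (\<integral>\<omega>. (cmod (bbm \<rho> \<beta> t \<omega>))\<^sup>2 \<partial>bbm_space) = (\<integral>\<^sup>+\<omega>. ennreal ((cmod (bbm \<rho> \<beta> t \<omega>))\<^sup>2) \<partial>bbm_space)"
      using i by (intro nn_integral_eq_integral[symmetric]) auto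
    also have "\<dots> = (\<integral>\<^sup>+\<omega>. ennreal (cmod (bbm \<rho> \<beta> t \<omega>) powr 2) \<partial>bbm_space)" by simp
    also have "\<dots> \<le> ennreal (exp ((7 + 2 * (Re \<beta>)\<^sup>2) * t))"
      using bbm_moment[of 2 t \<rho> \<beta>] assms by (simp add: powr_const_def)
    finally show ?thesis by simp
  qed
  also have "(cmod (mean \<beta> t))\<^sup>2 \<le> exp ((7 + 2 * (Re \<beta>)\<^sup>2) * t)"
  proof -
    have "2 * rate1 \<beta> \<le> 7 + 2 * (Re \<beta>)\<^sup>2"
      using zero_le_power2[of "Re \<beta>"] zero_le_power2[of "Im \<beta>"] unfolding rate1_def by (simp add: field_simps)
    then have "2 * rate1 \<beta> * t \<le> (7 + 2 * (Re \<beta>)\<^sup>2) * t" using assms by (intro mult_right_mono)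
    then show ?thesis unfolding cmod_mean exp_double[symmetric] by (simp add: mult.assoc)
  qed
  finally show ?thesis by simp
qed

lemma powr_sum_le_sum_powr:
  fixes f :: "'b \<Rightarrow> real"
  assumes "finite A" "\<And>x. x \<in> A \<Longrightarrow> 0 \<le> f x" "0 < r" "r \<le> 1"
  shows "(\<Sum>x\<in>A. f x) powr r \<le> (\<Sum>x\<in>A. f x powr r)"
  using assms(1,2)
proof (induction A)
  case (insert a A)
  have "(\<Sum>x\<in>insert a A. f x) powr r = (f a + (\<Sum>x\<in>A. f x)) powr r" using insert by simp
  also have "\<dots> \<le> powr_const r * (f a powr r + (\<Sum>x\<in>A. f x) powr r)"
    using insert assms by (intro powr_add_le) (auto intro!: sum_nonneg)
  also have "\<dots> \<le> f a powr r + (\<Sum>x\<in>A. f x powr r)" using insert assms by (simp add: powr_const_def)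
  finally show ?case using insert by simp
qed (use assms in simp)

text \<open>A pointwise substitute for Jensen's inequality: integrated with \<open>A\<close> the
  second moment of \<open>x\<close>, it bounds the p-th moment by 2 A^(p/2).\<close>

lemma powr_le_second_moment:
  fixes x A p :: real
  assumes "0 \<le> x" "0 < A" "0 < p" "p \<le> 2"
  shows "x powr p \<le> A powr (p / 2) + A powr (p / 2 - 1) * x\<^sup>2"
proof (cases "x\<^sup>2 \<le> A")
  case True
  have "x powr p = (x\<^sup>2) powr (p / 2)" using assms by (cases "x = 0") (auto simp: powr_powr powr_numeral[symmetric] simp del: powr_numeral)
  also have "\<dots> \<le> A powr (p / 2)" using True assms by (intro powr_mono2) auto
  finally show ?thesis by (simp add: add_increasing2)
next
  case False
  then have "0 < x\<^sup>2" using assms by linarith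
  then have x: "0 < x" using assms by (cases "x = 0") auto
  have "x powr p = (x\<^sup>2) powr (p / 2)" using x by (auto simp: powr_powr powr_numeral[symmetric] simp del: powr_numeral)
  also have "\<dots> = (x\<^sup>2) powr (p / 2 - 1) * (x\<^sup>2) powr 1" by (subst powr_add[symmetric]) simp
  also have "\<dots> \<le> A powr (p / 2 - 1) * x\<^sup>2"
    using False assms x by (intro mult_mono powr_mono2') auto
  finally show ?thesis by (simp add: add_increasing)
qed

text \<open>Given the tree up to \<open>s\<close>, the sum at \<open>s + t\<close> is
  \<open>w\<close>, the mean times the sum at \<open>s\<close>, plus independent centred terms, so
  its second moment is \<open>A\<close>. For \<open>p\<close> at most 2 the power p/2 is
  subadditive, which separates |w|^p from the variance part and turns the latter into a real
  partition function.\<close>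

lemma bbm_conditional_moment:
  assumes p: "0 < p" "p \<le> 2" and t: "0 \<le> t" and ok: "tree_ok (\<lambda>u. fst (\<eta> u))"
  shows "(\<integral>\<^sup>+\<zeta>. ennreal (cmod (bbm_sum \<rho> \<beta> s \<eta> (\<lambda>u. bbm \<rho> \<beta> t (\<zeta> u))) powr p) \<partial>PiM UNIV (\<lambda>_. bbm_space))
    \<le> ennreal (2 * (exp (p * rate1 \<beta> * t) * cmod (bbm \<rho> \<beta> s \<eta>) powr p + bvar \<beta> t powr (p / 2) * rsum (p * Re \<beta>) s \<eta>))"
proof -
  interpret C: centered_marks bbm_space "\<lambda>\<omega>. bbm \<rho> \<beta> t \<omega> - mean \<beta> t" "bvar \<beta> t" "\<integral>\<omega>. (cmod (bbm \<rho> \<beta> t \<omega> - mean \<beta> t)) ^ 4 \<partial>bbm_space"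
    by (rule centered_marks_bbm[OF t])
  interpret KK: prob_space C.KK by (rule C.prob_space_KK)
  let ?A = "bbm_alive s \<eta>" and ?c = "coef \<rho> \<beta> s \<eta>"
  have fin: "finite ?A" by (rule tree_ok_finite_alive[OF ok])
  define w where "w = mean \<beta> t * bbm \<rho> \<beta> s \<eta>"
  define V where "V = (\<Sum>u\<in>?A. (cmod (?c u))\<^sup>2)"
  define A where "A = (cmod w)\<^sup>2 + bvar \<beta> t * V"
  let ?T = "\<lambda>\<zeta>. w + (\<Sum>u\<in>?A. ?c u * (bbm \<rho> \<beta> t (\<zeta> u) - mean \<beta> t))"
  have V0: "0 \<le> V" by (auto simp: V_def sum_nonneg)
  have T: "bbm_sum \<rho> \<beta> s \<eta> (\<lambda>u. bbm \<rho> \<beta> t (\<zeta> u)) = ?T \<zeta>" for \<zeta>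
    unfolding bbm_sum_coef w_def bbm_coef[of \<rho> \<beta> s \<eta>] sum_distrib_left sum.distrib[symmetric]
    by (intro sum.cong) (auto simp: algebra_simps)
  have m2: "(\<integral>\<^sup>+\<zeta>. ennreal ((cmod (?T \<zeta>))\<^sup>2) \<partial>C.KK) = ennreal A"
    unfolding A_def V_def by (rule C.mark_sum_second_moment[OF fin])
  have Tm [measurable]: "?T \<in> borel_measurable C.KK" using C.mark_sum_measurable by measurable
  have A0: "0 \<le> A" unfolding A_def using V0 C.v_nonneg by simp
  have "(\<integral>\<^sup>+\<zeta>. ennreal (cmod (?T \<zeta>) powr p) \<partial>C.KK) \<le> ennreal (2 * A powr (p / 2))"
  proof (cases "A = 0")
    case True
    then have "(\<integral>\<^sup>+\<zeta>. ennreal ((cmod (?T \<zeta>))\<^sup>2) \<partial>C.KK) = 0" using m2 by simp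
    moreover have "(\<lambda>\<zeta>. ennreal ((cmod (?T \<zeta>))\<^sup>2)) \<in> borel_measurable C.KK" by measurable
    ultimately have "AE \<zeta> in C.KK. ennreal ((cmod (?T \<zeta>))\<^sup>2) = 0"
      using nn_integral_0_iff_AE by blast
    then have "AE \<zeta> in C.KK. ennreal (cmod (?T \<zeta>) powr p) = 0" by eventually_elim simp
    then have "(\<integral>\<^sup>+\<zeta>. ennreal (cmod (?T \<zeta>) powr p) \<partial>C.KK) = 0"
      by (subst nn_integral_0_iff_AE) auto
    then show ?thesis by simp
  next
    case False
    then have A: "0 < A" using A0 by simp
    have "(\<integral>\<^sup>+\<zeta>. ennreal (cmod (?T \<zeta>) powr p) \<partial>C.KK) \<le> (\<integral>\<^sup>+\<zeta>. ennreal (A powr (p / 2)) + ennreal (A powr (p / 2 - 1)) * ennreal ((cmod (?T \<zeta>))\<^sup>2) \<partial>C.KK)"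
    proof (rule nn_integral_mono)
      fix \<zeta>
      have "ennreal (cmod (?T \<zeta>) powr p) \<le> ennreal (A powr (p / 2) + A powr (p / 2 - 1) * (cmod (?T \<zeta>))\<^sup>2)"
        by (intro ennreal_leI powr_le_second_moment A p) simp
      then show "ennreal (cmod (?T \<zeta>) powr p) \<le> ennreal (A powr (p / 2)) + ennreal (A powr (p / 2 - 1)) * ennreal ((cmod (?T \<zeta>))\<^sup>2)"
        by (simp add: ennreal_plus ennreal_mult)
    qed
    also have "\<dots> = ennreal (A powr (p / 2)) + ennreal (A powr (p / 2 - 1)) * ennreal A"
      by (simp add: nn_integral_add nn_integral_cmult m2 KK.emeasure_space_1)
    also have "A powr (p / 2 - 1) * A = A powr (p / 2)"
      using A by (simp add: powr_diff)
    then have "ennreal (A powr (p / 2)) + ennreal (A powr (p / 2 - 1)) * ennreal A = ennreal (2 * A powr (p / 2))"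
      using A by (simp add: ennreal_mult[symmetric] ennreal_plus[symmetric] del: ennreal_plus)
    finally show ?thesis .
  qed
  also have "\<dots> \<le> ennreal (2 * (exp (p * rate1 \<beta> * t) * cmod (bbm \<rho> \<beta> s \<eta>) powr p + bvar \<beta> t powr (p / 2) * rsum (p * Re \<beta>) s \<eta>))"
  proof (intro ennreal_leI mult_left_mono)
    have "A powr (p / 2) \<le> powr_const (p / 2) * (((cmod w)\<^sup>2) powr (p / 2) + (bvar \<beta> t * V) powr (p / 2))"
      unfolding A_def using p V0 C.v_nonneg by (intro powr_add_le) auto
    also have "\<dots> = ((cmod w)\<^sup>2) powr (p / 2) + (bvar \<beta> t * V) powr (p / 2)" using p by (simp add: powr_const_def)
    also have "((cmod w)\<^sup>2) powr (p / 2) = cmod w powr p"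
      by (cases "w = 0") (auto simp: powr_powr powr_numeral[symmetric] simp del: powr_numeral)
    also have "cmod w powr p = exp (p * rate1 \<beta> * t) * cmod (bbm \<rho> \<beta> s \<eta>) powr p"
      unfolding w_def norm_mult cmod_mean by (simp add: powr_mult powr_def[of "exp _"] mult_ac)
    also have "(bvar \<beta> t * V) powr (p / 2) = bvar \<beta> t powr (p / 2) * V powr (p / 2)"
      using V0 C.v_nonneg by (simp add: powr_mult)
    also have "V powr (p / 2) \<le> (\<Sum>u\<in>?A. ((cmod (?c u))\<^sup>2) powr (p / 2))"
      unfolding V_def using fin p by (intro powr_sum_le_sum_powr) auto
    also have "(\<Sum>u\<in>?A. ((cmod (?c u))\<^sup>2) powr (p / 2)) = rsum (p * Re \<beta>) s \<eta>"
      unfolding rsum_def cmod_coef by (intro sum.cong refl) (simp add: powr_def power2_eq_square ln_mult mult_ac)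
    finally show "A powr (p / 2) \<le> exp (p * rate1 \<beta> * t) * cmod (bbm \<rho> \<beta> s \<eta>) powr p + bvar \<beta> t powr (p / 2) * rsum (p * Re \<beta>) s \<eta>"
      by (simp add: mult_left_mono)
  qed simp
  finally show ?thesis unfolding T .
qed


section \<open>Growth rates of p-th moments\<close>

definition pmom :: "real \<Rightarrow> complex \<Rightarrow> real \<Rightarrow> ennreal" where
  "pmom p \<beta> t = (\<integral>\<^sup>+\<omega>. ennreal (cmod (bbm \<rho> \<beta> t \<omega>) powr p) \<partial>bbm_space)"

lemma pmom_step:
  assumes p: "0 < p" "p \<le> 2" and s: "0 \<le> s" and t: "0 \<le> t"
  shows "pmom p \<beta> (s + t) \<le> ennreal (2 * exp (p * rate1 \<beta> * t)) * pmom p \<beta> s +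
    ennreal (8 * exp ((7 + 2 * (Re \<beta>)\<^sup>2) * t) * exp ((1 + p\<^sup>2 * (Re \<beta>)\<^sup>2 / 2) * s))"
proof -
  let ?D = "7 + 2 * (Re \<beta>)\<^sup>2"
  have v0: "0 \<le> bvar \<beta> t" unfolding bvar_def by (rule Bochner_Integration.integral_nonneg) simp
  \<comment> \<open>The bound 4 exp (D t) is at least 1, so the exponent p/2 may be raised to 1, and
    the constant no longer depends on \<open>p\<close>.\<close>
  have v: "bvar \<beta> t powr (p / 2) \<le> 4 * exp (?D * t)"
  proof -
    have 1: "1 \<le> 4 * exp (?D * t)"
    proof -
      have "1 \<le> exp (?D * t)" using t by simp
      then show ?thesis by linarith
    qed
    have "bvar \<beta> t powr (p / 2) \<le> (4 * exp (?D * t)) powr (p / 2)"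
      using v0 p bvar_le[OF t] by (intro powr_mono2) auto
    also have "\<dots> \<le> (4 * exp (?D * t)) powr 1" using 1 p by (intro powr_mono) auto
    also have "\<dots> = 4 * exp (?D * t)" by simp
    finally show ?thesis .
  qed
  have "pmom p \<beta> (s + t) = (\<integral>\<^sup>+\<eta>. \<integral>\<^sup>+\<zeta>. ennreal (cmod (bbm_sum \<rho> \<beta> s \<eta> (\<lambda>u. bbm \<rho> \<beta> t (\<zeta> u))) powr p) \<partial>PiM UNIV (\<lambda>_. bbm_space) \<partial>bbm_space)"
    unfolding pmom_def by (rule bbm_branching[OF s t]) measurable
  also have "\<dots> \<le> (\<integral>\<^sup>+\<eta>. ennreal (2 * exp (p * rate1 \<beta> * t)) * ennreal (cmod (bbm \<rho> \<beta> s \<eta>) powr p) + ennreal (8 * exp (?D * t)) * ennreal (rsum (p * Re \<beta>) s \<eta>) \<partial>bbm_space)"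
  proof (rule nn_integral_mono_AE)
    show "AE \<eta> in bbm_space. (\<integral>\<^sup>+\<zeta>. ennreal (cmod (bbm_sum \<rho> \<beta> s \<eta> (\<lambda>u. bbm \<rho> \<beta> t (\<zeta> u))) powr p) \<partial>PiM UNIV (\<lambda>_. bbm_space))
       \<le> ennreal (2 * exp (p * rate1 \<beta> * t)) * ennreal (cmod (bbm \<rho> \<beta> s \<eta>) powr p) + ennreal (8 * exp (?D * t)) * ennreal (rsum (p * Re \<beta>) s \<eta>)"
      using AE_bbm_tree_ok
    proof eventually_elim
      case (elim \<eta>)
      note bbm_conditional_moment[OF p t elim, of \<beta> s]
      also have "ennreal (2 * (exp (p * rate1 \<beta> * t) * cmod (bbm \<rho> \<beta> s \<eta>) powr p + bvar \<beta> t powr (p / 2) * rsum (p * Re \<beta>) s \<eta>))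
        \<le> ennreal (2 * exp (p * rate1 \<beta> * t) * cmod (bbm \<rho> \<beta> s \<eta>) powr p + 8 * exp (?D * t) * rsum (p * Re \<beta>) s \<eta>)"
      proof (rule ennreal_leI)
        have "bvar \<beta> t powr (p / 2) * rsum (p * Re \<beta>) s \<eta> \<le> 4 * exp (?D * t) * rsum (p * Re \<beta>) s \<eta>"
          by (intro mult_right_mono v rsum_nonneg)
        then show "2 * (exp (p * rate1 \<beta> * t) * cmod (bbm \<rho> \<beta> s \<eta>) powr p + bvar \<beta> t powr (p / 2) * rsum (p * Re \<beta>) s \<eta>)
          \<le> 2 * exp (p * rate1 \<beta> * t) * cmod (bbm \<rho> \<beta> s \<eta>) powr p + 8 * exp (?D * t) * rsum (p * Re \<beta>) s \<eta>"
          by (simp add: mult_ac)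
      qed
      also have "\<dots> = ennreal (2 * exp (p * rate1 \<beta> * t)) * ennreal (cmod (bbm \<rho> \<beta> s \<eta>) powr p) + ennreal (8 * exp (?D * t)) * ennreal (rsum (p * Re \<beta>) s \<eta>)"
        using rsum_nonneg[of "p * Re \<beta>" s \<eta>] by (simp add: ennreal_plus ennreal_mult)
      finally show ?case .
    qed
  qed
  also have "\<dots> = ennreal (2 * exp (p * rate1 \<beta> * t)) * pmom p \<beta> s + ennreal (8 * exp (?D * t)) * (\<integral>\<^sup>+\<eta>. ennreal (rsum (p * Re \<beta>) s \<eta>) \<partial>bbm_space)"
    unfolding pmom_def by (simp add: nn_integral_add nn_integral_cmult)
  also have "\<dots> \<le> ennreal (2 * exp (p * rate1 \<beta> * t)) * pmom p \<beta> s + ennreal (8 * exp (?D * t)) * ennreal (exp ((1 + p\<^sup>2 * (Re \<beta>)\<^sup>2 / 2) * s))"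
    using rsum_mean_le[OF s, of "p * Re \<beta>"] by (intro add_left_mono mult_left_mono) (auto simp: power_mult_distrib)
  finally show ?thesis by (simp add: ennreal_mult)
qed

text \<open>Each block multiplies the old bound by 2 exp (p F r) and adds a term with constant 8;
  both are absorbed in a factor 10. The crude factor exp (D r) does not accumulate, since the added
  term carries it once and the old bound already contains it.\<close>

lemma pmom_blocks:
  assumes p: "0 < p" "p \<le> 2" and r: "0 \<le> r"
    and F1: "p * rate1 \<beta> \<le> p * F" and F2: "1 + p\<^sup>2 * (Re \<beta>)\<^sup>2 / 2 \<le> p * F"
  shows "pmom p \<beta> (real j * r) \<le> ennreal (10 ^ j * exp ((7 + 2 * (Re \<beta>)\<^sup>2) * r) * exp (p * F * (real j * r)))"
proof (induction j)
  case 0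
  have "pmom p \<beta> 0 \<le> ennreal 1" using bbm_moment[OF p(1), of 0 \<rho> \<beta>] by (simp add: pmom_def)
  also have "\<dots> \<le> ennreal (exp ((7 + 2 * (Re \<beta>)\<^sup>2) * r))" using r by (intro ennreal_leI) simp
  finally show ?case by simp
next
  case (Suc j)
  let ?D = "exp ((7 + 2 * (Re \<beta>)\<^sup>2) * r)" and ?E = "\<lambda>x. exp (p * F * x)"
  have pF: "0 \<le> p * F" using F2 by (rule order_trans[rotated]) simp
  have "pmom p \<beta> (real (Suc j) * r) = pmom p \<beta> (real j * r + r)" by (simp add: distrib_right add.commute)
  also have "\<dots> \<le> ennreal (2 * exp (p * rate1 \<beta> * r)) * pmom p \<beta> (real j * r) +
    ennreal (8 * ?D * exp ((1 + p\<^sup>2 * (Re \<beta>)\<^sup>2 / 2) * (real j * r)))"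
    using r by (intro pmom_step p) auto
  also have "\<dots> \<le> ennreal (2 * ?E r) * ennreal (10 ^ j * ?D * ?E (real j * r)) + ennreal (8 * ?D * ?E (real j * r))"
    using r F1 F2 by (intro add_mono mult_mono Suc.IH ennreal_leI mult_left_mono) (auto intro!: mult_right_mono)
  also have "\<dots> = ennreal (2 * ?E r * (10 ^ j * ?D * ?E (real j * r)) + 8 * ?D * ?E (real j * r))"
    by (simp add: ennreal_mult[symmetric] ennreal_plus[symmetric] del: ennreal_plus)
  also have "\<dots> \<le> ennreal (10 ^ Suc j * ?D * ?E (real (Suc j) * r))"
  proof (rule ennreal_leI)
    have e: "?E (real (Suc j) * r) = ?E r * ?E (real j * r)" by (simp add: mult_exp_exp algebra_simps)
    have "1 \<le> (10::real) ^ j" by simp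
    moreover have "1 \<le> ?E r" using pF r by simp
    ultimately have "1 * 1 \<le> 10 ^ j * ?E r" by (intro mult_mono) auto
    then have "8 * ?D * ?E (real j * r) * 1 \<le> 8 * ?D * ?E (real j * r) * (10 ^ j * ?E r)"
      by (intro mult_left_mono) auto
    then show "2 * ?E r * (10 ^ j * ?D * ?E (real j * r)) + 8 * ?D * ?E (real j * r) \<le> 10 ^ Suc j * ?D * ?E (real (Suc j) * r)"
      unfolding e by (simp add: algebra_simps)
  qed
  finally show ?case .
qed

text \<open>The number \<open>K\<close> of blocks is fixed while their length t / K grows. Then 10^K
  is negligible, and the crude rate D costs only D / K, at most \<epsilon> / 2.\<close>

lemma pmom_rate:
  assumes p: "0 < p" "p \<le> 2"
    and F1: "p * rate1 \<beta> \<le> p * F" and F2: "1 + p\<^sup>2 * (Re \<beta>)\<^sup>2 / 2 \<le> p * F" and \<epsilon>: "0 < \<epsilon>"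
  shows "eventually (\<lambda>t. pmom p \<beta> t \<le> ennreal (exp ((p * F + \<epsilon>) * t))) at_top"
proof -
  let ?D = "7 + 2 * (Re \<beta>)\<^sup>2"
  obtain K :: nat where K: "2 * ?D / \<epsilon> < K" using reals_Archimedean2 by blast
  have D: "0 < ?D" using zero_le_power2[of "Re \<beta>"] by linarith
  have K0: "0 < real K" using K D \<epsilon> by (smt (verit) divide_pos_pos)
  have KD: "?D / K \<le> \<epsilon> / 2" using K K0 \<epsilon> by (simp add: field_simps)
  show ?thesis
    using eventually_ge_at_top[of "max 0 (real K * ln 10 * 2 / \<epsilon>)"]
  proof eventually_elim
    case (elim t)
    then have t: "0 \<le> t" "real K * ln 10 * 2 / \<epsilon> \<le> t" by auto
    have "pmom p \<beta> t = pmom p \<beta> (real K * (t / K))" using K0 by simp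
    also have "\<dots> \<le> ennreal (10 ^ K * exp (?D * (t / K)) * exp (p * F * (real K * (t / K))))"
      using t K0 by (intro pmom_blocks p F1 F2) auto
    also have "\<dots> \<le> ennreal (exp (\<epsilon> / 2 * t) * exp (\<epsilon> / 2 * t) * exp (p * F * t))"
    proof (intro ennreal_leI mult_mono)
      have "(10::real) ^ K = exp (real K * ln 10)" by (simp add: exp_of_nat_mult)
      also have "real K * ln 10 \<le> \<epsilon> / 2 * t" using t(2) \<epsilon> by (simp add: field_simps)
      finally show "10 ^ K \<le> exp (\<epsilon> / 2 * t)" by simp
      have "?D * (t / K) = ?D / K * t" by simp
      also have "\<dots> \<le> \<epsilon> / 2 * t" using KD t by (intro mult_right_mono)
      finally show "exp (?D * (t / K)) \<le> exp (\<epsilon> / 2 * t)" by simp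
    qed (use K0 in auto)
    also have "exp (\<epsilon> / 2 * t) * exp (\<epsilon> / 2 * t) * exp (p * F * t) = exp ((p * F + \<epsilon>) * t)"
      by (simp add: mult_exp_exp algebra_simps)
    finally show ?case .
  qed
qed

section \<open>Tail probabilities from moments\<close>

definition psmall :: "complex \<Rightarrow> real \<Rightarrow> real \<Rightarrow> real" where
  "psmall \<beta> t r = measure bbm_space {\<omega> \<in> space bbm_space. cmod (bbm \<rho> \<beta> t \<omega>) \<le> r}"

definition plarge :: "complex \<Rightarrow> real \<Rightarrow> real \<Rightarrow> real" where
  "plarge \<beta> t r = measure bbm_space {\<omega> \<in> space bbm_space. r \<le> cmod (bbm \<rho> \<beta> t \<omega>)}"

lemma plarge_markov:
  assumes "0 < p" "0 < r" "pmom p \<beta> t \<le> ennreal m" "0 \<le> m"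
  shows "plarge \<beta> t r \<le> m / r powr p"
proof -
  interpret P: prob_space bbm_space by (rule prob_space_bbm_space)
  let ?S = "{\<omega> \<in> space bbm_space. r \<le> cmod (bbm \<rho> \<beta> t \<omega>)}"
  have "ennreal (r powr p) * emeasure bbm_space ?S = (\<integral>\<^sup>+\<omega>. ennreal (r powr p) * indicator ?S \<omega> \<partial>bbm_space)"
    by (subst nn_integral_cmult) auto
  also have "\<dots> \<le> pmom p \<beta> t" unfolding pmom_def
    using assms by (intro nn_integral_mono) (auto simp: indicator_def intro!: ennreal_leI powr_mono2)
  also have "\<dots> \<le> ennreal m" by fact
  finally have "ennreal (r powr p * measure bbm_space ?S) \<le> ennreal m"
    by (simp add: P.emeasure_eq_measure ennreal_mult)
  then have "r powr p * measure bbm_space ?S \<le> m" using assms by (simp add: ennreal_le_iff)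
  then show ?thesis using assms by (simp add: plarge_def field_simps)
qed

lemma upper_of_pmom:
  assumes p: "0 < p" and F: "\<And>\<epsilon>. 0 < \<epsilon> \<Longrightarrow> eventually (\<lambda>t. pmom p \<beta> t \<le> ennreal (exp ((p * F + \<epsilon>) * t))) at_top"
    and \<epsilon>: "0 < \<epsilon>"
  shows "((\<lambda>t. plarge \<beta> t (exp ((F + \<epsilon>) * t))) \<longlongrightarrow> 0) at_top"
proof (rule tendsto_sandwich)
  show "eventually (\<lambda>t. 0 \<le> plarge \<beta> t (exp ((F + \<epsilon>) * t))) at_top" by (simp add: plarge_def)
  have "0 < p * \<epsilon> / 2" using p \<epsilon> by simp
  from F[OF this] show "eventually (\<lambda>t. plarge \<beta> t (exp ((F + \<epsilon>) * t)) \<le> exp (- (p * \<epsilon> / 2) * t)) at_top"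
  proof eventually_elim
    case (elim t)
    have "plarge \<beta> t (exp ((F + \<epsilon>) * t)) \<le> exp ((p * F + p * \<epsilon> / 2) * t) / exp ((F + \<epsilon>) * t) powr p"
      by (rule plarge_markov[OF p _ elim]) auto
    also have "\<dots> = exp ((p * F + p * \<epsilon> / 2) * t - p * ((F + \<epsilon>) * t))" by (simp add: powr_def exp_diff)
    also have "(p * F + p * \<epsilon> / 2) * t - p * ((F + \<epsilon>) * t) = - (p * \<epsilon> / 2) * t" by (simp add: field_simps)
    finally show ?case .
  qed
  have "filterlim (\<lambda>t::real. - (p * \<epsilon> / 2) * t) at_bot at_top"
    using p \<epsilon> by (intro filterlim_tendsto_neg_mult_at_bot[OF tendsto_const] filterlim_ident) auto
  then show "((\<lambda>t. exp (- (p * \<epsilon> / 2) * t)) \<longlongrightarrow> 0) at_top" by (rule filterlim_compose[OF exp_at_bot])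
qed (rule tendsto_const)

definition lower_prob :: "complex \<Rightarrow> real \<Rightarrow> bool" where
  "lower_prob \<beta> F \<longleftrightarrow> (\<forall>\<epsilon>>0. \<forall>\<delta>>0. eventually (\<lambda>t. exp (- \<delta> * t) \<le> plarge \<beta> t (exp ((F - \<epsilon>) * t))) at_top)"

lemma plarge_mono: "r' \<le> r \<Longrightarrow> plarge \<beta> t r \<le> plarge \<beta> t r'"
proof -
  assume "r' \<le> r"
  interpret P: prob_space bbm_space by (rule prob_space_bbm_space)
  show ?thesis unfolding plarge_def using \<open>r' \<le> r\<close> by (intro P.finite_measure_mono) auto
qed

text \<open>A truncated first moment. Values above \<open>L\<close> contribute little to the mean,
  because some moment with p > 1 grows no faster than the p-th power of the mean; values below half
  the mean contribute at most half of it. The rest must come from the event, where the modulus is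
  capped by \<open>L\<close>.\<close>

lemma plarge_half_mean:
  assumes p: "1 < p" "p \<le> 2" and F2: "1 + p\<^sup>2 * (Re \<beta>)\<^sup>2 / 2 \<le> p * rate1 \<beta>" and \<delta>: "0 < \<delta>"
  shows "eventually (\<lambda>t. exp (- \<delta> * t) \<le> plarge \<beta> t (exp (rate1 \<beta> * t) / 2)) at_top"
proof -
  define e where "e = \<delta> / 2"
  \<comment> \<open>Chosen so that the part above \<open>L\<close> has exponent (1 - p) (rate1 + e)
    + p rate1 + \<epsilon> = rate1 - \<epsilon>.\<close>
  define \<epsilon> where "\<epsilon> = (p - 1) * e / 2"
  have pos: "0 < e" "0 < \<epsilon>" using p \<delta> by (auto simp: e_def \<epsilon>_def)
  let ?f = "rate1 \<beta>"
  have ev: "eventually (\<lambda>t. pmom p \<beta> t \<le> ennreal (exp ((p * ?f + \<epsilon>) * t))) at_top"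
    using p F2 pos by (intro pmom_rate) auto
  show ?thesis
    using ev eventually_ge_at_top[of "max 0 (max (ln 4 / \<epsilon>) (ln 4 / e))"]
  proof eventually_elim
    case (elim t)
    interpret P: prob_space bbm_space by (rule prob_space_bbm_space)
    have t: "0 \<le> t" "ln 4 \<le> \<epsilon> * t" "ln 4 \<le> e * t" using elim(2) pos by (auto simp: field_simps)
    let ?x = "\<lambda>\<omega>. cmod (bbm \<rho> \<beta> t \<omega>)" and ?r = "exp (?f * t) / 2"
    let ?S = "{\<omega> \<in> space bbm_space. ?r \<le> ?x \<omega>}"
    define L where "L = exp ((?f + e) * t)"
    have L: "0 < L" by (simp add: L_def)
    have pt: "?x \<omega> \<le> ?r + L * indicator ?S \<omega> + L powr (1 - p) * ?x \<omega> powr p" if "\<omega> \<in> space bbm_space" for \<omega>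
    proof (cases "\<omega> \<in> ?S")
      case False
      then have "?x \<omega> \<le> ?r" using that by auto
      then show ?thesis using L by (simp add: add_increasing2)
    next
      case True
      show ?thesis
      proof (cases "?x \<omega> \<le> L")
        case True
        then show ?thesis using \<open>\<omega> \<in> ?S\<close> by (simp add: add_increasing add_increasing2)
      next
        case False
        then have x: "L \<le> ?x \<omega>" by simp
        have "?x \<omega> = ?x \<omega> powr (1 - p) * ?x \<omega> powr p" using x L by (subst powr_add[symmetric]) auto
        also have "\<dots> \<le> L powr (1 - p) * ?x \<omega> powr p" using x L p by (intro mult_right_mono powr_mono2') auto
        finally show ?thesis using L by (simp add: add_increasing)
      qed
    qed
    have "exp (?f * t) = cmod (\<integral>\<omega>. bbm \<rho> \<beta> t \<omega> \<partial>bbm_space)"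
      unfolding bbm_mean[OF rho t(1)] mean_def[symmetric] cmod_mean ..
    also have "\<dots> \<le> (\<integral>\<omega>. ?x \<omega> \<partial>bbm_space)" by (rule integral_norm_bound)
    finally have "ennreal (exp (?f * t)) \<le> ennreal (\<integral>\<omega>. ?x \<omega> \<partial>bbm_space)" by (rule ennreal_leI)
    also have "\<dots> = (\<integral>\<^sup>+\<omega>. ennreal (?x \<omega>) \<partial>bbm_space)"
      using bbm_integrable[OF t(1)] by (intro nn_integral_eq_integral[symmetric]) auto
    also have "\<dots> \<le> (\<integral>\<^sup>+\<omega>. ennreal ?r + ennreal L * indicator ?S \<omega> + ennreal (L powr (1 - p)) * ennreal (?x \<omega> powr p) \<partial>bbm_space)"
    proof (rule nn_integral_mono)
      fix \<omega> assume "\<omega> \<in> space bbm_space"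
      then have "ennreal (?x \<omega>) \<le> ennreal (?r + L * indicator ?S \<omega> + L powr (1 - p) * ?x \<omega> powr p)" by (intro ennreal_leI pt)
      also have "\<dots> = ennreal ?r + ennreal L * indicator ?S \<omega> + ennreal (L powr (1 - p)) * ennreal (?x \<omega> powr p)"
        using L by (cases "\<omega> \<in> ?S") (simp_all add: ennreal_mult[symmetric] ennreal_plus[symmetric] del: ennreal_plus)
      finally show "ennreal (?x \<omega>) \<le> \<dots>" .
    qed
    also have "\<dots> = ennreal ?r + ennreal L * emeasure bbm_space ?S + ennreal (L powr (1 - p)) * pmom p \<beta> t"
      unfolding pmom_def by (simp add: nn_integral_add nn_integral_cmult P.emeasure_space_1)
    also have "\<dots> \<le> ennreal ?r + ennreal L * emeasure bbm_space ?S + ennreal (L powr (1 - p)) * ennreal (exp ((p * ?f + \<epsilon>) * t))"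
      by (intro add_left_mono mult_left_mono elim(1)) simp
    also have "\<dots> = ennreal (?r + L * plarge \<beta> t ?r + L powr (1 - p) * exp ((p * ?f + \<epsilon>) * t))"
      using L by (simp add: P.emeasure_eq_measure plarge_def ennreal_mult[symmetric] ennreal_plus[symmetric] del: ennreal_plus)
    finally have main: "exp (?f * t) \<le> ?r + L * plarge \<beta> t ?r + L powr (1 - p) * exp ((p * ?f + \<epsilon>) * t)"
      using L by (subst (asm) ennreal_le_iff) (auto simp: plarge_def)
    have "L powr (1 - p) * exp ((p * ?f + \<epsilon>) * t) = exp ((1 - p) * ((?f + e) * t) + (p * ?f + \<epsilon>) * t)"
      by (simp add: L_def powr_def mult_exp_exp)
    also have "(1 - p) * ((?f + e) * t) + (p * ?f + \<epsilon>) * t = ?f * t - \<epsilon> * t"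
      by (simp add: \<epsilon>_def field_simps)
    also have "exp (?f * t - \<epsilon> * t) \<le> exp (?f * t - ln 4)" using t by simp
    also have "\<dots> = exp (?f * t) / 4" by (simp add: exp_diff)
    finally have "exp (?f * t) / 4 \<le> L * plarge \<beta> t ?r" using main by simp
    then have "exp (?f * t) / 4 / L \<le> plarge \<beta> t ?r" using L by (simp add: field_simps)
    moreover have "exp (- \<delta> * t) \<le> exp (?f * t) / 4 / L"
    proof -
      have "exp (- \<delta> * t) = exp (- (e * t)) * exp (- (e * t))" by (simp add: mult_exp_exp e_def)
      also have "\<dots> \<le> exp (- ln 4) * exp (- (e * t))" using t by (intro mult_right_mono) auto
      also have "\<dots> = exp (?f * t) / 4 / L" by (simp add: L_def exp_minus distrib_right exp_add field_simps)
      finally show ?thesis .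
    qed
    ultimately show ?case by linarith
  qed
qed

lemma lower_prob_rate1:
  assumes p: "1 < p" "p \<le> 2" and F2: "1 + p\<^sup>2 * (Re \<beta>)\<^sup>2 / 2 \<le> p * rate1 \<beta>"
  shows "lower_prob \<beta> (rate1 \<beta>)"
  unfolding lower_prob_def
proof (intro allI impI)
  fix \<epsilon> \<delta> :: real assume pos: "0 < \<epsilon>" "0 < \<delta>"
  show "eventually (\<lambda>t. exp (- \<delta> * t) \<le> plarge \<beta> t (exp ((rate1 \<beta> - \<epsilon>) * t))) at_top"
    using plarge_half_mean[OF p F2 pos(2)] eventually_ge_at_top[of "ln 2 / \<epsilon>"]
  proof eventually_elim
    case (elim t)
    have "exp ((rate1 \<beta> - \<epsilon>) * t) = exp (rate1 \<beta> * t) * exp (- (\<epsilon> * t))" by (simp add: mult_exp_exp algebra_simps)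
    also have "\<dots> \<le> exp (rate1 \<beta> * t) * exp (- ln 2)" using elim(2) pos by (intro mult_left_mono) (auto simp: field_simps)
    also have "\<dots> = exp (rate1 \<beta> * t) / 2" by (simp add: exp_minus)
    finally show ?case using elim(1) plarge_mono by (meson order_trans)
  qed
qed

end

section \<open>From exponentially unlikely to typical lower bounds\<close>

lemma countable_cis_eq: "countable {x::real. exp (\<i> * complex_of_real x) = z}"
proof (cases "{x::real. exp (\<i> * complex_of_real x) = z} = {}")
  case False
  then obtain x0 :: real where x0: "exp (\<i> * complex_of_real x0) = z" by auto
  have "{x::real. exp (\<i> * complex_of_real x) = z} \<subseteq> range (\<lambda>n::int. x0 + 2 * of_int n * pi)"
  proof
    fix x :: real assume "x \<in> {x. exp (\<i> * complex_of_real x) = z}"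
    then have "exp (\<i> * complex_of_real x) = exp (\<i> * complex_of_real x0)" using x0 by simp
    then obtain n :: int where "\<i> * complex_of_real x = \<i> * complex_of_real x0 + complex_of_real (of_int (2 * n) * pi) * \<i>"
      unfolding exp_eq by blast
    then have "x = x0 + 2 * of_int n * pi" by (simp add: complex_eq_iff)
    then show "x \<in> range (\<lambda>n::int. x0 + 2 * of_int n * pi)" by blast
  qed
  then show ?thesis by (rule countable_subset) simp
qed simp

lemma emeasure_std_normal_countable:
  assumes "countable A" shows "emeasure std_normal A = 0" "A \<in> sets borel"
proof -
  show A: "A \<in> sets borel" by (rule sets.countable[OF _ assms]) simp
  have "A \<in> null_sets lborel" using assms by (rule countable_imp_null_set_lborel)
  moreover have "absolutely_continuous lborel std_normal" by (rule absolutely_continuousI_density) measurable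
  ultimately have "A \<in> null_sets std_normal" unfolding absolutely_continuous_def by blast
  then show "emeasure std_normal A = 0" by (rule null_setsD1)
qed

lemma nn_integral_indicator_affine_countable:
  assumes "a \<noteq> 0" "countable A"
  shows "(\<integral>\<^sup>+x. indicator A (a * x + b) \<partial>std_normal) = 0"
proof -
  have inj: "inj (\<lambda>x::real. a * x + b)" using assms(1) by (auto intro!: injI)
  have c: "countable ((\<lambda>x. a * x + b) -` A)"
    using countable_image_inj_on[of "\<lambda>x. a * x + b" "(\<lambda>x. a * x + b) -` A"] assms(2) inj
    by (meson countable_subset image_vimage_subset inj_on_subset subset_UNIV)
  have "(\<integral>\<^sup>+x. indicator A (a * x + b) \<partial>std_normal) = (\<integral>\<^sup>+x. indicator ((\<lambda>x. a * x + b) -` A) x \<partial>std_normal)"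
    by (intro nn_integral_cong) (auto simp: indicator_def)
  also have "\<dots> = 0" using emeasure_std_normal_countable[OF c] by simp
  finally show ?thesis .
qed

text \<open>If Re \<beta> is not 0, the modulus already determines the first Gaussian. Otherwise the
  phase is a linear form in the two Gaussians, nonzero because \<rho> and sqrt (1 - \<rho>^2) do not
  vanish together, and it is confined to a countable set.\<close>

lemma exp_disp_nonatomic:
  assumes \<beta>: "\<beta> \<noteq> 0" and rho: "-1 \<le> \<rho>" "\<rho> \<le> 1"
  shows "(\<integral>\<^sup>+p. indicator {z} (exp (disp \<rho> \<beta> 1 p)) \<partial>gauss2) = 0"
proof -
  interpret N: prob_space std_normal by (rule prob_space_std_normal)
  interpret NN: pair_prob_space std_normal std_normal ..
  show ?thesis
  proof (cases "Re \<beta> = 0")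
    case False
    have "(\<integral>\<^sup>+p. indicator {z} (exp (disp \<rho> \<beta> 1 p)) \<partial>gauss2) \<le> (\<integral>\<^sup>+p. indicator {ln (cmod z)} (Re \<beta> * fst p + 0) \<partial>gauss2)"
    proof (rule nn_integral_mono)
      fix p :: "real \<times> real"
      have "ln (cmod z) = Re \<beta> * fst p" if "exp (disp \<rho> \<beta> 1 p) = z"
        using cmod_exp_disp[of \<rho> \<beta> 1 p] that by (metis ln_exp mult_1 real_sqrt_one)
      then show "indicator {z} (exp (disp \<rho> \<beta> 1 p)) \<le> (indicator {ln (cmod z)} (Re \<beta> * fst p + 0) :: ennreal)"
        by (auto simp: indicator_def)
    qed
    also have "\<dots> = (\<integral>\<^sup>+x. \<integral>\<^sup>+w. indicator {ln (cmod z)} (Re \<beta> * x + 0) \<partial>std_normal \<partial>std_normal)"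
      by (subst nn_integral_gauss2) auto
    also have "\<dots> = (\<integral>\<^sup>+x. indicator {ln (cmod z)} (Re \<beta> * x + 0) \<partial>std_normal)"
      using N.emeasure_space_1 by simp
    also have "\<dots> = 0" by (rule nn_integral_indicator_affine_countable[OF False]) simp
    finally show ?thesis by simp
  next
    case True
    then have \<tau>: "Im \<beta> \<noteq> 0" using \<beta> by (simp add: complex_eq_iff)
    let ?A = "{x::real. exp (\<i> * complex_of_real x) = z}"
    let ?a = "Im \<beta> * \<rho>" and ?b = "Im \<beta> * sqrt (1 - \<rho>\<^sup>2)"
    have Am [measurable]: "?A \<in> sets borel" by (rule emeasure_std_normal_countable(2)[OF countable_cis_eq])
    have "(\<integral>\<^sup>+p. indicator {z} (exp (disp \<rho> \<beta> 1 p)) \<partial>gauss2) = (\<integral>\<^sup>+p. indicator ?A (?a * fst p + ?b * snd p) \<partial>gauss2)"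
      using True by (intro nn_integral_cong) (simp add: indicator_def disp_def lin_def algebra_simps)
    also have "\<dots> = (\<integral>\<^sup>+x. \<integral>\<^sup>+w. indicator ?A (?a * x + ?b * w) \<partial>std_normal \<partial>std_normal)"
      by (subst nn_integral_gauss2) auto
    also have "\<dots> = 0"
    proof (cases "?b = 0")
      case False
      have "(\<integral>\<^sup>+w. indicator ?A (?a * x + ?b * w) \<partial>std_normal) = 0" for x
        using nn_integral_indicator_affine_countable[OF False countable_cis_eq, of z "?a * x"] by (simp add: add.commute)
      then show ?thesis by simp
    next
      case b: True
      then have "1 - \<rho>\<^sup>2 = 0" using \<tau> by simp
      then have "\<rho> \<noteq> 0" by auto
      then have a: "?a \<noteq> 0" using \<tau> by simp
      have "(\<integral>\<^sup>+x. \<integral>\<^sup>+w. indicator ?A (?a * x + ?b * w) \<partial>std_normal \<partial>std_normal) = (\<integral>\<^sup>+x. indicator ?A (?a * x + 0) \<partial>std_normal)"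
        unfolding b using N.emeasure_space_1 by simp
      also have "\<dots> = 0" by (rule nn_integral_indicator_affine_countable[OF a countable_cis_eq])
      finally show ?thesis .
    qed
    finally show ?thesis .
  qed
qed

text \<open>The bound is uniform in the centre \<open>b\<close>: two independent copies near the
  same \<open>b\<close> are near each other, and the diagonal has measure 0 by
  \<open>exp_disp_nonatomic\<close>.\<close>

lemma exp_disp_concentration:
  assumes \<beta>: "\<beta> \<noteq> 0" and rho: "-1 \<le> \<rho>" "\<rho> \<le> 1" and \<epsilon>: "0 < \<epsilon>"
  obtains \<kappa> where "0 < \<kappa>" "\<And>b. measure gauss2 {p \<in> space gauss2. cmod (exp (disp \<rho> \<beta> 1 p) - b) \<le> \<kappa>} \<le> \<epsilon>"
proof -
  interpret G: prob_space gauss2 by (rule prob_space_gauss2)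
  interpret GG: pair_prob_space gauss2 gauss2 ..
  let ?e = "\<lambda>p. exp (disp \<rho> \<beta> 1 p)" and ?GG = "gauss2 \<Otimes>\<^sub>M gauss2"
  define D where "D n = {x \<in> space ?GG. cmod (?e (fst x) - ?e (snd x)) \<le> 2 / real (Suc n)}" for n
  have Dm [measurable]: "D n \<in> sets ?GG" for n unfolding D_def by measurable
  have "decseq D"
  proof (rule decseq_SucI)
    fix n
    have "2 / real (Suc (Suc n)) \<le> 2 / real (Suc n)" by (intro divide_left_mono) auto
    then show "D (Suc n) \<subseteq> D n" unfolding D_def by (auto intro: order_trans)
  qed
  then have lim: "(\<lambda>n. measure ?GG (D n)) \<longlonglongrightarrow> measure ?GG (\<Inter>n. D n)"
    using Dm by (intro GG.finite_Lim_measure_decseq) blast+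
  have "(\<Inter>n. D n) = {x \<in> space ?GG. ?e (fst x) = ?e (snd x)}"
  proof (intro set_eqI iffI)
    fix x assume x: "x \<in> (\<Inter>n. D n)"
    have "(\<lambda>n. 2 / real (Suc n)) \<longlonglongrightarrow> 0"
      using LIMSEQ_Suc[OF lim_const_over_n[of 2]] by simp
    moreover have "\<And>n. cmod (?e (fst x) - ?e (snd x)) \<le> 2 / real (Suc n)" using x by (auto simp: D_def)
    ultimately have "cmod (?e (fst x) - ?e (snd x)) \<le> 0" by (intro LIMSEQ_le_const[of _ 0] exI[of _ 0] allI impI)
    then show "x \<in> {x \<in> space ?GG. ?e (fst x) = ?e (snd x)}" using x by (auto simp: D_def)
  qed (auto simp: D_def)
  moreover have "emeasure ?GG {x \<in> space ?GG. ?e (fst x) = ?e (snd x)} = 0"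
  proof -
    let ?S = "{x \<in> space ?GG. ?e (fst x) = ?e (snd x)}"
    have S [measurable]: "?S \<in> sets ?GG" by measurable
    have "emeasure ?GG ?S = (\<integral>\<^sup>+p. \<integral>\<^sup>+q. indicator ?S (p, q) \<partial>gauss2 \<partial>gauss2)"
      by (rule G.emeasure_pair_measure) measurable
    also have "\<dots> \<le> (\<integral>\<^sup>+p. \<integral>\<^sup>+q. indicator {?e p} (?e q) \<partial>gauss2 \<partial>gauss2)"
      by (intro nn_integral_mono) (simp split: split_indicator)
    also have "\<dots> = 0" using exp_disp_nonatomic[OF \<beta> rho] by simp
    finally show ?thesis by simp
  qed
  ultimately have "measure ?GG (\<Inter>n. D n) = 0" by (simp add: measure_def)
  with lim have lim0: "(\<lambda>n. measure ?GG (D n)) \<longlonglongrightarrow> 0" by simp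
  \<comment> \<open>The square, because a ball of probability q puts a set of probability q^2 into
    \<open>D n\<close>.\<close>
  have "0 < \<epsilon>\<^sup>2" using \<epsilon> by simp
  from eventually_happens'[OF sequentially_bot order_tendstoD(2)[OF lim0 this]]
  obtain n where n: "measure ?GG (D n) < \<epsilon>\<^sup>2" by blast
  show ?thesis
  proof
    show "0 < 1 / real (Suc n)" by simp
    fix b
    let ?B = "{p \<in> space gauss2. cmod (?e p - b) \<le> 1 / real (Suc n)}"
    have [measurable]: "?B \<in> sets gauss2" by measurable
    have "?B \<times> ?B \<subseteq> D n"
    proof
      fix x assume x: "x \<in> ?B \<times> ?B"
      have "cmod (?e (fst x) - ?e (snd x)) \<le> cmod (?e (fst x) - b) + cmod (?e (snd x) - b)"
        using norm_triangle_ineq4[of "?e (fst x) - b" "?e (snd x) - b"] by simp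
      also have "\<dots> \<le> 1 / real (Suc n) + 1 / real (Suc n)" using x by (intro add_mono) auto
      finally show "x \<in> D n" using x by (auto simp: D_def space_pair_measure)
    qed
    then have "measure ?GG (?B \<times> ?B) \<le> measure ?GG (D n)" by (rule GG.finite_measure_mono[OF _ Dm])
    moreover have "measure ?GG (?B \<times> ?B) = (measure gauss2 ?B)\<^sup>2"
    proof -
      have "emeasure ?GG (?B \<times> ?B) = emeasure gauss2 ?B * emeasure gauss2 ?B"
        by (rule G.emeasure_pair_measure_Times) measurable
      then show ?thesis unfolding measure_def power2_eq_square by (simp only: enn2real_mult)
    qed
    ultimately have "(measure gauss2 ?B)\<^sup>2 \<le> \<epsilon>\<^sup>2" using n by simp
    then show "measure gauss2 ?B \<le> \<epsilon>" using \<epsilon> by (rule power2_le_imp_le[OF _ less_imp_le])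
  qed
qed

context bbm_corr
begin

text \<open>Only the event that the root outlives time 1 is kept, of probability exp (- 1). On it
  the first unit displacement is an independent factor of the whole sum.\<close>

lemma bbm_no_split:
  assumes t: "0 \<le> t" and [measurable]: "g \<in> borel_measurable borel"
  shows "ennreal (exp (- 1)) * (\<integral>\<^sup>+p. \<integral>\<^sup>+\<omega>. g (exp (disp \<rho> \<beta> 1 p) * bbm \<rho> \<beta> t \<omega>) \<partial>bbm_space \<partial>gauss2)
    \<le> (\<integral>\<^sup>+\<omega>. g (bbm \<rho> \<beta> (1 + t) \<omega>) \<partial>bbm_space)"
proof -
  have "(\<integral>\<^sup>+\<omega>. g (bbm \<rho> \<beta> (1 + t) \<omega>) \<partial>bbm_space) =
    ennreal (exp (- 1)) * (\<integral>\<^sup>+p. \<integral>\<^sup>+\<omega>. g (exp (disp \<rho> \<beta> 1 p) * bbm \<rho> \<beta> t \<omega>) \<partial>bbm_space \<partial>gauss2) +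
      (\<integral>\<^sup>+l. ennreal (exp (- l)) * indicator {0..1} l *
        (\<integral>\<^sup>+p. \<integral>\<^sup>+\<omega>. \<integral>\<^sup>+\<omega>'. g (exp (disp \<rho> \<beta> l p) * (bbm \<rho> \<beta> (1 - l + t) \<omega> + bbm \<rho> \<beta> (1 - l + t) \<omega>')) \<partial>bbm_space \<partial>bbm_space \<partial>gauss2) \<partial>lborel)"
    by (rule first_split_bbm_shift[OF t, of \<rho> \<beta>, unfolded first_split_def, THEN conjunct2, THEN conjunct2, rule_format]) auto
  then show ?thesis by simp
qed

text \<open>With zero variance the partition function at time 1 would be almost surely constant, but
  when the root has not split it is a displacement factor, which has no atoms.\<close>

lemma bvar_pos:
  assumes \<beta>: "\<beta> \<noteq> 0"
  shows "0 < bvar \<beta> 1"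
proof (rule ccontr)
  interpret P: prob_space bbm_space by (rule prob_space_bbm_space)
  interpret G: prob_space gauss2 by (rule prob_space_gauss2)
  assume "\<not> 0 < bvar \<beta> 1"
  moreover have "0 \<le> bvar \<beta> 1" unfolding bvar_def by (rule Bochner_Integration.integral_nonneg) simp
  ultimately have "bvar \<beta> 1 = 0" by simp
  then have "AE \<omega> in bbm_space. (cmod (bbm \<rho> \<beta> 1 \<omega> - mean \<beta> 1))\<^sup>2 = 0"
    unfolding bvar_def using bbm_centered_integrable2[of 1] by (subst (asm) integral_nonneg_eq_0_iff_AE) auto
  then have "AE \<omega> in bbm_space. indicator (- {mean \<beta> 1}) (bbm \<rho> \<beta> (0 + 1) \<omega>) = (0::ennreal)"
    by eventually_elim simp
  then have "(\<integral>\<^sup>+\<omega>. indicator (- {mean \<beta> 1}) (bbm \<rho> \<beta> 1 \<omega>) \<partial>bbm_space) = 0"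
    by (subst nn_integral_0_iff_AE) auto
  moreover have "(\<integral>\<^sup>+\<omega>. indicator (- {mean \<beta> 1}) (bbm \<rho> \<beta> 1 \<omega>) \<partial>bbm_space) \<ge>
     ennreal (exp (- 1)) * (\<integral>\<^sup>+p. indicator (- {mean \<beta> 1}) (exp (disp \<rho> \<beta> 1 p)) \<partial>gauss2)"
    by (subst bbm_first_split) auto
  ultimately have "(\<integral>\<^sup>+p. indicator (- {mean \<beta> 1}) (exp (disp \<rho> \<beta> 1 p)) \<partial>gauss2) = 0"
    by (simp add: ennreal_zero_less_mult_iff)
  moreover have "(\<integral>\<^sup>+p. indicator (- {mean \<beta> 1}) (exp (disp \<rho> \<beta> 1 p)) \<partial>gauss2) + (\<integral>\<^sup>+p. indicator {mean \<beta> 1} (exp (disp \<rho> \<beta> 1 p)) \<partial>gauss2) = (\<integral>\<^sup>+p. 1 \<partial>gauss2)"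
  proof (subst nn_integral_add[symmetric])
    show "(\<integral>\<^sup>+p. indicator (- {mean \<beta> 1}) (exp (disp \<rho> \<beta> 1 p)) + indicator {mean \<beta> 1} (exp (disp \<rho> \<beta> 1 p)) \<partial>gauss2) = (\<integral>\<^sup>+p. 1 \<partial>gauss2)"
      by (rule nn_integral_cong) (simp split: split_indicator)
  qed measurable
  ultimately show False using exp_disp_nonatomic[OF \<beta> rho, of "mean \<beta> 1"] by (simp add: G.emeasure_space_1)
qed

lemma plarge_eq_nn: "ennreal (plarge \<beta> t r) = (\<integral>\<^sup>+\<omega>. indicator {z. r \<le> cmod z} (bbm \<rho> \<beta> t \<omega>) \<partial>bbm_space)"
proof -
  interpret P: prob_space bbm_space by (rule prob_space_bbm_space)
  have "ennreal (plarge \<beta> t r) = emeasure bbm_space {\<omega> \<in> space bbm_space. r \<le> cmod (bbm \<rho> \<beta> t \<omega>)}"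
    unfolding plarge_def P.emeasure_eq_measure ..
  also have "\<dots> = (\<integral>\<^sup>+\<omega>. indicator {\<omega> \<in> space bbm_space. r \<le> cmod (bbm \<rho> \<beta> t \<omega>)} \<omega> \<partial>bbm_space)"
    by (rule nn_integral_indicator[symmetric]) measurable
  also have "\<dots> = (\<integral>\<^sup>+\<omega>. indicator {z. r \<le> cmod z} (bbm \<rho> \<beta> t \<omega>) \<partial>bbm_space)"
    by (rule nn_integral_cong) (simp split: split_indicator)
  finally show ?thesis .
qed

lemma psmall_eq_nn: "ennreal (psmall \<beta> t r) = (\<integral>\<^sup>+\<omega>. indicator {z. cmod z \<le> r} (bbm \<rho> \<beta> t \<omega>) \<partial>bbm_space)"
proof -
  interpret P: prob_space bbm_space by (rule prob_space_bbm_space)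
  have "ennreal (psmall \<beta> t r) = emeasure bbm_space {\<omega> \<in> space bbm_space. cmod (bbm \<rho> \<beta> t \<omega>) \<le> r}"
    unfolding psmall_def P.emeasure_eq_measure ..
  also have "\<dots> = (\<integral>\<^sup>+\<omega>. indicator {\<omega> \<in> space bbm_space. cmod (bbm \<rho> \<beta> t \<omega>) \<le> r} \<omega> \<partial>bbm_space)"
    by (rule nn_integral_indicator[symmetric]) measurable
  also have "\<dots> = (\<integral>\<^sup>+\<omega>. indicator {z. cmod z \<le> r} (bbm \<rho> \<beta> t \<omega>) \<partial>bbm_space)"
    by (rule nn_integral_cong) (simp split: split_indicator)
  finally show ?thesis .
qed

text \<open>Given the tree up to \<open>s\<close>, the squared modulus at \<open>s + 1\<close> has
  mean at least v times the sum of the squared weights, and its second moment is controlled by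
  \<open>mark_sum_fourth_moment\<close>. So it reaches half its mean with a conditional probability
  bounded below independently of the tree.\<close>

lemma plarge_square_sum:
  assumes \<beta>: "\<beta> \<noteq> 0"
  obtains \<kappa> c where "0 < \<kappa>" "0 < c"
    "\<And>s x. 0 \<le> s \<Longrightarrow> 0 \<le> x \<Longrightarrow> c * measure bbm_space {\<eta> \<in> space bbm_space. x \<le> rsum (2 * Re \<beta>) s \<eta>} \<le> plarge \<beta> (s + 1) (sqrt (\<kappa> * x))"
proof -
  define v where "v = bvar \<beta> 1"
  have v: "0 < v" unfolding v_def by (rule bvar_pos[OF \<beta>])
  interpret P: prob_space bbm_space by (rule prob_space_bbm_space)
  interpret C: centered_marks bbm_space "\<lambda>\<omega>. bbm \<rho> \<beta> 1 \<omega> - mean \<beta> 1" "bvar \<beta> 1" "\<integral>\<omega>. (cmod (bbm \<rho> \<beta> 1 \<omega> - mean \<beta> 1)) ^ 4 \<partial>bbm_space"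
    by (rule centered_marks_bbm) simp
  interpret KK: prob_space C.KK by (rule C.prob_space_KK)
  \<comment> \<open>From e >= min 1 v * (|w|^2 + V), the Paley-Zygmund ratio e^2 / (4 f) with f = C4
    (|w|^2 + V)^2 is at least this.\<close>
  define c where "c = (min 1 v)\<^sup>2 / (4 * C.C4)"
  have C4: "1 \<le> C.C4" by (simp add: C.C4_def)
  have c: "0 < c" "c \<le> 1"
  proof -
    show "0 < c" unfolding c_def using v C4 by simp
    have "(min 1 v)\<^sup>2 \<le> 1" using v by (simp add: power_le_one)
    then show "c \<le> 1" unfolding c_def using C4 by (simp add: divide_le_eq)
  qed
  have cond: "ennreal c * indicator {\<eta>. x \<le> rsum (2 * Re \<beta>) s \<eta>} \<eta> \<le>
      (\<integral>\<^sup>+\<zeta>. indicator {z. sqrt (v / 2 * x) \<le> cmod z} (bbm_sum \<rho> \<beta> s \<eta> (\<lambda>u. bbm \<rho> \<beta> 1 (\<zeta> u))) \<partial>C.KK)"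
    if ok: "tree_ok (\<lambda>u. fst (\<eta> u))" and x: "0 \<le> x" for s x \<eta>
  proof (cases "x \<le> rsum (2 * Re \<beta>) s \<eta>")
    case True
    let ?A = "bbm_alive s \<eta>" and ?c = "coef \<rho> \<beta> s \<eta>"
    have fin: "finite ?A" by (rule tree_ok_finite_alive[OF ok])
    define w where "w = mean \<beta> 1 * bbm \<rho> \<beta> s \<eta>"
    define V where "V = (\<Sum>u\<in>?A. (cmod (?c u))\<^sup>2)"
    have V: "V = rsum (2 * Re \<beta>) s \<eta>"
      unfolding V_def rsum_def cmod_coef exp_double[symmetric] by (simp add: mult.assoc)
    let ?T = "\<lambda>\<zeta>. w + (\<Sum>u\<in>?A. ?c u * (bbm \<rho> \<beta> 1 (\<zeta> u) - mean \<beta> 1))"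
    have T: "bbm_sum \<rho> \<beta> s \<eta> (\<lambda>u. bbm \<rho> \<beta> 1 (\<zeta> u)) = ?T \<zeta>" for \<zeta>
      unfolding bbm_sum_coef w_def bbm_coef[of \<rho> \<beta> s \<eta>] sum_distrib_left sum.distrib[symmetric]
      by (intro sum.cong) (auto simp: algebra_simps)
    have Tm [measurable]: "?T \<in> borel_measurable C.KK" using C.mark_sum_measurable by measurable
    define e where "e = (cmod w)\<^sup>2 + v * V"
    have V0: "0 \<le> V" unfolding V by (rule rsum_nonneg)
    have e0: "0 \<le> e" unfolding e_def using v V0 by simp
    have sq: "sqrt (v / 2 * x) \<le> cmod z" if "e / 2 \<le> (cmod z)\<^sup>2" for z
    proof -
      have "v * x \<le> v * V" using True v by (simp add: V)
      moreover have "(cmod w)\<^sup>2 + v * V \<le> 2 * (cmod z)\<^sup>2" using that by (simp add: e_def)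
      ultimately have "v * x \<le> 2 * (cmod z)\<^sup>2" using zero_le_power2[of "cmod w"] by linarith
      then have "v / 2 * x \<le> (cmod z)\<^sup>2" by simp
      then show ?thesis by (intro real_le_lsqrt) auto
    qed
    have "ennreal c \<le> emeasure C.KK {\<zeta> \<in> space C.KK. e / 2 \<le> (cmod (?T \<zeta>))\<^sup>2}"
    proof (cases "e = 0")
      case True
      then show ?thesis using c by (simp add: KK.emeasure_space_1)
    next
      case False
      have "c \<le> e\<^sup>2 / (4 * (C.C4 * ((cmod w)\<^sup>2 + V)\<^sup>2))"
      proof -
        have "min 1 v * (cmod w)\<^sup>2 \<le> 1 * (cmod w)\<^sup>2" "min 1 v * V \<le> v * V" using V0 by (intro mult_right_mono; simp)+
        then have 1: "min 1 v * ((cmod w)\<^sup>2 + V) \<le> e" unfolding e_def by (simp add: distrib_left)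
        have 2: "0 < (cmod w)\<^sup>2 + V"
        proof (rule ccontr)
          assume "\<not> 0 < (cmod w)\<^sup>2 + V"
          then have "(cmod w)\<^sup>2 = 0" "V = 0" using V0 zero_le_power2[of "cmod w"] by linarith+
          then show False using False by (simp add: e_def)
        qed
        have "(min 1 v * ((cmod w)\<^sup>2 + V))\<^sup>2 \<le> e\<^sup>2" using 1 2 v by (intro power_mono) auto
        then have "(min 1 v)\<^sup>2 * ((cmod w)\<^sup>2 + V)\<^sup>2 \<le> e\<^sup>2" by (simp add: power_mult_distrib)
        then have "(min 1 v)\<^sup>2 \<le> e\<^sup>2 / ((cmod w)\<^sup>2 + V)\<^sup>2" using 2 by (simp add: pos_le_divide_eq)
        then have "(min 1 v)\<^sup>2 / (4 * C.C4) \<le> e\<^sup>2 / ((cmod w)\<^sup>2 + V)\<^sup>2 / (4 * C.C4)" using C4 by (intro divide_right_mono) auto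
        then show ?thesis unfolding c_def by (simp add: mult_ac)
      qed
      also have "\<dots> \<le> KK.prob {\<zeta> \<in> space C.KK. e / 2 \<le> (cmod (?T \<zeta>))\<^sup>2}"
      proof (rule KK.paley_zygmund)
        show "(\<integral>\<^sup>+\<zeta>. ennreal ((cmod (?T \<zeta>))\<^sup>2) \<partial>C.KK) = ennreal e"
          unfolding e_def V_def v_def by (rule C.mark_sum_second_moment[OF fin])
        show "(\<integral>\<^sup>+\<zeta>. ennreal (((cmod (?T \<zeta>))\<^sup>2)\<^sup>2) \<partial>C.KK) \<le> ennreal (C.C4 * ((cmod w)\<^sup>2 + V)\<^sup>2)"
          using C.mark_sum_fourth_moment[OF fin, of w ?c] unfolding V_def by simp
      qed (use False e0 in auto)
      finally show ?thesis unfolding KK.emeasure_eq_measure by (rule ennreal_leI)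
    qed
    also have "\<dots> = (\<integral>\<^sup>+\<zeta>. indicator {\<zeta> \<in> space C.KK. e / 2 \<le> (cmod (?T \<zeta>))\<^sup>2} \<zeta> \<partial>C.KK)"
      by (rule nn_integral_indicator[symmetric]) measurable
    also have "\<dots> \<le> (\<integral>\<^sup>+\<zeta>. indicator {z. sqrt (v / 2 * x) \<le> cmod z} (?T \<zeta>) \<partial>C.KK)"
      using sq by (intro nn_integral_mono) (auto simp: indicator_def)
    finally show ?thesis unfolding T using True by simp
  qed auto
  show ?thesis
  proof
    show "0 < v / 2" "0 < c" using v c by auto
    fix s x :: real assume s: "0 \<le> s" and x: "0 \<le> x"
    have "ennreal (c * measure bbm_space {\<eta> \<in> space bbm_space. x \<le> rsum (2 * Re \<beta>) s \<eta>}) =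
        (\<integral>\<^sup>+\<eta>. ennreal c * indicator {\<eta> \<in> space bbm_space. x \<le> rsum (2 * Re \<beta>) s \<eta>} \<eta> \<partial>bbm_space)"
      using c by (subst nn_integral_cmult) (auto simp: P.emeasure_eq_measure ennreal_mult)
    also have "\<dots> = (\<integral>\<^sup>+\<eta>. ennreal c * indicator {\<eta>. x \<le> rsum (2 * Re \<beta>) s \<eta>} \<eta> \<partial>bbm_space)"
      by (intro nn_integral_cong) (auto simp: indicator_def)
    also have "\<dots> \<le> (\<integral>\<^sup>+\<eta>. \<integral>\<^sup>+\<zeta>. indicator {z. sqrt (v / 2 * x) \<le> cmod z} (bbm_sum \<rho> \<beta> s \<eta> (\<lambda>u. bbm \<rho> \<beta> 1 (\<zeta> u))) \<partial>C.KK \<partial>bbm_space)"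
    proof (rule nn_integral_mono_AE)
      show "AE \<eta> in bbm_space. ennreal c * indicator {\<eta>. x \<le> rsum (2 * Re \<beta>) s \<eta>} \<eta> \<le>
        (\<integral>\<^sup>+\<zeta>. indicator {z. sqrt (v / 2 * x) \<le> cmod z} (bbm_sum \<rho> \<beta> s \<eta> (\<lambda>u. bbm \<rho> \<beta> 1 (\<zeta> u))) \<partial>C.KK)"
        using AE_bbm_tree_ok by eventually_elim (rule cond[OF _ x])
    qed
    also have "\<dots> = ennreal (plarge \<beta> (s + 1) (sqrt (v / 2 * x)))"
      unfolding plarge_eq_nn by (rule bbm_branching[symmetric]) (use s in auto)
    finally show "c * measure bbm_space {\<eta> \<in> space bbm_space. x \<le> rsum (2 * Re \<beta>) s \<eta>} \<le> plarge \<beta> (s + 1) (sqrt (v / 2 * x))"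
      by (subst (asm) ennreal_le_iff) (auto simp: plarge_def)
  qed
qed

end

section \<open>Anticoncentration and the amplification of weak lower bounds\<close>

lemma eventually_linear_ge:
  fixes a b :: real
  assumes "0 < a"
  shows "eventually (\<lambda>t. b \<le> a * t) at_top"
  using eventually_ge_at_top[of "b / a"]
proof eventually_elim
  case (elim t)
  then show ?case using assms by (simp add: pos_divide_le_eq mult.commute)
qed

context bbm_corr
begin

text \<open>Reveal the subtrees one at a time. Each is good with probability \<open>p'\<close>: its
  root survives one unit of time and the continuation has modulus at least \<open>R\<close>. None is
  good with probability (1 - p')^card; a good one adds a large multiple of a factor that does not
  concentrate, and then the small-ball probability is at most \<open>q\<close> whatever the others
  do.\<close>

lemma mark_sum_anticoncentration:
  fixes A :: "bool list set"
  assumes t: "0 \<le> t" and R: "0 < R" and \<alpha>: "0 < \<alpha>"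
    and q: "\<And>b. measure gauss2 {p \<in> space gauss2. cmod (exp (disp \<rho> \<beta> 1 p) - b) \<le> \<kappa>} \<le> q"
    and r: "r \<le> \<kappa> * \<alpha> * R"
    and p': "p' = exp (- 1) * plarge \<beta> t R"
    and "finite A" "\<And>u. u \<in> A \<Longrightarrow> \<alpha> \<le> cmod (c u)"
  shows "(\<integral>\<^sup>+\<zeta>. indicator {z. cmod z \<le> r} (w + (\<Sum>u\<in>A. c u * bbm \<rho> \<beta> (1 + t) (\<zeta> u))) \<partial>PiM UNIV (\<lambda>_. bbm_space))
    \<le> ennreal ((1 - p') ^ card A + q)"
  using assms(7,8)
proof (induction A arbitrary: w)
  case empty
  interpret KK: prob_space "PiM UNIV (\<lambda>_::bool list. bbm_space)" by (intro prob_space_PiM prob_space_bbm_space)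
  have "0 \<le> q" using q[of 0] measure_nonneg order_trans by blast
  then have "ennreal 1 \<le> ennreal (1 + q)" by (intro ennreal_leI) simp
  moreover have "(\<integral>\<^sup>+\<zeta>. indicator {z. cmod z \<le> r} w \<partial>PiM UNIV (\<lambda>_::bool list. bbm_space)) \<le> (\<integral>\<^sup>+\<zeta>. 1 \<partial>PiM UNIV (\<lambda>_::bool list. bbm_space))"
    by (intro nn_integral_mono) (simp split: split_indicator)
  ultimately show ?case by (auto simp: KK.emeasure_space_1 intro: add_increasing2)
next
  case (insert u A)
  interpret P: prob_space bbm_space by (rule prob_space_bbm_space)
  interpret G: prob_space gauss2 by (rule prob_space_gauss2)
  interpret I: iid_marks bbm_space "bbm \<rho> \<beta> (1 + t)" by unfold_locales measurable
  interpret KK: prob_space I.KK by (rule I.prob_space_KK)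
  interpret GP: pair_prob_space gauss2 bbm_space ..
  interpret GK: pair_prob_space gauss2 I.KK ..
  let ?S = "\<lambda>\<zeta>. \<Sum>u\<in>A. c u * bbm \<rho> \<beta> (1 + t) (\<zeta> u)" and ?e = "\<lambda>p. exp (disp \<rho> \<beta> 1 p)" and ?X = "bbm \<rho> \<beta> t"
  have Sm [measurable]: "?S \<in> borel_measurable I.KK" by (rule I.mark_sum_measurable)
  have q0: "0 \<le> q" using q[of 0] measure_nonneg order_trans by blast
  have pl: "0 \<le> plarge \<beta> t R" "plarge \<beta> t R \<le> 1" by (auto simp: plarge_def)
  have p'01: "0 \<le> p'" "p' \<le> 1"
  proof -
    show "0 \<le> p'" unfolding p' using pl by simp
    have "p' \<le> 1 * 1" unfolding p' using pl by (intro mult_mono) auto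
    then show "p' \<le> 1" by simp
  qed
  define C where "C = (1 - p') ^ card A + q"
  have C0: "0 \<le> C" using q0 p'01 by (simp add: C_def)
  define H where "H w = (\<integral>\<^sup>+\<zeta>. indicator {z. cmod z \<le> r} (w + ?S \<zeta>) \<partial>I.KK)" for w
  have Hm [measurable]: "H \<in> borel_measurable borel" unfolding H_def by measurable
  have HC: "H w \<le> ennreal C" for w unfolding H_def C_def using insert.prems by (intro insert.IH) auto
  \<comment> \<open>\<open>bbm_no_split\<close> bounds integrals from below only, so it is applied
    to the deficit \<open>D\<close> of \<open>H\<close> under its bound \<open>C\<close>; since
    \<open>D\<close> and \<open>H\<close> add up to \<open>C\<close>, this yields the upper estimate
    for \<open>H\<close>.\<close>
  define D where "D x = ennreal C - H (w + c u * x)" for x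
  have Dm [measurable]: "D \<in> borel_measurable borel" unfolding D_def by measurable
  have DH: "D x + H (w + c u * x) = ennreal C" for x unfolding D_def using HC by (rule diff_add_cancel_ennreal)
  define ind where "ind \<omega> = (indicator {z. R \<le> cmod z} (?X \<omega>) :: ennreal)" for \<omega>
  have indm [measurable]: "ind \<in> borel_measurable bbm_space" unfolding ind_def by measurable
  define I where "I = (\<integral>\<^sup>+\<omega>. H (w + c u * bbm \<rho> \<beta> (1 + t) \<omega>) \<partial>bbm_space)"
  define I1 where "I1 = (\<integral>\<^sup>+\<omega>. D (bbm \<rho> \<beta> (1 + t) \<omega>) \<partial>bbm_space)"
  define J where "J = ennreal (exp (- 1)) * (\<integral>\<^sup>+p. \<integral>\<^sup>+\<omega>. ind \<omega> * H (w + c u * (?e p * ?X \<omega>)) \<partial>bbm_space \<partial>gauss2)"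
  define J1 where "J1 = ennreal (exp (- 1)) * (\<integral>\<^sup>+p. \<integral>\<^sup>+\<omega>. ind \<omega> * D (?e p * ?X \<omega>) \<partial>bbm_space \<partial>gauss2)"
  have eq1: "I1 + I = ennreal C"
    unfolding I1_def I_def by (subst nn_integral_add[symmetric]) (auto simp: DH P.emeasure_space_1)
  have "J1 \<le> ennreal (exp (- 1)) * (\<integral>\<^sup>+p. \<integral>\<^sup>+\<omega>. D (?e p * ?X \<omega>) \<partial>bbm_space \<partial>gauss2)"
    unfolding J1_def by (intro mult_left_mono nn_integral_mono) (auto simp: ind_def indicator_def)
  also have "\<dots> \<le> I1" unfolding I1_def by (rule bbm_no_split[OF t]) measurable
  finally have le1: "J1 \<le> I1" .
  have eq2: "J1 + J = ennreal (p' * C)"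
  proof -
    have "J1 + J = ennreal (exp (- 1)) * (\<integral>\<^sup>+p. (\<integral>\<^sup>+\<omega>. ind \<omega> * D (?e p * ?X \<omega>) \<partial>bbm_space) + (\<integral>\<^sup>+\<omega>. ind \<omega> * H (w + c u * (?e p * ?X \<omega>)) \<partial>bbm_space) \<partial>gauss2)"
      unfolding J1_def J_def distrib_left[symmetric] by (subst nn_integral_add[symmetric]) measurable
    also have "(\<lambda>p. (\<integral>\<^sup>+\<omega>. ind \<omega> * D (?e p * ?X \<omega>) \<partial>bbm_space) + (\<integral>\<^sup>+\<omega>. ind \<omega> * H (w + c u * (?e p * ?X \<omega>)) \<partial>bbm_space)) =
        (\<lambda>p. \<integral>\<^sup>+\<omega>. ind \<omega> * ennreal C \<partial>bbm_space)"
    proof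
      fix p
      have "(\<integral>\<^sup>+\<omega>. ind \<omega> * D (?e p * ?X \<omega>) \<partial>bbm_space) + (\<integral>\<^sup>+\<omega>. ind \<omega> * H (w + c u * (?e p * ?X \<omega>)) \<partial>bbm_space) =
         (\<integral>\<^sup>+\<omega>. ind \<omega> * D (?e p * ?X \<omega>) + ind \<omega> * H (w + c u * (?e p * ?X \<omega>)) \<partial>bbm_space)"
        by (rule nn_integral_add[symmetric]) measurable
      also have "\<dots> = (\<integral>\<^sup>+\<omega>. ind \<omega> * ennreal C \<partial>bbm_space)"
        by (simp only: distrib_left[symmetric] DH)
      finally show "(\<integral>\<^sup>+\<omega>. ind \<omega> * D (?e p * ?X \<omega>) \<partial>bbm_space) + (\<integral>\<^sup>+\<omega>. ind \<omega> * H (w + c u * (?e p * ?X \<omega>)) \<partial>bbm_space) = (\<integral>\<^sup>+\<omega>. ind \<omega> * ennreal C \<partial>bbm_space)" .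
    qed
    also have "(\<integral>\<^sup>+p. \<integral>\<^sup>+\<omega>. ind \<omega> * ennreal C \<partial>bbm_space \<partial>gauss2) = ennreal (plarge \<beta> t R) * ennreal C"
      unfolding plarge_eq_nn ind_def[symmetric] by (simp add: nn_integral_multc G.emeasure_space_1)
    finally show ?thesis unfolding p' using pl C0 by (simp add: ennreal_mult mult.assoc)
  qed
  have le2: "J \<le> ennreal (p' * q)"
  proof -
    \<comment> \<open>Division by c u * x turns the event into a ball for the displacement factor;
      its radius is at most \<kappa> because |c u * x| is at least \<alpha> R.\<close>
    have small: "(\<integral>\<^sup>+p. indicator {z. cmod z \<le> r} (w + c u * (?e p * x) + y) \<partial>gauss2) \<le> ennreal q"
      if x: "R \<le> cmod x" for x y
    proof -
      have cu: "\<alpha> \<le> cmod (c u)" using insert.prems by auto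
      have x0: "c u * x \<noteq> 0" using x cu R \<alpha> by auto
      have ar: "\<alpha> * R \<le> cmod (c u * x)" unfolding norm_mult using x cu R \<alpha> by (intro mult_mono) auto
      have "(\<integral>\<^sup>+p. indicator {z. cmod z \<le> r} (w + c u * (?e p * x) + y) \<partial>gauss2) \<le>
        (\<integral>\<^sup>+p. indicator {p \<in> space gauss2. cmod (?e p - (- (w + y) / (c u * x))) \<le> \<kappa>} p \<partial>gauss2)"
      proof (rule nn_integral_mono)
        fix p assume p: "p \<in> space gauss2"
        have "cmod (?e p - (- (w + y) / (c u * x))) \<le> \<kappa>" if "cmod (w + c u * (?e p * x) + y) \<le> r"
        proof -
          have "?e p - (- (w + y) / (c u * x)) = (w + c u * (?e p * x) + y) / (c u * x)"
            using x0 by (simp add: field_simps)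
          then have "cmod (?e p - (- (w + y) / (c u * x))) = cmod (w + c u * (?e p * x) + y) / cmod (c u * x)"
            by (simp add: norm_divide)
          also have "\<dots> \<le> (\<kappa> * (\<alpha> * R)) / cmod (c u * x)"
            using that r by (intro divide_right_mono) (auto simp: mult.assoc)
          also have "\<dots> \<le> \<kappa>"
          proof (cases "0 \<le> \<kappa>")
            case True
            then have "\<kappa> * (\<alpha> * R) \<le> \<kappa> * cmod (c u * x)" by (intro mult_left_mono ar)
            then show ?thesis using x0 by (simp add: pos_divide_le_eq)
          next
            case False
            have "\<kappa> * (\<alpha> * R) < 0" using False \<alpha> R by (simp add: mult_neg_pos)
            moreover have "cmod (w + c u * (?e p * x) + y) \<le> \<kappa> * (\<alpha> * R)" using that r by (simp add: mult.assoc)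
            ultimately have False using norm_ge_zero[of "w + c u * (?e p * x) + y"] by linarith
            then show ?thesis ..
          qed
          finally show ?thesis .
        qed
        then show "indicator {z. cmod z \<le> r} (w + c u * (?e p * x) + y) \<le> (indicator {p \<in> space gauss2. cmod (?e p - (- (w + y) / (c u * x))) \<le> \<kappa>} p :: ennreal)"
          using p by (simp split: split_indicator)
      qed
      also have "\<dots> = ennreal (measure gauss2 {p \<in> space gauss2. cmod (?e p - (- (w + y) / (c u * x))) \<le> \<kappa>})"
        by (subst nn_integral_indicator, measurable) (simp add: G.emeasure_eq_measure)
      also have "\<dots> \<le> ennreal q" by (intro ennreal_leI q)
      finally show ?thesis .
    qed
    have "(\<integral>\<^sup>+p. \<integral>\<^sup>+\<omega>. ind \<omega> * H (w + c u * (?e p * ?X \<omega>)) \<partial>bbm_space \<partial>gauss2) =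
       (\<integral>\<^sup>+\<omega>. \<integral>\<^sup>+p. ind \<omega> * H (w + c u * (?e p * ?X \<omega>)) \<partial>gauss2 \<partial>bbm_space)"
      by (rule GP.Fubini'[symmetric]) measurable
    also have "\<dots> = (\<integral>\<^sup>+\<omega>. ind \<omega> * (\<integral>\<^sup>+p. H (w + c u * (?e p * ?X \<omega>)) \<partial>gauss2) \<partial>bbm_space)"
      by (intro nn_integral_cong nn_integral_cmult) measurable
    also have "\<dots> \<le> (\<integral>\<^sup>+\<omega>. ind \<omega> * ennreal q \<partial>bbm_space)"
    proof (rule nn_integral_mono)
      fix \<omega>
      show "ind \<omega> * (\<integral>\<^sup>+p. H (w + c u * (?e p * ?X \<omega>)) \<partial>gauss2) \<le> ind \<omega> * ennreal q"
      proof (cases "R \<le> cmod (?X \<omega>)")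
        case True
        have "(\<integral>\<^sup>+p. H (w + c u * (?e p * ?X \<omega>)) \<partial>gauss2) = (\<integral>\<^sup>+\<zeta>. \<integral>\<^sup>+p. indicator {z. cmod z \<le> r} (w + c u * (?e p * ?X \<omega>) + ?S \<zeta>) \<partial>gauss2 \<partial>I.KK)"
          unfolding H_def by (rule GK.Fubini'[symmetric]) measurable
        also have "\<dots> \<le> (\<integral>\<^sup>+\<zeta>. ennreal q \<partial>I.KK)" by (intro nn_integral_mono small True)
        also have "\<dots> = ennreal q" by (simp add: KK.emeasure_space_1)
        finally show ?thesis by (rule mult_left_mono) simp
      qed (simp add: ind_def)
    qed
    also have "\<dots> = ennreal (plarge \<beta> t R) * ennreal q"
      unfolding plarge_eq_nn ind_def[symmetric] by (rule nn_integral_multc) measurable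
    finally have "J \<le> ennreal (exp (- 1)) * (ennreal (plarge \<beta> t R) * ennreal q)" unfolding J_def by (rule mult_left_mono) simp
    then show ?thesis unfolding p' using pl q0 by (simp add: ennreal_mult mult.assoc)
  qed
  have "I + ennreal (p' * C) = (I + J1) + J" unfolding eq2[symmetric] by (simp add: add.assoc)
  also have "\<dots> \<le> (I + I1) + ennreal (p' * q)" by (intro add_mono le1 le2 order_refl)
  also have "\<dots> = ennreal C + ennreal (p' * q)" using eq1 by (simp add: add.commute)
  finally have fin: "I + ennreal (p' * C) \<le> ennreal (C + p' * q)" using C0 p'01 q0 by simp
  have "I \<le> ennreal (C + p' * q - p' * C)"
  proof (cases I)
    case (real i)
    then have "ennreal (i + p' * C) \<le> ennreal (C + p' * q)" using fin C0 p'01 by simp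
    moreover have "0 \<le> C + p' * q" using C0 p'01 q0 by simp
    ultimately have "i + p' * C \<le> C + p' * q" by (simp only: ennreal_le_iff)
    then show ?thesis using real by (auto intro: ennreal_leI)
  next
    case top
    then show ?thesis using fin by (simp add: top_unique)
  qed
  \<comment> \<open>The good case contributes p' q and the bad one (1 - p') C; the \<open>q\<close>
    inside \<open>C\<close> completes p' q to q.\<close>
  also have "C + p' * q - p' * C = (1 - p') ^ card (insert u A) + q"
    using insert.hyps by (simp add: C_def algebra_simps)
  finally have fin2: "I \<le> ennreal ((1 - p') ^ card (insert u A) + q)" .
  have "(\<integral>\<^sup>+\<zeta>. indicator {z. cmod z \<le> r} (w + (\<Sum>u\<in>insert u A. c u * bbm \<rho> \<beta> (1 + t) (\<zeta> u))) \<partial>I.KK) = I"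
    unfolding I_def H_def by (rule I.mark_sum_insert[OF insert.hyps]) measurable
  then show ?case using fin2 by simp
qed

text \<open>Three ways to be small: no good subtree because of too few particles at
  \<open>s\<close>, which the generating function at 1 - p' measures; a small ball, of probability
  at most q; or some weight below \<alpha>, which is charged to the mean of the real partition
  function at - Re \<beta>.\<close>

lemma psmall_bound:
  assumes s: "0 \<le> s" and t: "0 \<le> t" and R: "0 < R" and \<alpha>: "0 < \<alpha>"
    and q: "\<And>b. measure gauss2 {p \<in> space gauss2. cmod (exp (disp \<rho> \<beta> 1 p) - b) \<le> \<kappa>} \<le> q"
    and r: "r \<le> \<kappa> * \<alpha> * R"
    and p': "p' = exp (- 1) * plarge \<beta> t R" "0 < p'"
  shows "psmall \<beta> (s + (1 + t)) r \<le> exp (- s) / p' + q + \<alpha> * exp ((1 + (Re \<beta>)\<^sup>2 / 2) * s)"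
proof -
  interpret P: prob_space bbm_space by (rule prob_space_bbm_space)
  interpret KK: prob_space "PiM UNIV (\<lambda>_::bool list. bbm_space)" by (intro prob_space_PiM prob_space_bbm_space)
  have q0: "0 \<le> q" using q[of 0] measure_nonneg order_trans by blast
  have p'1: "p' < 1"
  proof -
    have "plarge \<beta> t R \<le> 1" by (simp add: plarge_def)
    then have "p' \<le> exp (- 1) * 1" unfolding p' by (intro mult_left_mono) auto
    also have "\<dots> < 1" by simp
    finally show ?thesis .
  qed
  have cond: "(\<integral>\<^sup>+\<zeta>. indicator {z. cmod z \<le> r} (bbm_sum \<rho> \<beta> s \<eta> (\<lambda>u. bbm \<rho> \<beta> (1 + t) (\<zeta> u))) \<partial>PiM UNIV (\<lambda>_. bbm_space))
     \<le> ennreal ((1 - p') powr cmod (bbm \<rho> 0 s \<eta>)) + ennreal q + ennreal \<alpha> * ennreal (rsum (- Re \<beta>) s \<eta>)"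
    if ok: "tree_ok (\<lambda>u. fst (\<eta> u))" for \<eta>
  proof (cases "\<forall>u\<in>bbm_alive s \<eta>. \<alpha> \<le> cmod (coef \<rho> \<beta> s \<eta> u)")
    case True
    have "(\<integral>\<^sup>+\<zeta>. indicator {z. cmod z \<le> r} (bbm_sum \<rho> \<beta> s \<eta> (\<lambda>u. bbm \<rho> \<beta> (1 + t) (\<zeta> u))) \<partial>PiM UNIV (\<lambda>_. bbm_space))
       \<le> ennreal ((1 - p') ^ card (bbm_alive s \<eta>) + q)"
      using mark_sum_anticoncentration[OF t R \<alpha> q r p'(1) tree_ok_finite_alive[OF ok], of s "coef \<rho> \<beta> s \<eta>" 0] True
      unfolding bbm_sum_coef by simp
    also have "\<dots> = ennreal ((1 - p') powr cmod (bbm \<rho> 0 s \<eta>)) + ennreal q"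
      using p'1 q0 by (simp add: bbm_zero norm_of_nat powr_realpow)
    finally show ?thesis by (rule order_trans) simp
  next
    case False
    then obtain u where u: "u \<in> bbm_alive s \<eta>" "exp (Re \<beta> * bbm_pos s \<eta> u) < \<alpha>" by (auto simp: cmod_coef not_le)
    have "1 \<le> \<alpha> * exp (- Re \<beta> * bbm_pos s \<eta> u)"
      using u(2) by (simp add: exp_minus field_simps)
    also have "\<dots> \<le> \<alpha> * rsum (- Re \<beta>) s \<eta>"
      unfolding rsum_def using u(1) tree_ok_finite_alive[OF ok, of s] \<alpha> by (intro mult_left_mono member_le_sum) auto
    finally have 1: "1 \<le> ennreal \<alpha> * ennreal (rsum (- Re \<beta>) s \<eta>)"
      using \<alpha> rsum_nonneg[of "- Re \<beta>" s \<eta>] by (simp add: ennreal_mult[symmetric])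
    have "(\<integral>\<^sup>+\<zeta>. indicator {z. cmod z \<le> r} (bbm_sum \<rho> \<beta> s \<eta> (\<lambda>u. bbm \<rho> \<beta> (1 + t) (\<zeta> u))) \<partial>PiM UNIV (\<lambda>_. bbm_space)) \<le> (\<integral>\<^sup>+\<zeta>. 1 \<partial>PiM UNIV (\<lambda>_::bool list. bbm_space))"
      by (intro nn_integral_mono) (simp split: split_indicator)
    also have "\<dots> = 1" by (simp add: KK.emeasure_space_1)
    also note 1
    finally show ?thesis by (rule order_trans) simp
  qed
  have "ennreal (psmall \<beta> (s + (1 + t)) r) = (\<integral>\<^sup>+\<eta>. \<integral>\<^sup>+\<zeta>. indicator {z. cmod z \<le> r} (bbm_sum \<rho> \<beta> s \<eta> (\<lambda>u. bbm \<rho> \<beta> (1 + t) (\<zeta> u))) \<partial>PiM UNIV (\<lambda>_. bbm_space) \<partial>bbm_space)"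
    unfolding psmall_eq_nn by (rule bbm_branching) (use s t in auto)
  also have "\<dots> \<le> (\<integral>\<^sup>+\<eta>. ennreal ((1 - p') powr cmod (bbm \<rho> 0 s \<eta>)) + ennreal q + ennreal \<alpha> * ennreal (rsum (- Re \<beta>) s \<eta>) \<partial>bbm_space)"
  proof (rule nn_integral_mono_AE)
    show "AE \<eta> in bbm_space. (\<integral>\<^sup>+\<zeta>. indicator {z. cmod z \<le> r} (bbm_sum \<rho> \<beta> s \<eta> (\<lambda>u. bbm \<rho> \<beta> (1 + t) (\<zeta> u))) \<partial>PiM UNIV (\<lambda>_. bbm_space))
     \<le> ennreal ((1 - p') powr cmod (bbm \<rho> 0 s \<eta>)) + ennreal q + ennreal \<alpha> * ennreal (rsum (- Re \<beta>) s \<eta>)"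
      using AE_bbm_tree_ok by eventually_elim (rule cond)
  qed
  also have "\<dots> = (\<integral>\<^sup>+\<eta>. ennreal ((1 - p') powr cmod (bbm \<rho> 0 s \<eta>)) \<partial>bbm_space) + ennreal q + ennreal \<alpha> * (\<integral>\<^sup>+\<eta>. ennreal (rsum (- Re \<beta>) s \<eta>) \<partial>bbm_space)"
    by (simp add: nn_integral_add nn_integral_cmult P.emeasure_space_1)
  also have "\<dots> \<le> ennreal (exp (- s) / (1 - (1 - p'))) + ennreal q + ennreal \<alpha> * ennreal (exp ((1 + (- Re \<beta>)\<^sup>2 / 2) * s))"
    using s p' p'1 by (intro add_mono mult_left_mono bbm_count_generating_function rsum_mean_le) auto
  also have "\<dots> = ennreal (exp (- s) / p' + q + \<alpha> * exp ((1 + (Re \<beta>)\<^sup>2 / 2) * s))"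
    using p' q0 \<alpha> by (simp add: ennreal_mult[symmetric] ennreal_plus[symmetric] del: ennreal_plus)
  finally show ?thesis
    using p' q0 \<alpha> by (subst (asm) ennreal_le_iff) (auto intro!: add_nonneg_nonneg)
qed

end

lemma exp_linear_tendsto_0:
  fixes a b :: real
  assumes "a < 0"
  shows "((\<lambda>t. exp (a * t + b)) \<longlongrightarrow> 0) at_top"
proof -
  have "filterlim (\<lambda>t::real. a * t) at_bot at_top"
    using assms by (intro filterlim_tendsto_neg_mult_at_bot[OF tendsto_const] filterlim_ident) auto
  then have "((\<lambda>t. exp (a * t)) \<longlongrightarrow> 0) at_top" by (rule filterlim_compose[OF exp_at_bot])
  then have "((\<lambda>t. exp (a * t) * exp b) \<longlongrightarrow> 0 * exp b) at_top" by (intro tendsto_mult tendsto_const)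
  then show ?thesis by (simp add: exp_add)
qed

context bbm_corr
begin

text \<open>At time \<open>s\<close>, a small fraction h of \<open>T\<close>, about exp (s) subtrees
  are available, against a success probability of at least exp (- s / 2) up to a constant. So few
  particles that none succeeds is unlikely, and restarting this early costs a rate of at most
  \<epsilon> / 2.\<close>

lemma lower_tail_nonzero:
  assumes \<beta>: "\<beta> \<noteq> 0" and low: "lower_prob \<beta> F" and \<epsilon>: "0 < \<epsilon>"
  shows "((\<lambda>t. psmall \<beta> t (exp ((F - \<epsilon>) * t))) \<longlongrightarrow> 0) at_top"
proof (rule order_tendstoI)
  fix e :: real assume e: "0 < e"
  obtain \<kappa> where \<kappa>: "0 < \<kappa>" "\<And>b. measure gauss2 {p \<in> space gauss2. cmod (exp (disp \<rho> \<beta> 1 p) - b) \<le> \<kappa>} \<le> e / 3"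
    using exp_disp_concentration[OF \<beta> rho, of "e / 3"] e by auto
  \<comment> \<open>With weights cut at \<alpha> = exp (- D s), this \<open>D\<close> makes the
    third error term of \<open>psmall_bound\<close> at most exp (- s).\<close>
  define D where "D = 2 + (Re \<beta>)\<^sup>2"
  \<comment> \<open>Small enough that losing the time \<open>s\<close> and cutting at \<alpha>
    together cost at most \<epsilon> / 4 in the rate; at most 1/2 so that a nonnegative time remains
    after \<open>s\<close> and the unit displacement.\<close>
  define h where "h = min (1 / 2) (\<epsilon> / (4 * (D + \<bar>F\<bar> + \<epsilon>)))"
  have D: "2 \<le> D" by (simp add: D_def)
  have den: "0 < D + \<bar>F\<bar> + \<epsilon>" using D \<epsilon> by simp
  have h: "0 < h" "h \<le> 1 / 2" unfolding h_def using den \<epsilon> by (simp, intro min.cobounded1)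
  have hD: "h * (D + \<bar>F\<bar> + \<epsilon>) \<le> \<epsilon> / 4"
  proof -
    have "h \<le> \<epsilon> / (4 * (D + \<bar>F\<bar> + \<epsilon>))" by (simp add: h_def)
    then have "h * (D + \<bar>F\<bar> + \<epsilon>) \<le> \<epsilon> / (4 * (D + \<bar>F\<bar> + \<epsilon>)) * (D + \<bar>F\<bar> + \<epsilon>)" using den by (intro mult_right_mono) auto
    also have "\<dots> = \<epsilon> / 4" using den by (simp add: field_simps)
    finally show ?thesis .
  qed
  have lim: "filterlim (\<lambda>T::real. (1 - h) * T - 1) at_top at_top"
  proof -
    have "filterlim (\<lambda>T::real. (1 - h) * T) at_top at_top"
      using h by (intro filterlim_tendsto_pos_mult_at_top[OF tendsto_const] filterlim_ident) auto
    then have "filterlim (\<lambda>T::real. - 1 + (1 - h) * T) at_top at_top"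
      by (rule filterlim_tendsto_add_at_top[OF tendsto_const])
    then show ?thesis by (simp add: add.commute)
  qed
  have "0 < \<epsilon> / 2" "0 < h / 2" using \<epsilon> h by auto
  then have "eventually (\<lambda>t. exp (- (h / 2) * t) \<le> plarge \<beta> t (exp ((F - \<epsilon> / 2) * t))) at_top"
    using low unfolding lower_prob_def by blast
  from eventually_compose_filterlim[OF this lim]
  have ev1: "eventually (\<lambda>T. exp (- (h / 2) * ((1 - h) * T - 1)) \<le> plarge \<beta> ((1 - h) * T - 1) (exp ((F - \<epsilon> / 2) * ((1 - h) * T - 1)))) at_top" .
  have ev2: "eventually (\<lambda>T. (F - \<epsilon> / 2) - ln \<kappa> \<le> \<epsilon> / 4 * T) at_top" using \<epsilon> by (intro eventually_linear_ge) simp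
  have ev3: "eventually (\<lambda>T. exp (- (h / 2) * T + 1) < e / 3) at_top"
    using order_tendstoD(2)[OF exp_linear_tendsto_0[of "- (h / 2)" 1], of "e / 3"] h e by simp
  have ev4: "eventually (\<lambda>T. exp (- h * T + 0) < e / 3) at_top"
    using order_tendstoD(2)[OF exp_linear_tendsto_0[of "- h" 0], of "e / 3"] h e by simp
  show "eventually (\<lambda>t. psmall \<beta> t (exp ((F - \<epsilon>) * t)) < e) at_top"
    using ev1 ev2 ev3 ev4 eventually_ge_at_top[of 2]
  proof eventually_elim
    case (elim T)
    define s where "s = h * T"
    define t where "t = (1 - h) * T - 1"
    define \<alpha> where "\<alpha> = exp (- (D * s))"
    define R where "R = exp ((F - \<epsilon> / 2) * t)"
    define p' where "p' = exp (- 1) * plarge \<beta> t R"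
    have s: "0 \<le> s" unfolding s_def using h elim by simp
    have "1 / 2 * 2 \<le> (1 - h) * T" using h elim by (intro mult_mono) auto
    then have t: "0 \<le> t" unfolding t_def by simp
    have T: "T = s + (1 + t)" by (simp add: s_def t_def algebra_simps)
    have tT: "t \<le> T" using s T by simp
    have pl: "exp (- (h / 2) * t) \<le> plarge \<beta> t R" using elim(1) by (simp add: R_def t_def)
    have "exp (- (h / 2) * T) \<le> exp (- (h / 2) * t)" using tT h by simp
    also note pl
    finally have "exp (- 1) * exp (- (h / 2) * T) \<le> p'" unfolding p'_def by (intro mult_left_mono) auto
    then have p': "exp (- 1 - h / 2 * T) \<le> p'" by (simp add: mult_exp_exp)
    then have p'0: "0 < p'" using exp_gt_zero less_le_trans by blast
    have r: "exp ((F - \<epsilon>) * T) \<le> \<kappa> * \<alpha> * R"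
    proof -
      have "\<kappa> * \<alpha> * R = exp (ln \<kappa>) * exp (- (D * s)) * exp ((F - \<epsilon> / 2) * t)"
        using \<kappa>(1) by (simp add: \<alpha>_def R_def)
      then have "\<kappa> * \<alpha> * R = exp (ln \<kappa> + - (D * s) + (F - \<epsilon> / 2) * t)" by (simp only: exp_add)
      moreover have "(F - \<epsilon>) * T \<le> ln \<kappa> + - (D * s) + (F - \<epsilon> / 2) * t"
      proof -
        have "D * s + (F - \<epsilon> / 2) * s \<le> (D + \<bar>F\<bar> + \<epsilon>) * s"
          unfolding distrib_right[symmetric] using s \<epsilon> by (intro mult_right_mono) auto
        also have "\<dots> = h * (D + \<bar>F\<bar> + \<epsilon>) * T" by (simp add: s_def)
        also have "\<dots> \<le> \<epsilon> / 4 * T" using hD elim by (intro mult_right_mono) auto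
        finally have 1: "D * s + (F - \<epsilon> / 2) * s \<le> \<epsilon> / 4 * T" .
        have tt: "t = T - s - 1" using T by simp
        have "(F - \<epsilon> / 2) * t = (F - \<epsilon> / 2) * T - (F - \<epsilon> / 2) * s - (F - \<epsilon> / 2)"
          unfolding tt by (simp only: right_diff_distrib mult_1_right)
        moreover have "(F - \<epsilon>) * T = (F - \<epsilon> / 2) * T - \<epsilon> / 4 * T - \<epsilon> / 4 * T" by (simp add: algebra_simps)
        ultimately show ?thesis using 1 elim(2) by linarith
      qed
      ultimately show ?thesis by simp
    qed
    have "psmall \<beta> T (exp ((F - \<epsilon>) * T)) \<le> exp (- s) / p' + e / 3 + \<alpha> * exp ((1 + (Re \<beta>)\<^sup>2 / 2) * s)"
      unfolding T
      by (rule psmall_bound[OF s t _ _ \<kappa>(2) _ p'_def p'0]) (use r T in \<open>auto simp: R_def \<alpha>_def\<close>)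
    also have "exp (- s) / p' \<le> exp (- (h / 2) * T + 1)"
    proof -
      have "exp (- s) / p' \<le> exp (- s) / exp (- 1 - h / 2 * T)" using p' p'0 by (intro divide_left_mono) auto
      also have "\<dots> = exp (- (h / 2) * T + 1)" by (simp add: exp_diff[symmetric] s_def algebra_simps)
      finally show ?thesis .
    qed
    also have "\<alpha> * exp ((1 + (Re \<beta>)\<^sup>2 / 2) * s) \<le> exp (- h * T + 0)"
    proof -
      have "- (D * s) + (1 + (Re \<beta>)\<^sup>2 / 2) * s = - s - (Re \<beta>)\<^sup>2 / 2 * s" by (simp add: D_def algebra_simps)
      also have "\<dots> \<le> - s" using s by simp
      finally show ?thesis by (simp add: \<alpha>_def mult_exp_exp s_def)
    qed
    finally show ?case using elim(3,4) by linarith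
  qed
qed (simp add: psmall_def less_le_trans[OF _ measure_nonneg])

text \<open>For \<beta> = 0 the displacement factor is constant and the argument above does not
  apply. Here the sum is the particle number itself, and its generating function bounds the
  probability of a small value.\<close>

lemma lower_tail_zero:
  assumes \<epsilon>: "0 < \<epsilon>"
  shows "((\<lambda>t. psmall 0 t (exp ((1 - \<epsilon>) * t))) \<longlongrightarrow> 0) at_top"
proof (rule tendsto_sandwich)
  show "eventually (\<lambda>t. 0 \<le> psmall 0 t (exp ((1 - \<epsilon>) * t))) at_top" by (simp add: psmall_def)
  have bound: "psmall 0 t m \<le> 2 * exp 1 * (exp (- t) * M)" if t: "0 \<le> t" and M: "m \<le> M" "1 \<le> M" for t m M
  proof -
    interpret P: prob_space bbm_space by (rule prob_space_bbm_space)
    \<comment> \<open>Then z^N is at least exp (- 1) for N at most M, while 1 / (1 - z) is of order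
      M.\<close>
    define z where "z = exp (- (1 / M))"
    have z: "0 < z" "z < 1" using M by (auto simp: z_def)
    have inv: "1 / (1 - z) \<le> 2 * M"
    proof -
      have "1 + 1 / M \<le> exp (1 / M)" by (rule exp_ge_add_one_self)
      then have "z \<le> 1 / (1 + 1 / M)" unfolding z_def exp_minus using M
        by (simp add: inverse_eq_divide divide_left_mono add_pos_pos)
      also have "\<dots> = M / (M + 1)" using M by (simp add: field_simps)
      also have "\<dots> \<le> 1 - 1 / (2 * M)" using M by (simp add: field_simps)
      finally have "1 / (2 * M) \<le> 1 - z" by simp
      then have "1 / (1 - z) \<le> 1 / (1 / (2 * M))" using M z by (intro divide_left_mono) auto
      then show ?thesis using M by simp
    qed
    have "ennreal (psmall 0 t m) \<le> (\<integral>\<^sup>+\<omega>. ennreal (exp 1) * ennreal (z powr cmod (bbm \<rho> 0 t \<omega>)) \<partial>bbm_space)"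
      unfolding psmall_eq_nn
    proof (rule nn_integral_mono)
      fix \<omega>
      have "1 \<le> exp 1 * z powr cmod (bbm \<rho> 0 t \<omega>)" if "cmod (bbm \<rho> 0 t \<omega>) \<le> m"
      proof -
        have "cmod (bbm \<rho> 0 t \<omega>) / M \<le> 1" using that M by (simp add: divide_le_eq_1)
        then have "1 \<le> exp (1 - cmod (bbm \<rho> 0 t \<omega>) / M)" by simp
        also have "\<dots> = exp 1 * z powr cmod (bbm \<rho> 0 t \<omega>)" by (simp add: z_def powr_def mult_exp_exp)
        finally show ?thesis .
      qed
      then show "indicator {z. cmod z \<le> m} (bbm \<rho> 0 t \<omega>) \<le> ennreal (exp 1) * ennreal (z powr cmod (bbm \<rho> 0 t \<omega>))"
        by (simp add: ennreal_mult[symmetric] split: split_indicator)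
    qed
    also have "\<dots> = ennreal (exp 1) * (\<integral>\<^sup>+\<omega>. ennreal (z powr cmod (bbm \<rho> 0 t \<omega>)) \<partial>bbm_space)"
      by (rule nn_integral_cmult) measurable
    also have "\<dots> \<le> ennreal (exp 1) * ennreal (exp (- t) / (1 - z))"
      by (intro mult_left_mono bbm_count_generating_function z t) simp
    also have "\<dots> = ennreal (exp 1 * (exp (- t) / (1 - z)))" using z by (subst ennreal_mult[symmetric]) auto
    finally have "psmall 0 t m \<le> exp 1 * (exp (- t) / (1 - z))" using z by (subst (asm) ennreal_le_iff) auto
    also have "exp 1 * (exp (- t) / (1 - z)) = exp 1 * exp (- t) * (1 / (1 - z))" by simp
    also have "\<dots> \<le> exp 1 * exp (- t) * (2 * M)" by (intro mult_left_mono inv) simp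
    finally show ?thesis by (simp add: mult_ac)
  qed
  \<comment> \<open>The minimum with 1/2 keeps the threshold \<open>M\<close> of
    \<open>bound\<close> at least 1 also for large \<epsilon>.\<close>
  show "eventually (\<lambda>t. psmall 0 t (exp ((1 - \<epsilon>) * t)) \<le> 2 * exp 1 * (exp (- t) * exp ((1 - min \<epsilon> (1 / 2)) * t))) at_top"
    using eventually_ge_at_top[of 0]
  proof eventually_elim
    case (elim t)
    then have t0: "0 \<le> t" .
    have "1 \<le> exp ((1 - min \<epsilon> (1 / 2)) * t)" using t0 by simp
    moreover have "exp ((1 - \<epsilon>) * t) \<le> exp ((1 - min \<epsilon> (1 / 2)) * t)" using t0 by (auto intro!: mult_right_mono)
    ultimately show ?case by (intro bound t0)
  qed
  have "((\<lambda>t. 2 * exp 1 * exp (- min \<epsilon> (1 / 2) * t + 0)) \<longlongrightarrow> 2 * exp 1 * 0) at_top"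
    using \<epsilon> by (intro tendsto_mult tendsto_const exp_linear_tendsto_0) auto
  then show "((\<lambda>t. 2 * exp 1 * (exp (- t) * exp ((1 - min \<epsilon> (1 / 2)) * t))) \<longlongrightarrow> 0) at_top"
    by (simp add: mult_exp_exp algebra_simps)
qed (rule tendsto_const)

end

section \<open>Lower bounds in the frozen and the square-root phase\<close>

text \<open>Up to the factor exp (b y), the two terms are exp ((b - a) (x - y)) and exp ((c - b) (y
  - x)), and one of them is at least 1. Positions below the cut \<open>x\<close> are charged to the
  tilt \<open>a\<close>, those above it to \<open>c\<close>.\<close>

lemma exp_interpolate:
  fixes a b c x y :: real
  assumes "a \<le> b" "b \<le> c"
  shows "exp (b * y) \<le> exp ((b - a) * x) * exp (a * y) + exp (- ((c - b) * x)) * exp (c * y)"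
proof (cases "y \<le> x")
  case True
  have "b * y = (b - a) * y + a * y" by (simp add: algebra_simps)
  also have "\<dots> \<le> (b - a) * x + a * y" using True assms by (simp add: mult_left_mono)
  finally have "exp (b * y) \<le> exp ((b - a) * x) * exp (a * y)" by (simp add: mult_exp_exp)
  then show ?thesis by (rule order_trans) simp
next
  case False
  have "b * y = - ((c - b) * y) + c * y" by (simp add: algebra_simps)
  also have "\<dots> \<le> - ((c - b) * x) + c * y" using False assms by (simp add: mult_left_mono)
  finally have "exp (b * y) \<le> exp (- ((c - b) * x)) * exp (c * y)" by (simp add: mult_exp_exp)
  then show ?thesis by (rule order_trans) simp
qed

text \<open>The rate obtained at tilt \<open>c\<close> from the rate 1 + b^2 / 2 at b = q - h, with
  the cut at a = q - 2 h. As \<open>h\<close> tends to 0 it tends to q c, the rate of the second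
  phase.\<close>

lemma tilt_identity:
  fixes q h c :: real
  assumes "q * q = 2"
  shows "1 + (q - h)\<^sup>2 / 2 + (c - (q - h)) * (q - 2 * h) = q * c + 2 * h * q - 2 * (h * c) - 3 / 2 * h\<^sup>2"
proof -
  have 1: "(q - h)\<^sup>2 = 2 - 2 * (h * q) + h\<^sup>2" using assms by (simp add: power2_eq_square algebra_simps)
  have 2: "(c - (q - h)) * (q - 2 * h) = q * c - 2 * (h * c) - q * q + 3 * (h * q) - 2 * h\<^sup>2"
    by (simp add: power2_eq_square algebra_simps)
  show ?thesis unfolding 1 2 assms by (simp add: field_simps)
qed

lemma rsum_interpolate:
  fixes a b c x g :: real
  assumes "a \<le> b" "b \<le> c"
  shows "rsum (g * b) s \<eta> \<le> exp ((b - a) * x) * rsum (g * a) s \<eta> + exp (- ((c - b) * x)) * rsum (g * c) s \<eta>"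
proof -
  have "exp (g * b * bbm_pos s \<eta> u) \<le> exp ((b - a) * x) * exp (g * a * bbm_pos s \<eta> u) + exp (- ((c - b) * x)) * exp (g * c * bbm_pos s \<eta> u)" for u
    using exp_interpolate[OF assms, of "g * bbm_pos s \<eta> u" x] by (simp add: mult_ac)
  then show ?thesis unfolding rsum_def sum_distrib_left sum.distrib[symmetric] by (intro sum_mono)
qed

text \<open>In the disc part p = 2 works. Otherwise p = sqrt 2 / |Re \<beta>| minimises (1 + p^2 (Re
  \<beta>)^2 / 2) / p, with value sqrt 2 |Re \<beta>|; squaring |Im \<beta>| <= sqrt 2 - |Re
  \<beta>| shows that this is at most \<open>rate1\<close>. The strict bound on |Re \<beta>| makes p
  > 1.\<close>

lemma exists_moment_exponent:
  assumes "(2 * (Re \<beta>)\<^sup>2 \<le> 1 \<and> (Re \<beta>)\<^sup>2 + (Im \<beta>)\<^sup>2 \<le> 1) \<or> (1 \<le> 2 * (Re \<beta>)\<^sup>2 \<and> \<bar>Re \<beta>\<bar> + \<bar>Im \<beta>\<bar> \<le> sqrt 2)"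
    and "\<bar>Re \<beta>\<bar> < sqrt 2"
  obtains p where "1 < p" "p \<le> 2" "1 + p\<^sup>2 * (Re \<beta>)\<^sup>2 / 2 \<le> p * rate1 \<beta>"
proof (cases "2 * (Re \<beta>)\<^sup>2 \<le> 1 \<and> (Re \<beta>)\<^sup>2 + (Im \<beta>)\<^sup>2 \<le> 1")
  case True
  show ?thesis by (rule that[of 2]) (use True in \<open>auto simp: rate1_def field_simps\<close>)
next
  case False
  define s where "s = \<bar>Re \<beta>\<bar>"
  have h: "1 \<le> 2 * s\<^sup>2" "s + \<bar>Im \<beta>\<bar> \<le> sqrt 2" using False assms(1) by (auto simp: s_def)
  have s0: "0 < s" using h(1) by (cases "s = 0") (auto simp: s_def)
  show ?thesis
  proof (rule that[of "sqrt 2 / s"])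
    show "1 < sqrt 2 / s" using assms(2) s0 unfolding s_def[symmetric] by (simp only: less_divide_eq_1_pos)
    have "1\<^sup>2 \<le> (sqrt 2 * s)\<^sup>2" using h(1) by (simp add: power_mult_distrib)
    then have "1 \<le> sqrt 2 * s" by (rule power2_le_imp_le) (use s0 in simp)
    then have "sqrt 2 * 1 \<le> sqrt 2 * (sqrt 2 * s)" by (intro mult_left_mono) auto
    then have "sqrt 2 \<le> 2 * s" by (simp add: mult.assoc[symmetric])
    then show "sqrt 2 / s \<le> 2" using s0 by (simp add: divide_le_eq)
    have "(Im \<beta>)\<^sup>2 \<le> (sqrt 2 - s)\<^sup>2" using h(2) by (simp add: abs_le_square_iff[symmetric])
    also have "\<dots> = 2 - 2 * (sqrt 2 * s) + s\<^sup>2" by (simp add: power2_diff)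
    finally have "sqrt 2 * s \<le> rate1 \<beta>" unfolding rate1_def s_def by (simp add: field_simps)
    then have "sqrt 2 / s * (sqrt 2 * s) \<le> sqrt 2 / s * rate1 \<beta>" using s0 by (intro mult_left_mono) auto
    moreover have "sqrt 2 / s * (sqrt 2 * s) = 2" using s0 by simp
    moreover have "(sqrt 2 / s)\<^sup>2 * (Re \<beta>)\<^sup>2 / 2 = 1" using s0 by (simp add: power_divide s_def)
    ultimately show "1 + (sqrt 2 / s)\<^sup>2 * (Re \<beta>)\<^sup>2 / 2 \<le> sqrt 2 / s * rate1 \<beta>" by linarith
  qed
qed

context bbm_corr
begin

lemma plarge_real: "plarge (complex_of_real \<theta>) t r = measure bbm_space {\<omega> \<in> space bbm_space. r \<le> rsum \<theta> t \<omega>}"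
  unfolding plarge_def rsum_eq[of \<theta> t _ \<rho>] ..

lemma exists_moment_exponent_real:
  assumes "\<bar>\<theta>\<bar> < sqrt 2"
  obtains p where "1 < p" "p \<le> 2" "1 + p\<^sup>2 * (Re (complex_of_real \<theta>))\<^sup>2 / 2 \<le> p * rate1 (complex_of_real \<theta>)"
proof -
  have "(2 * \<theta>\<^sup>2 \<le> 1 \<and> \<theta>\<^sup>2 + 0 \<le> 1) \<or> (1 \<le> 2 * \<theta>\<^sup>2 \<and> \<bar>\<theta>\<bar> + 0 \<le> sqrt 2)"
    using assms by auto
  then show ?thesis using exists_moment_exponent[of "complex_of_real \<theta>"] assms that by auto
qed

lemma rate1_real: "rate1 (complex_of_real \<theta>) = 1 + \<theta>\<^sup>2 / 2"
  by (simp add: rate1_def)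

text \<open>At \<open>b\<close> slightly below \<open>\<surd>2\<close> the sum has its mean rate. Interpolating \<open>e^(b y)\<close> between \<open>e^(a y)\<close> with
  \<open>a < b\<close>, whose contribution is negligible by its mean, and \<open>e^(c y)\<close> with \<open>c = |\<theta>|\<close> carries the bound to \<open>\<theta>\<close>.\<close>

lemma lower_prob_real_large:
  assumes \<theta>: "sqrt 2 \<le> \<bar>\<theta>\<bar>"
  shows "lower_prob (complex_of_real \<theta>) (sqrt 2 * \<bar>\<theta>\<bar>)"
  unfolding lower_prob_def
proof (intro allI impI)
  fix \<epsilon> \<delta> :: real assume pos: "0 < \<epsilon>" "0 < \<delta>"
  interpret P: prob_space bbm_space by (rule prob_space_bbm_space)
  define c where "c = \<bar>\<theta>\<bar>"
  \<comment> \<open>The sign of \<theta>; with it positive and negative \<theta> are treated by the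
    same tilts a < b < c.\<close>
  define g where "g = sgn \<theta>"
  have s2: "1 < sqrt 2" "sqrt 2 < 2" "sqrt 2 * sqrt 2 = (2::real)" by (auto simp: real_less_lsqrt)
  have c: "sqrt 2 \<le> c" "1 < c" using \<theta> less_le_trans[OF s2(1) \<theta>] by (auto simp: c_def)
  have g: "g * c = \<theta>" "g\<^sup>2 = 1" "\<bar>g\<bar> = 1" using c by (auto simp: g_def c_def sgn_if)
  \<comment> \<open>The loss in the rate at \<open>c\<close> is at most 2 h c + 3/2 h^2, so h of
    order \<epsilon> / c suffices; h <= 1/4 keeps \<open>a\<close> and \<open>b\<close>
    positive.\<close>
  define h where "h = min (1 / 4) (\<epsilon> / (8 * c))"
  have h: "0 < h" "h \<le> 1 / 4" "h \<le> \<epsilon> / (8 * c)" unfolding h_def using pos c by auto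
  have hc: "h * c \<le> \<epsilon> / 8" using h(3) c by (simp add: field_simps)
  define b where "b = sqrt 2 - h"
  define a where "a = sqrt 2 - 2 * h"
  have ab: "0 < a" "a \<le> b" "b \<le> c" "b < sqrt 2" "0 < b" "a < sqrt 2" using h(1,2) s2(1) c(1) unfolding a_def b_def by linarith+
  \<comment> \<open>At most h^2 / 4, so that the event \<open>?A\<close> at tilt \<open>b\<close>
    stays more likely than \<open>?B\<close>, whose probability decays at rate h^2 / 2.\<close>
  define \<delta>1 where "\<delta>1 = min (\<delta> / 2) (h\<^sup>2 / 4)"
  have \<delta>1: "0 < \<delta>1" "\<delta>1 \<le> \<delta> / 2" "\<delta>1 \<le> h\<^sup>2 / 4" unfolding \<delta>1_def using pos h by auto
  have gb: "\<bar>g * b\<bar> < sqrt 2" using ab g by (simp add: abs_mult)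
  obtain p where p: "1 < p" "p \<le> 2" "1 + p\<^sup>2 * (Re (complex_of_real (g * b)))\<^sup>2 / 2 \<le> p * rate1 (complex_of_real (g * b))"
    using exists_moment_exponent_real[OF gb] by blast
  define r1 where "r1 = 1 + b\<^sup>2 / 2"
  have r1: "rate1 (complex_of_real (g * b)) = r1" unfolding rate1_real r1_def by (simp add: power_mult_distrib g)
  have evA: "eventually (\<lambda>t. exp (- \<delta>1 * t) \<le> plarge (complex_of_real (g * b)) t (exp (r1 * t) / 2)) at_top"
    using plarge_half_mean[OF p \<delta>1(1)] unfolding r1 .
  have ev1: "eventually (\<lambda>t. ln 8 \<le> (h\<^sup>2 / 4) * t) at_top" using h by (intro eventually_linear_ge) simp
  have ev2: "eventually (\<lambda>t. ln 2 \<le> \<delta> / 2 * t) at_top" using pos by (intro eventually_linear_ge) simp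
  have ev3: "eventually (\<lambda>t. ln 4 \<le> \<epsilon> / 4 * t) at_top" using pos by (intro eventually_linear_ge) simp
  show "eventually (\<lambda>t. exp (- \<delta> * t) \<le> plarge (complex_of_real \<theta>) t (exp ((sqrt 2 * \<bar>\<theta>\<bar> - \<epsilon>) * t))) at_top"
    using evA ev1 ev2 ev3 eventually_ge_at_top[of 0]
  proof eventually_elim
    case (elim t)
    then have t: "0 \<le> t" by simp
    \<comment> \<open>The sum at tilt \<open>b\<close> is carried by positions near b t. Cutting h t
      below them makes the lower part negligible: the rate of its mean is smaller by (b - a)^2 / 2 =
      h^2 / 2.\<close>
    define x where "x = a * t"
    define E where "E = exp (r1 * t)"
    let ?A = "{\<omega> \<in> space bbm_space. E / 2 \<le> rsum (g * b) t \<omega>}"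
    let ?B = "{\<omega> \<in> space bbm_space. E / 4 / exp ((b - a) * x) \<le> rsum (g * a) t \<omega>}"
    let ?C = "{\<omega> \<in> space bbm_space. exp ((sqrt 2 * \<bar>\<theta>\<bar> - \<epsilon>) * t) \<le> rsum \<theta> t \<omega>}"
    have "?A \<subseteq> ?B \<union> ?C"
    proof
      fix \<omega> assume A: "\<omega> \<in> ?A"
      show "\<omega> \<in> ?B \<union> ?C"
      proof (cases "\<omega> \<in> ?B")
        case False
        then have "rsum (g * a) t \<omega> < E / 4 / exp ((b - a) * x)" using A by auto
        then have "exp ((b - a) * x) * rsum (g * a) t \<omega> < E / 4" by (simp add: pos_less_divide_eq mult.commute)
        moreover have "rsum (g * b) t \<omega> \<le> exp ((b - a) * x) * rsum (g * a) t \<omega> + exp (- ((c - b) * x)) * rsum (g * c) t \<omega>"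
          by (rule rsum_interpolate[OF ab(2,3)])
        moreover have "E / 2 \<le> rsum (g * b) t \<omega>" using A by simp
        ultimately have "E / 4 \<le> exp (- ((c - b) * x)) * rsum \<theta> t \<omega>" using g(1) by simp
        then have "E / 4 * exp ((c - b) * x) \<le> (exp (- ((c - b) * x)) * rsum \<theta> t \<omega>) * exp ((c - b) * x)" by (intro mult_right_mono) auto
        also have "\<dots> = rsum \<theta> t \<omega> * (exp (- ((c - b) * x)) * exp ((c - b) * x))" by (simp only: mult_ac)
        also have "\<dots> = rsum \<theta> t \<omega>" by (simp add: mult_exp_exp del: exp_minus_inverse)
        finally have 1: "E / 4 * exp ((c - b) * x) \<le> rsum \<theta> t \<omega>" .
        have "exp ((sqrt 2 * \<bar>\<theta>\<bar> - \<epsilon>) * t) \<le> exp (- ln 4 + r1 * t + (c - b) * x)"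
        proof -
          have "sqrt 2 * c - \<epsilon> \<le> - (\<epsilon> / 4) + r1 + (c - b) * a"
          proof -
            have "r1 + (c - b) * a = sqrt 2 * c + 2 * h * sqrt 2 - 2 * (h * c) - 3 / 2 * h\<^sup>2"
              unfolding r1_def a_def b_def by (rule tilt_identity[OF s2(3)])
            moreover have "h\<^sup>2 \<le> h * c" unfolding power2_eq_square using h c by (intro mult_left_mono) auto
            moreover have "0 \<le> 2 * h * sqrt 2" using h by simp
            ultimately show ?thesis using hc pos by linarith
          qed
          then have "(sqrt 2 * c - \<epsilon>) * t \<le> (- (\<epsilon> / 4) + r1 + (c - b) * a) * t" using t by (rule mult_right_mono)
          also have "\<dots> = - (\<epsilon> / 4 * t) + r1 * t + (c - b) * x" by (simp add: x_def algebra_simps)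
          finally show ?thesis using elim(4) by (simp add: c_def)
        qed
        also have "\<dots> = E / 4 * exp ((c - b) * x)" unfolding exp_add E_def by (simp add: exp_minus)
        finally have "exp ((sqrt 2 * \<bar>\<theta>\<bar> - \<epsilon>) * t) \<le> E / 4 * exp ((c - b) * x)" .
        then have "exp ((sqrt 2 * \<bar>\<theta>\<bar> - \<epsilon>) * t) \<le> rsum \<theta> t \<omega>" using 1 by (rule order_trans)
        then show ?thesis using A by simp
      qed simp
    qed
    moreover have BC: "?B \<in> sets bbm_space" "?C \<in> sets bbm_space" by measurable
    ultimately have "measure bbm_space ?A \<le> measure bbm_space (?B \<union> ?C)" by (intro P.finite_measure_mono sets.Un)
    moreover have "measure bbm_space (?B \<union> ?C) \<le> measure bbm_space ?B + measure bbm_space ?C" by (rule measure_Un_le[OF BC])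
    ultimately have AB: "measure bbm_space ?A \<le> measure bbm_space ?B + measure bbm_space ?C" by (rule order_trans)
    have B: "measure bbm_space ?B \<le> exp (- \<delta>1 * t) / 2"
    proof -
      have m: "pmom 1 (complex_of_real (g * a)) t \<le> ennreal (exp ((1 + a\<^sup>2 / 2) * t))"
      proof -
        have "2 * powr_const 1 - 1 + 1\<^sup>2 * (Re (complex_of_real (g * a)))\<^sup>2 / 2 = 1 + a\<^sup>2 / 2"
          by (simp add: powr_const_def power_mult_distrib g)
        then show ?thesis using bbm_moment[OF zero_less_one t, of \<rho> "complex_of_real (g * a)"] unfolding pmom_def by (simp only:)
      qed
      have "measure bbm_space ?B \<le> exp ((1 + a\<^sup>2 / 2) * t) / (E / 4 / exp ((b - a) * x)) powr 1"
        unfolding plarge_real[symmetric] by (rule plarge_markov[OF _ _ m]) (auto simp: E_def)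
      also have "\<dots> = 4 * (exp ((1 + a\<^sup>2 / 2) * t) * exp ((b - a) * x) / E)"
        by (simp add: E_def)
      also have "\<dots> = 4 * exp ((1 + a\<^sup>2 / 2) * t + (b - a) * x - r1 * t)"
        unfolding E_def exp_add exp_diff ..
      also have "(1 + a\<^sup>2 / 2) * t + (b - a) * x - r1 * t = - (h\<^sup>2 / 2) * t"
      proof -
        have "2 * (1 + a\<^sup>2 / 2 + (b - a) * a - r1) = - h\<^sup>2"
          unfolding r1_def a_def b_def by (simp add: power2_eq_square algebra_simps add_divide_distrib diff_divide_distrib)
        then have "1 + a\<^sup>2 / 2 + (b - a) * a - r1 = - (h\<^sup>2 / 2)" by simp
        then have "(1 + a\<^sup>2 / 2 + (b - a) * a - r1) * t = - (h\<^sup>2 / 2) * t" by simp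
        then show ?thesis unfolding x_def by (simp only: ring_distribs mult.assoc)
      qed
      also have "4 * exp (- (h\<^sup>2 / 2) * t) = 4 * (exp (- (h\<^sup>2 / 4 * t)) * exp (- (h\<^sup>2 / 4 * t)))" by (simp add: mult_exp_exp)
      also have "\<dots> \<le> 4 * (exp (- ln 8) * exp (- (\<delta>1 * t)))"
      proof (intro mult_left_mono mult_mono)
        show "exp (- (h\<^sup>2 / 4 * t)) \<le> exp (- ln 8)" using elim(2) by simp
        show "exp (- (h\<^sup>2 / 4 * t)) \<le> exp (- (\<delta>1 * t))" using mult_right_mono[OF \<delta>1(3) t] by simp
      qed auto
      also have "\<dots> = exp (- \<delta>1 * t) / 2" by (simp add: exp_minus)
      finally show ?thesis .
    qed
    have "exp (- \<delta>1 * t) \<le> measure bbm_space ?A" using elim(1) unfolding plarge_real E_def .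
    then have C: "exp (- \<delta>1 * t) / 2 \<le> measure bbm_space ?C" using AB B by linarith
    have "exp (- \<delta> * t) = exp (- (\<delta> / 2 * t)) * exp (- (\<delta> / 2 * t))" by (simp add: mult_exp_exp)
    also have "\<dots> \<le> exp (- ln 2) * exp (- (\<delta>1 * t))"
    proof (intro mult_mono)
      show "exp (- (\<delta> / 2 * t)) \<le> exp (- ln 2)" using elim(3) by simp
      show "exp (- (\<delta> / 2 * t)) \<le> exp (- (\<delta>1 * t))" using mult_right_mono[OF \<delta>1(2) t] by simp
    qed auto
    also have "\<dots> = exp (- \<delta>1 * t) / 2" by (simp add: exp_minus)
    finally have "exp (- \<delta> * t) \<le> exp (- \<delta>1 * t) / 2" .
    then have "exp (- \<delta> * t) \<le> measure bbm_space ?C" using C by (rule order_trans)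
    then show ?case by (simp only: plarge_real)
  qed
qed

text \<open>By \<open>plarge_square_sum\<close> the squared modulus is bounded below by a multiple
  of the real partition function one unit of time earlier, which halves the rate. The time shift and
  the constants are absorbed by \<epsilon> and \<delta>.\<close>

lemma lower_prob_square:
  assumes \<beta>: "\<beta> \<noteq> 0" and low: "lower_prob (complex_of_real (2 * Re \<beta>)) G"
  shows "lower_prob \<beta> (G / 2)"
  unfolding lower_prob_def
proof (intro allI impI)
  fix \<epsilon> \<delta> :: real assume pos: "0 < \<epsilon>" "0 < \<delta>"
  obtain \<kappa> c where \<kappa>: "0 < \<kappa>" "0 < c"
    "\<And>s x. 0 \<le> s \<Longrightarrow> 0 \<le> x \<Longrightarrow> c * measure bbm_space {\<eta> \<in> space bbm_space. x \<le> rsum (2 * Re \<beta>) s \<eta>} \<le> plarge \<beta> (s + 1) (sqrt (\<kappa> * x))"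
    by (rule plarge_square_sum[OF \<beta>]) (rule that)
  have "eventually (\<lambda>t. exp (- (\<delta> / 2) * t) \<le> plarge (complex_of_real (2 * Re \<beta>)) t (exp ((G - \<epsilon>) * t))) at_top"
    using low[unfolded lower_prob_def, rule_format, OF pos(1), of "\<delta> / 2"] pos(2) by (simp only: half_gt_zero)
  moreover have "filterlim (\<lambda>t::real. - 1 + t) at_top at_top"
    by (rule filterlim_tendsto_add_at_top[OF tendsto_const filterlim_ident])
  ultimately have ev: "eventually (\<lambda>t. exp (- (\<delta> / 2) * (- 1 + t)) \<le> plarge (complex_of_real (2 * Re \<beta>)) (- 1 + t) (exp ((G - \<epsilon>) * (- 1 + t)))) at_top"
    by (rule eventually_compose_filterlim)
  have ev1: "eventually (\<lambda>t. - ln c - \<delta> / 2 \<le> \<delta> / 2 * t) at_top" using pos by (intro eventually_linear_ge) simp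
  have ev2: "eventually (\<lambda>t. (G - \<epsilon>) / 2 - ln \<kappa> / 2 \<le> \<epsilon> / 2 * t) at_top" using pos by (intro eventually_linear_ge) simp
  show "eventually (\<lambda>t. exp (- \<delta> * t) \<le> plarge \<beta> t (exp ((G / 2 - \<epsilon>) * t))) at_top"
    using ev ev1 ev2 eventually_ge_at_top[of 1]
  proof eventually_elim
    case (elim t)
    define s where "s = - 1 + t"
    have s: "0 \<le> s" "t = s + 1" using elim by (auto simp: s_def)
    let ?x = "exp ((G - \<epsilon>) * s)"
    have "exp ((G / 2 - \<epsilon>) * t) \<le> sqrt (\<kappa> * ?x)"
    proof -
      have "(\<kappa> * ?x) = (exp (ln \<kappa> / 2 + (G - \<epsilon>) * s / 2))\<^sup>2"
        unfolding power2_eq_square mult_exp_exp using \<kappa>(1) by (simp add: exp_add)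
      then have "sqrt (\<kappa> * ?x) = exp (ln \<kappa> / 2 + (G - \<epsilon>) * s / 2)" by simp
      moreover have "(G / 2 - \<epsilon>) * t \<le> ln \<kappa> / 2 + (G - \<epsilon>) * s / 2"
      proof -
        have "(G - \<epsilon>) * s / 2 = (G / 2 - \<epsilon>) * t + \<epsilon> / 2 * t - (G - \<epsilon>) / 2" by (simp add: s_def field_simps)
        then show ?thesis using elim(3) by linarith
      qed
      ultimately show ?thesis by simp
    qed
    then have "plarge \<beta> t (sqrt (\<kappa> * ?x)) \<le> plarge \<beta> t (exp ((G / 2 - \<epsilon>) * t))" by (rule plarge_mono)
    moreover have "c * plarge (complex_of_real (2 * Re \<beta>)) s ?x \<le> plarge \<beta> t (sqrt (\<kappa> * ?x))"
      using \<kappa>(3)[OF s(1), of ?x] unfolding plarge_real s(2) by (simp only: exp_ge_zero)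
    moreover have "exp (- \<delta> * t) \<le> c * plarge (complex_of_real (2 * Re \<beta>)) s ?x"
    proof -
      have "exp (- \<delta> * t) \<le> exp (ln c + - (\<delta> / 2) * s)" using elim(2) by (simp add: s_def field_simps)
      also have "\<dots> = c * exp (- (\<delta> / 2) * s)" unfolding exp_add using \<kappa>(2) by (simp only: exp_ln)
      also have "\<dots> \<le> c * plarge (complex_of_real (2 * Re \<beta>)) s ?x"
        using elim(1) \<kappa>(2) unfolding s_def by (intro mult_left_mono) auto
      finally show ?thesis .
    qed
    ultimately show ?case by linarith
  qed
qed

end

section \<open>Reduction to the canonical model\<close>

lemma PiM_map:
  fixes A :: "'i \<Rightarrow> 'd measure" and B :: "'i \<Rightarrow> 'k measure"
  assumes A: "\<And>u. prob_space (A u)" and f: "\<And>u. f u \<in> A u \<rightarrow>\<^sub>M B u"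
  shows "distr (PiM UNIV A) (PiM UNIV B) (\<lambda>\<eta> u. f u (\<eta> u)) = PiM UNIV (\<lambda>u. distr (A u) (B u) (f u))"
proof -
  interpret P: prob_space "PiM UNIV A" using A by (intro prob_space_PiM)
  have comp: "(\<lambda>\<eta>. \<eta> u) \<in> PiM UNIV A \<rightarrow>\<^sub>M A u" for u by (rule measurable_component_singleton) simp
  have d: "distr (PiM UNIV A) (A u) (\<lambda>\<eta>. \<eta> u) = A u" for u
    using distr_PiM_component[of UNIV A u] A by simp
  have "P.indep_vars A (\<lambda>u \<eta>. \<eta> u) UNIV"
    using P.indep_vars_iff_distr_eq_PiM'[of UNIV "\<lambda>u \<eta>. \<eta> u" A] comp by (simp add: d distr_id2 restrict_def)
  then have "P.indep_vars B (\<lambda>u \<eta>. f u (\<eta> u)) UNIV" by (rule P.indep_vars_compose2) (rule f)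
  then have "distr (PiM UNIV A) (PiM UNIV B) (\<lambda>\<eta> u. f u (\<eta> u)) = PiM UNIV (\<lambda>u. distr (PiM UNIV A) (B u) (\<lambda>\<eta>. f u (\<eta> u)))"
    using P.indep_vars_iff_distr_eq_PiM'[of UNIV "\<lambda>u \<eta>. f u (\<eta> u)" B] measurable_compose[OF comp f] by (simp add: restrict_def)
  moreover have "distr (PiM UNIV A) (B u) (\<lambda>\<eta>. f u (\<eta> u)) = distr (A u) (B u) (f u)" for u
    using distr_distr[OF f comp, of u] by (simp add: d comp_def)
  ultimately show ?thesis by simp
qed

text \<open>The increment over the list [0, r] is the value at \<open>r\<close>, since paths start
  at 0. For r = 0 that list is not strictly increasing, and the law is the point mass.\<close>

lemma std_bm_marginal:
  assumes "prob_space M" "std_bm M B" "0 \<le> r"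
  shows "distr M borel (\<lambda>\<omega>. B \<omega> r) = distr std_normal borel (\<lambda>x. sqrt r * x)"
proof -
  interpret prob_space M by fact
  interpret N: prob_space std_normal by (rule prob_space_std_normal)
  have B0: "B \<omega> 0 = 0" if "\<omega> \<in> space M" for \<omega> using assms(2) that by (simp add: std_bm_def)
  show ?thesis
  proof (cases "r = 0")
    case True
    have "distr M borel (\<lambda>\<omega>. B \<omega> r) = distr M borel (\<lambda>\<omega>. 0)" by (rule distr_cong) (auto simp: True B0)
    also have "\<dots> = distr std_normal borel (\<lambda>x. 0)" by (simp add: distr_const N.distr_const)
    finally show ?thesis by (simp add: True)
  next
    case False
    have "distributed M lborel (\<lambda>\<omega>. B \<omega> ([0, r] ! Suc 0) - B \<omega> ([0, r] ! 0)) (\<lambda>x. ennreal (normal_density 0 (sqrt ([0, r] ! Suc 0 - [0, r] ! 0)) x))"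
      using assms(2)[unfolded std_bm_def, THEN conjunct2, THEN conjunct2, rule_format, of "[0, r]"] False assms(3) by auto
    then have "density lborel (\<lambda>x. ennreal (normal_density 0 (sqrt r) x)) = distr M lborel (\<lambda>\<omega>. B \<omega> r - B \<omega> 0)"
      using distributed_distr_eq_density by fastforce
    also have "\<dots> = distr M borel (\<lambda>\<omega>. B \<omega> r)" by (rule distr_cong) (auto simp: B0)
    finally have D: "distr M borel (\<lambda>\<omega>. B \<omega> r) = density lborel (\<lambda>x. ennreal (normal_density 0 (sqrt r) x))" ..
    show ?thesis unfolding D
    proof (rule measure_eqI)
      fix A assume "A \<in> sets (density lborel (\<lambda>x. ennreal (normal_density 0 (sqrt r) x)))"
      then have [measurable]: "A \<in> sets borel" by simp
      have "emeasure (distr std_normal borel (\<lambda>x. sqrt r * x)) A = (\<integral>\<^sup>+y. indicator A y \<partial>distr std_normal borel (\<lambda>x. sqrt r * x))"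
        by simp
      also have "\<dots> = (\<integral>\<^sup>+x. indicator A (sqrt r * x) \<partial>std_normal)" by (rule nn_integral_distr) measurable
      also have "\<dots> = (\<integral>\<^sup>+x. ennreal (normal_density 0 (sqrt r) x) * indicator A x \<partial>lborel)"
        using False assms(3) by (intro nn_integral_std_normal_scale) auto
      finally show "emeasure (density lborel (\<lambda>x. ennreal (normal_density 0 (sqrt r) x))) A = emeasure (distr std_normal borel (\<lambda>x. sqrt r * x)) A"
        by (simp add: emeasure_density)
    qed simp
  qed
qed

text \<open>Evaluation at the dyadic approximations makes the value of a path at a random time measurable on the
  product space, and agrees with the path where it is continuous.\<close>

definition path_eval :: "(real \<Rightarrow> real) \<Rightarrow> real \<Rightarrow> real" where
  "path_eval f r = lim (\<lambda>n. f (of_int \<lceil>2 ^ n * r\<rceil> / 2 ^ n))"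

lemma path_eval_continuous:
  assumes "continuous_on {0..} f" "0 \<le> r"
  shows "path_eval f r = f r"
proof -
  let ?x = "\<lambda>n. of_int \<lceil>2 ^ n * r\<rceil> / 2 ^ n :: real"
  \<comment> \<open>The dyadic points approach \<open>r\<close> from the right, so they stay in the
    half-line where the path is known to be continuous.\<close>
  have lo: "r \<le> ?x n" for n
  proof -
    have "2 ^ n * r \<le> of_int \<lceil>2 ^ n * r\<rceil>" by linarith
    then show ?thesis by (simp add: pos_le_divide_eq mult.commute)
  qed
  have up: "?x n \<le> r + 1 / 2 ^ n" for n
  proof -
    have "of_int \<lceil>2 ^ n * r\<rceil> \<le> 2 ^ n * r + 1" by linarith
    also have "\<dots> = (r + 1 / 2 ^ n) * 2 ^ n" by (simp add: distrib_right)
    finally show ?thesis by (simp add: pos_divide_le_eq)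
  qed
  have "(\<lambda>n. r + (1 / 2) ^ n) \<longlonglongrightarrow> r + 0" by (intro tendsto_intros LIMSEQ_power_zero) simp
  then have "(\<lambda>n. r + 1 / 2 ^ n) \<longlonglongrightarrow> r" by (simp add: power_one_over)
  then have "?x \<longlonglongrightarrow> r"
    using lo up by (intro tendsto_sandwich[OF _ _ tendsto_const, of r ?x sequentially "\<lambda>n. r + 1 / 2 ^ n"]) auto
  then have "(\<lambda>n. f (?x n)) \<longlonglongrightarrow> f r"
    using assms order_trans[OF assms(2) lo] by (intro continuous_on_tendsto_compose[OF assms(1)]) auto
  then show ?thesis unfolding path_eval_def by (rule limI)
qed

text \<open>Each approximation reads the path at countably many times only, and at each of them
  evaluation is a coordinate of the product.\<close>

lemma measurable_path_eval: "(\<lambda>x. path_eval (fst x) (snd x)) \<in> borel_measurable (PiM UNIV (\<lambda>_::real. borel) \<Otimes>\<^sub>M borel)"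
  unfolding path_eval_def
proof (rule borel_measurable_lim_metric)
  fix n :: nat
  let ?P = "PiM UNIV (\<lambda>_::real. borel :: real measure) \<Otimes>\<^sub>M (borel :: real measure)"
  show "(\<lambda>x. fst x (of_int \<lceil>2 ^ n * snd x\<rceil> / 2 ^ n)) \<in> borel_measurable ?P"
  proof (rule measurable_compose_countable[where f="\<lambda>k x. fst x (of_int k / 2 ^ n)" and g="\<lambda>x. \<lceil>2 ^ n * snd x\<rceil>"])
    fix k :: int
    show "(\<lambda>x. fst x (of_int k / 2 ^ n)) \<in> borel_measurable ?P"
      using measurable_compose[OF measurable_fst measurable_component_singleton[of "of_int k / 2 ^ n :: real" UNIV "\<lambda>_. borel :: real measure"]] by simp
    show "(\<lambda>x. \<lceil>2 ^ n * snd x\<rceil>) \<in> ?P \<rightarrow>\<^sub>M count_space UNIV" by measurable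
  qed
qed

section \<open>Laws of the lifetimes and of the paths at fixed ages\<close>

definition primitive :: "(bool list \<Rightarrow> 'a \<Rightarrow> real) \<Rightarrow> (bool list \<Rightarrow> 'a \<Rightarrow> real \<Rightarrow> real) \<Rightarrow> (bool list \<Rightarrow> 'a \<Rightarrow> real \<Rightarrow> real) \<Rightarrow>
    bool list \<times> src \<Rightarrow> 'a \<Rightarrow> real \<Rightarrow> real" where
  "primitive L W Z = (\<lambda>(u, k) \<omega>. case k of Life \<Rightarrow> (\<lambda>_. L u \<omega>) | Wx \<Rightarrow> W u \<omega> | Wz \<Rightarrow> Z u \<omega>)"

lemma primitive_simps [simp]:
  "primitive L W Z (u, Life) \<omega> = (\<lambda>_. L u \<omega>)" "primitive L W Z (u, Wx) \<omega> = W u \<omega>" "primitive L W Z (u, Wz) \<omega> = Z u \<omega>"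
  by (simp_all add: primitive_def)

abbreviation path_space :: "(real \<Rightarrow> real) measure" where
  "path_space \<equiv> PiM UNIV (\<lambda>_. borel)"

lemma measurable_path_component: "i \<in> J \<Longrightarrow> (\<lambda>q. q i r) \<in> borel_measurable (PiM J (\<lambda>_. path_space))"
  by (rule measurable_compose[OF measurable_component_singleton[of i]]) (auto intro: measurable_component_singleton)

locale bbm_prim =
  fixes M :: "'a measure" and L W Z
  assumes prim: "bbm_primitives M L W Z"
begin

sublocale prob_space M using prim by (simp add: bbm_primitives_def)

lemma indep_primitive: "indep_vars (\<lambda>_. path_space) (primitive L W Z) UNIV"
  using prim unfolding bbm_primitives_def primitive_def by simp

lemma std_bm_W: "std_bm M (W u)" and std_bm_Z: "std_bm M (Z u)"
  using prim by (auto simp: bbm_primitives_def)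

lemma measurable_L: "L u \<in> borel_measurable M"
  using prim distributed_measurable[of M lborel "L u"] by (auto simp: bbm_primitives_def)

lemma continuous_paths:
  assumes "\<omega> \<in> space M" shows "continuous_on {0..} (W u \<omega>)" "continuous_on {0..} (Z u \<omega>)"
  using assms std_bm_W[of u] std_bm_Z[of u] by (auto simp: std_bm_def)

text \<open>A lifetime is stored in the primitive family as a constant path; evaluation at time 0
  recovers it.\<close>

lemma law_lifetimes: "distr M (PiM UNIV (\<lambda>_. borel)) (\<lambda>\<omega> u. L u \<omega>) = PiM UNIV (\<lambda>_. exp1)"
proof -
  have "indep_vars (\<lambda>u. PiM {(u, Life)} (\<lambda>_. path_space)) (\<lambda>u \<omega>. restrict (\<lambda>i. primitive L W Z i \<omega>) {(u, Life)}) UNIV"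
    by (rule indep_vars_restrict[OF indep_primitive]) (auto simp: disjoint_family_on_def)
  then have "indep_vars (\<lambda>_. borel) (\<lambda>u \<omega>. (restrict (\<lambda>i. primitive L W Z i \<omega>) {(u, Life)}) (u, Life) 0) UNIV"
    by (rule indep_vars_compose2) (rule measurable_path_component, simp)
  then have "indep_vars (\<lambda>_. borel) L UNIV" by simp
  then have "distr M (PiM UNIV (\<lambda>_. borel)) (\<lambda>\<omega> u. L u \<omega>) = PiM UNIV (\<lambda>u. distr M borel (L u))"
    using indep_vars_iff_distr_eq_PiM'[of UNIV L "\<lambda>_. borel"] measurable_L by (simp add: restrict_def)
  moreover have "distr M borel (L u) = exp1" for u
  proof -
    have "distr M lborel (L u) = exp1"
      using prim distributed_distr_eq_density[of M lborel "L u"] by (auto simp: bbm_primitives_def exp1_def)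
    moreover have "distr M borel (L u) = distr M lborel (L u)" by (rule distr_cong) auto
    ultimately show ?thesis by simp
  qed
  ultimately show ?thesis by simp
qed

text \<open>The ages \<open>r\<close> are deterministic, as they are once the lifetimes are frozen.
  Grouping the two paths of each particle gives independence over \<open>u\<close>, and within a
  group the two paths are independent of each other.\<close>

lemma law_displacements:
  assumes r: "\<And>u. 0 \<le> r u"
  shows "distr M (PiM UNIV (\<lambda>_. borel \<Otimes>\<^sub>M borel)) (\<lambda>\<omega> u. (W u \<omega> (r u), Z u \<omega> (r u))) =
    distr (PiM UNIV (\<lambda>_. gauss2)) (PiM UNIV (\<lambda>_. borel \<Otimes>\<^sub>M borel)) (\<lambda>\<eta> u. (sqrt (r u) * fst (\<eta> u), sqrt (r u) * snd (\<eta> u)))"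
proof -
  let ?V = "\<lambda>u \<omega>. (W u \<omega> (r u), Z u \<omega> (r u))"
  let ?S = "\<lambda>u p. (sqrt (r u) * fst p, sqrt (r u) * snd p)"
  have WZ [measurable]: "(\<lambda>\<omega>. W u \<omega> s) \<in> borel_measurable M" "(\<lambda>\<omega>. Z u \<omega> s) \<in> borel_measurable M" for u s
    using std_bm_W[of u] std_bm_Z[of u] by (auto simp: std_bm_def)
  have "indep_vars (\<lambda>u. PiM {(u, Wx), (u, Wz)} (\<lambda>_. path_space)) (\<lambda>u \<omega>. restrict (\<lambda>i. primitive L W Z i \<omega>) {(u, Wx), (u, Wz)}) UNIV"
    by (rule indep_vars_restrict[OF indep_primitive]) (auto simp: disjoint_family_on_def)
  then have "indep_vars (\<lambda>_. borel \<Otimes>\<^sub>M borel) (\<lambda>u \<omega>. (\<lambda>q. (q (u, Wx) (r u), q (u, Wz) (r u))) (restrict (\<lambda>i. primitive L W Z i \<omega>) {(u, Wx), (u, Wz)})) UNIV"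
    by (rule indep_vars_compose2) (intro measurable_Pair measurable_path_component, auto)
  then have "indep_vars (\<lambda>_. borel \<Otimes>\<^sub>M borel) ?V UNIV" by simp
  then have 1: "distr M (PiM UNIV (\<lambda>_. borel \<Otimes>\<^sub>M borel)) (\<lambda>\<omega> u. ?V u \<omega>) = PiM UNIV (\<lambda>u. distr M (borel \<Otimes>\<^sub>M borel) (?V u))"
    using indep_vars_iff_distr_eq_PiM'[of UNIV ?V "\<lambda>_. borel \<Otimes>\<^sub>M borel"] by (simp add: restrict_def)
  have 2: "distr M (borel \<Otimes>\<^sub>M borel) (?V u) = distr gauss2 (borel \<Otimes>\<^sub>M borel) (?S u)" for u
  proof -
    have "indep_var (PiM {(u, Wx)} (\<lambda>_. path_space)) (\<lambda>\<omega>. restrict (\<lambda>i. primitive L W Z i \<omega>) {(u, Wx)})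
        (PiM {(u, Wz)} (\<lambda>_. path_space)) (\<lambda>\<omega>. restrict (\<lambda>i. primitive L W Z i \<omega>) {(u, Wz)})"
      by (rule indep_var_restrict[OF indep_primitive]) auto
    then have "indep_var borel ((\<lambda>q. q (u, Wx) (r u)) \<circ> (\<lambda>\<omega>. restrict (\<lambda>i. primitive L W Z i \<omega>) {(u, Wx)}))
        borel ((\<lambda>q. q (u, Wz) (r u)) \<circ> (\<lambda>\<omega>. restrict (\<lambda>i. primitive L W Z i \<omega>) {(u, Wz)}))"
      by (rule indep_var_compose) (auto intro: measurable_path_component)
    then have "indep_var borel (\<lambda>\<omega>. W u \<omega> (r u)) borel (\<lambda>\<omega>. Z u \<omega> (r u))" by (simp add: comp_def)
    then have "distr M (borel \<Otimes>\<^sub>M borel) (?V u) = distr M borel (\<lambda>\<omega>. W u \<omega> (r u)) \<Otimes>\<^sub>M distr M borel (\<lambda>\<omega>. Z u \<omega> (r u))"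
      unfolding indep_var_distribution_eq by simp
    also have "\<dots> = distr std_normal borel (\<lambda>x. sqrt (r u) * x) \<Otimes>\<^sub>M distr std_normal borel (\<lambda>x. sqrt (r u) * x)"
      unfolding std_bm_marginal[OF prob_space_axioms std_bm_W r] std_bm_marginal[OF prob_space_axioms std_bm_Z r] ..
    also have "\<dots> = distr (std_normal \<Otimes>\<^sub>M std_normal) (borel \<Otimes>\<^sub>M borel) (\<lambda>(x, y). (sqrt (r u) * x, sqrt (r u) * y))"
    proof (rule pair_measure_distr)
      interpret N: prob_space "distr std_normal borel (\<lambda>x. sqrt (r u) * x)"
        by (rule prob_space.prob_space_distr[OF prob_space_std_normal]) simp
      show "sigma_finite_measure (distr std_normal borel (\<lambda>x. sqrt (r u) * x))" ..
    qed auto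
    finally show ?thesis by (simp add: gauss2_def split_beta')
  qed
  have "PiM UNIV (\<lambda>u. distr M (borel \<Otimes>\<^sub>M borel) (?V u)) = distr (PiM UNIV (\<lambda>_. gauss2)) (PiM UNIV (\<lambda>_. borel \<Otimes>\<^sub>M borel)) (\<lambda>\<eta> u. ?S u (\<eta> u))"
    unfolding 2 by (rule PiM_map[symmetric]) (auto intro: prob_space_gauss2)
  then show ?thesis using 1 by simp
qed

end

text \<open>The partition function as a function on the product of lifetimes and paths.
  \<open>path_eval\<close> makes it jointly measurable, so that the two can be separated by
  Fubini.\<close>

definition path_sum :: "real \<Rightarrow> complex \<Rightarrow> real \<Rightarrow> (bool list \<Rightarrow> real) \<Rightarrow> (bool list \<times> src \<Rightarrow> real \<Rightarrow> real) \<Rightarrow> complex" where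
  "path_sum \<rho> \<beta> t l p = tree_sum l (\<lambda>u r. lin \<rho> \<beta> (path_eval (p (u, Wx)) r, path_eval (p (u, Wz)) r)) (\<lambda>_. 1) t"

definition used_time :: "(bool list \<Rightarrow> real) \<Rightarrow> real \<Rightarrow> bool list \<Rightarrow> real" where
  "used_time l t u = (if u \<in> tree_alive l t then t - tree_birth l u else l u)"

lemma used_time_nonneg: "(\<And>u. 0 \<le> l u) \<Longrightarrow> 0 \<le> used_time l t u"
  by (auto simp: used_time_def tree_alive_def)

lemma tree_sum_cong_disp:
  assumes "\<And>u. u \<in> tree_alive l t \<Longrightarrow> tree_pos l d u t = tree_pos l d' u t"
  shows "tree_sum l d y t = tree_sum l d' y t"
  unfolding tree_sum_def using assms by (intro sum.cong) auto

text \<open>A particle contributes its displacement at a single age only: at its death if it has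
  descendants at time \<open>t\<close>, and at age \<open>t\<close> minus birth time if it is alive at time \<open>t\<close>.\<close>

lemma tree_sum_used_time:
  assumes l: "\<And>u. 0 \<le> l u"
  shows "tree_sum l d y t = tree_sum l (\<lambda>u _. d u (used_time l t u)) y t"
proof (rule tree_sum_cong_disp)
  fix u assume u: "u \<in> tree_alive l t"
  have "used_time l t (take k u) = l (take k u)" if "k < length u" for k
    using tree_alive_prefix[of l u t k, OF l u that] by (simp add: used_time_def)
  moreover have "used_time l t u = t - tree_birth l u" using u by (simp add: used_time_def)
  ultimately show "tree_pos l d u t = tree_pos l (\<lambda>u _. d u (used_time l t u)) u t"
    unfolding tree_pos_def by simp
qed

lemma lin_scale: "lin \<rho> \<beta> (c * x, c * z) = complex_of_real c * lin \<rho> \<beta> (x, z)"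
  by (simp add: lin_def algebra_simps)

lemma lin_add: "lin \<rho> \<beta> (x, z) + lin \<rho> \<beta> (x', z') = lin \<rho> \<beta> (x + x', z + z')"
  by (simp add: lin_def algebra_simps)

lemma lin_sum: "finite A \<Longrightarrow> (\<Sum>k\<in>A. lin \<rho> \<beta> (f k, g k)) = lin \<rho> \<beta> (sum f A, sum g A)"
proof (induction A rule: finite_induct)
  case empty
  then show ?case by (simp add: lin_def)
qed (simp add: lin_add)

lemma nn_integral_distr_target:
  "T \<in> N \<rightarrow>\<^sub>M N' \<Longrightarrow> f \<in> borel_measurable N' \<Longrightarrow> (\<integral>\<^sup>+y. f y \<partial>distr N N' T) = (\<integral>\<^sup>+x. f (T x) \<partial>N)"
  by (simp add: nn_integral_distr)

lemma bbm_used_time: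
  assumes l: "\<And>u. 0 \<le> l u"
  shows "bbm \<rho> \<beta> t (\<lambda>u. (l u, \<eta> u)) =
    tree_sum l (\<lambda>u _. lin \<rho> \<beta> (sqrt (used_time l t u) * fst (\<eta> u), sqrt (used_time l t u) * snd (\<eta> u))) (\<lambda>_. 1) t"
  unfolding bbm_def bbm_sum_def fst_conv snd_conv
  by (subst tree_sum_used_time[OF l]) (simp add: disp_def lin_scale)

lemma measurable_path_eval_compose:
  assumes p: "p \<in> N \<rightarrow>\<^sub>M path_space" and r: "r \<in> borel_measurable N"
  shows "(\<lambda>x. path_eval (p x) (r x)) \<in> borel_measurable N"
  using measurable_compose[OF measurable_Pair[OF p r] measurable_path_eval] by simp

lemma measurable_path_sum:
  "(\<lambda>x. path_sum \<rho> \<beta> t (fst x) (snd x)) \<in> borel_measurable (PiM UNIV (\<lambda>_. borel) \<Otimes>\<^sub>M PiM (UNIV \<times> {Wx, Wz}) (\<lambda>_. path_space))"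
    (is "_ \<in> borel_measurable (?A \<Otimes>\<^sub>M ?B)")
  unfolding path_sum_def
proof (rule measurable_tree_sum)
  fix u :: "bool list"
  show "(\<lambda>x. fst x u) \<in> borel_measurable (?A \<Otimes>\<^sub>M ?B)"
    by (rule measurable_compose[OF measurable_fst]) (rule measurable_component_singleton, simp)
  have p: "(\<lambda>y. snd (fst y) (u, k)) \<in> (?A \<Otimes>\<^sub>M ?B) \<Otimes>\<^sub>M borel \<rightarrow>\<^sub>M path_space" if "k \<in> {Wx, Wz}" for k
    by (rule measurable_compose[OF measurable_compose[OF measurable_fst measurable_snd]])
      (rule measurable_component_singleton, use that in simp)
  have "(\<lambda>y. lin \<rho> \<beta> (path_eval (snd (fst y) (u, Wx)) (snd y), path_eval (snd (fst y) (u, Wz)) (snd y))) \<in> borel_measurable ((?A \<Otimes>\<^sub>M ?B) \<Otimes>\<^sub>M borel)"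
    by (rule measurable_compose[OF measurable_Pair measurable_lin])
      (intro measurable_path_eval_compose p measurable_snd, simp)+
  then show "(\<lambda>(x, r). lin \<rho> \<beta> (path_eval (snd x (u, Wx)) r, path_eval (snd x (u, Wz)) r)) \<in> borel_measurable ((?A \<Otimes>\<^sub>M ?B) \<Otimes>\<^sub>M borel)"
    by (simp add: split_beta')
qed simp_all

lemma measurable_tree_sum_disp:
  "(\<lambda>v. tree_sum l (\<lambda>u _. lin \<rho> \<beta> (v u)) (\<lambda>_. 1) t) \<in> borel_measurable (PiM UNIV (\<lambda>_. borel \<Otimes>\<^sub>M borel))"
    (is "_ \<in> borel_measurable ?A")
proof (rule measurable_tree_sum)
  fix u :: "bool list"
  have "(\<lambda>y. lin \<rho> \<beta> (fst y u)) \<in> borel_measurable (?A \<Otimes>\<^sub>M borel)"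
    by (rule measurable_compose[OF _ measurable_lin], rule measurable_compose[OF measurable_fst]) (rule measurable_component_singleton, simp)
  then show "(\<lambda>(x, r). lin \<rho> \<beta> (x u)) \<in> borel_measurable (?A \<Otimes>\<^sub>M borel)" by (simp add: split_beta')
qed simp_all

context bbm_prim
begin

abbreviation paths :: "'a \<Rightarrow> bool list \<times> src \<Rightarrow> real \<Rightarrow> real" where
  "paths \<omega> \<equiv> restrict (\<lambda>i. primitive L W Z i \<omega>) (UNIV \<times> {Wx, Wz})"

abbreviation lifetimes :: "'a \<Rightarrow> bool list \<Rightarrow> real" where
  "lifetimes \<omega> \<equiv> (\<lambda>u. L u \<omega>)"

lemma measurable_lifetimes: "lifetimes \<in> M \<rightarrow>\<^sub>M PiM UNIV (\<lambda>_. borel)"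
  by (rule measurable_PiM_single') (auto intro: measurable_L)

lemma measurable_paths: "paths \<in> M \<rightarrow>\<^sub>M PiM (UNIV \<times> {Wx, Wz}) (\<lambda>_. path_space)"
  using indep_primitive by (intro measurable_restrict) (auto simp: indep_vars_def)

text \<open>Lifetimes and paths are disjoint groups of an independent family, so their joint law is
  a product.\<close>

lemma law_lifetimes_paths:
  "distr M (PiM UNIV (\<lambda>_. borel) \<Otimes>\<^sub>M PiM (UNIV \<times> {Wx, Wz}) (\<lambda>_. path_space)) (\<lambda>\<omega>. (lifetimes \<omega>, paths \<omega>)) =
    PiM UNIV (\<lambda>_. exp1) \<Otimes>\<^sub>M distr M (PiM (UNIV \<times> {Wx, Wz}) (\<lambda>_. path_space)) paths"
proof -
  let ?I = "UNIV \<times> {Life} :: (bool list \<times> src) set" and ?J = "UNIV \<times> {Wx, Wz} :: (bool list \<times> src) set"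
  let ?A = "PiM UNIV (\<lambda>_::bool list. borel :: real measure)" and ?P = "\<lambda>J. PiM J (\<lambda>_. path_space)"
  let ?Q = "\<lambda>\<omega>. restrict (\<lambda>i. primitive L W Z i \<omega>) ?I" and ?f = "\<lambda>q u. q (u, Life) (0::real) :: real"
  have "indep_var (?P ?I) ?Q (?P ?J) paths"
    by (rule indep_var_restrict[OF indep_primitive]) auto
  then have Q: "?Q \<in> M \<rightarrow>\<^sub>M ?P ?I" and d: "distr M (?P ?I) ?Q \<Otimes>\<^sub>M distr M (?P ?J) paths = distr M (?P ?I \<Otimes>\<^sub>M ?P ?J) (\<lambda>\<omega>. (?Q \<omega>, paths \<omega>))"
    unfolding indep_var_distribution_eq by auto
  have f: "?f \<in> ?P ?I \<rightarrow>\<^sub>M ?A"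
    by (rule measurable_PiM_single') (auto intro: measurable_path_component)
  interpret D: prob_space "distr M (?P ?J) paths" by (rule prob_space_distr[OF measurable_paths])
  have "distr (distr M (?P ?I) ?Q) ?A ?f \<Otimes>\<^sub>M distr (distr M (?P ?J) paths) (?P ?J) (\<lambda>p. p) =
      distr (distr M (?P ?I \<Otimes>\<^sub>M ?P ?J) (\<lambda>\<omega>. (?Q \<omega>, paths \<omega>))) (?A \<Otimes>\<^sub>M ?P ?J) (\<lambda>(q, p). (?f q, p))"
    unfolding d[symmetric]
  proof (rule pair_measure_distr)
    show "sigma_finite_measure (distr (distr M (?P ?J) paths) (?P ?J) (\<lambda>p. p))"
      using D.sigma_finite_measure_axioms by (simp add: distr_id2)
  qed (use f in auto)
  also have "\<dots> = distr M (?A \<Otimes>\<^sub>M ?P ?J) ((\<lambda>(q, p). (?f q, p)) \<circ> (\<lambda>\<omega>. (?Q \<omega>, paths \<omega>)))"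
  proof (rule distr_distr)
    show "(\<lambda>(q, p). (?f q, p)) \<in> ?P ?I \<Otimes>\<^sub>M ?P ?J \<rightarrow>\<^sub>M ?A \<Otimes>\<^sub>M ?P ?J"
      unfolding split_beta' by (intro measurable_Pair measurable_compose[OF measurable_fst f] measurable_snd)
  qed (intro measurable_Pair Q measurable_paths)
  also have "\<dots> = distr M (?A \<Otimes>\<^sub>M ?P ?J) (\<lambda>\<omega>. (lifetimes \<omega>, paths \<omega>))" by (simp add: comp_def)
  finally have 1: "distr M (?A \<Otimes>\<^sub>M ?P ?J) (\<lambda>\<omega>. (lifetimes \<omega>, paths \<omega>)) = distr (distr M (?P ?I) ?Q) ?A ?f \<Otimes>\<^sub>M distr M (?P ?J) paths"
    by (simp add: distr_id2)
  have "distr (distr M (?P ?I) ?Q) ?A ?f = distr M ?A (?f \<circ> ?Q)" by (rule distr_distr[OF f Q])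
  also have "\<dots> = PiM UNIV (\<lambda>_. exp1)" unfolding law_lifetimes[symmetric] by (simp add: comp_def)
  finally show ?thesis using 1 by simp
qed

lemma AE_tree_ok_lifetimes: "AE \<omega> in M. tree_ok (lifetimes \<omega>)"
proof -
  have m: "lifetimes \<in> M \<rightarrow>\<^sub>M PiM UNIV (\<lambda>_. borel)" by (rule measurable_lifetimes)
  have "AE l in distr M (PiM UNIV (\<lambda>_. borel)) lifetimes. tree_ok l"
    unfolding law_lifetimes by (rule AE_PiM_exp1_tree_ok)
  then show ?thesis by (rule AE_distrD[OF m])
qed

lemma path_sum_eq:
  assumes "\<omega> \<in> space M" "tree_ok l"
  shows "path_sum \<rho> \<beta> t l (paths \<omega>) = tree_sum l (\<lambda>u r. lin \<rho> \<beta> (W u \<omega> r, Z u \<omega> r)) (\<lambda>_. 1) t"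
  unfolding path_sum_def
proof (rule tree_sum_cong_disp)
  fix u assume u: "u \<in> tree_alive l t"
  have e: "path_eval (W v \<omega>) r = W v \<omega> r" "path_eval (Z v \<omega>) r = Z v \<omega> r" if "0 \<le> r" for v r
    using continuous_paths[OF assms(1)] that by (auto intro: path_eval_continuous)
  show "tree_pos l (\<lambda>u r. lin \<rho> \<beta> (path_eval (paths \<omega> (u, Wx)) r, path_eval (paths \<omega> (u, Wz)) r)) u t = tree_pos l (\<lambda>u r. lin \<rho> \<beta> (W u \<omega> r, Z u \<omega> r)) u t"
    using u tree_ok_nonneg[OF assms(2)] unfolding tree_pos_def by (simp add: e tree_alive_def)
qed

lemma partition_fn_eq_tree_sum:
  "partition_fn L W Z \<beta> \<rho> t \<omega> = tree_sum (lifetimes \<omega>) (\<lambda>u r. lin \<rho> \<beta> (W u \<omega> r, Z u \<omega> r)) (\<lambda>_. 1) t"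
proof -
  have b: "birth L u \<omega> = tree_birth (lifetimes \<omega>) u" for u by (simp add: birth_def tree_birth_def)
  have "alive L t \<omega> = tree_alive (lifetimes \<omega>) t" by (simp add: alive_def tree_alive_def b)
  moreover have "tree_pos (lifetimes \<omega>) (\<lambda>u r. lin \<rho> \<beta> (W u \<omega> r, Z u \<omega> r)) u t = lin \<rho> \<beta> (pos L W u t \<omega>, pos L Z u t \<omega>)" for u
    unfolding tree_pos_def pos_def b by (simp only: lin_sum lin_add finite_lessThan)
  ultimately show ?thesis by (simp add: partition_fn_def tree_sum_def lin_def)
qed

text \<open>With the lifetimes frozen, each particle is read at the fixed age
  \<open>used_time\<close>, and the law of these values is that of rescaled Gaussians. This is where
  the paths are exchanged for one Gaussian pair per particle.\<close>

lemma nn_integral_path_sum: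
  assumes [measurable]: "g \<in> borel_measurable borel"
  shows "(\<integral>\<^sup>+\<omega>. g (path_sum \<rho> \<beta> t (lifetimes \<omega>) (paths \<omega>)) \<partial>M) = (\<integral>\<^sup>+\<eta>. g (bbm \<rho> \<beta> t \<eta>) \<partial>bbm_space)"
proof -
  let ?A = "PiM UNIV (\<lambda>_::bool list. borel :: real measure)" and ?B = "PiM (UNIV \<times> {Wx, Wz} :: (bool list \<times> src) set) (\<lambda>_. path_space)"
  let ?G = "PiM UNIV (\<lambda>_::bool list. gauss2)" and ?C = "PiM UNIV (\<lambda>_::bool list. borel \<Otimes>\<^sub>M borel :: (real \<times> real) measure)"
  have m1: "lifetimes \<in> M \<rightarrow>\<^sub>M ?A" by (rule measurable_lifetimes)
  have m2: "paths \<in> M \<rightarrow>\<^sub>M ?B" by (rule measurable_paths)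
  interpret D: prob_space "distr M ?B paths" by (rule prob_space_distr[OF m2])
  have mG: "(\<lambda>x. g (path_sum \<rho> \<beta> t (fst x) (snd x))) \<in> borel_measurable (?A \<Otimes>\<^sub>M ?B)"
    by (rule measurable_compose[OF measurable_path_sum assms])
  have dist: "distr M (?A \<Otimes>\<^sub>M ?B) (\<lambda>\<omega>. (lifetimes \<omega>, paths \<omega>)) = PiM UNIV (\<lambda>_. exp1) \<Otimes>\<^sub>M distr M ?B paths"
    by (rule law_lifetimes_paths)
  have "(\<integral>\<^sup>+\<omega>. g (path_sum \<rho> \<beta> t (lifetimes \<omega>) (paths \<omega>)) \<partial>M) =
      (\<integral>\<^sup>+x. g (path_sum \<rho> \<beta> t (fst x) (snd x)) \<partial>distr M (?A \<Otimes>\<^sub>M ?B) (\<lambda>\<omega>. (lifetimes \<omega>, paths \<omega>)))"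
    using nn_integral_distr_target[OF measurable_Pair[OF m1 m2] mG] by simp
  also have "\<dots> = (\<integral>\<^sup>+l. \<integral>\<^sup>+p. g (path_sum \<rho> \<beta> t l p) \<partial>distr M ?B paths \<partial>PiM UNIV (\<lambda>_. exp1))"
  proof -
    have "sets (?A \<Otimes>\<^sub>M ?B) = sets (PiM UNIV (\<lambda>_. exp1) \<Otimes>\<^sub>M distr M ?B paths)" unfolding dist[symmetric] by simp
    then have "(\<lambda>x. g (path_sum \<rho> \<beta> t (fst x) (snd x))) \<in> borel_measurable (PiM UNIV (\<lambda>_. exp1) \<Otimes>\<^sub>M distr M ?B paths)"
      using mG by (simp cong: measurable_cong_sets)
    from D.nn_integral_fst[OF this] show ?thesis unfolding dist by simp
  qed
  also have "\<dots> = (\<integral>\<^sup>+l. \<integral>\<^sup>+\<eta>. g (bbm \<rho> \<beta> t (\<lambda>u. (l u, \<eta> u))) \<partial>?G \<partial>PiM UNIV (\<lambda>_. exp1))"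
  proof (rule nn_integral_cong_AE)
    show "AE l in PiM UNIV (\<lambda>_. exp1). (\<integral>\<^sup>+p. g (path_sum \<rho> \<beta> t l p) \<partial>distr M ?B paths) = (\<integral>\<^sup>+\<eta>. g (bbm \<rho> \<beta> t (\<lambda>u. (l u, \<eta> u))) \<partial>?G)"
      using AE_PiM_exp1_tree_ok
    proof eventually_elim
      case (elim l)
      have l: "0 \<le> l u" for u by (rule tree_ok_nonneg[OF elim])
      let ?r = "used_time l t"
      have r: "0 \<le> ?r u" for u by (rule used_time_nonneg[OF l])
      let ?H = "\<lambda>v. g (tree_sum l (\<lambda>u _. lin \<rho> \<beta> (v u)) (\<lambda>_. 1) t)"
      have mH: "?H \<in> borel_measurable ?C" by (rule measurable_compose[OF measurable_tree_sum_disp assms])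
      have mp: "(\<lambda>p. g (path_sum \<rho> \<beta> t l p)) \<in> borel_measurable ?B"
        using measurable_Pair2[OF mG, of l] by (simp add: space_PiM)
      have mV: "(\<lambda>\<omega> u. (W u \<omega> (?r u), Z u \<omega> (?r u))) \<in> M \<rightarrow>\<^sub>M ?C"
      proof (rule measurable_PiM_single')
        fix u show "(\<lambda>\<omega>. (W u \<omega> (?r u), Z u \<omega> (?r u))) \<in> M \<rightarrow>\<^sub>M borel \<Otimes>\<^sub>M borel"
          using std_bm_W[of u] std_bm_Z[of u] by (intro measurable_Pair) (auto simp: std_bm_def)
      qed (auto simp: space_pair_measure)
      have mS: "(\<lambda>\<eta> u. (sqrt (?r u) * fst (\<eta> u), sqrt (?r u) * snd (\<eta> u))) \<in> ?G \<rightarrow>\<^sub>M ?C"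
      proof (rule measurable_PiM_single')
        fix u :: "bool list"
        have "(\<lambda>p. (sqrt (?r u) * fst p, sqrt (?r u) * snd p)) \<in> gauss2 \<rightarrow>\<^sub>M borel \<Otimes>\<^sub>M borel" by measurable
        then show "(\<lambda>\<eta>. (sqrt (?r u) * fst (\<eta> u), sqrt (?r u) * snd (\<eta> u))) \<in> ?G \<rightarrow>\<^sub>M borel \<Otimes>\<^sub>M borel"
          by (rule measurable_compose[OF measurable_component_singleton, rotated]) simp
      qed (auto simp: space_pair_measure)
      have "(\<integral>\<^sup>+p. g (path_sum \<rho> \<beta> t l p) \<partial>distr M ?B paths) = (\<integral>\<^sup>+\<omega>. g (path_sum \<rho> \<beta> t l (paths \<omega>)) \<partial>M)"
        by (rule nn_integral_distr_target[OF m2 mp])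
      also have "\<dots> = (\<integral>\<^sup>+\<omega>. ?H (\<lambda>u. (W u \<omega> (?r u), Z u \<omega> (?r u))) \<partial>M)"
      proof (rule nn_integral_cong)
        fix \<omega> assume "\<omega> \<in> space M"
        then show "g (path_sum \<rho> \<beta> t l (paths \<omega>)) = ?H (\<lambda>u. (W u \<omega> (?r u), Z u \<omega> (?r u)))"
          using tree_sum_used_time[of l "\<lambda>u r. lin \<rho> \<beta> (W u \<omega> r, Z u \<omega> r)" "\<lambda>_. 1" t, OF l] by (simp only: path_sum_eq[OF _ elim])
      qed
      also have "\<dots> = (\<integral>\<^sup>+v. ?H v \<partial>distr M ?C (\<lambda>\<omega> u. (W u \<omega> (?r u), Z u \<omega> (?r u))))"
        by (rule nn_integral_distr_target[OF mV mH, symmetric])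
      also have "\<dots> = (\<integral>\<^sup>+v. ?H v \<partial>distr ?G ?C (\<lambda>\<eta> u. (sqrt (?r u) * fst (\<eta> u), sqrt (?r u) * snd (\<eta> u))))"
        unfolding law_displacements[of ?r, OF r] ..
      also have "\<dots> = (\<integral>\<^sup>+\<eta>. ?H (\<lambda>u. (sqrt (?r u) * fst (\<eta> u), sqrt (?r u) * snd (\<eta> u))) \<partial>?G)"
        by (rule nn_integral_distr_target[OF mS mH])
      also have "\<dots> = (\<integral>\<^sup>+\<eta>. g (bbm \<rho> \<beta> t (\<lambda>u. (l u, \<eta> u))) \<partial>?G)"
        unfolding bbm_used_time[of l, OF l] ..
      finally show ?case .
    qed
  qed
  also have "\<dots> = (\<integral>\<^sup>+\<eta>. g (bbm \<rho> \<beta> t \<eta>) \<partial>bbm_space)"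
  proof -
    have "(\<lambda>\<eta>. g (bbm \<rho> \<beta> t \<eta>)) \<in> borel_measurable bbm_space" by measurable
    then show ?thesis unfolding bbm_space_def particle_def
      by (intro nn_integral_PiM_zip[symmetric]) (auto intro: prob_space_exp1 prob_space_gauss2)
  qed
  finally show ?thesis .
qed

text \<open>\<open>partition_fn\<close> agrees with the measurable \<open>path_sum\<close> on
  \<open>tree_ok\<close> trees; the remaining outcomes are covered by a null set
  \<open>N\<close>.\<close>

lemma partition_fn_outer_measure:
  assumes S: "S \<in> sets borel"
  obtains A where "A \<in> sets M" "{\<omega> \<in> space M. partition_fn L W Z \<beta> \<rho> t \<omega> \<in> S} \<subseteq> A"
    "measure M A = measure bbm_space {\<eta> \<in> space bbm_space. bbm \<rho> \<beta> t \<eta> \<in> S}"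
proof -
  let ?X = "\<lambda>\<omega>. path_sum \<rho> \<beta> t (lifetimes \<omega>) (paths \<omega>)"
  have m1: "lifetimes \<in> M \<rightarrow>\<^sub>M PiM UNIV (\<lambda>_. borel)" by (rule measurable_lifetimes)
  have m2: "paths \<in> M \<rightarrow>\<^sub>M PiM (UNIV \<times> {Wx, Wz}) (\<lambda>_. path_space)" by (rule measurable_paths)
  have mX: "?X \<in> borel_measurable M"
    using measurable_compose[OF measurable_Pair[OF m1 m2] measurable_path_sum] by simp
  have Xs: "{\<omega> \<in> space M. ?X \<omega> \<in> S} \<in> sets M" using measurable_sets[OF mX S] by (simp add: vimage_def Int_def conj_commute)
  have bs: "{\<eta> \<in> space bbm_space. bbm \<rho> \<beta> t \<eta> \<in> S} \<in> sets bbm_space" using S by measurable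
  from AE_tree_ok_lifetimes obtain N where N: "{\<omega> \<in> space M. \<not> tree_ok (lifetimes \<omega>)} \<subseteq> N" "emeasure M N = 0" "N \<in> sets M"
    by (rule AE_E)
  have "emeasure M {\<omega> \<in> space M. ?X \<omega> \<in> S} = (\<integral>\<^sup>+\<omega>. indicator S (?X \<omega>) \<partial>M)"
    by (subst nn_integral_indicator[OF Xs, symmetric]) (auto intro!: nn_integral_cong split: split_indicator)
  also have "\<dots> = (\<integral>\<^sup>+\<eta>. indicator S (bbm \<rho> \<beta> t \<eta>) \<partial>bbm_space)" using S by (intro nn_integral_path_sum) simp
  also have "\<dots> = emeasure bbm_space {\<eta> \<in> space bbm_space. bbm \<rho> \<beta> t \<eta> \<in> S}"
    by (subst nn_integral_indicator[OF bs, symmetric]) (auto intro!: nn_integral_cong split: split_indicator)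
  finally have e: "measure M {\<omega> \<in> space M. ?X \<omega> \<in> S} = measure bbm_space {\<eta> \<in> space bbm_space. bbm \<rho> \<beta> t \<eta> \<in> S}"
    by (simp add: measure_def)
  show ?thesis
  proof
    show "{\<omega> \<in> space M. ?X \<omega> \<in> S} \<union> N \<in> sets M" using Xs N(3) by auto
    show "{\<omega> \<in> space M. partition_fn L W Z \<beta> \<rho> t \<omega> \<in> S} \<subseteq> {\<omega> \<in> space M. ?X \<omega> \<in> S} \<union> N"
    proof
      fix \<omega> assume \<omega>: "\<omega> \<in> {\<omega> \<in> space M. partition_fn L W Z \<beta> \<rho> t \<omega> \<in> S}"
      show "\<omega> \<in> {\<omega> \<in> space M. ?X \<omega> \<in> S} \<union> N"
      proof (cases "tree_ok (lifetimes \<omega>)")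
        case True
        then have "?X \<omega> = partition_fn L W Z \<beta> \<rho> t \<omega>" using \<omega> by (simp only: path_sum_eq partition_fn_eq_tree_sum mem_Collect_eq)
        then show ?thesis using \<omega> by simp
      qed (use \<omega> N(1) in auto)
    qed
    show "measure M ({\<omega> \<in> space M. ?X \<omega> \<in> S} \<union> N) = measure bbm_space {\<eta> \<in> space bbm_space. bbm \<rho> \<beta> t \<eta> \<in> S}"
      using e measure_Un_null_set[OF Xs, of N] N by (simp add: null_setsI)
  qed
qed

end

section \<open>The three phases\<close>

context bbm_corr
begin

definition exp_rate :: "complex \<Rightarrow> real \<Rightarrow> bool" where
  "exp_rate \<beta> F \<longleftrightarrow> (\<forall>\<epsilon>>0. ((\<lambda>t. plarge \<beta> t (exp ((F + \<epsilon>) * t))) \<longlongrightarrow> 0) at_top \<and>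
     ((\<lambda>t. psmall \<beta> t (exp ((F - \<epsilon>) * t))) \<longlongrightarrow> 0) at_top)"

lemma exp_rateI:
  assumes "0 < p" "\<And>\<epsilon>. 0 < \<epsilon> \<Longrightarrow> eventually (\<lambda>t. pmom p \<beta> t \<le> ennreal (exp ((p * F + \<epsilon>) * t))) at_top"
    and "lower_prob \<beta> F" "\<beta> \<noteq> 0"
  shows "exp_rate \<beta> F"
  unfolding exp_rate_def using upper_of_pmom[OF assms(1,2)] lower_tail_nonzero[OF assms(4,3)] by blast

lemma exp_rate_region1:
  assumes C: "(2 * (Re \<beta>)\<^sup>2 \<le> 1 \<and> (Re \<beta>)\<^sup>2 + (Im \<beta>)\<^sup>2 \<le> 1) \<or> (1 \<le> 2 * (Re \<beta>)\<^sup>2 \<and> \<bar>Re \<beta>\<bar> + \<bar>Im \<beta>\<bar> \<le> sqrt 2)"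
    and "\<bar>Re \<beta>\<bar> < sqrt 2"
  shows "exp_rate \<beta> (rate1 \<beta>)"
proof -
  obtain p where p: "1 < p" "p \<le> 2" "1 + p\<^sup>2 * (Re \<beta>)\<^sup>2 / 2 \<le> p * rate1 \<beta>"
    using exists_moment_exponent[OF assms] by blast
  have p0: "0 < p" using p(1) by simp
  have up: "eventually (\<lambda>t. pmom p \<beta> t \<le> ennreal (exp ((p * rate1 \<beta> + \<epsilon>) * t))) at_top" if "0 < \<epsilon>" for \<epsilon>
    by (rule pmom_rate[OF p0 p(2) order_refl p(3) that])
  show ?thesis
  proof (cases "\<beta> = 0")
    case True
    then have "rate1 \<beta> = 1" by (simp add: rate1_def)
    then show ?thesis unfolding exp_rate_def using upper_of_pmom[OF p0 up] lower_tail_zero True by auto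
  next
    case False
    show ?thesis by (rule exp_rateI[OF p0 up lower_prob_rate1[OF p] False])
  qed
qed

text \<open>The upper bound takes p = sqrt 2 / |Re \<beta>|, for which 1 + p^2 (Re \<beta>)^2 / 2 =
  2 is p times the claimed rate. The lower bound comes from the real case at 2 Re \<beta>, which
  here has modulus at least sqrt 2.\<close>

lemma exp_rate_region2:
  assumes C: "1 \<le> 2 * (Re \<beta>)\<^sup>2" "sqrt 2 \<le> \<bar>Re \<beta>\<bar> + \<bar>Im \<beta>\<bar>"
  shows "exp_rate \<beta> (sqrt 2 * \<bar>Re \<beta>\<bar>)"
proof -
  define s where "s = \<bar>Re \<beta>\<bar>"
  have s0: "0 < s" using C(1) by (cases "s = 0") (auto simp: s_def)
  then have \<beta>: "\<beta> \<noteq> 0" by (auto simp: s_def)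
  have "1\<^sup>2 \<le> (sqrt 2 * s)\<^sup>2" using C(1) by (simp add: power_mult_distrib s_def)
  then have "1 \<le> sqrt 2 * s" by (rule power2_le_imp_le) (use s0 in simp)
  then have "sqrt 2 * 1 \<le> sqrt 2 * (sqrt 2 * s)" by (intro mult_left_mono) auto
  then have s2: "sqrt 2 \<le> 2 * s" by (simp add: mult.assoc[symmetric])
  define p where "p = sqrt 2 / s"
  have p: "0 < p" "p \<le> 2" using s0 s2 by (auto simp: p_def divide_le_eq)
  have pF: "p * (sqrt 2 * s) = 2" using s0 by (simp add: p_def)
  have ps: "p\<^sup>2 * (Re \<beta>)\<^sup>2 / 2 = 1" using s0 by (simp add: power_divide s_def p_def)
  have "sqrt 2 \<le> \<bar>2 * Re \<beta>\<bar>" using s2 by (simp add: s_def abs_mult)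
  from lower_prob_square[OF \<beta> lower_prob_real_large[OF this]]
  have low: "lower_prob \<beta> (sqrt 2 * s)" by (simp add: s_def abs_mult)
  have up: "eventually (\<lambda>t. pmom p \<beta> t \<le> ennreal (exp ((p * (sqrt 2 * s) + \<epsilon>) * t))) at_top" if \<epsilon>: "0 < \<epsilon>" for \<epsilon>
  proof (cases "s < sqrt 2")
    case True
    have "(sqrt 2 - s)\<^sup>2 \<le> (Im \<beta>)\<^sup>2" using C(2) True unfolding abs_le_square_iff[symmetric] s_def by simp
    moreover have "(sqrt 2 - s)\<^sup>2 = 2 - 2 * (sqrt 2 * s) + (Re \<beta>)\<^sup>2" by (simp add: power2_diff s_def)
    ultimately have "rate1 \<beta> \<le> sqrt 2 * s" unfolding rate1_def by (simp add: field_simps)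
    then have "p * rate1 \<beta> \<le> p * (sqrt 2 * s)" using p by (intro mult_left_mono) auto
    moreover have "1 + p\<^sup>2 * (Re \<beta>)\<^sup>2 / 2 \<le> p * (sqrt 2 * s)" unfolding pF ps by simp
    ultimately show ?thesis using \<epsilon> by (rule pmom_rate[OF p])
  next
    case False
    \<comment> \<open>Beyond sqrt 2 the rate of the mean can exceed sqrt 2 * s, so
      \<open>pmom_rate\<close> does not apply; but \<open>p\<close> is at most 1, and
      \<open>bbm_moment\<close> has the right rate 2 by itself.\<close>
    then have p1: "p \<le> 1" using s0 by (simp add: p_def)
    show ?thesis using eventually_ge_at_top[of 0]
    proof eventually_elim
      case (elim t)
      have "2 * powr_const p - 1 + p\<^sup>2 * (Re \<beta>)\<^sup>2 / 2 = 2" unfolding ps using p1 by (simp add: powr_const_def)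
      then have "pmom p \<beta> t \<le> ennreal (exp (2 * t))" using bbm_moment[OF p(1) elim, of \<rho> \<beta>] unfolding pmom_def by (simp only:)
      also have "\<dots> \<le> ennreal (exp ((p * (sqrt 2 * s) + \<epsilon>) * t))" unfolding pF using \<epsilon> elim by (intro ennreal_leI) (simp add: mult_right_mono)
      finally show ?case .
    qed
  qed
  show ?thesis unfolding s_def[symmetric] by (rule exp_rateI[OF p(1) up low \<beta>])
qed

lemma exp_rate_region3:
  assumes C: "2 * (Re \<beta>)\<^sup>2 \<le> 1" "1 \<le> (Re \<beta>)\<^sup>2 + (Im \<beta>)\<^sup>2"
  shows "exp_rate \<beta> (1/2 + (Re \<beta>)\<^sup>2)"
proof -
  have \<beta>: "\<beta> \<noteq> 0" using C(2) by auto
  have sq: "(2 * Re \<beta>)\<^sup>2 \<le> (sqrt 2)\<^sup>2" using C(1) by (simp add: power_mult_distrib)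
  have low: "lower_prob \<beta> (1/2 + (Re \<beta>)\<^sup>2)"
  proof (cases "\<bar>2 * Re \<beta>\<bar> < sqrt 2")
    case True
    obtain p where p: "1 < p" "p \<le> 2" "1 + p\<^sup>2 * (Re (complex_of_real (2 * Re \<beta>)))\<^sup>2 / 2 \<le> p * rate1 (complex_of_real (2 * Re \<beta>))"
      using exists_moment_exponent_real[OF True] by blast
    have r: "rate1 (complex_of_real (2 * Re \<beta>)) / 2 = 1/2 + (Re \<beta>)\<^sup>2"
      unfolding rate1_real by (simp add: power_mult_distrib)
    show ?thesis using lower_prob_square[OF \<beta> lower_prob_rate1[OF p]] unfolding r .
  next
    case False
    then have e: "\<bar>2 * Re \<beta>\<bar> = sqrt 2" using sq unfolding abs_le_square_iff[symmetric] by simp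
    then have "\<bar>2 * Re \<beta>\<bar>\<^sup>2 = (sqrt 2)\<^sup>2" by simp
    then have "(Re \<beta>)\<^sup>2 = 1/2" by (simp add: power_mult_distrib)
    then have r: "sqrt 2 * \<bar>2 * Re \<beta>\<bar> / 2 = 1/2 + (Re \<beta>)\<^sup>2" unfolding e by simp
    have "sqrt 2 \<le> \<bar>2 * Re \<beta>\<bar>" unfolding e ..
    from lower_prob_square[OF \<beta> lower_prob_real_large[OF this]] show ?thesis unfolding r .
  qed
  have up: "eventually (\<lambda>t. pmom 2 \<beta> t \<le> ennreal (exp ((2 * (1/2 + (Re \<beta>)\<^sup>2) + \<epsilon>) * t))) at_top" if \<epsilon>: "0 < \<epsilon>" for \<epsilon>
    using C \<epsilon> by (intro pmom_rate) (auto simp: rate1_def field_simps)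
  show ?thesis by (rule exp_rateI[OF zero_less_numeral up low \<beta>])
qed

end

section \<open>Closures of the regions\<close>

lemma closure_B2: "closure B2 \<subseteq> {b. 1 \<le> 2 * (Re b)\<^sup>2 \<and> sqrt 2 \<le> \<bar>Re b\<bar> + \<bar>Im b\<bar>}"
  by (rule closure_minimal) (auto simp: B2_def intro!: closed_Collect_conj closed_Collect_le continuous_intros)

lemma closure_B3: "closure B3 \<subseteq> {b. 2 * (Re b)\<^sup>2 \<le> 1 \<and> 1 \<le> (Re b)\<^sup>2 + (Im b)\<^sup>2}"
  by (rule closure_minimal) (auto simp: B3_def intro!: closed_Collect_conj closed_Collect_le continuous_intros)

text \<open>Points with 2 (Re b)^2 = 1 lie in neither open region, yet those with |Re b| + |Im b| >
  sqrt 2 have to be excluded from \<open>B1\<close>. Enlarging the real part slightly shows that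
  they are limits from \<open>B2\<close>.\<close>

lemma boundary_in_closure_B2:
  assumes b: "2 * (Re b)\<^sup>2 = 1" "sqrt 2 < \<bar>Re b\<bar> + \<bar>Im b\<bar>"
  shows "b \<in> closure B2"
  unfolding closure_sequential
proof (intro exI conjI allI)
  let ?c = "\<lambda>n::nat. 1 + inverse (real (Suc n))"
  let ?x = "\<lambda>n. Complex (?c n * Re b) (Im b)"
  have c: "1 < ?c n" for n by simp
  show "?x n \<in> B2" for n
  proof -
    have "1 < (?c n)\<^sup>2" using c[of n] by (rule one_less_power) simp
    also have "(?c n)\<^sup>2 = (?c n)\<^sup>2 * (2 * (Re b)\<^sup>2)" unfolding b(1) by simp
    also have "\<dots> = 2 * (?c n * Re b)\<^sup>2" by (simp only: power_mult_distrib mult_ac)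
    finally have "1 < 2 * (?c n * Re b)\<^sup>2" .
    moreover have "1 * \<bar>Re b\<bar> \<le> ?c n * \<bar>Re b\<bar>" using c[of n] by (intro mult_right_mono) auto
    then have "\<bar>Re b\<bar> \<le> \<bar>?c n * Re b\<bar>" using c[of n] by (simp add: abs_mult)
    then have "sqrt 2 < \<bar>?c n * Re b\<bar> + \<bar>Im b\<bar>" using b(2) by linarith
    ultimately show ?thesis unfolding B2_def by (simp only: mem_Collect_eq complex.sel simp_thms)
  qed
  have "(\<lambda>n. ?c n * Re b) \<longlonglongrightarrow> (1 + 0) * Re b" by (intro tendsto_intros LIMSEQ_inverse_real_of_nat)
  then have "(\<lambda>n. Complex (?c n * Re b) (Im b)) \<longlonglongrightarrow> Complex (Re b) (Im b)" by (intro tendsto_Complex tendsto_const) simp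
  then show "?x \<longlonglongrightarrow> b" by simp
qed

lemma closure_B1:
  "closure B1 \<subseteq> {b. (2 * (Re b)\<^sup>2 \<le> 1 \<and> (Re b)\<^sup>2 + (Im b)\<^sup>2 \<le> 1) \<or> (1 \<le> 2 * (Re b)\<^sup>2 \<and> \<bar>Re b\<bar> + \<bar>Im b\<bar> \<le> sqrt 2)}" (is "_ \<subseteq> ?C")
proof (rule closure_minimal)
  show "closed ?C" by (intro closed_Collect_disj closed_Collect_conj closed_Collect_le continuous_intros)
  show "B1 \<subseteq> ?C"
  proof
    fix b assume "b \<in> B1"
    then have b: "b \<notin> B2" "b \<notin> B3" "b \<notin> closure B2"
      using closure_subset[of "B2 \<union> B3"] closure_mono[of B2 "B2 \<union> B3"] by (auto simp: B1_def)
    consider "2 * (Re b)\<^sup>2 < 1" | "2 * (Re b)\<^sup>2 = 1" | "2 * (Re b)\<^sup>2 > 1" by linarith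
    then show "b \<in> ?C"
    proof cases
      case 1
      then show ?thesis using b(2) by (simp add: B3_def)
    next
      case 2
      then show ?thesis using boundary_in_closure_B2[of b] b(3) by fastforce
    next
      case 3
      then show ?thesis using b(1) by (simp add: B2_def)
    qed
  qed
qed

section \<open>Transfer of the rates to the given process\<close>

locale bbm_process = bbm_prim M L W Z + bbm_corr \<rho> for M :: "'a measure" and L W Z \<rho>
begin

lemma log_rate_of_exp_rate:
  assumes "exp_rate \<beta> c"
  shows "log_rate_in_prob M (partition_fn L W Z \<beta> \<rho>) c"
  unfolding log_rate_in_prob_def
proof (intro allI impI)
  fix \<epsilon> \<delta> :: real assume pos: "0 < \<epsilon>" "0 < \<delta>"
  have \<delta>: "0 < \<delta> / 2" using pos by simp
  have "((\<lambda>t. plarge \<beta> t (exp ((c + \<epsilon>) * t))) \<longlongrightarrow> 0) at_top" "((\<lambda>t. psmall \<beta> t (exp ((c - \<epsilon>) * t))) \<longlongrightarrow> 0) at_top"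
    using assms pos unfolding exp_rate_def by blast+
  then have "eventually (\<lambda>t. plarge \<beta> t (exp ((c + \<epsilon>) * t)) < \<delta> / 2) at_top" "eventually (\<lambda>t. psmall \<beta> t (exp ((c - \<epsilon>) * t)) < \<delta> / 2) at_top"
    using \<delta> by (blast dest: order_tendstoD(2))+
  then show "eventually (\<lambda>t. \<exists>A\<in>sets M. {\<omega> \<in> space M. partition_fn L W Z \<beta> \<rho> t \<omega> = 0 \<or>
      \<bar>ln (cmod (partition_fn L W Z \<beta> \<rho> t \<omega>)) / t - c\<bar> > \<epsilon>} \<subseteq> A \<and> measure M A < \<delta>) at_top"
    using eventually_gt_at_top[of 0]
  proof eventually_elim
    case (elim t)
    let ?X = "partition_fn L W Z \<beta> \<rho> t"
    let ?S1 = "{z :: complex. exp ((c + \<epsilon>) * t) \<le> cmod z}" and ?S2 = "{z :: complex. cmod z \<le> exp ((c - \<epsilon>) * t)}"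
    have S: "?S1 \<in> sets borel" "?S2 \<in> sets borel" by measurable
    obtain A1 where A1: "A1 \<in> sets M" "{\<omega> \<in> space M. ?X \<omega> \<in> ?S1} \<subseteq> A1" "measure M A1 = measure bbm_space {\<eta> \<in> space bbm_space. bbm \<rho> \<beta> t \<eta> \<in> ?S1}"
      by (rule partition_fn_outer_measure[OF S(1)])
    obtain A2 where A2: "A2 \<in> sets M" "{\<omega> \<in> space M. ?X \<omega> \<in> ?S2} \<subseteq> A2" "measure M A2 = measure bbm_space {\<eta> \<in> space bbm_space. bbm \<rho> \<beta> t \<eta> \<in> ?S2}"
      by (rule partition_fn_outer_measure[OF S(2)])
    have "measure M A1 < \<delta> / 2" "measure M A2 < \<delta> / 2" using elim A1(3) A2(3) by (simp_all add: plarge_def psmall_def)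
    moreover have "measure M (A1 \<union> A2) \<le> measure M A1 + measure M A2" by (rule measure_Un_le[OF A1(1) A2(1)])
    ultimately have "measure M (A1 \<union> A2) < \<delta>" by linarith
    moreover have "{\<omega> \<in> space M. ?X \<omega> = 0 \<or> \<bar>ln (cmod (?X \<omega>)) / t - c\<bar> > \<epsilon>} \<subseteq> A1 \<union> A2"
    proof
      fix \<omega> assume \<omega>: "\<omega> \<in> {\<omega> \<in> space M. ?X \<omega> = 0 \<or> \<bar>ln (cmod (?X \<omega>)) / t - c\<bar> > \<epsilon>}"
      have "?X \<omega> \<in> ?S1 \<or> ?X \<omega> \<in> ?S2"
      proof (cases "?X \<omega> = 0")
        case False
        define y where "y = ln (cmod (?X \<omega>))"
        have y: "cmod (?X \<omega>) = exp y" using False by (simp add: y_def)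
        from False \<omega> have "c + \<epsilon> \<le> y / t \<or> y / t \<le> c - \<epsilon>" by (auto simp: y_def)
        then have "(c + \<epsilon>) * t \<le> y \<or> y \<le> (c - \<epsilon>) * t" using elim(3) by (simp add: pos_le_divide_eq pos_divide_le_eq)
        then have "exp ((c + \<epsilon>) * t) \<le> cmod (?X \<omega>) \<or> cmod (?X \<omega>) \<le> exp ((c - \<epsilon>) * t)" unfolding y by (simp only: exp_le_cancel_iff)
        then show ?thesis by simp
      qed simp
      then show "\<omega> \<in> A1 \<union> A2" using \<omega> A1(2) A2(2) by blast
    qed
    ultimately show ?case using A1(1) A2(1) by blast
  qed
qed

lemma log_rate_partition_fn:
  "(\<beta> \<in> closure B1 \<longrightarrow> log_rate_in_prob M (partition_fn L W Z \<beta> \<rho>) (1 + ((Re \<beta>)\<^sup>2 - (Im \<beta>)\<^sup>2) / 2)) \<and>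
   (\<beta> \<in> closure B2 \<longrightarrow> log_rate_in_prob M (partition_fn L W Z \<beta> \<rho>) (sqrt 2 * \<bar>Re \<beta>\<bar>)) \<and>
   (\<beta> \<in> closure B3 \<longrightarrow> log_rate_in_prob M (partition_fn L W Z \<beta> \<rho>) (1/2 + (Re \<beta>)\<^sup>2))"
proof (intro conjI impI)
  assume "\<beta> \<in> closure B1"
  then have C: "(2 * (Re \<beta>)\<^sup>2 \<le> 1 \<and> (Re \<beta>)\<^sup>2 + (Im \<beta>)\<^sup>2 \<le> 1) \<or> (1 \<le> 2 * (Re \<beta>)\<^sup>2 \<and> \<bar>Re \<beta>\<bar> + \<bar>Im \<beta>\<bar> \<le> sqrt 2)"
    using closure_B1 by blast
  have "exp_rate \<beta> (rate1 \<beta>)"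
  proof (cases "\<bar>Re \<beta>\<bar> < sqrt 2")
    case True
    then show ?thesis by (rule exp_rate_region1[OF C])
  next
    case False
    \<comment> \<open>Only the tips \<beta> = sqrt 2 and \<beta> = - sqrt 2 remain. There no p > 1
      works, but they also satisfy the inequalities of the second phase, whose rate takes the same
      value.\<close>
    then have "(sqrt 2)\<^sup>2 \<le> (Re \<beta>)\<^sup>2" unfolding abs_le_square_iff[symmetric] by simp
    then have "2 \<le> (Re \<beta>)\<^sup>2" by simp
    then have *: "1 \<le> 2 * (Re \<beta>)\<^sup>2" "\<bar>Re \<beta>\<bar> + \<bar>Im \<beta>\<bar> \<le> sqrt 2" using C by linarith+
    then have e: "\<bar>Re \<beta>\<bar> = sqrt 2" "Im \<beta> = 0" using False by linarith+
    then have "\<bar>Re \<beta>\<bar>\<^sup>2 = (sqrt 2)\<^sup>2" by simp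
    then have "(Re \<beta>)\<^sup>2 = 2" by simp
    then have r: "rate1 \<beta> = sqrt 2 * \<bar>Re \<beta>\<bar>" unfolding e(1) by (simp add: rate1_def e(2))
    have "sqrt 2 \<le> \<bar>Re \<beta>\<bar> + \<bar>Im \<beta>\<bar>" using e by linarith
    then show ?thesis unfolding r by (rule exp_rate_region2[OF *(1)])
  qed
  then show "log_rate_in_prob M (partition_fn L W Z \<beta> \<rho>) (1 + ((Re \<beta>)\<^sup>2 - (Im \<beta>)\<^sup>2) / 2)"
    unfolding rate1_def by (rule log_rate_of_exp_rate)
next
  assume "\<beta> \<in> closure B2"
  then have C: "1 \<le> 2 * (Re \<beta>)\<^sup>2" "sqrt 2 \<le> \<bar>Re \<beta>\<bar> + \<bar>Im \<beta>\<bar>" using closure_B2 by blast+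
  show "log_rate_in_prob M (partition_fn L W Z \<beta> \<rho>) (sqrt 2 * \<bar>Re \<beta>\<bar>)"
    by (rule log_rate_of_exp_rate[OF exp_rate_region2[OF C]])
next
  assume "\<beta> \<in> closure B3"
  then have C: "2 * (Re \<beta>)\<^sup>2 \<le> 1" "1 \<le> (Re \<beta>)\<^sup>2 + (Im \<beta>)\<^sup>2" using closure_B3 by blast+
  show "log_rate_in_prob M (partition_fn L W Z \<beta> \<rho>) (1/2 + (Re \<beta>)\<^sup>2)"
    by (rule log_rate_of_exp_rate[OF exp_rate_region3[OF C]])
qed

end

theorem theorem1:
  fixes M :: "'a measure"
    and L :: "bool list \<Rightarrow> 'a \<Rightarrow> real"
    and W Z :: "bool list \<Rightarrow> 'a \<Rightarrow> real \<Rightarrow> real"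
    and \<rho> :: real and \<beta> :: complex
  assumes "bbm_primitives M L W Z"
    and "-1 \<le> \<rho>" and "\<rho> \<le> 1"
  shows "(\<beta> \<in> closure B1 \<longrightarrow>
            log_rate_in_prob M (partition_fn L W Z \<beta> \<rho>) (1 + ((Re \<beta>)\<^sup>2 - (Im \<beta>)\<^sup>2) / 2)) \<and>
         (\<beta> \<in> closure B2 \<longrightarrow>
            log_rate_in_prob M (partition_fn L W Z \<beta> \<rho>) (sqrt 2 * \<bar>Re \<beta>\<bar>)) \<and>
         (\<beta> \<in> closure B3 \<longrightarrow>
            log_rate_in_prob M (partition_fn L W Z \<beta> \<rho>) (1/2 + (Re \<beta>)\<^sup>2))"
proof -
  interpret bbm_process M L W Z \<rho> by unfold_locales (fact assms)+
  show ?thesis by (rule log_rate_partition_fn)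
qed

end
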